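(* Let $\mathbb{R}^2_+$ be the open upper half-plane in $\mathbb{C}$, and let $$\Phi_1(z)=z^{3/2}e^{-\mathrm{i}\pi/4}-\mathrm{i},\quad \Phi_2(z)=-z^{3/2}e^{-\mathrm{i}\pi/4}+\mathrm{i},\quad \Phi_3(z)=z^{1/2}e^{-\mathrm{i}\pi/4}-2,\quad \Phi_4(z)=-z^{1/2}e^{-\mathrm{i}\pi/4}+2 .$$ Let $\Omega_j=\Phi_j(\mathbb{R}^2_+)$ and $\Omega=\bigcap_{j=1}^4\Omega_j$. Then there are constants $c,C>0$ independent of $p$ such that, for all $\frac65<p<6$, the Szegő projection $\mathcal{S}$ of $\Omega$ satisfies $$c\left(\frac1{6-p}\left(\frac{4(p-1)}{5p-6}\right)^{p-1}\right)^{\frac1{2p}}\le\|\mathcal{S}\|_{L^p(\partial\Omega)\to L^p(\partial\Omega)}\le C\left(\frac1{6-p}\left(\frac{4(p-1)}{5p-6}\right)^{p-1}\right)^{\max\{1,\frac1{p-1}\}}.$$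
   Context: Powers $z^{1/2},z^{3/2}$ on $\mathbb{R}^2_+$ are taken with $0<\arg z<\pi$. The set $\Omega$ is a bounded simply connected (Lipschitz) polygonal domain. $\mathbb{D}$ is the open unit disc; $H^2(\partial\mathbb{D})\subset L^2(\partial\mathbb{D})$ is the closed subspace of functions with Fourier series $\sum_{n\ge0}a_ne^{\mathrm{i}n\theta}$, and $\mathcal{S}_0$ is the orthogonal projection of $L^2(\partial\mathbb{D})$ onto it. Let $\varphi:\mathbb{D}\to\Omega$ be biholomorphic, extended to a homeomorphism $\overline{\mathbb{D}}\to\overline\Omega$; $\varphi'\in H^1$ is identified with its a.e. non-tangential boundary values, and $(\varphi')^{1/2}$ denotes the boundary values of a holomorphic $\phi\in H^2(\mathbb{D})$ with $\phi^2=\varphi'$. Put $\tau_{1/2}(f)(e^{\mathrm{i}\theta})=f(\varphi(e^{\mathrm{i}\theta}))(\varphi'(e^{\mathrm{i}\theta}))^{1/2}$, a surjective isometry $L^2(\partial\Omega,d\sigma)\to L^2(\partial\mathbb{D},d\theta)$, where $d\sigma$ is arc length. The Szegő projection of $\Omega$ is $\mathcal{S}=\tau_{1/2}^{-1}\mathcal{S}_0\tau_{1/2}$; its operator norm on $L^p(\partial\Omega)=L^p(\partial\Omega,d\sigma)$ is understood through extension from $L^2\cap L^p$. *)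

theory Defs
  imports "HOL-Complex_Analysis.Complex_Analysis"
begin

section \<open>Arc length\<close>

definition hausdorff1 :: "'a::metric_space set \<Rightarrow> ennreal" where
  "hausdorff1 A =
     (SUP \<delta>\<in>{0::real<..}.
        INF U\<in>{U :: nat \<Rightarrow> 'a set. A \<subseteq> (\<Union>i. U i) \<and> (\<forall>i. bounded (U i) \<and> diameter (U i) \<le> \<delta>)}.
          (\<Sum>i. ennreal (diameter (U i))))"

text \<open>
  Arc length on a set \<open>S\<close> is one-dimensional Hausdorff measure (normalised so that a line segment
  receives its length), on the Borel subsets of \<open>S\<close>. One-dimensional Hausdorff measure is a metric
  outer measure, hence countably additive on Borel sets.
\<close>

definition arc_length :: "'a::metric_space set \<Rightarrow> 'a measure" where
  "arc_length S = measure_of S (sets (restrict_space borel S)) hausdorff1"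

text \<open>The measure \<open>d\<theta>\<close> on the unit circle; its total mass is \<open>2\<pi>\<close>.\<close>

definition circle_measure :: "complex measure" where
  "circle_measure =
     distr (restrict_space lborel {0..<2*pi}) (restrict_space borel (sphere 0 1)) cis"


section \<open>Lebesgue spaces and operator norms\<close>

text \<open>Elements of \<open>L\<^sup>p\<close> are represented by functions; equality in \<open>L\<^sup>p\<close> is equality almost everywhere.
  The norm of a measurable function outside \<open>L\<^sup>p\<close> is \<open>\<infinity>\<close>.\<close>

definition Lp_norm :: "'a measure \<Rightarrow> real \<Rightarrow> ('a \<Rightarrow> complex) \<Rightarrow> ennreal" where
  "Lp_norm M p f =
     (let I = (\<integral>\<^sup>+x. ennreal (norm (f x) powr p) \<partial>M)
      in if I = \<infinity> then \<infinity> else ennreal (enn2real I powr (1 / p)))"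

definition Lp_space :: "'a measure \<Rightarrow> real \<Rightarrow> ('a \<Rightarrow> complex) set" where
  "Lp_space M p = {f \<in> borel_measurable M. Lp_norm M p f < \<infinity>}"

text \<open>The norm on \<open>L\<^sup>p\<close> of (the extension from \<open>L\<^sup>2 \<inter> L\<^sup>p\<close> of) an operator given on \<open>L\<^sup>2\<close>; it is \<open>\<infinity>\<close>
  if there is no bounded extension.\<close>

definition Lp_opnorm :: "'a measure \<Rightarrow> real \<Rightarrow> (('a \<Rightarrow> complex) \<Rightarrow> 'a \<Rightarrow> complex) \<Rightarrow> ennreal" where
  "Lp_opnorm M p T = (SUP f\<in>{f \<in> Lp_space M 2 \<inter> Lp_space M p. Lp_norm M p f \<le> 1}. Lp_norm M p (T f))"


section \<open>Hardy spaces of the disc\<close>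

definition fourier_coeff :: "(complex \<Rightarrow> complex) \<Rightarrow> int \<Rightarrow> complex" where
  "fourier_coeff f n = (\<integral>\<zeta>. f \<zeta> * \<zeta> powi (- n) \<partial>circle_measure) / (2 * pi)"

definition H2_circle :: "(complex \<Rightarrow> complex) set" where
  "H2_circle = {f \<in> Lp_space circle_measure 2. \<forall>n<0. fourier_coeff f n = 0}"

definition H2_disc :: "(complex \<Rightarrow> complex) set" where
  "H2_disc = {h. h holomorphic_on ball 0 1 \<and>
     (\<exists>B. \<forall>r. 0 \<le> r \<and> r < 1 \<longrightarrow>
        integral {0..2*pi} (\<lambda>\<theta>. (norm (h (of_real r * cis \<theta>)))\<^sup>2) \<le> B)}"

text \<open>The orthogonal projection of \<open>L\<^sup>2\<close> of the circle onto \<open>H\<^sup>2\<close>. A representative of the projected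
  class is chosen; it is unique up to null sets.\<close>

definition szego_disc :: "(complex \<Rightarrow> complex) \<Rightarrow> complex \<Rightarrow> complex" where
  "szego_disc f = (SOME g. g \<in> H2_circle \<and>
     (\<forall>h\<in>H2_circle. (\<integral>\<zeta>. (f \<zeta> - g \<zeta>) * cnj (h \<zeta>) \<partial>circle_measure) = 0))"

definition stolz_region :: "complex \<Rightarrow> real \<Rightarrow> complex set" where
  "stolz_region \<zeta> M = {z. norm z < 1 \<and> norm (z - \<zeta>) < M * (1 - norm z)}"

definition nontangential_boundary_values ::
    "(complex \<Rightarrow> complex) \<Rightarrow> (complex \<Rightarrow> complex) \<Rightarrow> bool" where
  "nontangential_boundary_values h w \<longleftrightarrow> w \<in> borel_measurable circle_measure \<and>
     (AE \<zeta> in circle_measure. \<forall>M>1. (h \<longlongrightarrow> w \<zeta>) (at \<zeta> within stolz_region \<zeta> M))"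


section \<open>The Szego projection of a domain\<close>

text \<open>A biholomorphic map of the disc onto \<open>\<Omega>\<close> together with its extension to the closures.\<close>

definition riemann_map :: "complex set \<Rightarrow> (complex \<Rightarrow> complex) \<Rightarrow> bool" where
  "riemann_map \<Omega> \<phi> \<longleftrightarrow> \<phi> holomorphic_on ball 0 1 \<and> \<phi> ` ball 0 1 = \<Omega> \<and>
     (\<exists>\<psi>. homeomorphism (cball 0 1) (closure \<Omega>) \<phi> \<psi>)"

text \<open>\<open>w\<close> is (a representative of) \<open>(\<phi>')\<^bsup>1/2\<^esup>\<close> on the circle.\<close>

definition sqrt_deriv_boundary :: "(complex \<Rightarrow> complex) \<Rightarrow> (complex \<Rightarrow> complex) \<Rightarrow> bool" where
  "sqrt_deriv_boundary \<phi> w \<longleftrightarrow>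
     (\<exists>h\<in>H2_disc. (\<forall>z\<in>ball 0 1. (h z)\<^sup>2 = deriv \<phi> z) \<and> nontangential_boundary_values h w)"

definition tau_half ::
    "(complex \<Rightarrow> complex) \<Rightarrow> (complex \<Rightarrow> complex) \<Rightarrow> (complex \<Rightarrow> complex) \<Rightarrow> complex \<Rightarrow> complex" where
  "tau_half \<phi> w f = (\<lambda>\<zeta>. f (\<phi> \<zeta>) * w \<zeta>)"

definition tau_half_inv ::
    "complex set \<Rightarrow> (complex \<Rightarrow> complex) \<Rightarrow> (complex \<Rightarrow> complex) \<Rightarrow> (complex \<Rightarrow> complex) \<Rightarrow> complex \<Rightarrow> complex" where
  "tau_half_inv \<Omega> \<phi> w g = (SOME f. f \<in> Lp_space (arc_length (frontier \<Omega>)) 2 \<and>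
     (AE \<zeta> in circle_measure. tau_half \<phi> w f \<zeta> = g \<zeta>))"

text \<open>As an operator on \<open>L\<^sup>2\<close> of the boundary this does not depend on the choice of \<open>\<phi>\<close> and \<open>w\<close>.\<close>

definition szego_projection ::
    "complex set \<Rightarrow> (complex \<Rightarrow> complex) \<Rightarrow> (complex \<Rightarrow> complex) \<Rightarrow> (complex \<Rightarrow> complex) \<Rightarrow> complex \<Rightarrow> complex" where
  "szego_projection \<Omega> \<phi> w f = tau_half_inv \<Omega> \<phi> w (szego_disc (tau_half \<phi> w f))"


section \<open>The domain\<close>

definition upper_half_plane :: "complex set" where
  "upper_half_plane = {z. 0 < Im z}"

text \<open>\<open>powr\<close> uses the principal logarithm, so on the upper half-plane it is the branch with
  argument in \<open>(0, \<pi>)\<close>.\<close>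

definition Phi1 :: "complex \<Rightarrow> complex" where
  "Phi1 z = z powr (3/2) * exp (- (\<i> * pi / 4)) - \<i>"

definition Phi2 :: "complex \<Rightarrow> complex" where
  "Phi2 z = - (z powr (3/2)) * exp (- (\<i> * pi / 4)) + \<i>"

definition Phi3 :: "complex \<Rightarrow> complex" where
  "Phi3 z = z powr (1/2) * exp (- (\<i> * pi / 4)) - 2"

definition Phi4 :: "complex \<Rightarrow> complex" where
  "Phi4 z = - (z powr (1/2)) * exp (- (\<i> * pi / 4)) + 2"

definition Omega :: "complex set" where
  "Omega = Phi1 ` upper_half_plane \<inter> Phi2 ` upper_half_plane
         \<inter> Phi3 ` upper_half_plane \<inter> Phi4 ` upper_half_plane"

end

(* The domain is the square |x| + |y| < 2 cut by |y| < 1 + |x|: six convex corners of angle pi/2 and two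
   reflex corners of angle 3 pi/2 at i and -i. Reflection at the boundary shows that a Riemann map phi with
   phi(0) = 0, which is odd by Schwarz's lemma, satisfies |phi'(z)|^2 ~ |z^2 - s1| * sum_j 1/|z^2 - s_j| with s1, s_j
   on the circle, and that arc length is the image of |phi'| d theta. For p <= 2 the weight |phi'|^(1 - p/2) is
   comparable to |H|, where H = sum_j u_j^((2 - p)/4) and each u_j = c_j (z^2 - s1)/(z^2 - s_j) has positive real
   part. Integrating a pointwise inequality between |F|^p |H|, (Re F)^p |H| and Re (F^p H) over the circle gives the
   upper bound of order 1/(5p - 6); duality gives 1/(6 - p) for p >= 2. The lower bound comes from the boundary
   function 1 - s1 cnj(z)^2, whose projection is 1, so that the norm of the image is the integral of the weight,
   which blows up like 1/(6 - p) near the reflex corners. *)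

theory Submission
 imports Defs
begin

text \<open>Squaring is what makes the weight usable. Antipodal corners have preimages with the same
  square, so the two reflex corners become a single zero \<open>s1\<close> in the variable z^2, and
  each quotient by a pole is a Moebius function of z^2 onto a half-plane. Small powers of such
  functions lie in a narrow convex cone, so their sum has no cancellation. The range of p comes from
  a competition of arguments: when F is close to the imaginary axis, F^p is turned past that axis by
  (p - 1) \<pi>/2, while the weight can turn it back by (2 - p)/4 times \<pi>/2; the difference
  \<open>\<kappa>\<close> = (5p - 6) \<pi>/8 is positive exactly for p > 6/5. The constants must not
  depend on the Riemann map, so all estimates are made for one normalized map, and disc
  automorphisms show that every other map gives the same operator up to null sets. The lower
  estimate obtained has exponent 1/p at the endpoint 6, twice the exponent that is claimed
  there.\<close>

abbreviation (input) mu :: "complex measure" where "mu \<equiv> circle_measure"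

section \<open>Mean-square calculus: domination, Cauchy-Schwarz, completeness\<close>

section \<open>Square integrable functions\<close>

text \<open>Written with the second power instead of \<open>powr\<close>, so that Bochner
  integrability applies directly; \<open>Lp_space_2_iff\<close> identifies it with
  \<open>Lp_space M 2\<close>.\<close>

definition L2 :: "'a measure \<Rightarrow> ('a \<Rightarrow> complex) \<Rightarrow> bool" where
 "L2 M f \<longleftrightarrow> f \<in> borel_measurable M \<and> integrable M (\<lambda>x. (norm (f x))\<^sup>2)"

lemma L2_measurable [measurable_dest]: "L2 M f ==> f \<in> borel_measurable M" by (simp add: L2_def)

lemma L2_integrable: "L2 M f ==> integrable M (\<lambda>x. (norm (f x))\<^sup>2)" by (simp add: L2_def)

lemma norm_add_sq_le: "(norm (a + b))\<^sup>2 \<le> 2 * (norm a)\<^sup>2 + 2 * (norm (b :: 'a :: real_normed_vector))\<^sup>2"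
proof -
 have "(norm (a + b))\<^sup>2 \<le> (norm a + norm b)\<^sup>2" by (intro power_mono norm_triangle_ineq) auto
 also have "\<dots> \<le> 2 * (norm a)\<^sup>2 + 2 * (norm b)\<^sup>2"
  using sum_squares_bound[of "norm a" "norm b"] by (simp add: power2_sum)
 finally show ?thesis .
qed

lemma L2_add:
 assumes "L2 M f" "L2 M g" shows "L2 M (\<lambda>x. f x + g x)" unfolding L2_def
proof
 show "(\<lambda>x. f x + g x) \<in> borel_measurable M" using assms by measurable
 show "integrable M (\<lambda>x. (norm (f x + g x))\<^sup>2)"
 proof (rule Bochner_Integration.integrable_bound)
  show "integrable M (\<lambda>x. 2 * (norm (f x))\<^sup>2 + 2 * (norm (g x))\<^sup>2)"
   using assms by (auto simp: L2_def)
  show "(\<lambda>x. (norm (f x + g x))\<^sup>2) \<in> borel_measurable M" using assms by measurable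
 qed (use norm_add_sq_le in auto)
qed

lemma L2_cmult: "L2 M f ==> L2 M (\<lambda>x. c * f x)"
 unfolding L2_def by (auto simp: norm_mult power_mult_distrib)

lemma L2_minus: "L2 M f ==> L2 M (\<lambda>x. - f x)" unfolding L2_def by auto

lemma L2_diff: "L2 M f ==> L2 M g ==> L2 M (\<lambda>x. f x - g x)"
 using L2_add[of M f "\<lambda>x. - g x"] L2_minus[of M g] by simp

lemma L2_cnj: "L2 M f ==> L2 M (\<lambda>x. cnj (f x))" unfolding L2_def
 by (auto intro: borel_measurable_continuous_on[OF continuous_on_cnj[OF continuous_on_id]])

lemma L2_dom:
 assumes "L2 M g" "f \<in> borel_measurable M" "AE x in M. norm (f x) \<le> norm (g x)"
 shows "L2 M f" unfolding L2_def
proof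
 have [measurable]: "f \<in> borel_measurable M" by fact
 show "integrable M (\<lambda>x. (norm (f x))\<^sup>2)"
 proof (rule Bochner_Integration.integrable_bound[OF L2_integrable[OF assms(1)]])
  show "AE x in M. norm ((norm (f x))\<^sup>2) \<le> norm ((norm (g x))\<^sup>2)"
   using assms(3) by eventually_elim (auto intro: power_mono)
 qed measurable
qed fact

lemma L2_prod:
 assumes "L2 M f" "L2 M g" shows "integrable M (\<lambda>x. f x * g x)"
proof (rule Bochner_Integration.integrable_bound)
 show "integrable M (\<lambda>x. (norm (f x))\<^sup>2 + (norm (g x))\<^sup>2)"
  using assms by (auto simp: L2_def)
 show "(\<lambda>x. f x * g x) \<in> borel_measurable M" using assms by measurable
 show "AE x in M. norm (f x * g x) \<le> norm ((norm (f x))\<^sup>2 + (norm (g x))\<^sup>2)"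
 proof (rule AE_I2)
  fix x
  have "2 * (norm (f x) * norm (g x)) \<le> (norm (f x))\<^sup>2 + (norm (g x))\<^sup>2"
   using sum_squares_bound[of "norm (f x)" "norm (g x)"] by simp
  moreover have "0 \<le> norm (f x) * norm (g x)" by simp
  ultimately show "norm (f x * g x) \<le> norm ((norm (f x))\<^sup>2 + (norm (g x))\<^sup>2)"
   unfolding norm_mult real_norm_def by linarith
 qed
qed

lemma L2_cauchy_schwarz:
 assumes "L2 M f" "L2 M g"
 shows "(norm (\<integral>x. f x * g x \<partial>M))\<^sup>2 \<le> (\<integral>x. (norm (f x))\<^sup>2 \<partial>M) * (\<integral>x. (norm (g x))\<^sup>2 \<partial>M)"
proof -
 let ?F = "\<lambda>x. ennreal (norm (f x))" and ?G = "\<lambda>x. ennreal (norm (g x))"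
 have i: "integrable M (\<lambda>x. norm (f x) * norm (g x))"
  using integrable_norm[OF L2_prod[OF assms]] by (simp add: norm_mult)
 have "(\<integral>\<^sup>+x. ?F x * ?G x \<partial>M)\<^sup>2 \<le> (\<integral>\<^sup>+x. ?F x ^ 2 \<partial>M) * (\<integral>\<^sup>+x. ?G x ^ 2 \<partial>M)"
  using assms by (intro Cauchy_Schwarz_nn_integral) auto
 also have "(\<integral>\<^sup>+x. ?F x ^ 2 \<partial>M) = ennreal (\<integral>x. (norm (f x))\<^sup>2 \<partial>M)"
  using nn_integral_eq_integral[OF L2_integrable[OF assms(1)]] by (simp add: ennreal_power)
 also have "(\<integral>\<^sup>+x. ?G x ^ 2 \<partial>M) = ennreal (\<integral>x. (norm (g x))\<^sup>2 \<partial>M)"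
  using nn_integral_eq_integral[OF L2_integrable[OF assms(2)]] by (simp add: ennreal_power)
 also have "(\<integral>\<^sup>+x. ?F x * ?G x \<partial>M) = ennreal (\<integral>x. norm (f x) * norm (g x) \<partial>M)"
  using nn_integral_eq_integral[OF i] by (simp add: ennreal_mult)
 finally have "(\<integral>x. norm (f x) * norm (g x) \<partial>M)\<^sup>2 \<le> (\<integral>x. (norm (f x))\<^sup>2 \<partial>M) * (\<integral>x. (norm (g x))\<^sup>2 \<partial>M)"
  by (simp add: ennreal_power flip: ennreal_mult)
 moreover have "norm (\<integral>x. f x * g x \<partial>M) \<le> (\<integral>x. norm (f x) * norm (g x) \<partial>M)"
  using integral_norm_bound[of M "\<lambda>x. f x * g x"] by (simp add: norm_mult)
 ultimately show ?thesis by (meson norm_ge_zero order_trans power_mono)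
qed

lemma ennreal_term_le_suminf: "f k \<le> (\<Sum>j. f j :: ennreal)"
 using sum_le_suminf[OF summableI, of "{k}" f] by simp

text \<open>The Bochner integral of a non-integrable function is 0, so this expresses mean-square
  convergence only between functions already known to satisfy \<open>L2\<close>; hence the
  \<open>L2\<close> hypotheses that accompany it.\<close>

definition L2lim :: "'a measure \<Rightarrow> (nat \<Rightarrow> 'a \<Rightarrow> complex) \<Rightarrow> ('a \<Rightarrow> complex) \<Rightarrow> bool" where
 "L2lim M f g \<longleftrightarrow> (\<lambda>n. \<integral>x. (norm (f n x - g x))\<^sup>2 \<partial>M) \<longlonglongrightarrow> 0"

lemma L2lim_dom:
 assumes "L2lim M f g" "\<And>n. L2 M (f n)" "L2 M g"
  and "\<And>n. f' n \<in> borel_measurable M" "g' \<in> borel_measurable M"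
  and "\<And>n. AE x in M. norm (f' n x - g' x) \<le> norm (f n x - g x)"
 shows "L2lim M f' g'" unfolding L2lim_def
proof (rule tendsto_sandwich[OF _ _ tendsto_const assms(1)[unfolded L2lim_def]])
 show "\<forall>\<^sub>F n in sequentially. (\<integral>x. (norm (f' n x - g' x))\<^sup>2 \<partial>M) \<le> (\<integral>x. (norm (f n x - g x))\<^sup>2 \<partial>M)"
 proof (rule always_eventually, rule allI)
  fix n
  have [measurable]: "f' n \<in> borel_measurable M" "g' \<in> borel_measurable M" by fact+
  have 1: "L2 M (\<lambda>x. f n x - g x)" by (intro L2_diff assms)
  have 2: "L2 M (\<lambda>x. f' n x - g' x)" by (rule L2_dom[OF 1]) (use assms(6) in auto)
  show "(\<integral>x. (norm (f' n x - g' x))\<^sup>2 \<partial>M) \<le> (\<integral>x. (norm (f n x - g x))\<^sup>2 \<partial>M)"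
   by (rule integral_mono_AE[OF L2_integrable[OF 2] L2_integrable[OF 1]])
     (use assms(6)[of n] in \<open>eventually_elim, auto intro: power_mono\<close>)
 qed
qed auto

lemma L2lim_add:
 assumes "L2lim M f g" "L2lim M f' g'" "\<And>n. L2 M (f n)" "L2 M g" "\<And>n. L2 M (f' n)" "L2 M g'"
 shows "L2lim M (\<lambda>n x. f n x + f' n x) (\<lambda>x. g x + g' x)" unfolding L2lim_def
proof (rule tendsto_sandwich[OF _ _ tendsto_const])
 have "(\<lambda>n. 2 * (\<integral>x. (norm (f n x - g x))\<^sup>2 \<partial>M) + 2 * (\<integral>x. (norm (f' n x - g' x))\<^sup>2 \<partial>M)) \<longlonglongrightarrow> 2 * 0 + 2 * 0"
  using assms(1,2) unfolding L2lim_def by (intro tendsto_intros)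
 then show "(\<lambda>n. 2 * (\<integral>x. (norm (f n x - g x))\<^sup>2 \<partial>M) + 2 * (\<integral>x. (norm (f' n x - g' x))\<^sup>2 \<partial>M)) \<longlonglongrightarrow> 0" by simp
 show "\<forall>\<^sub>F n in sequentially. (\<integral>x. (norm (f n x + f' n x - (g x + g' x)))\<^sup>2 \<partial>M) \<le>
   2 * (\<integral>x. (norm (f n x - g x))\<^sup>2 \<partial>M) + 2 * (\<integral>x. (norm (f' n x - g' x))\<^sup>2 \<partial>M)"
 proof (rule always_eventually, rule allI)
  fix n
  have 1: "L2 M (\<lambda>x. f n x - g x)" "L2 M (\<lambda>x. f' n x - g' x)" by (intro L2_diff assms)+
  have 2: "L2 M (\<lambda>x. f n x + f' n x - (g x + g' x))" by (intro L2_diff L2_add assms)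
  have "(\<integral>x. (norm (f n x + f' n x - (g x + g' x)))\<^sup>2 \<partial>M)
    \<le> (\<integral>x. 2 * (norm (f n x - g x))\<^sup>2 + 2 * (norm (f' n x - g' x))\<^sup>2 \<partial>M)"
  proof (rule integral_mono)
   fix x
   have "f n x + f' n x - (g x + g' x) = (f n x - g x) + (f' n x - g' x)" by simp
   then show "(norm (f n x + f' n x - (g x + g' x)))\<^sup>2 \<le> 2 * (norm (f n x - g x))\<^sup>2 + 2 * (norm (f' n x - g' x))\<^sup>2"
    using norm_add_sq_le by metis
  qed (use L2_integrable[OF 1(1)] L2_integrable[OF 1(2)] L2_integrable[OF 2] in auto)
  also have "\<dots> = 2 * (\<integral>x. (norm (f n x - g x))\<^sup>2 \<partial>M) + 2 * (\<integral>x. (norm (f' n x - g' x))\<^sup>2 \<partial>M)"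
   using L2_integrable[OF 1(1)] L2_integrable[OF 1(2)] by simp
  finally show "(\<integral>x. (norm (f n x + f' n x - (g x + g' x)))\<^sup>2 \<partial>M) \<le>
   2 * (\<integral>x. (norm (f n x - g x))\<^sup>2 \<partial>M) + 2 * (\<integral>x. (norm (f' n x - g' x))\<^sup>2 \<partial>M)" .
 qed
qed auto

lemma L2lim_cmult:
 assumes "L2lim M f g" shows "L2lim M (\<lambda>n x. c * f n x) (\<lambda>x. c * g x)"
proof -
 have "(\<lambda>n. (norm c)\<^sup>2 * (\<integral>x. (norm (f n x - g x))\<^sup>2 \<partial>M)) \<longlonglongrightarrow> (norm c)\<^sup>2 * 0"
  using assms unfolding L2lim_def by (intro tendsto_intros)
 then show ?thesis unfolding L2lim_def by (simp add: norm_mult power_mult_distrib flip: right_diff_distrib)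
qed

lemma L2lim_integral:
 assumes "L2lim M f g" "\<And>n. L2 M (f n)" "L2 M g" "L2 M h"
 shows "(\<lambda>n. \<integral>x. f n x * h x \<partial>M) \<longlonglongrightarrow> (\<integral>x. g x * h x \<partial>M)"
proof -
 have "(\<lambda>n. (norm (\<integral>x. (f n x - g x) * h x \<partial>M))\<^sup>2) \<longlonglongrightarrow> 0"
 proof (rule tendsto_sandwich[OF _ _ tendsto_const])
  have "(\<lambda>n. (\<integral>x. (norm (f n x - g x))\<^sup>2 \<partial>M) * (\<integral>x. (norm (h x))\<^sup>2 \<partial>M)) \<longlonglongrightarrow> 0 * (\<integral>x. (norm (h x))\<^sup>2 \<partial>M)"
   using assms(1) unfolding L2lim_def by (intro tendsto_intros)
  then show "(\<lambda>n. (\<integral>x. (norm (f n x - g x))\<^sup>2 \<partial>M) * (\<integral>x. (norm (h x))\<^sup>2 \<partial>M)) \<longlonglongrightarrow> 0" by simp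
  show "\<forall>\<^sub>F n in sequentially. (norm (\<integral>x. (f n x - g x) * h x \<partial>M))\<^sup>2 \<le> (\<integral>x. (norm (f n x - g x))\<^sup>2 \<partial>M) * (\<integral>x. (norm (h x))\<^sup>2 \<partial>M)"
   using assms by (intro always_eventually allI L2_cauchy_schwarz L2_diff) auto
 qed auto
 then have "(\<lambda>n. (\<integral>x. (f n x - g x) * h x \<partial>M)) \<longlonglongrightarrow> 0"
  by (auto simp: tendsto_norm_zero_iff)
 moreover have "(\<integral>x. (f n x - g x) * h x \<partial>M) = (\<integral>x. f n x * h x \<partial>M) - (\<integral>x. g x * h x \<partial>M)" for n
  unfolding left_diff_distrib by (rule Bochner_Integration.integral_diff) (intro L2_prod assms)+
 ultimately show ?thesis using LIM_zero_iff by auto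
qed

text \<open>Riesz-Fischer for functions instead of classes: a fast subsequence converges almost
  everywhere, its pointwise limit is the candidate, and Fatou's lemma turns the Cauchy condition
  into convergence of the full sequence.\<close>

lemma L2_complete:
 fixes f :: "nat \<Rightarrow> 'a \<Rightarrow> complex"
 assumes L: "\<And>n. L2 M (f n)"
  and C: "\<And>e. e > 0 ==> \<exists>N. \<forall>m\<ge>N. \<forall>n\<ge>N. (\<integral>x. (norm (f m x - f n x))\<^sup>2 \<partial>M) < e"
 obtains g where "L2 M g" "L2lim M f g"
proof -
 have "\<forall>k. \<exists>N. \<forall>m\<ge>N. \<forall>n\<ge>N. (\<integral>x. (norm (f m x - f n x))\<^sup>2 \<partial>M) < (1/4)^k"
  using C by simp
 then obtain N where N: "\<And>k m n. m \<ge> N k ==> n \<ge> N k ==> (\<integral>x. (norm (f m x - f n x))\<^sup>2 \<partial>M) < (1/4)^k"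
  by metis
 \<comment> \<open>Adding k and all earlier thresholds makes \<open>r\<close> non-decreasing, at
   least \<open>N k\<close> and at least k.\<close>
 define r where "r k = k + (\<Sum>j\<le>k. N j)" for k
 have rN: "r k \<ge> N k" for k unfolding r_def using member_le_sum[of k "{..k}" N] by simp
 have rmono: "r (Suc k) \<ge> r k" for k unfolding r_def by simp
 have rk: "r k \<ge> k" for k unfolding r_def by simp
 note [measurable] = L2_measurable[OF L]
 have nnint: "(\<integral>\<^sup>+x. ennreal ((norm (f m x - f n x))\<^sup>2) \<partial>M) = ennreal (\<integral>x. (norm (f m x - f n x))\<^sup>2 \<partial>M)" for m n
  by (intro nn_integral_eq_integral L2_integrable L2_diff L) auto
 \<comment> \<open>The squared increments integrate to less than 4^-k. Weighted by 2^k they are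
   still summable, and where the weighted sum is finite the increments decay geometrically.\<close>
 define d where "d k x = norm (f (r (Suc k)) x - f (r k) x)" for k x
 have [measurable]: "d k \<in> borel_measurable M" for k unfolding d_def by measurable
 have "(\<integral>\<^sup>+x. (\<Sum>k. ennreal (2^k * (d k x)\<^sup>2)) \<partial>M) = (\<Sum>k. \<integral>\<^sup>+x. ennreal (2^k * (d k x)\<^sup>2) \<partial>M)"
  by (rule nn_integral_suminf) auto
 also have "\<dots> \<le> (\<Sum>k. ennreal ((1/2)^k))"
 proof (rule suminf_le)
  fix k
  have "(\<integral>\<^sup>+x. ennreal (2^k * (d k x)\<^sup>2) \<partial>M) = ennreal (2^k) * (\<integral>\<^sup>+x. ennreal ((d k x)\<^sup>2) \<partial>M)"
   by (subst nn_integral_cmult[symmetric]) (auto simp: ennreal_mult)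
  also have "\<dots> = ennreal (2^k * (\<integral>x. (d k x)\<^sup>2 \<partial>M))"
   unfolding d_def nnint by (simp add: ennreal_mult)
  also have "\<dots> \<le> ennreal (2^k * (1/4)^k)"
   unfolding d_def using N[of k "r (Suc k)" "r k"] rN[of k] rmono[of k]
   by (intro ennreal_leI mult_left_mono) auto
  also have "2^k * (1/4)^k = (1/2::real)^k" by (simp flip: power_mult_distrib)
  finally show "(\<integral>\<^sup>+x. ennreal (2^k * (d k x)\<^sup>2) \<partial>M) \<le> ennreal ((1/2)^k)" .
 qed auto
 also have "\<dots> < \<infinity>" by (subst suminf_ennreal2) (auto intro!: summable_geometric)
 finally have "AE x in M. (\<Sum>k. ennreal (2^k * (d k x)\<^sup>2)) \<noteq> \<infinity>"
  by (intro nn_integral_noteq_infinite) auto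
 then have conv: "AE x in M. convergent (\<lambda>k. f (r k) x)"
 proof eventually_elim
  fix x assume fin: "(\<Sum>k. ennreal (2^k * (d k x)\<^sup>2)) \<noteq> \<infinity>"
  define S where "S = enn2real (\<Sum>k. ennreal (2^k * (d k x)\<^sup>2))"
  have S0: "S \<ge> 0" unfolding S_def by simp
  have le: "2^k * (d k x)\<^sup>2 \<le> S" for k
  proof -
   have "ennreal (2^k * (d k x)\<^sup>2) \<le> (\<Sum>k. ennreal (2^k * (d k x)\<^sup>2))"
    by (rule ennreal_term_le_suminf)
   also have "\<dots> = ennreal S" unfolding S_def using fin
    by (intro ennreal_enn2real[symmetric]) (auto simp: less_top)
   finally show ?thesis using S0 by (simp add: ennreal_le_iff)
  qed
  have dk: "d k x \<le> sqrt S * (1 / sqrt 2)^k" for k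
  proof -
   have "(d k x)\<^sup>2 \<le> S / 2^k" using le[of k] by (simp add: field_simps)
   then have "sqrt ((d k x)\<^sup>2) \<le> sqrt (S / 2^k)" by (rule real_sqrt_le_mono)
   then show ?thesis by (simp add: d_def real_sqrt_divide real_sqrt_power power_divide)
  qed
  have "summable (\<lambda>k. sqrt S * (1 / sqrt 2)^k)" by (intro summable_mult summable_geometric) auto
  then have "summable (\<lambda>k. norm (f (r (Suc k)) x - f (r k) x))"
   by (rule summable_comparison_test'[where N = 0]) (use dk in \<open>auto simp: d_def\<close>)
  then have "summable (\<lambda>k. f (r (Suc k)) x - f (r k) x)" by (rule summable_norm_cancel)
  then have "convergent (\<lambda>n. \<Sum>k<n. f (r (Suc k)) x - f (r k) x)"
   by (simp add: summable_iff_convergent)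
  then have "convergent (\<lambda>n. f (r n) x - f (r 0) x)"
   using sum_lessThan_telescope[of "\<lambda>k. f (r k) x"] by simp
  then show "convergent (\<lambda>k. f (r k) x)" using convergent_diff_const_right_iff by blast
 qed
 define g where "g x = lim (\<lambda>k. f (r k) x)" for x
 have [measurable]: "g \<in> borel_measurable M"
  unfolding g_def by (rule borel_measurable_lim_metric) measurable
 have lim: "AE x in M. (\<lambda>k. f (r k) x) \<longlonglongrightarrow> g x"
  using conv unfolding g_def by eventually_elim (simp add: convergent_LIMSEQ_iff)
 have fatou: "(\<integral>\<^sup>+x. ennreal ((norm (f n x - g x))\<^sup>2) \<partial>M) \<le> ennreal e" if n: "\<forall>m\<ge>K. (\<integral>x. (norm (f n x - f m x))\<^sup>2 \<partial>M) \<le> e" for n K e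
 proof -
  have "(\<integral>\<^sup>+x. ennreal ((norm (f n x - g x))\<^sup>2) \<partial>M) = (\<integral>\<^sup>+x. liminf (\<lambda>k. ennreal ((norm (f n x - f (r k) x))\<^sup>2)) \<partial>M)"
  proof (rule nn_integral_cong_AE)
   show "AE x in M. ennreal ((norm (f n x - g x))\<^sup>2) = liminf (\<lambda>k. ennreal ((norm (f n x - f (r k) x))\<^sup>2))"
    using lim
   proof eventually_elim
    case (elim x)
    then have "(\<lambda>k. ennreal ((norm (f n x - f (r k) x))\<^sup>2)) \<longlonglongrightarrow> ennreal ((norm (f n x - g x))\<^sup>2)"
     by (intro tendsto_intros)
    then show ?case by (intro lim_imp_Liminf[symmetric]) (auto simp del: tendsto_ennreal_iff)
   qed
  qed
  also have "\<dots> \<le> liminf (\<lambda>k. \<integral>\<^sup>+x. ennreal ((norm (f n x - f (r k) x))\<^sup>2) \<partial>M)"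
   by (rule nn_integral_liminf) auto
  also have "\<dots> \<le> ennreal e"
  proof (rule Liminf_le)
   show "\<forall>\<^sub>F k in sequentially. (\<integral>\<^sup>+x. ennreal ((norm (f n x - f (r k) x))\<^sup>2) \<partial>M) \<le> ennreal e"
    unfolding nnint using n rk le_trans by (intro eventually_sequentiallyI[of K] ennreal_leI) (metis)
  qed auto
  finally show ?thesis .
 qed
 have cauchy: "\<exists>K. \<forall>n\<ge>K. (\<integral>\<^sup>+x. ennreal ((norm (f n x - g x))\<^sup>2) \<partial>M) \<le> ennreal e" if "e > 0" for e
 proof -
  from C[OF that] obtain K where "\<forall>m\<ge>K. \<forall>n\<ge>K. (\<integral>x. (norm (f m x - f n x))\<^sup>2 \<partial>M) < e" by blast
  then have "\<forall>n\<ge>K. (\<integral>\<^sup>+x. ennreal ((norm (f n x - g x))\<^sup>2) \<partial>M) \<le> ennreal e"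
   by (intro allI impI fatou[of K]) (auto intro: less_imp_le)
  then show ?thesis by blast
 qed
 have Lg: "L2 M g"
 proof -
  from cauchy[of 1] obtain K where K: "(\<integral>\<^sup>+x. ennreal ((norm (f K x - g x))\<^sup>2) \<partial>M) \<le> ennreal 1" by auto
  have "L2 M (\<lambda>x. f K x - g x)" unfolding L2_def using K
   by (auto intro!: integrableI_bounded simp: le_less_trans[OF K])
  then show ?thesis using L2_diff[OF L[of K], of "\<lambda>x. f K x - g x"] by simp
 qed
 moreover have "L2lim M f g" unfolding L2lim_def
 proof (rule LIMSEQ_I)
  fix e :: real assume "e > 0"
  then obtain K where K: "\<forall>n\<ge>K. (\<integral>\<^sup>+x. ennreal ((norm (f n x - g x))\<^sup>2) \<partial>M) \<le> ennreal (e/2)"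
   using cauchy[of "e/2"] by auto
  have "norm (\<integral>x. (norm (f n x - g x))\<^sup>2 \<partial>M) < e" if "n \<ge> K" for n
  proof -
   have "ennreal (\<integral>x. (norm (f n x - g x))\<^sup>2 \<partial>M) = (\<integral>\<^sup>+x. ennreal ((norm (f n x - g x))\<^sup>2) \<partial>M)"
    by (intro nn_integral_eq_integral[symmetric] L2_integrable L2_diff L Lg) auto
   also have "\<dots> \<le> ennreal (e/2)" using K that by auto
   finally have "(\<integral>x. (norm (f n x - g x))\<^sup>2 \<partial>M) \<le> e/2" using \<open>e > 0\<close> by (simp add: ennreal_le_iff)
   then show ?thesis using \<open>e > 0\<close> by simp
  qed
  then show "\<exists>no. \<forall>n\<ge>no. norm ((\<integral>x. (norm (f n x - g x))\<^sup>2 \<partial>M) - 0) < e" by auto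
 qed
 ultimately show ?thesis by (rule that)
qed

lemma L2lim_Cauchy:
 assumes "L2lim M f g" "\<And>n. L2 M (f n)" "L2 M g" "e > 0"
 shows "\<exists>N. \<forall>m\<ge>N. \<forall>n\<ge>N. (\<integral>x. (norm (f m x - f n x))\<^sup>2 \<partial>M) < e"
proof -
 from assms(1)[unfolded L2lim_def, THEN LIMSEQ_D, of "e/4"] assms(4)
 obtain N where N: "\<And>n. n \<ge> N ==> (\<integral>x. (norm (f n x - g x))\<^sup>2 \<partial>M) < e/4" by fastforce
 have "(\<integral>x. (norm (f m x - f n x))\<^sup>2 \<partial>M) < e" if "m \<ge> N" "n \<ge> N" for m n
 proof -
  have 1: "L2 M (\<lambda>x. f k x - g x)" for k by (intro L2_diff assms)
  have "(\<integral>x. (norm (f m x - f n x))\<^sup>2 \<partial>M) \<le> (\<integral>x. 2 * (norm (f m x - g x))\<^sup>2 + 2 * (norm (f n x - g x))\<^sup>2 \<partial>M)"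
  proof (rule integral_mono)
   show "integrable M (\<lambda>x. (norm (f m x - f n x))\<^sup>2)" by (intro L2_integrable L2_diff assms)
   show "(norm (f m x - f n x))\<^sup>2 \<le> 2 * (norm (f m x - g x))\<^sup>2 + 2 * (norm (f n x - g x))\<^sup>2" for x
    using norm_add_sq_le[of "f m x - g x" "g x - f n x"] by (simp add: norm_minus_commute)
  qed (use L2_integrable[OF 1] in auto)
  also have "\<dots> = 2 * (\<integral>x. (norm (f m x - g x))\<^sup>2 \<partial>M) + 2 * (\<integral>x. (norm (f n x - g x))\<^sup>2 \<partial>M)"
   using L2_integrable[OF 1] by simp
  also have "\<dots> < e" using N[OF that(1)] N[OF that(2)] by simp
  finally show ?thesis .
 qed
 then show ?thesis by blast
qed

section \<open>Integration over the circle, mean value property, polynomial approximation\<close>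

section \<open>The unit circle\<close>

lemma space_circle_measure [simp]: "space mu = sphere 0 1"
 by (simp add: circle_measure_def space_restrict_space)

lemma sets_circle_measure [measurable_cong]: "sets mu = sets (restrict_space borel (sphere 0 1))"
 by (simp add: circle_measure_def)

lemma measurable_cis_circle:
 "cis \<in> measurable (restrict_space lborel {0..<2*pi}) (restrict_space borel (sphere 0 1))"
proof (intro measurable_restrict_space2 measurable_restrict_space1)
 show "cis \<in> measurable lborel borel" by (simp add: borel_measurable_continuous_onI continuous_on_cis)
qed (auto simp: space_restrict_space)

lemma borel_measurable_circle_comp_cis:
 assumes "F \<in> borel_measurable mu"
 shows "(\<lambda>t. F (cis t)) \<in> borel_measurable (restrict_space lborel {0..<2*pi})"
 using measurable_comp[OF measurable_cis_circle, of F borel] assms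
 by (simp add: comp_def measurable_cong_sets[OF sets_circle_measure refl])

lemma nn_integral_circle:
 assumes "F \<in> borel_measurable mu"
 shows "(\<integral>\<^sup>+x. F x \<partial>mu) = (\<integral>\<^sup>+t. F (cis t) * indicator {0..<2*pi} t \<partial>lborel)"
proof -
 have F: "F \<in> borel_measurable (restrict_space borel (sphere 0 1))"
  using assms by (simp add: measurable_cong_sets[OF sets_circle_measure refl])
 have "(\<integral>\<^sup>+x. F x \<partial>mu) = (\<integral>\<^sup>+t. F (cis t) \<partial>restrict_space lborel {0..<2*pi})"
  unfolding circle_measure_def using F by (subst nn_integral_distr[OF measurable_cis_circle]) auto
 also have "\<dots> = (\<integral>\<^sup>+t. F (cis t) * indicator {0..<2*pi} t \<partial>lborel)"
  by (rule nn_integral_restrict_space) auto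
 finally show ?thesis .
qed

lemma integral_circle:
 fixes f :: "complex \<Rightarrow> 'b::{banach, second_countable_topology}"
 assumes "f \<in> borel_measurable mu"
 shows "(\<integral>x. f x \<partial>mu) = (\<integral>t. indicator {0..<2*pi} t *\<^sub>R f (cis t) \<partial>lborel)"
proof -
 have F: "f \<in> borel_measurable (restrict_space borel (sphere 0 1))"
  using assms by (simp add: measurable_cong_sets[OF sets_circle_measure refl])
 have "(\<integral>x. f x \<partial>mu) = (\<integral>t. f (cis t) \<partial>restrict_space lborel {0..<2*pi})"
  unfolding circle_measure_def by (rule integral_distr[OF measurable_cis_circle F])
 also have "\<dots> = (\<integral>t. indicator {0..<2*pi} t *\<^sub>R f (cis t) \<partial>lborel)"
  by (rule integral_restrict_space) auto
 finally show ?thesis .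
qed

lemma emeasure_circle_space: "emeasure mu (sphere 0 1) = ennreal (2*pi)"
proof -
 have "emeasure mu (sphere 0 1) = (\<integral>\<^sup>+x. 1 \<partial>mu)" by (simp add: nn_integral_const)
 also have "\<dots> = (\<integral>\<^sup>+t. 1 * indicator {0..<2*pi} t \<partial>lborel)"
  by (rule nn_integral_circle) auto
 also have "\<dots> = emeasure lborel {0..<2*pi}" by simp
 also have "\<dots> = ennreal (2*pi)" by simp
 finally show ?thesis .
qed

lemma finite_circle: "finite_measure mu" by (rule finite_measureI) (simp add: emeasure_circle_space)

lemma measurable_circle_continuous:
 fixes f :: "complex \<Rightarrow> 'b::topological_space"
 assumes "continuous_on (sphere 0 1) f"
 shows "f \<in> borel_measurable mu" using borel_measurable_continuous_on_restrict[OF assms]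
 by (simp add: measurable_cong_sets[OF sets_circle_measure refl])

lemma integrable_circle_continuous:
 fixes f :: "complex \<Rightarrow> 'b::{banach, second_countable_topology}"
 assumes "continuous_on (sphere 0 1) f"
 shows "integrable mu f"
proof -
 interpret finite_measure mu by (rule finite_circle)
 have "compact (f ` sphere 0 1)" using assms compact_continuous_image by fastforce
 then have "bounded (f ` sphere 0 1)" by (rule compact_imp_bounded)
 then obtain B where "\<And>x. x \<in> sphere 0 1 ==> norm (f x) \<le> B"
  unfolding bounded_iff by (meson imageI)
 then show ?thesis by (intro integrable_const_bound[of _ B] measurable_circle_continuous[OF assms] AE_I2) auto
qed

lemma L2_circle_continuous:
 assumes "continuous_on (sphere 0 1) f" shows "L2 mu f" unfolding L2_def
 using assms by (auto intro!: measurable_circle_continuous integrable_circle_continuous continuous_intros)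

text \<open>Cauchy's integral formula at the centre, where dz/z becomes i d\<theta>. The half-open
  parameter interval of \<open>circle_measure\<close> and the closed one of the contour integral
  differ by a null point.\<close>

lemma circle_mean_value:
 fixes f :: "complex \<Rightarrow> complex"
 assumes c: "continuous_on (cball 0 1) f" and h: "f holomorphic_on ball 0 1"
 shows "(\<integral>ze. f ze \<partial>mu) = 2 * pi * f 0"
proof -
 have cs: "continuous_on (sphere 0 1) f" using c continuous_on_subset sphere_cball by blast
 have "((\<lambda>u. f u / (u - 0)) has_contour_integral (2 * of_real pi * \<i> * f 0)) (circlepath 0 1)"
  by (rule Cauchy_integral_circlepath[OF c h]) simp
 then have "((\<lambda>t. f (cis t) / cis t * \<i> * cis t) has_integral (2 * of_real pi * \<i> * f 0)) {0..2*pi}"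
  unfolding circlepath_def by (subst (asm) has_contour_integral_part_circlepath_iff) (auto simp: mult_ac)
 moreover have "(\<lambda>t. f (cis t) / cis t * \<i> * cis t) = (\<lambda>t. \<i> * f (cis t))"
  by (rule ext) (simp add: cis_neq_zero)
 ultimately have "((\<lambda>t. \<i> * f (cis t)) has_integral (2 * of_real pi * \<i> * f 0)) {0..2*pi}"
  by simp
 then have "((\<lambda>t. -\<i> * (\<i> * f (cis t))) has_integral (-\<i> * (2 * of_real pi * \<i> * f 0))) {0..2*pi}"
  by (rule has_integral_mult_right)
 then have 1: "((\<lambda>t. f (cis t)) has_integral (2 * pi * f 0)) {0..2*pi}" by (simp add: algebra_simps)
 have "continuous_on {0..2*pi} (\<lambda>t. f (cis t))"
  by (intro continuous_on_compose2[OF cs] continuous_intros continuous_on_cis) auto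
 then have si: "set_integrable lborel {0..2*pi} (\<lambda>t. f (cis t))"
  by (rule borel_integrable_atLeastAtMost')
 have "(\<integral>ze. f ze \<partial>mu) = (\<integral>t. indicator {0..<2*pi} t *\<^sub>R f (cis t) \<partial>lborel)"
  by (rule integral_circle[OF measurable_circle_continuous[OF cs]])
 also have "\<dots> = (\<integral>t. indicator {0..2*pi} t *\<^sub>R f (cis t) \<partial>lborel)"
 proof (rule integral_cong_AE)
  show "AE t in lborel. indicator {0..<2*pi} t *\<^sub>R f (cis t) = indicator {0..2*pi} t *\<^sub>R f (cis t)"
   using AE_lborel_singleton[of "2*pi"] by eventually_elim (auto simp: indicator_def)
  show "(\<lambda>t. indicator {0..2*pi} t *\<^sub>R f (cis t)) \<in> borel_measurable lborel"
   using si unfolding set_integrable_def by auto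
  show "(\<lambda>t. indicator {0..<2*pi} t *\<^sub>R f (cis t)) \<in> borel_measurable lborel"
   using borel_measurable_circle_comp_cis[OF measurable_circle_continuous[OF cs]]
    borel_measurable_restrict_space_iff[of "{0..<2*pi}" lborel "\<lambda>t. f (cis t)"] by simp
 qed
 also have "\<dots> = integral {0..2*pi} (\<lambda>t. f (cis t))"
  using set_borel_integral_eq_integral(2)[OF si] by (simp add: set_lebesgue_integral_def)
 also have "\<dots> = 2 * pi * f 0" using 1 by (rule integral_unique)
 finally show ?thesis .
qed

text \<open>On the circle ze and its conjugate are inverse, so a power times a conjugate power
  collapses to a single power or the conjugate of one, and real parts do not distinguish the two.
  This makes real parts of polynomials closed under products.\<close>

lemma Re_poly_cnj_circle:
 "\<exists>F. \<forall>ze. norm ze = 1 \<longrightarrow> Re (poly A ze * cnj (poly B ze)) = Re (poly F ze)"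
proof (induction A arbitrary: B)
 case 0
 show ?case by (rule exI[of _ 0]) auto
next
 case (pCons a A)
 obtain b B' where B: "B = pCons b B'" by (cases B)
 from pCons.IH[of B'] obtain F where
  F: "\<And>ze. norm ze = 1 ==> Re (poly A ze * cnj (poly B' ze)) = Re (poly F ze)" by blast
 have "Re (poly (pCons a A) ze * cnj (poly B ze)) = Re (poly (smult (cnj a) B + smult (cnj b) (pCons 0 A) + F) ze)"
  if "norm ze = 1" for ze
 proof -
  have z: "ze * cnj ze = 1" using that by (simp add: complex_norm_square[symmetric])
  have "poly (pCons a A) ze * cnj (poly B ze)
    = a * cnj (poly B ze) + ze * poly A ze * cnj b + (ze * cnj ze) * (poly A ze * cnj (poly B' ze))"
   unfolding B by (simp add: algebra_simps)
  then have "Re (poly (pCons a A) ze * cnj (poly B ze))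
    = Re (a * cnj (poly B ze)) + Re (ze * poly A ze * cnj b) + Re (poly A ze * cnj (poly B' ze))"
   unfolding z by (simp only: plus_complex.sel mult_1_left)
  also have "Re (a * cnj (poly B ze)) = Re (cnj a * poly B ze)" by simp
  also have "Re (poly A ze * cnj (poly B' ze)) = Re (poly F ze)" by (rule F[OF that])
  finally show ?thesis by (simp add: algebra_simps)
 qed
 then show ?case by blast
qed

text \<open>Stone-Weierstrass delivers real polynomials in the coordinates; on the circle they are
  trigonometric polynomials. Products use 2 Re a Re b = Re (a b) + Re (a cnj b).\<close>

lemma real_polynomial_function_circle:
 assumes "real_polynomial_function (g :: complex \<Rightarrow> real)"
 shows "\<exists>F. \<forall>ze. norm ze = 1 \<longrightarrow> g ze = Re (poly F ze)" using assms
proof induction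
 case (linear f)
 then interpret bounded_linear f .
 have "f ze = Re (poly [:0, Complex (f 1) (- f \<i>):] ze)" for ze
 proof -
  have "ze = Re ze *\<^sub>R 1 + Im ze *\<^sub>R \<i>" by (simp add: complex_eq_iff)
  then have "f ze = Re ze * f 1 + Im ze * f \<i>" by (metis add scaleR real_scaleR_def)
  then show ?thesis by (simp add: algebra_simps)
 qed
 then show ?case by blast
next
 case (const c)
 have "c = Re (poly [:of_real c:] ze)" for ze by simp
 then show ?case by blast
next
 case (add f g)
 then obtain F G where "\<forall>ze. norm ze = 1 \<longrightarrow> f ze = Re (poly F ze)" "\<forall>ze. norm ze = 1 \<longrightarrow> g ze = Re (poly G ze)"
  by blast
 then show ?case by (intro exI[of _ "F + G"]) auto
next
 case (mult f g)
 then obtain F G where FG: "\<forall>ze. norm ze = 1 \<longrightarrow> f ze = Re (poly F ze)" "\<forall>ze. norm ze = 1 \<longrightarrow> g ze = Re (poly G ze)"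
  by blast
 from Re_poly_cnj_circle[of F G] obtain K where
  K: "\<forall>ze. norm ze = 1 \<longrightarrow> Re (poly F ze * cnj (poly G ze)) = Re (poly K ze)" by blast
 have "f ze * g ze = Re (poly (smult (1/2) (F * G + K)) ze)" if "norm ze = 1" for ze
  using FG K that by (simp add: field_simps)
 then show ?case by blast
qed

text \<open>Approximating f + e/2 within e/4 leaves a real part of at least e/4 on the circle, and
  the maximum principle for -Re F carries this into the disc. Positivity inside is what later makes
  F^p holomorphic; reality at 0 gives the projection of Re F a closed form.\<close>

lemma positive_poly_approx:
 assumes f: "continuous_on (sphere 0 1) f" and f0: "\<And>ze. ze \<in> sphere 0 1 ==> 0 \<le> f ze" and e: "e > 0"
 obtains F where "Im (poly F 0) = 0" "\<And>ze. norm ze \<le> 1 ==> 0 < Re (poly F ze)"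
  "\<And>ze. ze \<in> sphere 0 1 ==> \<bar>Re (poly F ze) - f ze\<bar> < e"
proof -
 obtain g where g: "real_polynomial_function g" "\<And>x. x \<in> sphere 0 1 ==> \<bar>(f x + e/2) - g x\<bar> < e/4"
  by (rule Stone_Weierstrass_real_polynomial_function[of "sphere 0 1" "\<lambda>x. f x + e/2" "e/4"])
    (use f e in \<open>auto intro!: continuous_intros\<close>)
 obtain G where G: "\<forall>ze. norm ze = 1 \<longrightarrow> g ze = Re (poly G ze)"
  using real_polynomial_function_circle[OF g(1)] by blast
 define F where "F = G - [:\<i> * Im (poly G 0):]"
 have ReF: "Re (poly F ze) = Re (poly G ze)" for ze by (simp add: F_def)
 have s: "e/4 \<le> Re (poly F ze)" "\<bar>Re (poly F ze) - f ze\<bar> < e" if "ze \<in> sphere 0 1" for ze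
  using g(2)[OF that] f0[OF that] G that e unfolding ReF abs_less_iff by auto
 have "Re (- poly F ze) \<le> - e/4" if "norm ze \<le> 1" for ze
 proof (rule maximum_real_frontier[of "\<lambda>z. - poly F z" "cball 0 1"])
  show "(\<lambda>z. - poly F z) holomorphic_on interior (cball 0 1)" by (intro holomorphic_intros)
  show "continuous_on (closure (cball 0 1)) (\<lambda>z. - poly F z)" by (intro continuous_intros)
 qed (use s that in auto)
 then show ?thesis using that[of F] s e by (fastforce simp: F_def)
qed

text \<open>Membership of a real function in the mean-square closure of the continuous
  functions.\<close>

definition C_approx :: "(complex \<Rightarrow> real) \<Rightarrow> bool" where
 "C_approx u \<longleftrightarrow> (\<forall>e>0. \<exists>c. continuous_on (sphere 0 1) c \<and> (\<integral>ze. (u ze - c ze)\<^sup>2 \<partial>mu) < e)"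

lemma sq_diff_integrable:
 fixes u v :: "'a \<Rightarrow> real"
 assumes "u \<in> borel_measurable M" "v \<in> borel_measurable M" "integrable M (\<lambda>x. (u x)\<^sup>2)" "integrable M (\<lambda>x. (v x)\<^sup>2)"
 shows "integrable M (\<lambda>x. (u x - v x)\<^sup>2)"
proof (rule Bochner_Integration.integrable_bound)
 show "integrable M (\<lambda>x. 2 * (u x)\<^sup>2 + 2 * (v x)\<^sup>2)" using assms by auto
 show "AE x in M. norm ((u x - v x)\<^sup>2) \<le> norm (2 * (u x)\<^sup>2 + 2 * (v x)\<^sup>2)"
  using norm_add_sq_le[of "u _" "- v _"] by (intro AE_I2) auto
 show "(\<lambda>x. (u x - v x)\<^sup>2) \<in> borel_measurable M" using assms(1,2) by measurable
qed

lemma sq_diff_triangle: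
 fixes u v w :: "'a \<Rightarrow> real"
 assumes "u \<in> borel_measurable M" "v \<in> borel_measurable M" "w \<in> borel_measurable M"
  "integrable M (\<lambda>x. (u x)\<^sup>2)" "integrable M (\<lambda>x. (v x)\<^sup>2)" "integrable M (\<lambda>x. (w x)\<^sup>2)"
 shows "(\<integral>x. (u x - w x)\<^sup>2 \<partial>M) \<le> 2 * (\<integral>x. (u x - v x)\<^sup>2 \<partial>M) + 2 * (\<integral>x. (v x - w x)\<^sup>2 \<partial>M)"
proof -
 have i: "integrable M (\<lambda>x. (u x - w x)\<^sup>2)" "integrable M (\<lambda>x. (u x - v x)\<^sup>2)" "integrable M (\<lambda>x. (v x - w x)\<^sup>2)"
  using assms by (auto intro: sq_diff_integrable)
 have "(\<integral>x. (u x - w x)\<^sup>2 \<partial>M) \<le> (\<integral>x. 2 * (u x - v x)\<^sup>2 + 2 * (v x - w x)\<^sup>2 \<partial>M)"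
 proof (rule integral_mono)
  show "(u x - w x)\<^sup>2 \<le> 2 * (u x - v x)\<^sup>2 + 2 * (v x - w x)\<^sup>2" for x
   using norm_add_sq_le[of "u x - v x" "v x - w x"] by simp
 qed (use i in auto)
 then show ?thesis using i by simp
qed

lemma C_approx_closed:
 assumes u: "u \<in> borel_measurable mu" "integrable mu (\<lambda>x. (u x)\<^sup>2)"
  and v: "\<And>e. e > 0 ==> \<exists>v. v \<in> borel_measurable mu \<and> integrable mu (\<lambda>x. (v x)\<^sup>2) \<and>
   C_approx v \<and> (\<integral>ze. (u ze - v ze)\<^sup>2 \<partial>mu) < e"
 shows "C_approx u" unfolding C_approx_def
proof (intro allI impI)
 fix e :: real assume "e > 0"
 then obtain v where v: "v \<in> borel_measurable mu" "integrable mu (\<lambda>x. (v x)\<^sup>2)"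
   "C_approx v" "(\<integral>ze. (u ze - v ze)\<^sup>2 \<partial>mu) < e/4" using v[of "e/4"] by auto
 from v(3) \<open>e > 0\<close> obtain c where c: "continuous_on (sphere 0 1) c" "(\<integral>ze. (v ze - c ze)\<^sup>2 \<partial>mu) < e/4"
  unfolding C_approx_def by (meson divide_pos_pos zero_less_numeral)
 have "(\<integral>ze. (u ze - c ze)\<^sup>2 \<partial>mu) \<le> 2 * (\<integral>x. (u x - v x)\<^sup>2 \<partial>mu) + 2 * (\<integral>x. (v x - c x)\<^sup>2 \<partial>mu)"
  using c(1) by (intro sq_diff_triangle[OF u(1) v(1) measurable_circle_continuous[OF c(1)] u(2) v(2)]
    integrable_circle_continuous continuous_intros)
 also have "\<dots> < e" using v(4) c(2) by simp
 finally show "\<exists>c. continuous_on (sphere 0 1) c \<and> (\<integral>ze. (u ze - c ze)\<^sup>2 \<partial>mu) < e" using c(1) by blast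
qed

text \<open>Inner regularity replaces A by a compact K up to small measure; the indicator of K is
  the bounded pointwise limit of Lipschitz cutoffs of the distance to K.\<close>

lemma C_approx_indicator:
 assumes A: "A \<in> sets mu"
 shows "C_approx (indicator A)"
proof (rule C_approx_closed)
 interpret finite_measure mu by (rule finite_circle)
 note fin = finite_circle
 show "(indicator A :: _ \<Rightarrow> real) \<in> borel_measurable mu" using A by simp
 have isq: "((indicator B x)\<^sup>2 :: real) = indicator B x" for B and x :: complex by (auto simp: indicator_def)
 show "integrable mu (\<lambda>x. (indicator A x :: real)\<^sup>2)"
  unfolding isq using A by (auto simp: emeasure_eq_measure)
 fix e :: real assume e: "e > 0"
 \<comment> \<open>Inner regularity is stated for measures on all Borel sets of a space, so the
   circle measure is pushed forward to the plane along the inclusion.\<close>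
 define M where "M = distr mu borel (\<lambda>x. x)"
 have idm: "(\<lambda>x. x) \<in> measurable mu borel"
  by (intro measurable_circle_continuous continuous_intros)
 have sM: "sets M = sets borel" by (simp add: M_def)
 have Msp: "space M = UNIV" by (simp add: M_def)
 have eM: "emeasure M B = emeasure mu (B \<inter> sphere 0 1)" if "B \<in> sets borel" for B
  unfolding M_def using that idm by (simp add: emeasure_distr vimage_def Int_def)
 have Msub: "A \<subseteq> sphere 0 1" using sets.sets_into_space[OF A] by simp
 have Ab: "A \<in> sets borel" using A unfolding sets_circle_measure by (auto simp: sets_restrict_space)
 have "emeasure M A = (SUP K\<in>{K. K \<subseteq> A \<and> compact K}. emeasure M K)"
  by (rule inner_regular[OF sM _ Ab]) (simp add: Msp eM emeasure_circle_space del: emeasure_eq_measure)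
 moreover have "emeasure M A \<noteq> \<infinity>" by (simp add: eM[OF Ab])
 ultimately have "\<exists>K. K \<subseteq> A \<and> compact K \<and> emeasure M A < emeasure M K + ennreal e"
 proof -
  assume sup: "emeasure M A = (SUP K\<in>{K. K \<subseteq> A \<and> compact K}. emeasure M K)" and fi: "emeasure M A \<noteq> \<infinity>"
  show ?thesis
  proof (cases "emeasure M A = 0")
   case True then show ?thesis using e by (intro exI[of _ "{}"]) auto
  next
   case False
   then have "emeasure M A - ennreal e < emeasure M A"
    using fi e by (intro ennreal_between) (auto simp: zero_less_iff_neq_zero less_top)
   then obtain K where "K \<subseteq> A" "compact K" "emeasure M A - ennreal e < emeasure M K"
    unfolding sup less_SUP_iff by auto
   moreover have "emeasure M K \<le> emeasure M A"
    using calculation Ab by (intro emeasure_mono) (auto simp: sM)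
   moreover obtain a where a: "emeasure M A = ennreal a" "0 \<le> a" using fi by (cases "emeasure M A") auto
   moreover obtain k where k: "emeasure M K = ennreal k" "0 \<le> k"
    using fi calculation by (cases "emeasure M K") (auto simp: top_unique)
   ultimately have "a < k + e" using e by (cases "0 \<le> a - e") (auto simp: ennreal_minus ennreal_less_iff)
   then show ?thesis using \<open>K \<subseteq> A\<close> \<open>compact K\<close> a k e
    by (intro exI[of _ K]) (auto simp: ennreal_less_iff simp flip: ennreal_plus)
  qed
 qed
 then obtain K where K: "K \<subseteq> A" "compact K" "emeasure M A < emeasure M K + ennreal e" by blast
 have Ks: "K \<in> sets mu"
  using K(1,2) Msub unfolding sets_circle_measure by (auto simp: sets_restrict_space image_iff intro!: bexI[of _ K] borel_compact)
 have ms: "measure mu A < measure mu K + e"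
 proof -
  have "emeasure mu A < emeasure mu K + ennreal e"
   using K(3) eM[OF Ab] eM[OF borel_compact[OF K(2)]] Msub K(1) by (simp add: Int_absorb2 subset_trans del: emeasure_eq_measure)
  then show ?thesis using e by (simp add: emeasure_eq_measure ennreal_less_iff flip: ennreal_plus)
 qed
 have "(\<integral>ze. (indicator A ze - indicator K ze :: real)\<^sup>2 \<partial>mu) = (\<integral>ze. indicator (A - K) ze \<partial>mu)"
  using K(1) by (intro Bochner_Integration.integral_cong refl) (auto simp: indicator_def)
 also have "\<dots> = measure mu (A - K)"
 proof -
  have "(A - K) \<inter> sphere 0 1 = A - K" using Msub by blast
  then show ?thesis by simp
 qed
 also have "\<dots> = measure mu A - measure mu K" using A Ks K(1) by (intro finite_measure_Diff) auto
 also have "\<dots> < e" using ms by simp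
 finally have small: "(\<integral>ze. (indicator A ze - indicator K ze :: real)\<^sup>2 \<partial>mu) < e" .
 have capp: "C_approx (indicator K)"
 proof (cases "K = {}")
  case True
  then show ?thesis unfolding C_approx_def by (auto intro!: exI[of _ "\<lambda>_. 0"])
 next
  case False
  \<comment> \<open>The cutoff is 1 on K and vanishes at x once n exceeds the reciprocal distance.
    For empty K the value of \<open>infdist\<close> is 0, hence the separate case.\<close>
  define c where "c n x = max 0 (1 - real n * infdist x K)" for n and x :: complex
  have cc: "continuous_on S (c n)" for S n unfolding c_def by (intro continuous_intros)
  have cb: "0 \<le> c n x" "c n x \<le> 1" for n x unfolding c_def by (auto simp: infdist_nonneg)
  have lim: "(\<lambda>n. (indicator K x - c n x)\<^sup>2) \<longlonglongrightarrow> 0" for x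
  proof (cases "x \<in> K")
   case True then show ?thesis by (simp add: c_def)
  next
   case xK: False
   then have d: "infdist x K > 0"
    using in_closed_iff_infdist_zero[of K x] compact_imp_closed[OF K(2)] False infdist_nonneg[of x K] by force
   obtain N where N: "real N * infdist x K > 1" using d reals_Archimedean3 by blast
   have "c n x = 0" if "n \<ge> N" for n
   proof -
    have "real n * infdist x K \<ge> real N * infdist x K" using that d by (intro mult_right_mono) auto
    then show ?thesis using N by (simp add: c_def)
   qed
   then have "eventually (\<lambda>n. (indicator K x - c n x)\<^sup>2 = 0) sequentially"
    using xK by (intro eventually_sequentiallyI[of N]) auto
   then show ?thesis by (rule tendsto_eventually)
  qed
  have "(\<lambda>n. \<integral>x. (indicator K x - c n x)\<^sup>2 \<partial>mu) \<longlonglongrightarrow> (\<integral>x. 0 \<partial>mu)"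
  proof (rule integral_dominated_convergence[where w = "\<lambda>_. 1"])
   show "AE x in mu. norm ((indicator K x - c n x)\<^sup>2) \<le> 1" for n
    using cb by (intro AE_I2) (auto simp: indicator_def power2_eq_square abs_if intro!: mult_le_one)
   show "(\<lambda>x. (indicator K x - c n x)\<^sup>2) \<in> borel_measurable mu" for n
    using measurable_circle_continuous[OF cc, of n] Ks by measurable
  qed (use lim in \<open>auto simp: emeasure_eq_measure\<close>)
  then have lim2: "(\<lambda>n. \<integral>x. (indicator K x - c n x)\<^sup>2 \<partial>mu) \<longlonglongrightarrow> 0" by simp
  show ?thesis unfolding C_approx_def
  proof (intro allI impI)
   fix e :: real assume "e > 0"
   then have "eventually (\<lambda>n. (\<integral>x. (indicator K x - c n x)\<^sup>2 \<partial>mu) < e) sequentially"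
    by (rule order_tendstoD(2)[OF lim2])
   then obtain n where "(\<integral>x. (indicator K x - c n x)\<^sup>2 \<partial>mu) < e"
    using eventually_happens sequentially_bot by blast
   then show "\<exists>c. continuous_on (sphere 0 1) c \<and> (\<integral>ze. (indicator K ze - c ze)\<^sup>2 \<partial>mu) < e"
    using cc by blast
  qed
 qed
 show "\<exists>v. v \<in> borel_measurable mu \<and> integrable mu (\<lambda>x. (v x)\<^sup>2) \<and>
   C_approx v \<and> (\<integral>ze. (indicator A ze - v ze)\<^sup>2 \<partial>mu) < e"
  by (rule exI[of _ "indicator K"]) (use small capp Ks in \<open>auto simp: isq emeasure_eq_measure\<close>)
qed

text \<open>Integrability sits as a premise inside the induction statement because it is inherited
  downwards: from a multiple, a sum or an increasing limit to its constituents.\<close>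

lemma C_approx_nonneg:
 assumes "u \<in> borel_measurable mu" "\<And>x. 0 \<le> u x" "integrable mu (\<lambda>x. (u x)\<^sup>2)"
 shows "C_approx u"
proof -
 interpret finite_measure mu by (rule finite_circle)
 have "integrable mu (\<lambda>x. (u x)\<^sup>2) \<longrightarrow> C_approx u" using assms(1,2)
 proof (induction u rule: borel_measurable_induct_real)
  case (set A) then show ?case using C_approx_indicator by blast
 next
  case (mult u c)
  show ?case
  proof (cases "c = 0")
   case True
   then show ?thesis unfolding C_approx_def by (auto intro!: exI[of _ "\<lambda>_. 0"])
  next
   case False
   show ?thesis
   proof
    assume "integrable mu (\<lambda>x. (c * u x)\<^sup>2)"
    then have "integrable mu (\<lambda>x. (u x)\<^sup>2)" using False by (simp add: power_mult_distrib)
    then have C: "C_approx u" using mult by blast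
    show "C_approx (\<lambda>x. c * u x)" unfolding C_approx_def
    proof (intro allI impI)
     fix e :: real assume e: "e > 0"
     obtain v where v: "continuous_on (sphere 0 1) v" "(\<integral>ze. (u ze - v ze)\<^sup>2 \<partial>mu) < e / c\<^sup>2"
      using C e False unfolding C_approx_def by (metis divide_pos_pos zero_less_power2)
     have "(\<integral>ze. (c * u ze - c * v ze)\<^sup>2 \<partial>mu) = c\<^sup>2 * (\<integral>ze. (u ze - v ze)\<^sup>2 \<partial>mu)"
      by (simp add: power_mult_distrib flip: right_diff_distrib)
     also have "\<dots> < e" using v(2) False by (simp add: field_simps)
     finally show "\<exists>v. continuous_on (sphere 0 1) v \<and> (\<integral>ze. (c * u ze - v ze)\<^sup>2 \<partial>mu) < e"
      using v(1) by (intro exI[of _ "\<lambda>x. c * v x"]) (auto intro: continuous_intros)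
    qed
   qed
  qed
 next
  case (add u v)
  show ?case
  proof
   assume int: "integrable mu (\<lambda>x. (v x + u x)\<^sup>2)"
   note [measurable] = add(1) add(3)
   have ui: "integrable mu (\<lambda>x. (u x)\<^sup>2)"
    by (rule Bochner_Integration.integrable_bound[OF int]) (use add in \<open>auto intro!: power_mono\<close>)
   have vi: "integrable mu (\<lambda>x. (v x)\<^sup>2)"
    by (rule Bochner_Integration.integrable_bound[OF int]) (use add in \<open>auto intro!: power_mono\<close>)
   have C: "C_approx u" "C_approx v" using ui vi add by auto
   show "C_approx (\<lambda>x. v x + u x)" unfolding C_approx_def
   proof (intro allI impI)
    fix e :: real assume "e > 0"
    then obtain c d where c: "continuous_on (sphere 0 1) c" "(\<integral>ze. (u ze - c ze)\<^sup>2 \<partial>mu) < e/4"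
     and d: "continuous_on (sphere 0 1) d" "(\<integral>ze. (v ze - d ze)\<^sup>2 \<partial>mu) < e/4"
     using C unfolding C_approx_def by (meson divide_pos_pos zero_less_numeral)
    note cm = measurable_circle_continuous[OF c(1)] measurable_circle_continuous[OF d(1)]
    have ci: "integrable mu (\<lambda>x. (c x)\<^sup>2)" "integrable mu (\<lambda>x. (d x)\<^sup>2)"
     using c(1) d(1) by (auto intro!: integrable_circle_continuous continuous_intros)
    have i: "integrable mu (\<lambda>x. (u x - c x)\<^sup>2)" "integrable mu (\<lambda>x. (v x - d x)\<^sup>2)"
     using sq_diff_integrable add(1,3) cm ui vi ci by blast+
    have "(\<integral>ze. (v ze + u ze - (d ze + c ze))\<^sup>2 \<partial>mu)
      \<le> (\<integral>ze. 2 * (v ze - d ze)\<^sup>2 + 2 * (u ze - c ze)\<^sup>2 \<partial>mu)"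
    proof (rule integral_mono)
     show "(v x + u x - (d x + c x))\<^sup>2 \<le> 2 * (v x - d x)\<^sup>2 + 2 * (u x - c x)\<^sup>2" for x
      using norm_add_sq_le[of "v x - d x" "u x - c x"] by (simp add: algebra_simps)
     have "continuous_on (sphere 0 1) (\<lambda>x. d x + c x)" using c(1) d(1) by (intro continuous_on_add)
     then have "(\<lambda>x. d x + c x) \<in> borel_measurable mu"
       "integrable mu (\<lambda>x. (d x + c x)\<^sup>2)"
      by (intro integrable_circle_continuous measurable_circle_continuous continuous_on_power; assumption)+
     then show "integrable mu (\<lambda>x. (v x + u x - (d x + c x))\<^sup>2)"
      using int add(1,3) by (intro sq_diff_integrable) (auto intro: borel_measurable_add simp: add(1,3))
    qed (use i in auto)
    also have "\<dots> < e" using i c(2) d(2) by simp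
    finally show "\<exists>c. continuous_on (sphere 0 1) c \<and> (\<integral>ze. (v ze + u ze - c ze)\<^sup>2 \<partial>mu) < e"
     using c(1) d(1) by (intro exI[of _ "\<lambda>x. d x + c x"]) (auto intro: continuous_intros)
   qed
  qed
 next
  case (seq U)
  note [measurable] = seq.hyps(1)
  have Ule: "U i x \<le> u x" if "x \<in> space mu" for i x
   using incseq_le[of "\<lambda>i. U i x" "u x" i] seq.hyps(3) seq.hyps(4)[OF that] by (auto simp: incseq_def le_fun_def)
  have um [measurable]: "u \<in> borel_measurable mu"
   by (rule borel_measurable_LIMSEQ_real[of mu U]) (use seq in auto)
  show ?case
  proof
   assume int: "integrable mu (\<lambda>x. (u x)\<^sup>2)"
   have Ui: "integrable mu (\<lambda>x. (U i x)\<^sup>2)" for i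
    by (rule Bochner_Integration.integrable_bound[OF int])
      (use Ule seq.hyps(2) in \<open>auto intro!: power_mono AE_I2\<close>)
   have "(\<lambda>i. \<integral>x. (u x - U i x)\<^sup>2 \<partial>mu) \<longlonglongrightarrow> (\<integral>x. 0 \<partial>mu)"
   proof (rule integral_dominated_convergence[where w = "\<lambda>x. (u x)\<^sup>2"])
    show "AE x in mu. norm ((u x - U i x)\<^sup>2) \<le> (u x)\<^sup>2" for i
    proof (rule AE_I2)
     fix x assume "x \<in> space mu"
     then show "norm ((u x - U i x)\<^sup>2) \<le> (u x)\<^sup>2"
      using Ule[of x i] seq.hyps(2)[of i x] by (auto intro!: power_mono)
    qed
    show "AE x in mu. (\<lambda>i. (u x - U i x)\<^sup>2) \<longlonglongrightarrow> 0"
    proof (rule AE_I2)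
     fix x assume "x \<in> space mu"
     then have "(\<lambda>i. (u x - U i x)\<^sup>2) \<longlonglongrightarrow> (u x - u x)\<^sup>2" by (intro tendsto_intros seq.hyps(4))
     then show "(\<lambda>i. (u x - U i x)\<^sup>2) \<longlonglongrightarrow> 0" by simp
    qed
   qed (use int in auto)
   then have lim: "(\<lambda>i. \<integral>x. (u x - U i x)\<^sup>2 \<partial>mu) \<longlonglongrightarrow> 0" by simp
   show "C_approx u"
   proof (rule C_approx_closed[OF um int])
    fix e :: real assume "e > 0"
    then have "eventually (\<lambda>i. (\<integral>x. (u x - U i x)\<^sup>2 \<partial>mu) < e) sequentially"
     by (rule order_tendstoD(2)[OF lim])
    then obtain i where "(\<integral>x. (u x - U i x)\<^sup>2 \<partial>mu) < e"
     using eventually_happens sequentially_bot by blast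
    then show "\<exists>v. v \<in> borel_measurable mu \<and> integrable mu (\<lambda>x. (v x)\<^sup>2) \<and>
      C_approx v \<and> (\<integral>ze. (u ze - v ze)\<^sup>2 \<partial>mu) < e"
     using Ui seq.hyps(1) seq.IH by blast
   qed
  qed
 qed
 then show ?thesis using assms(3) by blast
qed

text \<open>The continuous approximant may be replaced by its absolute value, which is no further
  from the non-negative u; then the uniform approximation by positive real parts applies.\<close>

lemma positive_poly_L2_approx:
 assumes u: "u \<in> borel_measurable mu" "\<And>x. 0 \<le> u x" "integrable mu (\<lambda>x. (u x)\<^sup>2)"
 obtains F :: "nat \<Rightarrow> complex poly" where "\<And>n. Im (poly (F n) 0) = 0" "\<And>n ze. norm ze \<le> 1 ==> 0 < Re (poly (F n) ze)"
  "L2lim mu (\<lambda>n ze. of_real (Re (poly (F n) ze))) (\<lambda>ze. of_real (u ze))"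
proof -
 interpret finite_measure mu by (rule finite_circle)
 have "\<exists>F. Im (poly F 0) = 0 \<and> (\<forall>ze. norm ze \<le> 1 \<longrightarrow> 0 < Re (poly F ze)) \<and>
   (\<integral>ze. (u ze - Re (poly F ze))\<^sup>2 \<partial>mu) < 1 / real (Suc n)" for n
 proof -
  define e where "e = 1 / real (Suc n)"
  have e: "0 < e" "e \<le> 1" unfolding e_def by auto
  obtain c where c: "continuous_on (sphere 0 1) c" "(\<integral>ze. (u ze - c ze)\<^sup>2 \<partial>mu) < e / 4"
   using C_approx_nonneg[OF u] e unfolding C_approx_def by (meson divide_pos_pos zero_less_numeral)
  \<comment> \<open>The two halves of the triangle estimate contribute less than e/2 and 4 \<pi> d =
    \<pi> e/10, together less than e.\<close>
  define d where "d = e / 40"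
  have d: "0 < d" "d \<le> 1" using e unfolding d_def by auto
  obtain F where F: "Im (poly F 0) = 0" "\<And>ze. norm ze \<le> 1 ==> 0 < Re (poly F ze)"
   "\<And>ze. ze \<in> sphere 0 1 ==> \<bar>Re (poly F ze) - \<bar>c ze\<bar>\<bar> < d"
   using positive_poly_approx[of "\<lambda>x. \<bar>c x\<bar>" d] c(1) d(1) by (auto intro!: continuous_intros)
  have Fc: "continuous_on S (\<lambda>ze. Re (poly F ze))" for S by (intro continuous_intros)
  have ac: "continuous_on (sphere 0 1) (\<lambda>ze. \<bar>c ze\<bar>)" using c(1) by (intro continuous_intros)
  have i1: "integrable mu (\<lambda>ze. (u ze - c ze)\<^sup>2)"
   using c(1) by (intro sq_diff_integrable u measurable_circle_continuous integrable_circle_continuous continuous_intros)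
  have i2: "integrable mu (\<lambda>ze. (u ze - \<bar>c ze\<bar>)\<^sup>2)"
   by (intro sq_diff_integrable u measurable_circle_continuous integrable_circle_continuous continuous_on_power ac)
  have "(\<integral>ze. (u ze - Re (poly F ze))\<^sup>2 \<partial>mu) \<le> 2 * (\<integral>ze. (u ze - \<bar>c ze\<bar>)\<^sup>2 \<partial>mu)
    + 2 * (\<integral>ze. (\<bar>c ze\<bar> - Re (poly F ze))\<^sup>2 \<partial>mu)"
   by (intro sq_diff_triangle[OF u(1) measurable_circle_continuous[OF ac] measurable_circle_continuous[OF Fc] u(3)]
      integrable_circle_continuous continuous_on_power ac Fc)
  also have "(\<integral>ze. (u ze - \<bar>c ze\<bar>)\<^sup>2 \<partial>mu) \<le> (\<integral>ze. (u ze - c ze)\<^sup>2 \<partial>mu)"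
  proof (rule integral_mono[OF i2 i1])
   fix x
   have "\<bar>u x - \<bar>c x\<bar>\<bar> \<le> \<bar>u x - c x\<bar>" using u(2)[of x] by auto
   then show "(u x - \<bar>c x\<bar>)\<^sup>2 \<le> (u x - c x)\<^sup>2" by (simp add: abs_le_square_iff)
  qed
  also have "(\<integral>ze. (\<bar>c ze\<bar> - Re (poly F ze))\<^sup>2 \<partial>mu) \<le> (\<integral>ze. d \<partial>mu)"
  proof (rule integral_mono)
   show "integrable mu (\<lambda>ze. (\<bar>c ze\<bar> - Re (poly F ze))\<^sup>2)"
    by (intro integrable_circle_continuous continuous_on_power continuous_on_diff ac Fc)
   fix x assume "x \<in> space mu"
   then have "\<bar>\<bar>c x\<bar> - Re (poly F x)\<bar> \<le> d" using F(3)[of x] by (simp add: abs_minus_commute)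
   then have "(\<bar>c x\<bar> - Re (poly F x))\<^sup>2 \<le> d\<^sup>2" using d by (simp add: abs_le_square_iff[symmetric])
   also have "\<dots> \<le> d" using d by (simp add: power2_eq_square mult_left_le)
   finally show "(\<bar>c x\<bar> - Re (poly F x))\<^sup>2 \<le> d" .
  qed auto
  also have "(\<integral>ze. d \<partial>mu) = d * (2 * pi)"
   by (simp add: measure_def emeasure_circle_space del: emeasure_eq_measure)
  also have "2 * (\<integral>ze. (u ze - c ze)\<^sup>2 \<partial>mu) + 2 * (d * (2 * pi)) < e"
  proof -
   have "e * pi \<le> e * 4" using e pi_less_4 by (intro mult_left_mono) auto
   moreover have "d * (2 * pi) = e * pi / 20" unfolding d_def by simp
   ultimately show ?thesis using c(2) e by linarith
  qed
  finally show ?thesis using F(1,2) unfolding e_def by auto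
 qed
 then obtain F where F: "\<And>n. Im (poly (F n) 0) = 0" "\<And>n ze. norm ze \<le> 1 ==> 0 < Re (poly (F n) ze)"
   "\<And>n. (\<integral>ze. (u ze - Re (poly (F n) ze))\<^sup>2 \<partial>mu) < 1 / real (Suc n)" by metis
 have "L2lim mu (\<lambda>n ze. of_real (Re (poly (F n) ze))) (\<lambda>ze. of_real (u ze))"
  unfolding L2lim_def
 proof (rule tendsto_sandwich[OF _ _ tendsto_const])
  show "(\<lambda>n. 1 / real (Suc n)) \<longlonglongrightarrow> 0" by (rule LIMSEQ_Suc[OF lim_1_over_n])
  show "\<forall>\<^sub>F n in sequentially. (\<integral>ze. (cmod (of_real (Re (poly (F n) ze)) - of_real (u ze)))\<^sup>2 \<partial>mu) \<le> 1 / real (Suc n)"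
   using F(3) by (intro always_eventually allI) (simp add: power2_commute less_imp_le flip: of_real_diff)
 qed auto
 with F(1,2) show ?thesis by (rule that)
qed

section \<open>Hardy space of the circle; existence, contraction and limits of the
  projection\<close>

section \<open>The Hardy space and the projection of the disc\<close>

lemma Lp_space_iff:
 assumes "p > 0"
 shows "f \<in> Lp_space M p \<longleftrightarrow> f \<in> borel_measurable M \<and> integrable M (\<lambda>x. norm (f x) powr p)"
proof (cases "f \<in> borel_measurable M")
 case True
 note [measurable] = True
 have "Lp_norm M p f < \<infinity> \<longleftrightarrow> (\<integral>\<^sup>+x. ennreal (norm (f x) powr p) \<partial>M) < \<infinity>"
  by (auto simp: Lp_norm_def Let_def less_top)
 also have "\<dots> \<longleftrightarrow> integrable M (\<lambda>x. norm (f x) powr p)"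
  by (auto simp: integrable_iff_bounded)
 finally show ?thesis using True by (simp add: Lp_space_def)
qed (simp add: Lp_space_def)

lemma Lp_space_2_iff: "f \<in> Lp_space M 2 \<longleftrightarrow> L2 M f"
 by (subst Lp_space_iff) (auto simp: L2_def powr_numeral)

text \<open>The coefficient of index -n integrates against ze^n, so the Hardy condition involves
  only positive powers and no conjugates.\<close>

lemma H2_circle_iff:
 "f \<in> H2_circle \<longleftrightarrow> L2 mu f \<and> (\<forall>n>0. (\<integral>ze. f ze * ze ^ n \<partial>mu) = 0)"
proof -
 have "(\<forall>n<0. fourier_coeff f n = 0) \<longleftrightarrow> (\<forall>n>0. (\<integral>ze. f ze * ze ^ n \<partial>mu) = 0)"
 proof safe
  fix n :: nat assume a: "\<forall>n<0. fourier_coeff f n = 0" "0 < n"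
  then have "fourier_coeff f (- int n) = 0" by simp
  then show "(\<integral>ze. f ze * ze ^ n \<partial>mu) = 0" by (simp add: fourier_coeff_def)
 next
  fix n :: int assume a: "\<forall>n>0. (\<integral>ze. f ze * ze ^ n \<partial>mu) = 0" "n < 0"
  define m where "m = nat (- n)"
  have "- n = int m" "m > 0" using a(2) by (auto simp: m_def)
  then show "fourier_coeff f n = 0" using a(1) by (simp add: fourier_coeff_def)
 qed
 then show ?thesis by (simp add: H2_circle_def Lp_space_2_iff)
qed

lemma H2_circle_I:
 assumes "continuous_on (cball 0 1) f" "f holomorphic_on ball 0 1"
 shows "f \<in> H2_circle" unfolding H2_circle_iff
proof (intro conjI allI impI)
 show "L2 mu f" using assms(1) continuous_on_subset sphere_cball by (blast intro: L2_circle_continuous)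
 fix n :: nat assume "n > 0"
 have "(\<integral>ze. f ze * ze ^ n \<partial>mu) = 2 * pi * (f 0 * 0 ^ n)"
  using assms by (intro circle_mean_value[of "\<lambda>ze. f ze * ze ^ n"] continuous_intros holomorphic_intros)
 then show "(\<integral>ze. f ze * ze ^ n \<partial>mu) = 0" using \<open>n > 0\<close> by simp
qed

lemma H2_circle_poly: "poly P \<in> H2_circle"
 by (rule H2_circle_I) (auto intro: continuous_intros holomorphic_intros)

lemma H2_circle_L2: "f \<in> H2_circle ==> L2 mu f" by (simp add: H2_circle_iff)

lemma L2_power_circle: "L2 mu (\<lambda>ze. ze ^ n)" by (intro L2_circle_continuous continuous_intros)

lemma L2_poly_circle: "L2 mu (poly P)" by (intro L2_circle_continuous continuous_intros)

lemma H2_circle_add: "f \<in> H2_circle ==> g \<in> H2_circle ==> (\<lambda>x. f x + g x) \<in> H2_circle"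
 unfolding H2_circle_iff
 by (auto intro!: L2_add simp: distrib_right Bochner_Integration.integral_add L2_prod L2_power_circle)

lemma H2_circle_cmult: "f \<in> H2_circle ==> (\<lambda>x. c * f x) \<in> H2_circle"
 unfolding H2_circle_iff by (auto intro!: L2_cmult simp: mult.assoc)

text \<open>Members of \<open>H2_circle\<close> are functions, while representatives obtained from
  \<open>SOME\<close> or by inverting the boundary transform are determined only up to null
  sets.\<close>

lemma H2_circle_AE:
 assumes "f \<in> H2_circle" "g \<in> borel_measurable mu" "AE x in mu. g x = f x"
 shows "g \<in> H2_circle"
proof -
 have [measurable]: "f \<in> borel_measurable mu" "g \<in> borel_measurable mu"
  using assms H2_circle_L2 L2_measurable by auto
 have [measurable]: "(\<lambda>ze. ze ^ n) \<in> borel_measurable mu" for n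
  using L2_power_circle L2_measurable by auto
 have "L2 mu g" by (rule L2_dom[OF H2_circle_L2[OF assms(1)] assms(2)]) (use assms(3) in auto)
 moreover have "(\<integral>ze. g ze * ze ^ n \<partial>mu) = (\<integral>ze. f ze * ze ^ n \<partial>mu)" for n
  by (rule integral_cong_AE) (measurable, use assms(3) in auto)
 ultimately show ?thesis using assms(1) unfolding H2_circle_iff by simp
qed

lemma H2_circle_lim:
 assumes "L2lim mu f g" "\<And>n. f n \<in> H2_circle" "L2 mu g"
 shows "g \<in> H2_circle" unfolding H2_circle_iff
proof (intro conjI allI impI assms(3))
 fix n :: nat assume n: "n > 0"
 have "(\<lambda>k. \<integral>ze. f k ze * ze ^ n \<partial>mu) \<longlonglongrightarrow> (\<integral>ze. g ze * ze ^ n \<partial>mu)"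
  by (rule L2lim_integral[OF assms(1) H2_circle_L2[OF assms(2)] assms(3) L2_power_circle])
 moreover have "(\<integral>ze. f k ze * ze ^ n \<partial>mu) = 0" for k
  using assms(2)[of k] n by (auto simp: H2_circle_iff)
 ultimately show "(\<integral>ze. g ze * ze ^ n \<partial>mu) = 0" by (simp add: LIMSEQ_const_iff)
qed

text \<open>The induction on Q needs a free power k in front, because peeling off a coefficient
  multiplies the rest by ze.\<close>

lemma H2_circle_orth_poly:
 assumes "h \<in> H2_circle"
 shows "(\<integral>ze. h ze * (ze * poly Q ze) \<partial>mu) = 0"
proof -
 have "0 < k ==> (\<integral>ze. h ze * (ze ^ k * poly Q ze) \<partial>mu) = 0" for k
 proof (induction Q arbitrary: k)
  case 0 then show ?case by simp
 next
  case (pCons a Q)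
  have i: "integrable mu (\<lambda>ze. h ze * (a * ze ^ k))"
    "integrable mu (\<lambda>ze. h ze * (ze ^ Suc k * poly Q ze))"
   by (intro L2_prod H2_circle_L2[OF assms] L2_circle_continuous continuous_intros)+
  have "(\<integral>ze. h ze * (ze ^ k * poly (pCons a Q) ze) \<partial>mu)
    = (\<integral>ze. h ze * (a * ze ^ k) + h ze * (ze ^ Suc k * poly Q ze) \<partial>mu)"
   by (intro Bochner_Integration.integral_cong) (auto simp: algebra_simps)
  also have "\<dots> = (\<integral>ze. a * (h ze * ze ^ k) \<partial>mu) + (\<integral>ze. h ze * (ze ^ Suc k * poly Q ze) \<partial>mu)"
   using i by (subst Bochner_Integration.integral_add) (auto simp: mult_ac)
  also have "\<dots> = 0" using pCons.IH[of "Suc k"] assms pCons.prems by (simp add: H2_circle_iff)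
  finally show ?case .
 qed
 from this[of 1] show ?thesis by simp
qed

text \<open>g is some representative of the projection of f. A relation is used because
  \<open>szego_disc\<close> picks an unspecified representative, whereas linearity, contraction and
  limits hold for all of them.\<close>

definition szego_rel :: "(complex \<Rightarrow> complex) \<Rightarrow> (complex \<Rightarrow> complex) \<Rightarrow> bool" where
 "szego_rel f g \<longleftrightarrow> g \<in> H2_circle \<and>
   (\<forall>h\<in>H2_circle. (\<integral>ze. (f ze - g ze) * cnj (h ze) \<partial>mu) = 0)"

lemma szego_rel_H2: "szego_rel f g ==> g \<in> H2_circle" by (simp add: szego_rel_def)

lemma szego_rel_L2: "szego_rel f g ==> L2 mu g" by (simp add: szego_rel_def H2_circle_L2)

lemma szego_rel_add:
 assumes "szego_rel f g" "szego_rel f' g'" "L2 mu f" "L2 mu f'"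
 shows "szego_rel (\<lambda>x. f x + f' x) (\<lambda>x. g x + g' x)" unfolding szego_rel_def
proof (intro conjI ballI)
 show "(\<lambda>x. g x + g' x) \<in> H2_circle" using assms by (auto intro: H2_circle_add szego_rel_H2)
 fix h assume h: "h \<in> H2_circle"
 have "(\<integral>ze. (f ze + f' ze - (g ze + g' ze)) * cnj (h ze) \<partial>mu)
   = (\<integral>ze. (f ze - g ze) * cnj (h ze) + (f' ze - g' ze) * cnj (h ze) \<partial>mu)"
  by (intro Bochner_Integration.integral_cong) (auto simp: algebra_simps)
 also have "\<dots> = (\<integral>ze. (f ze - g ze) * cnj (h ze) \<partial>mu) + (\<integral>ze. (f' ze - g' ze) * cnj (h ze) \<partial>mu)"
  by (intro Bochner_Integration.integral_add L2_prod L2_diff L2_cnj assms(3,4)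
    szego_rel_L2[OF assms(1)] szego_rel_L2[OF assms(2)] H2_circle_L2[OF h])
 also have "\<dots> = 0" using assms h by (auto simp: szego_rel_def)
 finally show "(\<integral>ze. (f ze + f' ze - (g ze + g' ze)) * cnj (h ze) \<partial>mu) = 0" .
qed

lemma szego_rel_cmult:
 assumes "szego_rel f g" shows "szego_rel (\<lambda>x. c * f x) (\<lambda>x. c * g x)"
 using assms unfolding szego_rel_def
 by (auto intro: H2_circle_cmult simp: mult.assoc simp flip: right_diff_distrib)

lemma szego_rel_diff:
 assumes "szego_rel f g" "szego_rel f' g'" "L2 mu f" "L2 mu f'"
 shows "szego_rel (\<lambda>x. f x - f' x) (\<lambda>x. g x - g' x)"
 using szego_rel_add[OF assms(1) szego_rel_cmult[OF assms(2), of "-1"] assms(3) L2_cmult[OF assms(4)]] by simp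

lemma szego_rel_contract:
 assumes "szego_rel f g" "L2 mu f"
 shows "(\<integral>ze. (norm (g ze))\<^sup>2 \<partial>mu) \<le> (\<integral>ze. (norm (f ze))\<^sup>2 \<partial>mu)"
proof -
 note Lg = szego_rel_L2[OF assms(1)]
 note Ld = L2_diff[OF assms(2) Lg]
 have "(\<integral>ze. (f ze - g ze) * cnj (g ze) \<partial>mu) = 0"
  using assms(1) by (auto simp: szego_rel_def)
 then have z: "(\<integral>ze. Re ((f ze - g ze) * cnj (g ze)) \<partial>mu) = 0"
  by (subst integral_Re[OF L2_prod[OF Ld L2_cnj[OF Lg]]]) simp
 have e: "(norm (f ze))\<^sup>2 = (norm (g ze))\<^sup>2 + (norm (f ze - g ze))\<^sup>2 + 2 * Re ((f ze - g ze) * cnj (g ze))" for ze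
  unfolding cmod_power2 by (simp add: power2_eq_square algebra_simps)
 have "(\<integral>ze. (norm (f ze))\<^sup>2 \<partial>mu) = (\<integral>ze. (norm (g ze))\<^sup>2 \<partial>mu)
   + (\<integral>ze. (norm (f ze - g ze))\<^sup>2 \<partial>mu) + 2 * (\<integral>ze. Re ((f ze - g ze) * cnj (g ze)) \<partial>mu)"
 proof -
  define R where "R ze = Re ((f ze - g ze) * cnj (g ze))" for ze
  have "integrable mu R" unfolding R_def by (rule integrable_Re[OF L2_prod[OF Ld L2_cnj[OF Lg]]])
  then show ?thesis using L2_integrable[OF Lg] L2_integrable[OF Ld] unfolding e R_def[symmetric] by simp
 qed
 then show ?thesis using z by simp
qed

text \<open>By linearity the difference of two representatives is a projection of 0, and contraction
  makes its norm vanish.\<close>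

lemma szego_rel_unique:
 assumes "szego_rel f g" "szego_rel f g'" "L2 mu f"
 shows "AE ze in mu. g ze = g' ze"
proof -
 have "szego_rel (\<lambda>x. f x - f x) (\<lambda>x. g x - g' x)"
  by (rule szego_rel_diff) (use assms in auto)
 then have "(\<integral>ze. (norm (g ze - g' ze))\<^sup>2 \<partial>mu) \<le> 0"
  using szego_rel_contract[of "\<lambda>x. f x - f x" "\<lambda>x. g x - g' x"] L2_diff[OF assms(3,3)] by simp
 then have "(\<integral>ze. (norm (g ze - g' ze))\<^sup>2 \<partial>mu) = 0" by (intro antisym) auto
 moreover have "integrable mu (\<lambda>ze. (norm (g ze - g' ze))\<^sup>2)"
  by (intro L2_integrable L2_diff szego_rel_L2[OF assms(1)] szego_rel_L2[OF assms(2)])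
 ultimately have "AE ze in mu. (norm (g ze - g' ze))\<^sup>2 = 0"
  by (subst (asm) integral_nonneg_eq_0_iff_AE) auto
 then show ?thesis by simp
qed

lemma szego_rel_lim:
 assumes "L2lim mu f f'" "L2lim mu g g'" "\<And>n. szego_rel (f n) (g n)"
  "\<And>n. L2 mu (f n)" "L2 mu f'" "L2 mu g'"
 shows "szego_rel f' g'" unfolding szego_rel_def
proof (intro conjI ballI)
 show "g' \<in> H2_circle" by (rule H2_circle_lim[OF assms(2) _ assms(6)]) (use assms(3) szego_rel_H2 in auto)
 fix h assume h: "h \<in> H2_circle"
 note Lh = L2_cnj[OF H2_circle_L2[OF h]]
 have sp: "(\<integral>ze. (a ze - b ze) * cnj (h ze) \<partial>mu) = (\<integral>ze. a ze * cnj (h ze) \<partial>mu) - (\<integral>ze. b ze * cnj (h ze) \<partial>mu)"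
  if "L2 mu a" "L2 mu b" for a b
  unfolding left_diff_distrib using that by (intro Bochner_Integration.integral_diff L2_prod Lh)
 have "(\<lambda>n. (\<integral>ze. f n ze * cnj (h ze) \<partial>mu) - (\<integral>ze. g n ze * cnj (h ze) \<partial>mu))
   \<longlonglongrightarrow> (\<integral>ze. f' ze * cnj (h ze) \<partial>mu) - (\<integral>ze. g' ze * cnj (h ze) \<partial>mu)"
  using assms szego_rel_L2 by (intro tendsto_diff L2lim_integral Lh) blast+
 moreover have "(\<integral>ze. f n ze * cnj (h ze) \<partial>mu) - (\<integral>ze. g n ze * cnj (h ze) \<partial>mu) = 0" for n
  using assms(3)[of n] h sp[OF assms(4)[of n] szego_rel_L2[OF assms(3)[of n]]] unfolding szego_rel_def by simp
 ultimately have "(\<integral>ze. f' ze * cnj (h ze) \<partial>mu) - (\<integral>ze. g' ze * cnj (h ze) \<partial>mu) = 0"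
  by (simp add: LIMSEQ_const_iff)
 then show "(\<integral>ze. (f' ze - g' ze) * cnj (h ze) \<partial>mu) = 0" using sp[OF assms(5,6)] by simp
qed

text \<open>Re F = (F + cnj F)/2, and cnj F differs from the real constant F(0) by the conjugate of
  ze Q(ze), which is orthogonal to the Hardy space; what remains is (F + F(0))/2.\<close>

lemma szego_rel_Re_poly:
 assumes "Im (poly F 0) = 0"
 shows "szego_rel (\<lambda>ze. of_real (Re (poly F ze))) (\<lambda>ze. (poly F ze + poly F 0) / 2)"
 unfolding szego_rel_def
proof (intro conjI ballI)
 have "poly (smult (1/2) (F + [:poly F 0:])) \<in> H2_circle" by (rule H2_circle_poly)
 then show "(\<lambda>ze. (poly F ze + poly F 0) / 2) \<in> H2_circle"
  by (rule back_subst[of "\<lambda>f. f \<in> H2_circle"]) auto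
 fix h assume h: "h \<in> H2_circle"
 obtain a Q where F: "F = pCons a Q" by (cases F)
 have a: "cnj a = a" using assms F by (simp add: complex_eq_iff)
 have eq: "of_real (Re (poly F ze)) - (poly F ze + poly F 0) / 2 = cnj (ze * poly Q ze) / 2" for ze
  using a unfolding F by (simp add: complex_eq_iff field_simps)
 have "(\<integral>ze. (of_real (Re (poly F ze)) - (poly F ze + poly F 0) / 2) * cnj (h ze) \<partial>mu)
   = (\<integral>ze. cnj (h ze * (ze * poly Q ze)) / 2 \<partial>mu)" unfolding eq by (simp add: mult_ac)
 also have "\<dots> = cnj (\<integral>ze. h ze * (ze * poly Q ze) \<partial>mu) / 2"
  by (simp add: integral_cnj del: complex_cnj_mult)
 also have "\<dots> = 0" using H2_circle_orth_poly[OF h] by simp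
 finally show "(\<integral>ze. (of_real (Re (poly F ze)) - (poly F ze + poly F 0) / 2) * cnj (h ze) \<partial>mu) = 0" .
qed

text \<open>Contraction makes the projections of the approximating real parts a Cauchy sequence, and
  completeness supplies the projection of u. The polynomials are returned as well, since the
  weighted estimate is proved for them and then passed to the limit.\<close>

lemma szego_rel_nonneg:
 assumes u: "u \<in> borel_measurable mu" "\<And>x. 0 \<le> u x" "integrable mu (\<lambda>x. (u x)\<^sup>2)"
 obtains F G where "\<And>n. Im (poly (F n) 0) = 0" "\<And>n ze. norm ze \<le> 1 ==> 0 < Re (poly (F n) ze)"
  "L2lim mu (\<lambda>n ze. of_real (Re (poly (F n) ze))) (\<lambda>ze. of_real (u ze))"
  "L2lim mu (\<lambda>n ze. (poly (F n) ze + poly (F n) 0) / 2) G"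
  "szego_rel (\<lambda>ze. of_real (u ze)) G"
proof -
 obtain F :: "nat \<Rightarrow> complex poly" where F: "\<And>n. Im (poly (F n) 0) = 0" "\<And>n ze. norm ze \<le> 1 ==> 0 < Re (poly (F n) ze)"
  "L2lim mu (\<lambda>n ze. of_real (Re (poly (F n) ze))) (\<lambda>ze. of_real (u ze))"
  using positive_poly_L2_approx[OF u] by metis
 have Lu: "L2 mu (\<lambda>ze. of_real (u ze))" using u by (auto simp: L2_def)
 have LF: "L2 mu (\<lambda>ze. of_real (Re (poly (F n) ze)))" for n
  by (intro L2_circle_continuous continuous_intros)
 define g where "g n ze = (poly (F n) ze + poly (F n) 0) / 2" for n ze
 have sr: "szego_rel (\<lambda>ze. of_real (Re (poly (F n) ze))) (g n)" for n
  unfolding g_def by (rule szego_rel_Re_poly[OF F(1)])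
 have Lg: "L2 mu (g n)" for n using sr by (rule szego_rel_L2)
 have contr: "(\<integral>ze. (norm (g m ze - g n ze))\<^sup>2 \<partial>mu)
   \<le> (\<integral>ze. (norm (complex_of_real (Re (poly (F m) ze)) - of_real (Re (poly (F n) ze))))\<^sup>2 \<partial>mu)" for m n
  by (rule szego_rel_contract) (intro szego_rel_diff sr LF L2_diff)+
 obtain G where G: "L2 mu G" "L2lim mu g G"
 proof (rule L2_complete[OF Lg])
  fix e :: real assume "e > 0"
  then show "\<exists>N. \<forall>m\<ge>N. \<forall>n\<ge>N. (\<integral>x. (cmod (g m x - g n x))\<^sup>2 \<partial>mu) < e"
   using L2lim_Cauchy[OF F(3) LF Lu] contr by (meson le_less_trans)
 qed auto
 have "szego_rel (\<lambda>ze. of_real (u ze)) G" by (rule szego_rel_lim[OF F(3) G(2) sr LF Lu G(1)])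
 with F G(2) show ?thesis unfolding g_def by (rule that)
qed

lemma complex_four_parts:
 "z = of_real (max 0 (Re z)) - of_real (max 0 (- Re z)) + \<i> * (of_real (max 0 (Im z)) - of_real (max 0 (- Im z)))"
 by (auto simp: complex_eq_iff max_def)

lemma L2_part:
 assumes "L2 M f"
 shows "(\<lambda>x. max 0 (Re (f x))) \<in> borel_measurable M" "integrable M (\<lambda>x. (max 0 (Re (f x)))\<^sup>2)"
    "(\<lambda>x. max 0 (- Re (f x))) \<in> borel_measurable M" "integrable M (\<lambda>x. (max 0 (- Re (f x)))\<^sup>2)"
    "(\<lambda>x. max 0 (Im (f x))) \<in> borel_measurable M" "integrable M (\<lambda>x. (max 0 (Im (f x)))\<^sup>2)"
    "(\<lambda>x. max 0 (- Im (f x))) \<in> borel_measurable M" "integrable M (\<lambda>x. (max 0 (- Im (f x)))\<^sup>2)"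
proof -
 note [measurable] = L2_measurable[OF assms]
 show m: "(\<lambda>x. max 0 (Re (f x))) \<in> borel_measurable M" "(\<lambda>x. max 0 (- Re (f x))) \<in> borel_measurable M"
  "(\<lambda>x. max 0 (Im (f x))) \<in> borel_measurable M" "(\<lambda>x. max 0 (- Im (f x))) \<in> borel_measurable M"
  by measurable
 have *: "integrable M (\<lambda>x. (u x)\<^sup>2)" if "u \<in> borel_measurable M" "\<And>x. \<bar>u x\<bar> \<le> norm (f x)" for u :: "'a \<Rightarrow> real"
  by (rule Bochner_Integration.integrable_bound[OF L2_integrable[OF assms]])
    (use that in \<open>auto intro!: AE_I2 simp: abs_le_square_iff[symmetric]\<close>)
 have b: "\<bar>max 0 (Re z)\<bar> \<le> norm z" "\<bar>max 0 (- Re z)\<bar> \<le> norm z" "\<bar>max 0 (Im z)\<bar> \<le> norm z" "\<bar>max 0 (- Im z)\<bar> \<le> norm z" for z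
  using abs_Re_le_cmod[of z] abs_Im_le_cmod[of z] by auto
 show "integrable M (\<lambda>x. (max 0 (Re (f x)))\<^sup>2)" "integrable M (\<lambda>x. (max 0 (- Re (f x)))\<^sup>2)"
  "integrable M (\<lambda>x. (max 0 (Im (f x)))\<^sup>2)" "integrable M (\<lambda>x. (max 0 (- Im (f x)))\<^sup>2)"
  by (intro *; use m b in blast)+
qed

lemma L2_of_real: "u \<in> borel_measurable M ==> integrable M (\<lambda>x. (u x)\<^sup>2) ==> L2 M (\<lambda>x. complex_of_real (u x))"
 by (auto simp: L2_def)

lemma szego_rel_four:
 assumes f: "L2 mu f"
  and "szego_rel (\<lambda>ze. of_real (max 0 (Re (f ze)))) G1" "szego_rel (\<lambda>ze. of_real (max 0 (- Re (f ze)))) G2"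
   "szego_rel (\<lambda>ze. of_real (max 0 (Im (f ze)))) G3" "szego_rel (\<lambda>ze. of_real (max 0 (- Im (f ze)))) G4"
 shows "szego_rel f (\<lambda>ze. G1 ze - G2 ze + \<i> * (G3 ze - G4 ze))"
proof -
 note p = L2_part[OF f]
 note L = L2_of_real[OF p(1,2)] L2_of_real[OF p(3,4)] L2_of_real[OF p(5,6)] L2_of_real[OF p(7,8)]
 have "szego_rel (\<lambda>ze. of_real (max 0 (Re (f ze))) - of_real (max 0 (- Re (f ze))) + \<i> * (of_real (max 0 (Im (f ze))) - of_real (max 0 (- Im (f ze)))))
  (\<lambda>ze. G1 ze - G2 ze + \<i> * (G3 ze - G4 ze))"
  by (intro szego_rel_add szego_rel_cmult szego_rel_diff assms L2_diff L2_cmult L)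
 then show ?thesis by (simp flip: complex_four_parts)
qed

text \<open>Serves twice: it gives existence of the projection and, applied to an element of the
  Hardy space, density of the polynomials there.\<close>

lemma szego_rel_exists_poly_limit:
 assumes f: "L2 mu f"
 obtains P g where "L2lim mu (\<lambda>n. poly (P n)) g" "szego_rel f g"
proof -
 note p = L2_part[OF f]
 have *: "\<exists>P G. L2lim mu (\<lambda>n. poly (P n)) G \<and> szego_rel (\<lambda>ze. of_real (u ze)) G"
  if u: "u \<in> borel_measurable mu" "\<And>x. 0 \<le> u x" "integrable mu (\<lambda>x. (u x)\<^sup>2)" for u
 proof -
  obtain F G where FG: "\<And>n. Im (poly (F n) 0) = 0" "\<And>n ze. norm ze \<le> 1 ==> 0 < Re (poly (F n) ze)"
   "L2lim mu (\<lambda>n ze. of_real (Re (poly (F n) ze))) (\<lambda>ze. of_real (u ze))"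
   "L2lim mu (\<lambda>n ze. (poly (F n) ze + poly (F n) 0) / 2) G"
   "szego_rel (\<lambda>ze. of_real (u ze)) G" by (rule szego_rel_nonneg[OF u]) (rule that; assumption)
  have "(\<lambda>n ze. (poly (F n) ze + poly (F n) 0) / 2) = (\<lambda>n. poly (smult (1/2) (F n + [:poly (F n) 0:])))"
   by (simp add: fun_eq_iff)
  with FG(4,5) show ?thesis by metis
 qed
 obtain P1 G1 where 1: "L2lim mu (\<lambda>n. poly (P1 n)) G1" "szego_rel (\<lambda>ze. of_real (max 0 (Re (f ze)))) G1"
  using *[OF p(1) max.cobounded1 p(2)] by blast
 obtain P2 G2 where 2: "L2lim mu (\<lambda>n. poly (P2 n)) G2" "szego_rel (\<lambda>ze. of_real (max 0 (- Re (f ze)))) G2"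
  using *[OF p(3) max.cobounded1 p(4)] by blast
 obtain P3 G3 where 3: "L2lim mu (\<lambda>n. poly (P3 n)) G3" "szego_rel (\<lambda>ze. of_real (max 0 (Im (f ze)))) G3"
  using *[OF p(5) max.cobounded1 p(6)] by blast
 obtain P4 G4 where 4: "L2lim mu (\<lambda>n. poly (P4 n)) G4" "szego_rel (\<lambda>ze. of_real (max 0 (- Im (f ze)))) G4"
  using *[OF p(7) max.cobounded1 p(8)] by blast
 note LG = szego_rel_L2[OF 1(2)] szego_rel_L2[OF 2(2)] szego_rel_L2[OF 3(2)] szego_rel_L2[OF 4(2)]
 have sg: "szego_rel f (\<lambda>ze. G1 ze - G2 ze + \<i> * (G3 ze - G4 ze))"
  by (rule szego_rel_four[OF f 1(2) 2(2) 3(2) 4(2)])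
 have "L2lim mu (\<lambda>n ze. (poly (P1 n) ze + (-1) * poly (P2 n) ze) + \<i> * (poly (P3 n) ze + (-1) * poly (P4 n) ze))
   (\<lambda>ze. (G1 ze + (-1) * G2 ze) + \<i> * (G3 ze + (-1) * G4 ze))"
  by (intro L2lim_add L2lim_cmult 1 2 3 4 L2_add L2_cmult L2_poly_circle LG)
 moreover have "(\<lambda>n ze. (poly (P1 n) ze + (-1) * poly (P2 n) ze) + \<i> * (poly (P3 n) ze + (-1) * poly (P4 n) ze))
   = (\<lambda>n. poly (P1 n - P2 n + smult \<i> (P3 n - P4 n)))" by (simp add: fun_eq_iff)
 moreover have "(\<lambda>ze. (G1 ze + (-1) * G2 ze) + \<i> * (G3 ze + (-1) * G4 ze)) = (\<lambda>ze. G1 ze - G2 ze + \<i> * (G3 ze - G4 ze))"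
  by (simp add: fun_eq_iff)
 ultimately have "L2lim mu (\<lambda>n. poly (P1 n - P2 n + smult \<i> (P3 n - P4 n))) (\<lambda>ze. G1 ze - G2 ze + \<i> * (G3 ze - G4 ze))"
  by simp
 from that[OF this sg] show ?thesis .
qed

lemma szego_rel_szego_disc:
 assumes "L2 mu f" shows "szego_rel f (szego_disc f)"
proof -
 obtain g where "szego_rel f g" using szego_rel_exists_poly_limit[OF assms] by metis
 then have "\<exists>g. g \<in> H2_circle \<and> (\<forall>h\<in>H2_circle. (\<integral>ze. (f ze - g ze) * cnj (h ze) \<partial>mu) = 0)"
  unfolding szego_rel_def by blast
 from someI_ex[OF this] show ?thesis unfolding szego_rel_def szego_disc_def .
qed

lemma szego_rel_self: "h \<in> H2_circle ==> szego_rel h h" by (simp add: szego_rel_def)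

lemma H2_circle_poly_dense:
 assumes "h \<in> H2_circle"
 obtains P where "L2lim mu (\<lambda>n. poly (P n)) h"
proof -
 obtain P g where P: "L2lim mu (\<lambda>n. poly (P n)) g" "szego_rel h g"
  using szego_rel_exists_poly_limit[OF H2_circle_L2[OF assms]] by metis
 have "AE ze in mu. h ze = g ze"
  by (rule szego_rel_unique[OF szego_rel_self[OF assms] P(2) H2_circle_L2[OF assms]])
 then have "L2lim mu (\<lambda>n. poly (P n)) h"
  by (intro L2lim_dom[OF P(1) L2_poly_circle szego_rel_L2[OF P(2)]])
    (auto intro: L2_measurable L2_poly_circle H2_circle_L2[OF assms])
 then show ?thesis by (rule that)
qed

section \<open>Conformal maps at a corner: sectors, Cayley transform, Schwarz reflection\<close>

section \<open>Reflection at a corner\<close>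

text \<open>Sectors are described by comparing Re s with cos a times |s|: unlike a condition on
  \<open>Arg\<close>, this is continuous, makes sense at the vertex and passes to limits.\<close>

lemma cos_gt_iff_Arg:
 assumes "s \<noteq> 0" "0 < a" "a < pi"
 shows "Re s > cos a * norm s \<longleftrightarrow> \<bar>Arg s\<bar> < a" "Re s = cos a * norm s \<longleftrightarrow> \<bar>Arg s\<bar> = a"
proof -
 have r: "Re s = norm s * cos \<bar>Arg s\<bar>"
  using Arg_eq[OF assms(1)] by (metis Re_rcis cos_abs_real rcis_cmod_Arg)
 have b: "0 \<le> \<bar>Arg s\<bar>" "\<bar>Arg s\<bar> \<le> pi" using mpi_less_Arg[of s] Arg_le_pi[of s] by auto
 have n: "norm s > 0" using assms by simp
 have "Re s > cos a * norm s \<longleftrightarrow> cos a < cos \<bar>Arg s\<bar>"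
  unfolding r using n by (simp add: mult.commute)
 also have "\<dots> \<longleftrightarrow> \<bar>Arg s\<bar> < a"
  using cos_mono_less_eq[of a "\<bar>Arg s\<bar>"] assms b by auto
 finally show "Re s > cos a * norm s \<longleftrightarrow> \<bar>Arg s\<bar> < a" .
 have "Re s = cos a * norm s \<longleftrightarrow> cos \<bar>Arg s\<bar> = cos a"
  unfolding r using n by (simp add: mult.commute)
 also have "\<dots> \<longleftrightarrow> \<bar>Arg s\<bar> = a"
  using cos_inj_pi[of "\<bar>Arg s\<bar>" a] assms b by auto
 finally show "Re s = cos a * norm s \<longleftrightarrow> \<bar>Arg s\<bar> = a" .
qed

lemma Re_powr_real:
 assumes "s \<noteq> 0" shows "Re (s powr of_real b) = norm s powr b * cos (b * Arg s)"
 using assms by (simp add: powr_def Ln_Arg Re_exp algebra_simps)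

text \<open>The sector has half-opening \<alpha> \<pi>/2, so the power 1/\<alpha> maps it to the
  right half-plane; \<alpha> < 2 keeps the closed sector off the branch cut except at its
  vertex.\<close>

lemma sector_powr:
 fixes s :: complex and \<alpha> :: real
 assumes a: "0 < \<alpha>" "\<alpha> < 2"
 shows "Re s > cos (\<alpha> * pi / 2) * norm s ==> 0 < Re (s powr of_real (1 / \<alpha>))"
  and "Re s = cos (\<alpha> * pi / 2) * norm s ==> Re (s powr of_real (1 / \<alpha>)) = 0"
  and "Re s \<ge> cos (\<alpha> * pi / 2) * norm s ==> (s powr of_real (1 / \<alpha>)) powr of_real \<alpha> = s"
  and "Re s \<ge> cos (\<alpha> * pi / 2) * norm s ==> s \<noteq> 0 ==> s \<notin> \<real>\<^sub>\<le>\<^sub>0"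
proof -
 let ?a = "\<alpha> * pi / 2"
 have ap: "0 < ?a" "?a < pi" using a by auto
 have bA: "\<bar>(1 / \<alpha>) * Arg s\<bar> = (1 / \<alpha>) * \<bar>Arg s\<bar>" using a by (simp add: abs_mult)
 show 1: "0 < Re (s powr of_real (1 / \<alpha>))" if "Re s > cos ?a * norm s"
 proof -
  have s: "s \<noteq> 0" using that by auto
  then have "\<bar>Arg s\<bar> < ?a" using cos_gt_iff_Arg(1)[OF s ap] that by blast
  then have "(1 / \<alpha>) * \<bar>Arg s\<bar> < (1 / \<alpha>) * ?a" using a by (intro mult_strict_left_mono) auto
  then have "\<bar>(1 / \<alpha>) * Arg s\<bar> < pi / 2" unfolding bA using a by simp
  then have "- (pi / 2) < (1 / \<alpha>) * Arg s" "(1 / \<alpha>) * Arg s < pi / 2" by linarith+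
  then have "0 < cos ((1 / \<alpha>) * Arg s)" by (rule cos_gt_zero_pi)
  then show ?thesis unfolding Re_powr_real[OF s] using s by simp
 qed
 show 2: "Re (s powr of_real (1 / \<alpha>)) = 0" if "Re s = cos ?a * norm s"
 proof (cases "s = 0")
  case s: False
  then have "\<bar>Arg s\<bar> = ?a" using cos_gt_iff_Arg(2)[OF s ap] that by blast
  then have "\<bar>(1 / \<alpha>) * Arg s\<bar> = pi / 2" unfolding bA using a by simp
  then have "cos \<bar>(1 / \<alpha>) * Arg s\<bar> = 0" by (simp only: cos_pi_half)
  then have "cos ((1 / \<alpha>) * Arg s) = 0" by (simp only: cos_abs_real)
  then show ?thesis unfolding Re_powr_real[OF s] by simp
 qed simp
 show 3: "(s powr of_real (1 / \<alpha>)) powr of_real \<alpha> = s" if "Re s \<ge> cos ?a * norm s"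
 proof (cases "s = 0")
  case s: False
  then have "\<bar>Arg s\<bar> \<le> ?a" using cos_gt_iff_Arg[OF s ap] that by fastforce
  then have "(1 / \<alpha>) * \<bar>Arg s\<bar> \<le> (1 / \<alpha>) * ?a" using a by (intro mult_left_mono) auto
  then have b: "\<bar>(1 / \<alpha>) * Arg s\<bar> \<le> pi / 2" unfolding bA using a by simp
  define y where "y = of_real (1 / \<alpha>) * Ln s"
  have "Im y = (1 / \<alpha>) * Arg s" unfolding y_def using s by (simp add: Ln_Arg)
  then have "- pi < Im y" "Im y \<le> pi" using b pi_gt_zero by linarith+
  then have "exp y powr of_real \<alpha> = exp (y * of_real \<alpha>)" by (rule exp_powr_complex)
  also have "y * of_real \<alpha> = Ln s" unfolding y_def using a by simp
  finally show ?thesis using s unfolding y_def by (simp add: powr_def)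
 qed simp
 show "s \<notin> \<real>\<^sub>\<le>\<^sub>0" if "Re s \<ge> cos ?a * norm s" "s \<noteq> 0"
 proof
  assume "s \<in> \<real>\<^sub>\<le>\<^sub>0"
  then have "Arg s = pi" using that(2) by (auto simp: Arg_eq_pi complex_nonpos_Reals_iff complex_eq_iff)
  moreover have "\<bar>Arg s\<bar> \<le> ?a" using cos_gt_iff_Arg[OF that(2) ap] that by fastforce
  ultimately show False using ap by auto
 qed
qed

lemma Im_cayley:
 assumes "norm ze0 = 1" "ze0 + z \<noteq> 0"
 shows "Im (\<i> * (ze0 - z) / (ze0 + z)) = (1 - (norm z)\<^sup>2) / (norm (ze0 + z))\<^sup>2"
proof -
 have "(ze0 - z) / (ze0 + z) = (ze0 - z) * cnj (ze0 + z) / of_real ((norm (ze0 + z))\<^sup>2)"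
  by (rule complex_div_cnj)
 then have "Re ((ze0 - z) / (ze0 + z)) = Re ((ze0 - z) * cnj (ze0 + z)) / (norm (ze0 + z))\<^sup>2"
  by (simp only: Re_divide_of_real)
 also have "Re ((ze0 - z) * cnj (ze0 + z)) = (norm ze0)\<^sup>2 - (norm z)\<^sup>2"
  unfolding cmod_power2 by (simp add: power2_eq_square algebra_simps)
 finally show ?thesis using assms(1) by (simp add: times_divide_eq_right[symmetric] del: times_divide_eq_right)
qed

text \<open>The Cayley transform flattens the circle near ze0 and the power 1/\<alpha> flattens the
  corner, so the composite is real on a real interval and extends by Schwarz reflection. Thus \<phi>
  is locally a constant plus the power \<alpha> of an injective holomorphic function, from which the
  size of its derivative can be read; \<alpha> = 1 covers the sides.\<close>

lemma corner_reflection: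
 fixes \<phi> :: "complex \<Rightarrow> complex" and \<alpha> :: real
 assumes cont: "continuous_on (cball 0 1) \<phi>" and hol: "\<phi> holomorphic_on ball 0 1"
  and inj: "inj_on \<phi> (cball 0 1)" and z0: "norm ze0 = 1" and d: "norm d = 1"
  and a: "0 < \<alpha>" "\<alpha> < 2" and rho: "\<rho> > 0"
  and inside: "\<And>z. norm z < 1 ==> dist (\<phi> ze0) (\<phi> z) < \<rho> ==>
    Re ((\<phi> z - \<phi> ze0) / d) > cos (\<alpha> * pi / 2) * norm (\<phi> z - \<phi> ze0)"
  and boundary: "\<And>z. norm z = 1 ==> dist (\<phi> ze0) (\<phi> z) < \<rho> ==>
    Re ((\<phi> z - \<phi> ze0) / d) = cos (\<alpha> * pi / 2) * norm (\<phi> z - \<phi> ze0)"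
 obtains \<delta> g where "\<delta> > 0" "g holomorphic_on ball ze0 \<delta>" "g ze0 = 0" "inj_on g (ball ze0 \<delta>)"
  "\<And>z. z \<in> ball ze0 \<delta> ==> norm z \<le> 1 ==> \<phi> z = \<phi> ze0 + d * (- \<i> * g z) powr of_real \<alpha>"
  "\<And>z. z \<in> ball ze0 \<delta> ==> norm z < 1 ==> Im (g z) > 0"
  "\<And>z. z \<in> ball ze0 \<delta> ==> norm z = 1 ==> Im (g z) = 0"
proof -
 \<comment> \<open>\<open>T\<close> and \<open>X\<close> invert each other near 0 and ze0;
   \<open>X\<close> takes the disc to the upper half-plane, ze0 to 0 and -ze0 to infinity.\<close>
 define T where "T x = ze0 * (\<i> - x) / (\<i> + x)" for x
 define X where "X z = \<i> * (ze0 - z) / (ze0 + z)" for z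
 have z0n: "ze0 \<noteq> 0" using z0 by auto
 have d0: "d \<noteq> 0" using d by auto
 have iT: "\<i> + x \<noteq> 0" if "norm x < 1" for x
 proof
  assume "\<i> + x = 0" then have "x = - \<i>" by (simp add: eq_neg_iff_add_eq_0 add.commute)
  then show False using that by simp
 qed
 have iX: "ze0 + z \<noteq> 0" if "dist ze0 z < 1" for z
 proof
  assume "ze0 + z = 0" then have "z = - ze0" by (simp add: eq_neg_iff_add_eq_0 add.commute)
  then show False using that z0 by (simp add: dist_norm norm_mult flip: mult_2)
 qed
 have XT: "X (T x) = x" and TzX: "ze0 + T x \<noteq> 0" if "norm x < 1" for x
 proof -
  have e1: "ze0 + T x = ze0 * (2 * \<i>) / (\<i> + x)" unfolding T_def using iT[OF that] by (simp add: field_simps)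
  then show nz: "ze0 + T x \<noteq> 0" using z0n iT[OF that] by simp
  have e2: "ze0 - T x = ze0 * (2 * x) / (\<i> + x)" unfolding T_def using iT[OF that] by (simp add: field_simps)
  show "X (T x) = x" unfolding X_def e1 e2 using z0n iT[OF that] by simp
 qed
 have TX: "T (X z) = z" if "dist ze0 z < 1" for z
 proof -
  have e: "\<i> + X z = \<i> * (2 * ze0) / (ze0 + z)" "\<i> - X z = \<i> * (2 * z) / (ze0 + z)"
   unfolding X_def using iX[OF that] by (simp_all add: field_simps)
  show ?thesis unfolding T_def e using z0n iX[OF that] by simp
 qed
 have ImX: "Im (X z) = (1 - (norm z)\<^sup>2) / (norm (ze0 + z))\<^sup>2" if "ze0 + z \<noteq> 0" for z
  unfolding X_def by (rule Im_cayley[OF z0 that])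
 have sgnT: "Im x > 0 \<longleftrightarrow> norm (T x) < 1" "Im x = 0 \<longleftrightarrow> norm (T x) = 1" "Im x \<ge> 0 \<longleftrightarrow> norm (T x) \<le> 1" if "norm x < 1" for x
 proof -
  have n: "(norm (ze0 + T x))\<^sup>2 > 0" using TzX[OF that] by simp
  have e: "Im x = (1 - (norm (T x))\<^sup>2) / (norm (ze0 + T x))\<^sup>2"
   using ImX[OF TzX[OF that]] XT[OF that] by simp
  show "Im x > 0 \<longleftrightarrow> norm (T x) < 1" unfolding e using n
   by (simp add: zero_less_divide_iff power_less_one_iff abs_square_less_1)
  show "Im x = 0 \<longleftrightarrow> norm (T x) = 1" unfolding e using n by (auto simp: power2_eq_1_iff) (smt (verit) norm_ge_zero)
  show "Im x \<ge> 0 \<longleftrightarrow> norm (T x) \<le> 1" unfolding e using n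
   by (simp add: zero_le_divide_iff power_le_one_iff abs_square_le_1)
 qed
 define H where "H = {x :: complex. 0 \<le> Im x}"
 have Tcont: "continuous_on (ball 0 1) T" unfolding T_def by (intro continuous_intros) (use iT in auto)
 have Thol: "T holomorphic_on ball 0 1" unfolding T_def by (intro holomorphic_intros) (use iT in auto)
 have pTc: "continuous_on (ball 0 1 \<inter> H) (\<lambda>x. \<phi> (T x))"
  by (rule continuous_on_compose2[OF cont continuous_on_subset[OF Tcont]]) (auto simp: H_def sgnT(3))
 have T0: "T 0 = ze0" by (simp add: T_def complex_eq_iff)
 have "\<exists>r>0. \<forall>x\<in>ball 0 1 \<inter> H. dist x 0 < r \<longrightarrow> dist (\<phi> (T x)) (\<phi> (T 0)) < \<rho>"
 proof -
  have z: "0 \<in> ball 0 1 \<inter> H" by (simp add: H_def)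
  show ?thesis using pTc z rho unfolding continuous_on_iff by blast
 qed
 then obtain r0 where r0: "r0 > 0" "\<And>x. x \<in> ball 0 1 ==> x \<in> H ==> norm x < r0 ==> dist (\<phi> (T x)) (\<phi> (T 0)) < \<rho>"
  by auto
 define r where "r = min r0 1"
 have r: "r > 0" "r \<le> 1" using r0 by (auto simp: r_def)
 have near: "dist (\<phi> ze0) (\<phi> (T x)) < \<rho>" if "norm x < r" "0 \<le> Im x" for x
  using r0(2)[of x] that by (auto simp: r_def H_def T0 dist_commute)
 define S where "S x = (\<phi> (T x) - \<phi> ze0) / d" for x
 have nS: "norm (S x) = norm (\<phi> (T x) - \<phi> ze0)" for x unfolding S_def using d by (simp add: norm_divide)
 have Sin: "Re (S x) > cos (\<alpha> * pi / 2) * norm (S x)" if "norm x < r" "Im x > 0" for x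
  unfolding nS unfolding S_def using that r by (intro inside near) (auto simp: sgnT)
 have Sbd: "Re (S x) = cos (\<alpha> * pi / 2) * norm (S x)" if "norm x < r" "Im x = 0" for x
  unfolding nS unfolding S_def using that r by (intro boundary near) (auto simp: sgnT)
 have Scl: "Re (S x) \<ge> cos (\<alpha> * pi / 2) * norm (S x)" if "norm x < r" "Im x \<ge> 0" for x
  using Sin[of x] Sbd[of x] that by (cases "Im x = 0") auto
 \<comment> \<open>The factor i turns the right half-plane of \<open>sector_powr\<close> into the
   upper half-plane that reflection works with.\<close>
 define f where "f x = \<i> * (S x powr of_real (1 / \<alpha>))" for x
 have fin: "Im (f x) > 0" if "norm x < r" "Im x > 0" for x
  unfolding f_def using sector_powr(1)[OF a Sin[OF that]] by simp
 have fbd: "Im (f x) = 0" if "norm x < r" "Im x = 0" for x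
  unfolding f_def using sector_powr(2)[OF a Sbd[OF that]] by simp
 have finv: "(- \<i> * f x) powr of_real \<alpha> = S x" if "norm x < r" "Im x \<ge> 0" for x
 proof -
  have "- \<i> * f x = S x powr of_real (1 / \<alpha>)" unfolding f_def by (simp add: mult.assoc[symmetric])
  then show ?thesis using sector_powr(3)[OF a Scl[OF that]] by simp
 qed
 have fhol: "f holomorphic_on (ball 0 r \<inter> {z. 0 < Im z})" unfolding f_def
 proof (intro holomorphic_intros)
  show "S holomorphic_on (ball 0 r \<inter> {z. 0 < Im z})"
  proof -
   have "(\<lambda>x. \<phi> (T x)) holomorphic_on (ball 0 r \<inter> {z. 0 < Im z})"
    using holomorphic_on_compose_gen[OF holomorphic_on_subset[OF Thol] hol, of "ball 0 r \<inter> {z. 0 < Im z}"] r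
    by (force simp: o_def sgnT(1))
   then show ?thesis unfolding S_def using d0 by (intro holomorphic_intros) auto
  qed
  fix x assume x: "x \<in> ball 0 r \<inter> {z. 0 < Im z}"
  then have "S x \<noteq> 0" using Sin[of x] by auto
  then show "S x \<notin> \<real>\<^sub>\<le>\<^sub>0" using sector_powr(4)[OF a Scl[of x]] x by auto
 qed
 have fcont: "continuous_on (ball 0 r \<inter> {z. 0 \<le> Im z}) f" unfolding f_def
 proof (intro continuous_on_mult continuous_on_powr_complex continuous_on_const)
  have sub: "ball 0 r \<inter> {z. 0 \<le> Im z} \<subseteq> ball 0 1 \<inter> H" using r by (auto simp: H_def)
  show "continuous_on (ball 0 r \<inter> {z. 0 \<le> Im z}) S"
   unfolding S_def by (intro continuous_intros continuous_on_subset[OF pTc sub]) (use d0 in auto)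
  show "ball 0 r \<inter> {z. 0 \<le> Im z} \<subseteq> {z. 0 \<le> Re (S z) \<or> Im (S z) \<noteq> 0}"
  proof
   fix x assume x: "x \<in> ball 0 r \<inter> {z. 0 \<le> Im z}"
   then have "S x = 0 \<or> S x \<notin> \<real>\<^sub>\<le>\<^sub>0" using sector_powr(4)[OF a Scl[of x]] by auto
   then show "x \<in> {z. 0 \<le> Re (S z) \<or> Im (S z) \<noteq> 0}" by (auto simp: complex_nonpos_Reals_iff)
  qed
 qed (use a in auto)
 define G where "G x = (if 0 \<le> Im x then f x else cnj (f (cnj x)))" for x
 have Ghol: "G holomorphic_on ball 0 r" unfolding G_def
 proof (rule Schwarz_reflection[OF open_ball _ fhol fcont])
  show "cnj ` ball 0 r \<subseteq> ball 0 r" by auto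
  fix z :: complex assume "z \<in> ball 0 r" "z \<in> \<real>"
  then show "f z \<in> \<real>" using fbd[of z] by (auto simp: complex_is_Real_iff)
 qed
 \<comment> \<open>\<open>G\<close> preserves the sign of Im, so points of different half-planes
   never share a value. Injectivity is thereby reduced to the closed upper half of the ball, where
   it comes from injectivity of \<phi> on the closed disc.\<close>
 have Gs: "Im (G x) > 0 \<longleftrightarrow> Im x > 0" "Im (G x) < 0 \<longleftrightarrow> Im x < 0" if "norm x < r" for x
  using fin[of x] fbd[of x] fin[of "cnj x"] that unfolding G_def
  by (cases "Im x" "0::real" rule: linorder_cases; auto)+
 have finj: "x = y" if "f x = f y" "norm x < r" "norm y < r" "Im x \<ge> 0" "Im y \<ge> 0" for x y
 proof -
  have "S x = S y" using finv[of x] finv[of y] that by metis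
  then have "\<phi> (T x) = \<phi> (T y)" using d0 by (simp add: S_def)
  then have "T x = T y" using inj sgnT(3)[of x] sgnT(3)[of y] that r by (auto simp: inj_on_def)
  then show "x = y" using XT[of x] XT[of y] that(2,3) r(2) by (metis less_le_trans)
 qed
 have Ginj: "inj_on G (ball 0 r)"
 proof (rule inj_onI)
  fix x y assume xy: "x \<in> ball 0 r" "y \<in> ball 0 r" "G x = G y"
  have n: "norm x < r" "norm y < r" using xy by auto
  have s: "Im x > 0 \<longleftrightarrow> Im y > 0" "Im x < 0 \<longleftrightarrow> Im y < 0"
   using Gs[OF n(1)] Gs[OF n(2)] unfolding xy(3) by blast+
  show "x = y"
  proof (cases "Im x \<ge> 0")
   case True
   then have "0 \<le> Im y" using s by linarith
   with True show ?thesis using finj[of x y] n xy(3) by (simp add: G_def)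
  next
   case False
   then have "\<not> 0 \<le> Im y" using s by linarith
   with False have "cnj x = cnj y" using finj[of "cnj x" "cnj y"] n xy(3) by (simp add: G_def)
   then show ?thesis by simp
  qed
 qed
 have "X ze0 = 0" by (simp add: X_def)
 have "continuous (at ze0) X" unfolding X_def using z0n by (intro continuous_intros) auto
 then obtain \<delta>0 where d0': "\<delta>0 > 0" "\<And>z. dist z ze0 < \<delta>0 ==> dist (X z) (X ze0) < r"
  unfolding continuous_at_eps_delta using r by blast
 define \<delta> where "\<delta> = min \<delta>0 1"
 have de: "\<delta> > 0" "\<delta> \<le> 1" using d0' by (auto simp: \<delta>_def)
 have Xr: "norm (X z) < r" if "z \<in> ball ze0 \<delta>" for z
  using d0'(2)[of z] that \<open>X ze0 = 0\<close> by (auto simp: \<delta>_def dist_commute)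
 have Xhol: "X holomorphic_on ball ze0 \<delta>"
  unfolding X_def using iX de by (intro holomorphic_intros) auto
 have Xsg: "Im (X z) > 0 \<longleftrightarrow> norm z < 1" "Im (X z) = 0 \<longleftrightarrow> norm z = 1" "Im (X z) \<ge> 0 \<longleftrightarrow> norm z \<le> 1" if "z \<in> ball ze0 \<delta>" for z
  using sgnT[of "X z"] Xr[OF that] TX[of z] that de r by auto
 show thesis
 proof (rule that[of \<delta> "G \<circ> X"])
  show "\<delta> > 0" by fact
  show "G \<circ> X holomorphic_on ball ze0 \<delta>"
   by (rule holomorphic_on_compose_gen[OF Xhol Ghol]) (use Xr in auto)
  show "(G \<circ> X) ze0 = 0" using \<open>X ze0 = 0\<close> by (simp add: G_def f_def S_def T0)
  show "inj_on (G \<circ> X) (ball ze0 \<delta>)"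
  proof (rule comp_inj_on)
   show "inj_on X (ball ze0 \<delta>)" by (rule inj_on_inverseI[of _ T]) (use TX de in auto)
   show "inj_on G (X ` ball ze0 \<delta>)" by (rule inj_on_subset[OF Ginj]) (use Xr in auto)
  qed
  fix z assume z: "z \<in> ball ze0 \<delta>"
  show "Im ((G \<circ> X) z) > 0" if "norm z < 1" using Gs(1)[OF Xr[OF z]] Xsg[OF z] that by auto
  show "Im ((G \<circ> X) z) = 0" if "norm z = 1" using Gs[OF Xr[OF z]] Xsg[OF z] that by fastforce
  show "\<phi> z = \<phi> ze0 + d * (- \<i> * (G \<circ> X) z) powr of_real \<alpha>" if "norm z \<le> 1"
  proof -
   have i: "Im (X z) \<ge> 0" using Xsg[OF z] that by auto
   then have "(- \<i> * (G \<circ> X) z) powr of_real \<alpha> = S (X z)"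
    using finv[OF Xr[OF z] i] by (simp add: G_def)
   also have "\<dots> = (\<phi> z - \<phi> ze0) / d" unfolding S_def using TX[of z] z de by simp
   finally show ?thesis using d0 by simp
  qed
 qed
qed

text \<open>Differentiating the representation gives the modulus \<alpha> |g|^(\<alpha> - 1) |g'|,
  and |g| is comparable to |z - ze0| because an injective g has a non-zero derivative at
  ze0.\<close>

lemma corner_deriv_limit:
 fixes \<phi> :: "complex \<Rightarrow> complex" and \<alpha> :: real
 assumes "\<delta> > 0" "g holomorphic_on ball ze0 \<delta>" "g ze0 = 0" "inj_on g (ball ze0 \<delta>)" and a: "0 < \<alpha>" and d: "norm d = 1"
  and rep: "\<And>z. z \<in> ball ze0 \<delta> ==> norm z \<le> 1 ==> \<phi> z = \<phi> ze0 + d * (- \<i> * g z) powr of_real \<alpha>"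
  and pos: "\<And>z. z \<in> ball ze0 \<delta> ==> norm z < 1 ==> Im (g z) > 0"
 shows "((\<lambda>z. norm (deriv \<phi> z) / norm (z - ze0) powr (\<alpha> - 1)) \<longlongrightarrow> \<alpha> * norm (deriv g ze0) powr \<alpha>) (at ze0 within ball 0 1)"
  and "deriv g ze0 \<noteq> 0"
proof -
 have z0: "ze0 \<in> ball ze0 \<delta>" using assms by simp
 show nz: "deriv g ze0 \<noteq> 0"
  by (rule holomorphic_injective_imp_regular[OF assms(2) open_ball assms(4) z0])
 have gd: "(g has_field_derivative deriv g z) (at z)" if "z \<in> ball ze0 \<delta>" for z
  using assms(2) that holomorphic_derivI open_ball by blast
 have form: "norm (deriv \<phi> z) = \<alpha> * norm (g z) powr (\<alpha> - 1) * norm (deriv g z)"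
  if z: "z \<in> ball ze0 \<delta>" "norm z < 1" for z
 proof -
  let ?h = "\<lambda>z. - \<i> * g z"
  have nr: "?h z \<notin> \<real>\<^sub>\<le>\<^sub>0" using pos[OF z] by (auto simp: complex_nonpos_Reals_iff)
  have "((\<lambda>w. w powr of_real \<alpha>) has_field_derivative (of_real \<alpha> * (?h z) powr (of_real \<alpha> - 1))) (at (?h z))"
   by (rule has_field_derivative_powr[OF nr])
  moreover have "(?h has_field_derivative (- \<i> * deriv g z)) (at z)" by (intro DERIV_cmult gd z)
  ultimately have "((\<lambda>z. (?h z) powr of_real \<alpha>) has_field_derivative (of_real \<alpha> * (?h z) powr (of_real \<alpha> - 1) * (- \<i> * deriv g z))) (at z)"
   by (rule DERIV_chain2)
  then have "((\<lambda>z. \<phi> ze0 + d * (?h z) powr of_real \<alpha>) has_field_derivative (0 + d * (of_real \<alpha> * (?h z) powr (of_real \<alpha> - 1) * (- \<i> * deriv g z)))) (at z)"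
   by (intro DERIV_add DERIV_const DERIV_cmult)
  then have "(\<phi> has_field_derivative (0 + d * (of_real \<alpha> * (?h z) powr (of_real \<alpha> - 1) * (- \<i> * deriv g z)))) (at z)"
  proof (rule has_field_derivative_transform_within_open)
   show "open (ball ze0 \<delta> \<inter> ball 0 1)" by auto
  qed (use z rep in auto)
  then have "deriv \<phi> z = d * (of_real \<alpha> * (?h z) powr (of_real \<alpha> - 1) * (- \<i> * deriv g z))"
   by (simp add: DERIV_imp_deriv)
  moreover have "norm ((?h z) powr (of_real \<alpha> - 1)) = norm (g z) powr (\<alpha> - 1)"
   using norm_powr_real_powr'[of "of_real (\<alpha> - 1)" "?h z"] by (simp add: norm_mult)
  ultimately show ?thesis using a d by (simp add: norm_mult)
 qed
 have q: "((\<lambda>z. norm (g z) / norm (z - ze0)) \<longlongrightarrow> norm (deriv g ze0)) (at ze0)"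
  using tendsto_norm[OF gd[OF z0, unfolded has_field_derivative_iff assms(3)]] by (simp add: norm_divide)
 have "((\<lambda>z. (norm (g z) / norm (z - ze0)) powr (\<alpha> - 1)) \<longlongrightarrow> norm (deriv g ze0) powr (\<alpha> - 1)) (at ze0)"
  using q nz by (intro tendsto_powr) auto
 moreover have "((\<lambda>z. norm (deriv g z)) \<longlongrightarrow> norm (deriv g ze0)) (at ze0)"
 proof -
  have "deriv g holomorphic_on ball ze0 \<delta>" using assms(2) by (rule holomorphic_deriv) auto
  then have "isCont (deriv g) ze0"
   using z0 holomorphic_on_imp_continuous_on continuous_on_eq_continuous_at open_ball by blast
  then show ?thesis by (intro tendsto_norm) (simp add: isCont_def)
 qed
 ultimately have "((\<lambda>z. \<alpha> * ((norm (g z) / norm (z - ze0)) powr (\<alpha> - 1) * norm (deriv g z))) \<longlongrightarrow>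
   \<alpha> * (norm (deriv g ze0) powr (\<alpha> - 1) * norm (deriv g ze0))) (at ze0)"
  by (intro tendsto_mult tendsto_const)
 also have "norm (deriv g ze0) powr (\<alpha> - 1) * norm (deriv g ze0) = norm (deriv g ze0) powr \<alpha>"
  using nz by (simp add: powr_diff)
 finally have "((\<lambda>z. \<alpha> * ((norm (g z) / norm (z - ze0)) powr (\<alpha> - 1) * norm (deriv g z))) \<longlongrightarrow>
   \<alpha> * norm (deriv g ze0) powr \<alpha>) (at ze0 within ball 0 1)" by (rule tendsto_within_subset) auto
 then show "((\<lambda>z. norm (deriv \<phi> z) / norm (z - ze0) powr (\<alpha> - 1)) \<longlongrightarrow> \<alpha> * norm (deriv g ze0) powr \<alpha>) (at ze0 within ball 0 1)"
 proof (rule Lim_transform_eventually)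
  have "eventually (\<lambda>z. z \<in> ball ze0 \<delta>) (at ze0 within ball 0 1)"
   by (rule eventually_mono[OF eventually_at_ball[OF assms(1), of ze0 "ball 0 1"]]) simp
  moreover have "eventually (\<lambda>z. z \<in> ball 0 1 \<and> z \<noteq> ze0) (at ze0 within ball 0 1)"
   by (auto simp: eventually_at_filter)
  ultimately show "\<forall>\<^sub>F z in at ze0 within ball 0 1. \<alpha> * ((norm (g z) / norm (z - ze0)) powr (\<alpha> - 1) * norm (deriv g z))
    = norm (deriv \<phi> z) / norm (z - ze0) powr (\<alpha> - 1)"
  proof eventually_elim
   case (elim z)
   then show ?case by (simp add: form powr_divide)
  qed
 qed
qed

text \<open>Compactness of the closed disc: each of its points has a neighbourhood on which f lies
  between half and twice a positive number, and finitely many of these suffice.\<close>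

lemma bounded_from_boundary_limits:
 fixes f :: "complex \<Rightarrow> real"
 assumes c: "continuous_on (ball 0 1) f" and p: "\<And>z. z \<in> ball 0 1 ==> 0 < f z"
  and l: "\<And>ze. norm ze = 1 ==> \<exists>L>0. (f \<longlongrightarrow> L) (at ze within ball 0 1)"
 obtains m M where "0 < m" "0 < M" "\<And>z. z \<in> ball 0 1 ==> m \<le> f z \<and> f z \<le> M"
proof -
 have "\<exists>r>0. \<exists>m>0. \<exists>M>0. \<forall>z\<in>ball a r \<inter> ball 0 1. m \<le> f z \<and> f z \<le> M" if a: "a \<in> cball 0 1" for a
 proof -
  have "\<exists>L>0. eventually (\<lambda>z. L/2 < f z \<and> f z < 2 * L) (at a within ball 0 1) \<and> (a \<in> ball 0 1 \<longrightarrow> L/2 < f a \<and> f a < 2 * L)"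
  proof (cases "norm a = 1")
   case True
   then obtain L where "L > 0" "(f \<longlongrightarrow> L) (at a within ball 0 1)" using l by blast
   then show ?thesis using True
    by (intro exI[of _ L]) (auto intro!: eventually_conj order_tendstoD(1)[of f L _ "L/2"] order_tendstoD(2)[of f L _ "2*L"] simp del: less_divide_eq_numeral1 divide_less_eq_numeral1)
  next
   case False
   then have ab: "a \<in> ball 0 1" using a by auto
   then have "(f \<longlongrightarrow> f a) (at a within ball 0 1)" using c by (auto simp: continuous_on_def)
   then show ?thesis using p[OF ab]
    by (intro exI[of _ "f a"]) (auto intro!: eventually_conj order_tendstoD(1)[of f "f a" _ "f a/2"] order_tendstoD(2)[of f "f a" _ "2*f a"] simp del: less_divide_eq_numeral1 divide_less_eq_numeral1)
  qed
  then obtain L where L: "L > 0" "eventually (\<lambda>z. L/2 < f z \<and> f z < 2 * L) (at a within ball 0 1)"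
   "a \<in> ball 0 1 \<longrightarrow> L/2 < f a \<and> f a < 2 * L" by blast
  then obtain r where "r > 0" "\<forall>z\<in>ball 0 1. z \<noteq> a \<and> dist z a < r \<longrightarrow> L/2 < f z \<and> f z < 2 * L"
   unfolding eventually_at by auto
  then have "\<forall>z\<in>ball a r \<inter> ball 0 1. L/2 \<le> f z \<and> f z \<le> 2 * L"
   using L(3) by (metis IntE dist_commute less_imp_le mem_ball)
  with \<open>r > 0\<close> L(1) show ?thesis
   by (intro exI[of _ r] conjI exI[of _ "L/2"] exI[of _ "2 * L"]) auto
 qed
 then obtain r m M where rmM: "\<And>a. a \<in> cball 0 1 ==> 0 < r a \<and> 0 < m a \<and> 0 < M a \<and> (\<forall>z\<in>ball a (r a) \<inter> ball 0 1. m a \<le> f z \<and> f z \<le> M a)"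
  by metis
 have "compact (cball (0::complex) 1)" by simp
 moreover have "cball 0 1 \<subseteq> (\<Union>a\<in>cball 0 1. ball a (r a))" using rmM by force
 ultimately obtain D where D: "D \<subseteq> cball 0 1" "finite D" "cball 0 1 \<subseteq> (\<Union>a\<in>D. ball a (r a))"
  by (elim compactE_image[of _ "cball 0 1" "\<lambda>a. ball a (r a)"]) auto
 have Dne: "D \<noteq> {}" using D(3) by auto
 show thesis
 proof (rule that[of "Min (m ` D)" "Max (M ` D)"])
  show "0 < Min (m ` D)" using D Dne rmM by (subst Min_gr_iff) auto
  have "\<exists>a\<in>D. 0 < M a" using Dne D(1) rmM by fastforce
  then show "0 < Max (M ` D)" using D Dne by (subst Max_gr_iff) auto
  fix z :: complex assume z: "z \<in> ball 0 1"
  then obtain a where aD: "a \<in> D" "z \<in> ball a (r a)" using D(3) by force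
  then have "m a \<le> f z \<and> f z \<le> M a" using rmM[of a] D(1) z by auto
  moreover have "Min (m ` D) \<le> m a" "M a \<le> Max (M ` D)" using aD D by auto
  ultimately show "Min (m ` D) \<le> f z \<and> f z \<le> Max (M ` D)" by linarith
 qed
qed

section \<open>The polygon: explicit inequalities and the sector at each boundary point\<close>

section \<open>Geometry of the domain\<close>

text \<open>Comparison of a coordinate with cos(\<pi>/4) or cos(3\<pi>/4) times the modulus,
  converted to the linear inequalities of sectors with diagonal sides.\<close>

lemma sqrt_half_less_iff:
 fixes t y :: real
 shows "t > sqrt 2 / 2 * sqrt (t\<^sup>2 + y\<^sup>2) \<longleftrightarrow> t > \<bar>y\<bar>"
  and "t > - (sqrt 2 / 2) * sqrt (t\<^sup>2 + y\<^sup>2) \<longleftrightarrow> t > - \<bar>y\<bar>"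
proof -
 have h: "sqrt 2 / 2 = 1 / sqrt (2::real)" by (simp add: field_simps)
 have e: "sqrt 2 / 2 * sqrt (t\<^sup>2 + y\<^sup>2) = sqrt ((t\<^sup>2 + y\<^sup>2) / 2)"
  unfolding h by (simp add: real_sqrt_divide)
 have sq: "sqrt ((t\<^sup>2 + y\<^sup>2) / 2) < \<bar>t\<bar> \<longleftrightarrow> \<bar>y\<bar> < \<bar>t\<bar>"
 proof -
  have "sqrt ((t\<^sup>2 + y\<^sup>2) / 2) < \<bar>t\<bar> \<longleftrightarrow> sqrt ((t\<^sup>2 + y\<^sup>2) / 2) < sqrt (t\<^sup>2)" by simp
  also have "\<dots> \<longleftrightarrow> y\<^sup>2 < t\<^sup>2" by (subst real_sqrt_less_iff) auto
  also have "\<dots> \<longleftrightarrow> \<bar>y\<bar> < \<bar>t\<bar>" by (meson abs_le_square_iff not_le)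
  finally show ?thesis .
 qed
 have sq2: "\<bar>t\<bar> < sqrt ((t\<^sup>2 + y\<^sup>2) / 2) \<longleftrightarrow> \<bar>t\<bar> < \<bar>y\<bar>"
 proof -
  have "\<bar>t\<bar> < sqrt ((t\<^sup>2 + y\<^sup>2) / 2) \<longleftrightarrow> sqrt (t\<^sup>2) < sqrt ((t\<^sup>2 + y\<^sup>2) / 2)" by simp
  also have "\<dots> \<longleftrightarrow> t\<^sup>2 < y\<^sup>2" by (subst real_sqrt_less_iff) auto
  also have "\<dots> \<longleftrightarrow> \<bar>t\<bar> < \<bar>y\<bar>" by (meson abs_le_square_iff not_le)
  finally show ?thesis .
 qed
 have p: "sqrt ((t\<^sup>2 + y\<^sup>2) / 2) \<ge> 0" by simp
 show "t > sqrt 2 / 2 * sqrt (t\<^sup>2 + y\<^sup>2) \<longleftrightarrow> t > \<bar>y\<bar>"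
  unfolding e using sq p by (smt (verit))
 have "- (sqrt 2 / 2) * sqrt (t\<^sup>2 + y\<^sup>2) = - sqrt ((t\<^sup>2 + y\<^sup>2) / 2)"
  unfolding e[symmetric] by simp
 moreover have "t > - sqrt ((t\<^sup>2 + y\<^sup>2) / 2) \<longleftrightarrow> t > - \<bar>y\<bar>"
 proof (cases "t \<ge> 0")
  case True
  show ?thesis
  proof (cases "t = 0")
   case True then show ?thesis by auto
  next
   case False
   then have "t > 0" using True by auto
   then have "t > - sqrt ((t\<^sup>2 + y\<^sup>2) / 2)" "t > - \<bar>y\<bar>" using p by linarith+
   then show ?thesis by blast
  qed
 next
  case False
  then show ?thesis using sq2 by (smt (verit))
 qed
 ultimately show "t > - (sqrt 2 / 2) * sqrt (t\<^sup>2 + y\<^sup>2) \<longleftrightarrow> t > - \<bar>y\<bar>" by simp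
qed

lemma half_power_upper_half_plane:
 "(\<lambda>z. z powr (1/2)) ` upper_half_plane = {s. Re s > 0 \<and> Im s > 0}"
proof (intro subset_antisym subsetI)
 fix s assume "s \<in> (\<lambda>z. z powr (1/2)) ` upper_half_plane"
 then obtain z where z: "Im z > 0" "s = csqrt z" by (auto simp: upper_half_plane_def csqrt_conv_powr)
 have s2: "s\<^sup>2 = z" using z by simp
 have r: "Re s \<ge> 0" using z(2) csqrt_principal[of z] by auto
 have "Im z = 2 * Re s * Im s" using s2[symmetric] by (simp add: power2_eq_square)
 then show "s \<in> {s. Re s > 0 \<and> Im s > 0}" using z(1) r by (simp add: zero_less_mult_iff)
next
 fix s :: complex assume "s \<in> {s. Re s > 0 \<and> Im s > 0}"
 then have s: "Re s > 0" "Im s > 0" by auto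
 then have "csqrt (s\<^sup>2) = s" by (intro csqrt_square) auto
 moreover have "Im (s\<^sup>2) > 0" using s by (simp add: power2_eq_square)
 ultimately show "s \<in> (\<lambda>z. z powr (1/2)) ` upper_half_plane"
  by (intro image_eqI[of _ _ "s\<^sup>2"]) (auto simp: upper_half_plane_def csqrt_conv_powr)
qed

text \<open>The argument 3/2 Arg z runs through (0, 3\<pi>/2), so exactly the closed fourth quadrant
  is missed.\<close>

lemma three_half_power_upper_half_plane:
 "(\<lambda>z. z powr (3/2)) ` upper_half_plane = {s. Re s < 0 \<or> Im s > 0}"
proof (intro subset_antisym subsetI)
 fix s assume "s \<in> (\<lambda>z. z powr (3/2)) ` upper_half_plane"
 then obtain z where z: "Im z > 0" "s = z powr (3/2)" by (auto simp: upper_half_plane_def)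
 have z0: "z \<noteq> 0" using z by auto
 define t where "t = 3/2 * Arg z"
 have A: "0 < Arg z" "Arg z < pi" using z Arg_lt_pi[of z] by auto
 have "s = exp (of_real (3/2 * ln (norm z)) + \<i> * of_real t)"
  unfolding z(2) t_def using z0 by (simp add: powr_def Ln_Arg field_simps)
 then have R: "Re s = exp (3/2 * ln (norm z)) * cos t" "Im s = exp (3/2 * ln (norm z)) * sin t"
  by (simp_all add: Re_exp Im_exp)
 have "cos t < 0 \<or> sin t > 0"
 proof (cases "t < pi")
  case True then show ?thesis using A by (auto intro!: sin_gt_zero simp: t_def)
 next
  case False
  then have "0 < cos (t - pi)" using A by (intro cos_gt_zero_pi) (auto simp: t_def)
  then show ?thesis by simp
 qed
 then show "s \<in> {s. Re s < 0 \<or> Im s > 0}" unfolding mem_Collect_eq R by (auto simp: mult_less_0_iff)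
next
 fix s :: complex assume "s \<in> {s. Re s < 0 \<or> Im s > 0}"
 then have s: "Re s < 0 \<or> Im s > 0" by auto
 then have s0: "s \<noteq> 0" by auto
 \<comment> \<open>\<open>Arg2pi\<close> instead of \<open>Arg\<close>: arguments up to 3\<pi>/2
   have to be read off before the power 3/2 can be undone.\<close>
 define t where "t = Arg2pi s"
 have e: "s = of_real (norm s) * exp (\<i> * of_real t)" and t: "0 \<le> t" "t < 2 * pi"
  using Arg2pi[of s] by (auto simp: t_def is_Arg_def)
 have R: "norm s * cos t = Re s" "norm s * sin t = Im s" unfolding t_def by (rule cos_Arg2pi sin_Arg2pi)+
 have t0: "t > 0"
 proof (rule ccontr)
  assume "\<not> t > 0" then have "t = 0" using t by auto
  then have "Re s = norm s" "Im s = 0" using R by auto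
  then show False using s norm_ge_zero[of s] by linarith
 qed
 have t1: "t < 3 * pi / 2"
 proof (rule ccontr)
  assume "\<not> t < 3 * pi / 2"
  then have h: "0 \<le> t - 3 * pi / 2" "t - 3*pi/2 \<le> pi / 2" using t by auto
  have "sin t = - cos (t - 3 * pi / 2)" "cos t = sin (t - 3 * pi / 2)"
  proof -
   have "3 * pi / 2 = 3 / 2 * pi" by simp
   then show "sin t = - cos (t - 3 * pi / 2)" "cos t = sin (t - 3 * pi / 2)"
    by (simp_all only: cos_diff sin_diff cos_3over2_pi sin_3over2_pi)
  qed
  moreover have "cos (t - 3 * pi / 2) \<ge> 0" using h by (intro cos_ge_zero) auto
  moreover have "sin (t - 3 * pi / 2) \<ge> 0" using h by (intro sin_ge_zero) auto
  ultimately have "sin t \<le> 0" "cos t \<ge> 0" by auto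
  then have "Im s \<le> 0" "Re s \<ge> 0" unfolding R[symmetric] by (auto simp: mult_nonneg_nonpos)
  then show False using s by auto
 qed
 define y where "y = of_real (2/3 * ln (norm s)) + \<i> * of_real (2/3 * t)"
 have Iy: "Im y = 2/3 * t" by (simp add: y_def)
 have "Im (exp y) = exp (2/3 * ln (norm s)) * sin (2/3 * t)" by (simp add: Im_exp y_def)
 moreover have "sin (2/3 * t) > 0" using t0 t1 by (intro sin_gt_zero) auto
 ultimately have "exp y \<in> upper_half_plane" by (simp add: upper_half_plane_def)
 moreover have "exp y powr (3/2) = s"
 proof -
  have "exp y powr (3/2) = exp (y * (3/2))" using Iy t0 t1 by (intro exp_powr_complex) auto
  also have "y * (3/2) = of_real (ln (norm s)) + \<i> * of_real t" by (simp add: y_def field_simps)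
  also have "exp \<dots> = of_real (norm s) * exp (\<i> * of_real t)"
   using s0 by (simp add: exp_add exp_of_real)
  finally show ?thesis using e by simp
 qed
 ultimately show "s \<in> (\<lambda>z. z powr (3/2)) ` upper_half_plane" by (metis image_eqI)
qed

lemma exp_quarter: "exp (- (\<i> * pi / 4)) = (1 - \<i>) * of_real (sqrt 2 / 2)"
proof -
 have "exp (- (\<i> * pi / 4)) = cis (- (pi / 4))" by (simp add: cis_conv_exp)
 then show ?thesis by (simp add: complex_eq_iff cos_45 sin_45)
qed

lemma image_mult_right_Collect:
 fixes E K :: "'a :: comm_monoid_mult"
 assumes "f ` S = {s. P s}" and inv: "E * K = 1"
 shows "(\<lambda>z. f z * E) ` S = {u. P (u * K)}"
proof -
 have "(\<lambda>z. f z * E) ` S = (\<lambda>s. s * E) ` {s. P s}" unfolding assms(1)[symmetric] by auto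
 also have "\<dots> = {u. P (u * K)}"
 proof (intro subset_antisym subsetI)
  fix u assume "u \<in> (\<lambda>s. s * E) ` {s. P s}"
  then obtain s where s: "P s" "u = s * E" by auto
  then have "u * K = s" using inv by (simp only: mult.assoc mult_1_right)
  then show "u \<in> {u. P (u * K)}" using s by simp
 next
  fix u assume "u \<in> {u. P (u * K)}"
  moreover have "u = u * K * E" using inv by (metis mult.assoc mult.commute mult_1_right)
  ultimately show "u \<in> (\<lambda>s. s * E) ` {s. P s}" by blast
 qed
 finally show ?thesis .
qed

lemma exp_quarter_inverse: "exp (- (\<i> * pi / 4)) * ((1 + \<i>) * of_real (sqrt 2 / 2)) = 1"
 unfolding exp_quarter by (simp add: complex_eq_iff field_simps)

text \<open>The factor exp(-i\<pi>/4) rotates the quadrant to |Im| < Re and the three-quarter plane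
  to Im > -|Re|; translations and point reflections then put the vertices at -i, i, -2 and
  2.\<close>

lemma image_Phi:
 "Phi1 ` upper_half_plane = {w. Im w + 1 > - \<bar>Re w\<bar>}"
 "Phi2 ` upper_half_plane = {w. 1 - Im w > - \<bar>Re w\<bar>}"
 "Phi3 ` upper_half_plane = {w. \<bar>Im w\<bar> < Re w + 2}"
 "Phi4 ` upper_half_plane = {w. \<bar>Im w\<bar> < 2 - Re w}"
proof -
 note r3 = image_mult_right_Collect[OF three_half_power_upper_half_plane exp_quarter_inverse]
 note r1 = image_mult_right_Collect[OF half_power_upper_half_plane exp_quarter_inverse]
 have p: "sqrt 2 / 2 > (0::real)" by simp
 have R: "Re (u * ((1 + \<i>) * of_real (sqrt 2 / 2))) = (Re u - Im u) * (sqrt 2 / 2)"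
  "Im (u * ((1 + \<i>) * of_real (sqrt 2 / 2))) = (Re u + Im u) * (sqrt 2 / 2)" for u
  by (simp_all add: algebra_simps)
 have r3': "(\<lambda>z. z powr (3/2) * exp (- (\<i> * pi / 4))) ` upper_half_plane = {u. Im u > - \<bar>Re u\<bar>}"
  unfolding r3 R using p by (auto simp: mult_less_0_iff zero_less_mult_iff)
 have r1': "(\<lambda>z. z powr (1/2) * exp (- (\<i> * pi / 4))) ` upper_half_plane = {u. \<bar>Im u\<bar> < Re u}"
  unfolding r1 R using p by (auto simp: mult_less_0_iff zero_less_mult_iff)
 have im: "g ` S = {w. P (h w)}" if "f ` S = {u. P u}" "\<And>z. h (g z) = f z" "\<And>u w. f u = h w ==> g u = w"
  for f g h :: "complex \<Rightarrow> complex" and S P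
 proof (intro subset_antisym subsetI)
  fix w assume "w \<in> g ` S" then show "w \<in> {w. P (h w)}" using that(1,2) by auto
 next
  fix w assume "w \<in> {w. P (h w)}"
  then have "h w \<in> f ` S" using that(1) by auto
  then obtain z where z: "z \<in> S" "f z = h w" by auto
  then show "w \<in> g ` S" using that(3)[OF z(2)] by blast
 qed
 show "Phi1 ` upper_half_plane = {w. Im w + 1 > - \<bar>Re w\<bar>}"
  using im[OF r3', of "\<lambda>w. w + \<i>" Phi1] by (simp add: Phi1_def)
 have "Phi2 ` upper_half_plane = {w. Im (\<i> - w) > - \<bar>Re (\<i> - w)\<bar>}"
  by (rule im[OF r3', of "\<lambda>w. \<i> - w" Phi2]) (auto simp: Phi2_def)
 then show "Phi2 ` upper_half_plane = {w. 1 - Im w > - \<bar>Re w\<bar>}" by simp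
 show "Phi3 ` upper_half_plane = {w. \<bar>Im w\<bar> < Re w + 2}"
  using im[OF r1', of "\<lambda>w. w + 2" Phi3] by (simp add: Phi3_def)
 have "Phi4 ` upper_half_plane = {w. \<bar>Im (2 - w)\<bar> < Re (2 - w)}"
  by (rule im[OF r1', of "\<lambda>w. 2 - w" Phi4]) (auto simp: Phi4_def)
 then show "Phi4 ` upper_half_plane = {w. \<bar>Im w\<bar> < 2 - Re w}" by simp
qed

lemma Omega_eq: "Omega = {z. \<bar>Re z\<bar> + \<bar>Im z\<bar> < 2 \<and> \<bar>Im z\<bar> < 1 + \<bar>Re z\<bar>}"
 unfolding Omega_def image_Phi by auto

lemma open_Omega: "open Omega"
 unfolding Omega_eq by (intro open_Collect_conj open_Collect_less continuous_intros)

lemma zero_in_Omega: "0 \<in> Omega" by (simp add: Omega_eq)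

lemma minus_in_Omega: "- z \<in> Omega \<longleftrightarrow> z \<in> Omega" by (simp add: Omega_eq)

lemma cnj_in_Omega: "cnj z \<in> Omega \<longleftrightarrow> z \<in> Omega" by (simp add: Omega_eq)

lemma closure_Omega_subset: "closure Omega \<subseteq> {z. \<bar>Re z\<bar> + \<bar>Im z\<bar> \<le> 2 \<and> \<bar>Im z\<bar> \<le> 1 + \<bar>Re z\<bar>}"
proof (rule closure_minimal)
 show "Omega \<subseteq> {z. \<bar>Re z\<bar> + \<bar>Im z\<bar> \<le> 2 \<and> \<bar>Im z\<bar> \<le> 1 + \<bar>Re z\<bar>}" by (auto simp: Omega_eq)
 show "closed {z. \<bar>Re z\<bar> + \<bar>Im z\<bar> \<le> 2 \<and> \<bar>Im z\<bar> \<le> 1 + \<bar>Re z\<bar>}"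
  by (intro closed_Collect_conj closed_Collect_le continuous_intros)
qed

lemma frontier_Omega_D:
 assumes "b \<in> frontier Omega"
 shows "\<bar>Re b\<bar> + \<bar>Im b\<bar> \<le> 2" "\<bar>Im b\<bar> \<le> 1 + \<bar>Re b\<bar>" "\<bar>Re b\<bar> + \<bar>Im b\<bar> = 2 \<or> \<bar>Im b\<bar> = 1 + \<bar>Re b\<bar>"
proof -
 have "b \<in> closure Omega" "b \<notin> Omega"
  using assms by (auto simp: frontier_def interior_open[OF open_Omega])
 then show "\<bar>Re b\<bar> + \<bar>Im b\<bar> \<le> 2" "\<bar>Im b\<bar> \<le> 1 + \<bar>Re b\<bar>" "\<bar>Re b\<bar> + \<bar>Im b\<bar> = 2 \<or> \<bar>Im b\<bar> = 1 + \<bar>Re b\<bar>"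
  using closure_Omega_subset by (fastforce simp: Omega_eq)+
qed

text \<open>Near b the set S is the open sector of opening \<alpha> \<pi> with vertex b and bisector
  d; for \<alpha> = 1 it is a half-plane with inner normal d.\<close>

definition sector_at :: "complex set \<Rightarrow> complex \<Rightarrow> real \<Rightarrow> bool" where
 "sector_at S b \<alpha> \<longleftrightarrow> (\<exists>d \<rho>. norm d = 1 \<and> \<rho> > 0 \<and>
   (\<forall>z. dist b z < \<rho> \<longrightarrow> (z \<in> S \<longleftrightarrow> Re ((z - b) / d) > cos (\<alpha> * pi / 2) * norm (z - b))))"

lemma sector_at_uminus:
 assumes "sector_at Omega b \<alpha>" shows "sector_at Omega (- b) \<alpha>"
proof -
 obtain d \<rho> where d: "norm d = 1" "\<rho> > 0"
  "\<And>z. dist b z < \<rho> ==> (z \<in> Omega \<longleftrightarrow> Re ((z - b) / d) > cos (\<alpha> * pi / 2) * norm (z - b))"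
  using assms unfolding sector_at_def by blast
 show ?thesis unfolding sector_at_def
 proof (intro exI[of _ "- d"] exI[of _ \<rho>] conjI allI impI)
  fix z assume "dist (- b) z < \<rho>"
  then have "dist b (- z) < \<rho>" by (metis dist_minus minus_minus)
  then have "- z \<in> Omega \<longleftrightarrow> Re ((- z - b) / d) > cos (\<alpha> * pi / 2) * norm (- z - b)" by (rule d(3))
  moreover have "(- z - b) / d = (z - - b) / (- d)"
  proof -
   have "d \<noteq> 0" using d(1) by auto
   then show ?thesis by (simp add: field_simps)
  qed
  moreover have "norm (- z - b) = norm (z - - b)" by (metis minus_diff_minus norm_minus_cancel minus_minus)
  ultimately show "z \<in> Omega \<longleftrightarrow> Re ((z - - b) / (- d)) > cos (\<alpha> * pi / 2) * norm (z - - b)"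
   by (simp only: minus_in_Omega)
 qed (use d in auto)
qed

lemma sector_at_cnj:
 assumes "sector_at Omega b \<alpha>" shows "sector_at Omega (cnj b) \<alpha>"
proof -
 obtain d \<rho> where d: "norm d = 1" "\<rho> > 0"
  "\<And>z. dist b z < \<rho> ==> (z \<in> Omega \<longleftrightarrow> Re ((z - b) / d) > cos (\<alpha> * pi / 2) * norm (z - b))"
  using assms unfolding sector_at_def by blast
 show ?thesis unfolding sector_at_def
 proof (intro exI[of _ "cnj d"] exI[of _ \<rho>] conjI allI impI)
  fix z assume "dist (cnj b) z < \<rho>"
  then have "dist b (cnj z) < \<rho>" by (metis complex_cnj_cnj complex_cnj_diff complex_mod_cnj dist_norm)
  then have "cnj z \<in> Omega \<longleftrightarrow> Re ((cnj z - b) / d) > cos (\<alpha> * pi / 2) * norm (cnj z - b)" by (rule d(3))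
  moreover have "(cnj z - b) / d = cnj ((z - cnj b) / cnj d)" by simp
  moreover have "norm (cnj z - b) = norm (z - cnj b)" by (metis complex_cnj_cnj complex_cnj_diff complex_mod_cnj)
  ultimately show "z \<in> Omega \<longleftrightarrow> Re ((z - cnj b) / cnj d) > cos (\<alpha> * pi / 2) * norm (z - cnj b)"
   by (simp only: cnj_in_Omega cnj.sel)
 qed (use d in auto)
qed

lemma cos_sector: "cos (1 / 2 * pi / 2) = sqrt 2 / 2" "cos (1 * pi / 2) = 0" "cos (3 / 2 * pi / 2) = - (sqrt 2 / 2)"
proof -
 show "cos (1 / 2 * pi / 2) = sqrt 2 / 2" using cos_45 by simp
 show "cos (1 * pi / 2) = 0" by simp
 have "cos (3 / 2 * pi / 2) = cos (pi - pi / 4)" by (rule arg_cong[of _ _ cos]) simp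
 also have "\<dots> = - cos (pi / 4)" by (simp only: cos_pi_minus)
 finally show "cos (3 / 2 * pi / 2) = - (sqrt 2 / 2)" using cos_45 by simp
qed

definition convex_corners :: "complex set" where
 "convex_corners = {2, -2, Complex (1/2) (3/2), Complex (-1/2) (3/2), Complex (1/2) (-3/2), Complex (-1/2) (-3/2)}"

text \<open>Interior angle in units of \<pi>; the default 1 is the straight angle at points inside a
  side.\<close>

definition corner_angle :: "complex \<Rightarrow> real" where
 "corner_angle b = (if b = \<i> \<or> b = - \<i> then 3/2 else if b \<in> convex_corners then 1/2 else 1)"

lemma corner_angle_uminus: "corner_angle (- b) = corner_angle b"
 unfolding corner_angle_def convex_corners_def by (auto simp: complex_eq_iff)

lemma corner_angle_cnj: "corner_angle (cnj b) = corner_angle b"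
 unfolding corner_angle_def convex_corners_def by (auto simp: complex_eq_iff)

lemma dist_less_Re_Im: "dist b z < \<rho> ==> \<bar>Re z - Re b\<bar> < \<rho> \<and> \<bar>Im z - Im b\<bar> < \<rho>"
 using abs_Re_le_cmod[of "z - b"] abs_Im_le_cmod[of "z - b"] by (auto simp: dist_norm norm_minus_commute)

text \<open>Close to such a point at most two of the linear constraints are active, and they bound
  the sector. The symmetries \<open>sector_at_cnj\<close> and \<open>sector_at_uminus\<close> take
  care of the other quadrants.\<close>

lemma sector_at_first_quadrant:
 assumes b: "b \<in> frontier Omega" and q: "0 \<le> Re b" "0 \<le> Im b"
 shows "sector_at Omega b (corner_angle b)"
proof -
 note f = frontier_Omega_D[OF b]
 have nrm: "norm (z - b) = sqrt ((Re z - Re b)\<^sup>2 + (Im z - Im b)\<^sup>2)" for z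
  unfolding cmod_def by simp
 consider "b = 2" | "b = Complex (1/2) (3/2)" | "b = \<i>" | "Re b + Im b = 2" "1/2 < Re b" "Re b < 2"
  | "Im b = 1 + Re b" "0 < Re b" "Re b < 1/2" using f q by (auto simp: complex_eq_iff) linarith+
 then show ?thesis
 proof cases
  case 1
  have L: "z \<in> Omega \<longleftrightarrow> Re ((z - b) / (- 1)) > cos (1/2 * pi / 2) * norm (z - b)" if "dist b z < 1/2" for z
  proof -
   have d: "\<bar>Re z - 2\<bar> < 1/2" "\<bar>Im z\<bar> < 1/2" using dist_less_Re_Im[OF that] 1 by auto
   have "Re ((z - b) / (- 1)) > cos (1/2 * pi / 2) * norm (z - b) \<longleftrightarrow> 2 - Re z > sqrt 2 / 2 * sqrt ((2 - Re z)\<^sup>2 + (Im z)\<^sup>2)"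
    unfolding cos_sector nrm using 1 by (simp add: power2_commute)
   also have "\<dots> \<longleftrightarrow> 2 - Re z > \<bar>Im z\<bar>" by (rule sqrt_half_less_iff)
   also have "\<dots> \<longleftrightarrow> z \<in> Omega" using d unfolding Omega_eq mem_Collect_eq by linarith
   finally show ?thesis by blast
  qed
  have ca: "corner_angle b = 1/2" using 1 by (simp add: corner_angle_def convex_corners_def complex_eq_iff)
  show ?thesis unfolding sector_at_def ca by (intro exI[of _ "-1"] exI[of _ "1/2"] conjI allI impI L) auto
 next
  case 2
  have L: "z \<in> Omega \<longleftrightarrow> Re ((z - b) / (- \<i>)) > cos (1/2 * pi / 2) * norm (z - b)" if "dist b z < 1/2" for z
  proof -
   have d: "\<bar>Re z - 1/2\<bar> < 1/2" "\<bar>Im z - 3/2\<bar> < 1/2" using dist_less_Re_Im[OF that] 2 by auto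
   have "Re ((z - b) / (- \<i>)) > cos (1/2 * pi / 2) * norm (z - b) \<longleftrightarrow> 3/2 - Im z > sqrt 2 / 2 * sqrt ((3/2 - Im z)\<^sup>2 + (Re z - 1/2)\<^sup>2)"
    unfolding cos_sector nrm using 2 by (simp add: power2_commute add.commute)
   also have "\<dots> \<longleftrightarrow> 3/2 - Im z > \<bar>Re z - 1/2\<bar>" by (rule sqrt_half_less_iff)
   also have "\<dots> \<longleftrightarrow> z \<in> Omega" using d unfolding Omega_eq mem_Collect_eq by linarith
   finally show ?thesis by blast
  qed
  have ca: "corner_angle b = 1/2" using 2 by (simp add: corner_angle_def convex_corners_def complex_eq_iff)
  show ?thesis unfolding sector_at_def ca by (intro exI[of _ "-\<i>"] exI[of _ "1/2"] conjI allI impI L) auto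
 next
  case 3
  have L: "z \<in> Omega \<longleftrightarrow> Re ((z - b) / (- \<i>)) > cos (3/2 * pi / 2) * norm (z - b)" if "dist b z < 1/2" for z
  proof -
   have d: "\<bar>Re z\<bar> < 1/2" "\<bar>Im z - 1\<bar> < 1/2" using dist_less_Re_Im[OF that] 3 by auto
   have "Re ((z - b) / (- \<i>)) > cos (3/2 * pi / 2) * norm (z - b) \<longleftrightarrow> 1 - Im z > - (sqrt 2 / 2) * sqrt ((1 - Im z)\<^sup>2 + (Re z)\<^sup>2)"
    unfolding cos_sector nrm using 3 by (simp add: power2_commute add.commute)
   also have "\<dots> \<longleftrightarrow> 1 - Im z > - \<bar>Re z\<bar>" by (rule sqrt_half_less_iff)
   also have "\<dots> \<longleftrightarrow> z \<in> Omega" using d unfolding Omega_eq mem_Collect_eq by linarith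
   finally show ?thesis by blast
  qed
  have ca: "corner_angle b = 3/2" using 3 by (simp add: corner_angle_def)
  show ?thesis unfolding sector_at_def ca by (intro exI[of _ "-\<i>"] exI[of _ "1/2"] conjI allI impI L) auto
 next
  case 4
  \<comment> \<open>Inner unit normal of the side Re + Im = 2. The radius in \<open>L\<close> is
    half the slack in Re to each end of the side, so no other side interferes.\<close>
  define d where "d = - ((1 + \<i>) * of_real (sqrt 2 / 2))"
  have "d * ((\<i> - 1) * of_real (sqrt 2 / 2)) = 1" unfolding d_def by (simp add: complex_eq_iff field_simps)
  then have id: "1 / d = (\<i> - 1) * of_real (sqrt 2 / 2)" by (metis inverse_unique inverse_eq_divide)
  have L: "z \<in> Omega \<longleftrightarrow> Re ((z - b) / d) > cos (1 * pi / 2) * norm (z - b)"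
   if "dist b z < min ((Re b - 1/2) / 2) ((2 - Re b) / 2)" for z
  proof -
   have dd: "\<bar>Re z - Re b\<bar> < (Re b - 1/2) / 2" "\<bar>Im z - Im b\<bar> < (2 - Re b) / 2" "\<bar>Im z - Im b\<bar> < (Re b - 1/2) / 2"
    using dist_less_Re_Im[OF that] by auto
   have "Re ((z - b) / d) = - (((Re z - Re b) + (Im z - Im b)) * (sqrt 2 / 2))" (is "_ = ?rhs")
   proof -
    have "Re ((z - b) / d) = Re ((z - b) * (1 / d))" by simp
    also have "\<dots> = ?rhs" unfolding id by (simp add: field_simps)
    finally show ?thesis .
   qed
   then have "Re ((z - b) / d) > cos (1 * pi / 2) * norm (z - b) \<longleftrightarrow> (Re z - Re b) + (Im z - Im b) < 0"
    unfolding cos_sector by (simp add: mult_less_0_iff)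
   also have "\<dots> \<longleftrightarrow> z \<in> Omega"
   proof -
    note q = dd[unfolded abs_less_iff, THEN conjunct1] dd[unfolded abs_less_iff, THEN conjunct2] 4
    have "Re z > 0" using q by argo
    moreover have "Im z > 0" using q by argo
    moreover have "Im z < 1 + Re z" using q by argo
    ultimately have "Re z > 0" "Im z > 0" "Im z < 1 + Re z" by auto
    then show ?thesis using 4(1) by (auto simp: Omega_eq)
   qed
   finally show ?thesis by blast
  qed
  have ca: "corner_angle b = 1" using 4 q by (auto simp: corner_angle_def convex_corners_def complex_eq_iff)
  have nd: "norm d = 1"
  proof -
   have "(norm d)\<^sup>2 = 1" unfolding d_def cmod_power2 by (simp add: power2_eq_square)
   then show ?thesis by (simp add: power2_eq_1_iff) (smt (verit) norm_ge_zero)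
  qed
  show ?thesis unfolding sector_at_def ca
   by (intro exI[of _ d] exI[of _ "min ((Re b - 1/2) / 2) ((2 - Re b) / 2)"] conjI allI impI L nd) (use 4 in auto)
 next
  case 5
  \<comment> \<open>Inner unit normal of the side Im = 1 + Re, with a radius chosen in the same
    way.\<close>
  define d where "d = (1 - \<i>) * of_real (sqrt 2 / 2)"
  have "d * ((1 + \<i>) * of_real (sqrt 2 / 2)) = 1" unfolding d_def by (simp add: complex_eq_iff field_simps)
  then have id: "1 / d = (1 + \<i>) * of_real (sqrt 2 / 2)" by (metis inverse_unique inverse_eq_divide)
  have L: "z \<in> Omega \<longleftrightarrow> Re ((z - b) / d) > cos (1 * pi / 2) * norm (z - b)"
   if "dist b z < min (Re b / 2) ((1/2 - Re b) / 2)" for z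
  proof -
   have dd: "\<bar>Re z - Re b\<bar> < (1/2 - Re b) / 2" "\<bar>Im z - Im b\<bar> < (1/2 - Re b) / 2" "\<bar>Re z - Re b\<bar> < Re b / 2" "\<bar>Im z - Im b\<bar> < Re b / 2"
    using dist_less_Re_Im[OF that] by auto
   have "Re ((z - b) / d) = ((Re z - Re b) - (Im z - Im b)) * (sqrt 2 / 2)" (is "_ = ?rhs")
   proof -
    have "Re ((z - b) / d) = Re ((z - b) * (1 / d))" by simp
    also have "\<dots> = ?rhs" unfolding id by (simp add: field_simps)
    finally show ?thesis .
   qed
   then have "Re ((z - b) / d) > cos (1 * pi / 2) * norm (z - b) \<longleftrightarrow> ((Re z - Re b) - (Im z - Im b)) * (sqrt 2 / 2) > 0"
    unfolding cos_sector by (simp only: mult_zero_left)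
   also have "\<dots> \<longleftrightarrow> (Re z - Re b) - (Im z - Im b) > 0"
    by (subst zero_less_mult_iff) auto
   also have "\<dots> \<longleftrightarrow> z \<in> Omega"
   proof -
    note q = dd[unfolded abs_less_iff, THEN conjunct1] dd[unfolded abs_less_iff, THEN conjunct2] 5
    have "Re z > 0" using q by argo
    moreover have "Im z > 0" using q by argo
    moreover have "Re z + Im z < 2" using q by argo
    ultimately have "Re z > 0" "Im z > 0" "Re z + Im z < 2" by auto
    then show ?thesis using 5(1) by (auto simp: Omega_eq)
   qed
   finally show ?thesis by blast
  qed
  have ca: "corner_angle b = 1" using 5 q by (auto simp: corner_angle_def convex_corners_def complex_eq_iff)
  have nd: "norm d = 1"
  proof -
   have "(norm d)\<^sup>2 = 1" unfolding d_def cmod_power2 by (simp add: power2_eq_square)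
   then show ?thesis by (simp add: power2_eq_1_iff) (smt (verit) norm_ge_zero)
  qed
  show ?thesis unfolding sector_at_def ca
   by (intro exI[of _ d] exI[of _ "min (Re b / 2) ((1/2 - Re b) / 2)"] conjI allI impI L nd) (use 5 in auto)
 qed
qed

lemma frontier_Omega_uminus: "b \<in> frontier Omega ==> (- b) \<in> frontier Omega"
 unfolding frontier_straddle
proof (intro allI impI conjI)
 fix e :: real assume a: "\<forall>e>0. (\<exists>x\<in>Omega. dist b x < e) \<and> (\<exists>x. x \<notin> Omega \<and> dist b x < e)" and e: "0 < e"
 have dc: "dist (- b) (- x) = dist b x" for x by (rule dist_minus)
 from a e obtain x y where "x \<in> Omega" "dist b x < e" "y \<notin> Omega" "dist b y < e" by blast
 then show "\<exists>x\<in>Omega. dist (- b) x < e" "\<exists>x. x \<notin> Omega \<and> dist (- b) x < e"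
  using dc minus_in_Omega by (metis)+
qed

lemma frontier_Omega_cnj: "b \<in> frontier Omega ==> cnj b \<in> frontier Omega" unfolding frontier_straddle
proof (intro allI impI conjI)
 fix e :: real assume a: "\<forall>e>0. (\<exists>x\<in>Omega. dist b x < e) \<and> (\<exists>x. x \<notin> Omega \<and> dist b x < e)" and e: "0 < e"
 have dc: "dist (cnj b) (cnj x) = dist b x" for x by (simp add: dist_norm flip: complex_cnj_diff)
 from a e obtain x y where "x \<in> Omega" "dist b x < e" "y \<notin> Omega" "dist b y < e" by blast
 then show "\<exists>x\<in>Omega. dist (cnj b) x < e" "\<exists>x. x \<notin> Omega \<and> dist (cnj b) x < e"
  using dc cnj_in_Omega by (metis)+
qed

lemma sector_at_Omega:
 assumes "b \<in> frontier Omega" shows "sector_at Omega b (corner_angle b)"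
proof -
 have *: "sector_at Omega b (corner_angle b)" if "b \<in> frontier Omega" "0 \<le> Re b" for b
 proof (cases "0 \<le> Im b")
  case False
  then have "sector_at Omega (cnj b) (corner_angle (cnj b))"
   using sector_at_first_quadrant[OF frontier_Omega_cnj[OF that(1)]] that by auto
  then show ?thesis using sector_at_cnj[of "cnj b"] corner_angle_cnj[of b] by simp
 qed (use sector_at_first_quadrant that in auto)
 show ?thesis
 proof (cases "0 \<le> Re b")
  case False
  then have "sector_at Omega (- b) (corner_angle (- b))" using *[OF frontier_Omega_uminus[OF assms]] by auto
  then show ?thesis using sector_at_uminus[of "- b"] corner_angle_uminus[of b] by simp
 qed (use * assms in auto)
qed

text \<open>Shrinking a corner towards 0 lands inside the domain, by inspection of all eight, and
  the shrunken points approach the corner.\<close>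

lemma corners_in_frontier:
 assumes "b = \<i> \<or> b = - \<i> \<or> b \<in> convex_corners" shows "b \<in> frontier Omega"
proof -
 have "b \<notin> Omega" using assms by (auto simp: Omega_eq convex_corners_def)
 moreover have "b \<in> closure Omega" unfolding closure_approachable
 proof (intro allI impI)
  fix e :: real assume "e > 0"
  define t where "t = min (1/2) (e / 4)"
  have t: "0 < t" "t \<le> 1/2" "t \<le> e / 4" using \<open>e > 0\<close> by (auto simp: t_def)
  have "norm b \<le> 2" using assms by (auto simp: convex_corners_def intro!: order_trans[OF cmod_le])
  then have "t * norm b \<le> t * 2" using t by (intro mult_left_mono) auto
  then have "t * norm b < e" using t \<open>e > 0\<close> by linarith
  moreover have "of_real (1 - t) * b - b = - (of_real t * b)" by (simp add: algebra_simps)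
  ultimately have "dist (of_real (1 - t) * b) b < e" using t unfolding dist_norm by (simp add: norm_mult)
  moreover have "of_real (1 - t) * b \<in> Omega"
   using assms t by (auto simp: Omega_eq convex_corners_def abs_mult field_simps)
  ultimately show "\<exists>y\<in>Omega. dist y b < e" by blast
 qed
 ultimately show ?thesis by (simp add: frontier_def interior_open[OF open_Omega])
qed

section \<open>One-dimensional Hausdorff measure along locally straight curves\<close>

section \<open>Arc length of rectifiable arcs\<close>

lemma hausdorff1_mono: "A \<subseteq> B ==> hausdorff1 A \<le> hausdorff1 B"
 unfolding hausdorff1_def by (intro SUP_subset_mono INF_superset_mono order_refl) blast

text \<open>Prepending a singleton, of diameter 0, to a cover costs nothing.\<close>

lemma hausdorff1_insert_le: "hausdorff1 (insert x A) \<le> hausdorff1 A" unfolding hausdorff1_def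
proof (rule SUP_mono)
 fix \<delta> :: real assume d: "\<delta> \<in> {0<..}"
 let ?C = "\<lambda>A. {U :: nat \<Rightarrow> 'a set. A \<subseteq> (\<Union>i. U i) \<and> (\<forall>i. bounded (U i) \<and> diameter (U i) \<le> \<delta>)}"
 have "(INF U\<in>?C (insert x A). (\<Sum>i. ennreal (diameter (U i)))) \<le> (INF U\<in>?C A. (\<Sum>i. ennreal (diameter (U i))))"
 proof (rule INF_greatest)
  fix U assume U: "U \<in> ?C A"
  define V where "V = (case_nat {x} U)"
  have V0: "V 0 = {x}" and VS: "V (Suc i) = U i" for i by (simp_all add: V_def)
  have "insert x A \<subseteq> (\<Union>i. V i)"
  proof
   fix y assume "y \<in> insert x A"
   then consider "y = x" | i where "y \<in> U i" using U by auto
   then show "y \<in> (\<Union>i. V i)" using V0 VS by cases (metis UN_I UNIV_I singletonI, metis UN_I UNIV_I)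
  qed
  moreover have "bounded (V i) \<and> diameter (V i) \<le> \<delta>" for i
   using U d by (cases i) (auto simp: V0 VS)
  ultimately have "V \<in> ?C (insert x A)" by blast
  then have "(INF U\<in>?C (insert x A). (\<Sum>i. ennreal (diameter (U i)))) \<le> (\<Sum>i. ennreal (diameter (V i)))"
   by (rule INF_lower)
  also have "\<dots> = (\<Sum>i. ennreal (diameter (V (i + 1)))) + (\<Sum>i<1. ennreal (diameter (V i)))"
   by (rule suminf_offset) auto
  also have "\<dots> = (\<Sum>i. ennreal (diameter (U i)))" by (simp add: V0 VS)
  finally show "(INF U\<in>?C (insert x A). (\<Sum>i. ennreal (diameter (U i)))) \<le> (\<Sum>i. ennreal (diameter (U i)))" .
 qed
 then show "\<exists>m\<in>{0<..}. (INF U\<in>?C (insert x A). (\<Sum>i. ennreal (diameter (U i))))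
  \<le> (INF U\<in>{U :: nat \<Rightarrow> 'a set. A \<subseteq> (\<Union>i. U i) \<and> (\<forall>i. bounded (U i) \<and> diameter (U i) \<le> m)}. (\<Sum>i. ennreal (diameter (U i))))"
  using d by blast
qed

lemma hausdorff1_Un_finite:
 assumes "finite X" shows "hausdorff1 (A \<union> X) = hausdorff1 A"
proof (rule antisym)
 show "hausdorff1 (A \<union> X) \<le> hausdorff1 A" using assms
 proof induction
  case (insert x X)
  then show ?case using hausdorff1_insert_le[of x "A \<union> X"] by (simp add: Un_insert_right)
 qed simp
qed (auto intro: hausdorff1_mono)

lemma ennreal_suminf_bound_add:
 assumes "\<And>e :: real. e > 0 ==> x \<le> y + ennreal e" shows "x \<le> (y :: ennreal)"
 by (rule ennreal_le_epsilon) (use assms in auto)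

text \<open>Length as a measure on the parameter set I, an open set that need not be connected. By
  \<open>loc\<close>, distances near a parameter equal the f-mass of the parameter interval, which
  means that the curve runs monotonically along a line with speed f; \<open>inv\<close> is
  continuity of the inverse parametrization.\<close>

locale rectifiable_arc =
 fixes f :: "real \<Rightarrow> ennreal" and I :: "real set" and \<gamma> :: "real \<Rightarrow> complex" and a b :: real
 assumes f [measurable]: "f \<in> borel_measurable borel"
  and f0: "\<And>t. t \<notin> I ==> f t = 0"
  and I: "open I" "I \<subseteq> {a<..<b}" and ab: "a < b"
  and loc: "\<And>t. t \<in> I ==> \<exists>\<delta>>0. \<forall>s1 s2. t - \<delta> < s1 \<and> s1 \<le> s2 \<and> s2 < t + \<delta> \<longrightarrow>
    {s1..s2} \<subseteq> I \<and> ennreal (dist (\<gamma> s1) (\<gamma> s2)) = emeasure (density lborel f) {s1..s2}"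
  and inv: "\<And>t \<delta>. t \<in> I ==> \<delta> > 0 ==> \<exists>\<epsilon>>0. \<forall>s\<in>I. dist (\<gamma> s) (\<gamma> t) < \<epsilon> \<longrightarrow> \<bar>s - t\<bar> < \<delta>"
  and cont: "continuous_on I \<gamma>"
begin

abbreviation "N \<equiv> density lborel f"

lemma sets_N [simp, measurable_cong]: "sets N = sets borel" by simp

lemma N_singleton: "{x} \<in> null_sets N"
proof -
 have "{x} \<in> null_sets lborel" by auto
 then have "{x} \<in> null_sets N"
  using absolutely_continuousI_density[of f lborel] f unfolding absolutely_continuous_def by auto
 then show "{x} \<in> null_sets N" .
qed

lemma N_UNIV: "emeasure N UNIV = emeasure N I"
 using I(1) f0 by (auto simp: emeasure_density intro!: nn_integral_cong split: split_indicator)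

text \<open>Outer regularity gives an open W of almost the same mass, and a covering argument fills
  E by non-overlapping intervals inside W, so short that each image has small diameter, at most the
  mass of its interval. The masses add up because the interiors are disjoint.\<close>

lemma upper:
 assumes fin: "emeasure N UNIV < \<infinity>" and E: "E \<in> sets borel" "E \<subseteq> I"
 shows "hausdorff1 (\<gamma> ` E) \<le> emeasure N E"
proof -
 have N_fin: "emeasure N A < \<infinity>" for A using fin emeasure_space[of N A] by (simp add: le_less_trans)
 have main: "(INF U\<in>{U. \<gamma> ` E \<subseteq> (\<Union>i. U i) \<and> (\<forall>i. bounded (U i) \<and> diameter (U i) \<le> \<delta>)}. \<Sum>i::nat. ennreal (diameter (U i)))
    \<le> emeasure N E + ennreal e" if d: "\<delta> > 0" and e: "e > 0" for \<delta> e :: real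
 proof -
  have "emeasure N E = (INF U\<in>{U. E \<subseteq> U \<and> open U}. emeasure N U)"
   by (rule outer_regular) (use N_fin[of UNIV] E in \<open>auto simp: less_top\<close>)
  moreover have "emeasure N E < emeasure N E + ennreal e"
   using N_fin[of E] e by (simp add: ennreal_add_left_cancel_less[of _ 0, simplified] less_top)
  ultimately have "(INF U\<in>{U. E \<subseteq> U \<and> open U}. emeasure N U) < emeasure N E + ennreal e" by simp
  then obtain W where W: "E \<subseteq> W" "open W" "emeasure N W < emeasure N E + ennreal e"
   unfolding INF_less_iff by auto
  have "\<forall>t\<in>I. \<exists>\<eta>>0. ball t \<eta> \<subseteq> I \<and> (t \<in> W \<longrightarrow> ball t \<eta> \<subseteq> W) \<and>
    (\<forall>s1 s2. t - \<eta> < s1 \<and> s1 \<le> s2 \<and> s2 < t + \<eta> \<longrightarrow> ennreal (dist (\<gamma> s1) (\<gamma> s2)) = emeasure N {s1..s2}) \<and>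
    (\<forall>s. dist s t < \<eta> \<longrightarrow> dist (\<gamma> s) (\<gamma> t) < \<delta>/4)"
  proof
   fix t assume t: "t \<in> I"
   obtain e1 where e1: "e1 > 0" "ball t e1 \<subseteq> I" using I t open_contains_ball by blast
   obtain e2 where e2: "e2 > 0" "t \<in> W \<longrightarrow> ball t e2 \<subseteq> W"
   proof (cases "t \<in> W")
    case True
    then show ?thesis using W(2) that unfolding open_contains_ball by blast
   qed (use that[of 1] in auto)
   obtain e3 where e3: "e3 > 0" "\<forall>s1 s2. t - e3 < s1 \<and> s1 \<le> s2 \<and> s2 < t + e3 \<longrightarrow>
    {s1..s2} \<subseteq> I \<and> ennreal (dist (\<gamma> s1) (\<gamma> s2)) = emeasure N {s1..s2}" using loc[OF t] by blast
   have "isCont \<gamma> t" using cont I(1) t continuous_on_eq_continuous_at by blast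
   then obtain e4 where e4: "e4 > 0" "\<forall>s. dist s t < e4 \<longrightarrow> dist (\<gamma> s) (\<gamma> t) < \<delta>/4"
    unfolding continuous_at_eps_delta using d by (meson divide_pos_pos zero_less_numeral)
   show "\<exists>\<eta>>0. ball t \<eta> \<subseteq> I \<and> (t \<in> W \<longrightarrow> ball t \<eta> \<subseteq> W) \<and>
    (\<forall>s1 s2. t - \<eta> < s1 \<and> s1 \<le> s2 \<and> s2 < t + \<eta> \<longrightarrow> ennreal (dist (\<gamma> s1) (\<gamma> s2)) = emeasure N {s1..s2}) \<and>
    (\<forall>s. dist s t < \<eta> \<longrightarrow> dist (\<gamma> s) (\<gamma> t) < \<delta>/4)"
   proof (intro exI[of _ "min (min e1 e2) (min e3 e4)"] conjI allI impI)
    show "0 < min (min e1 e2) (min e3 e4)" using e1 e2 e3 e4 by auto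
    show "ball t (min (min e1 e2) (min e3 e4)) \<subseteq> I" using e1(2) by (rule order_trans[rotated]) (auto intro: subset_ball)
    show "ball t (min (min e1 e2) (min e3 e4)) \<subseteq> W" if "t \<in> W"
     using e2(2)[rule_format, OF that] by (rule order_trans[rotated]) (auto intro: subset_ball)
    show "ennreal (dist (\<gamma> s1) (\<gamma> s2)) = emeasure N {s1..s2}"
     if "t - min (min e1 e2) (min e3 e4) < s1 \<and> s1 \<le> s2 \<and> s2 < t + min (min e1 e2) (min e3 e4)" for s1 s2
     using e3(2)[rule_format, of s1 s2] that by linarith
    show "dist (\<gamma> s) (\<gamma> t) < \<delta>/4" if "dist s t < min (min e1 e2) (min e3 e4)" for s
     using e4(2) that by auto
   qed
  qed
  from bchoice[OF this] obtain \<eta> where \<eta>0: "\<forall>t\<in>I. \<eta> t > 0 \<and> ball t (\<eta> t) \<subseteq> I \<and> (t \<in> W \<longrightarrow> ball t (\<eta> t) \<subseteq> W) \<and>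
    (\<forall>s1 s2. t - \<eta> t < s1 \<and> s1 \<le> s2 \<and> s2 < t + \<eta> t \<longrightarrow> ennreal (dist (\<gamma> s1) (\<gamma> s2)) = emeasure N {s1..s2}) \<and>
    (\<forall>s. dist s t < \<eta> t \<longrightarrow> dist (\<gamma> s) (\<gamma> t) < \<delta>/4)" ..
  then have \<eta>: "\<And>t. t \<in> I ==> \<eta> t > 0" "\<And>t. t \<in> I ==> ball t (\<eta> t) \<subseteq> I"
    "\<And>t. t \<in> I ==> t \<in> W ==> ball t (\<eta> t) \<subseteq> W"
    "\<And>t s1 s2. t \<in> I ==> t - \<eta> t < s1 ==> s1 \<le> s2 ==> s2 < t + \<eta> t ==> ennreal (dist (\<gamma> s1) (\<gamma> s2)) = emeasure N {s1..s2}"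
    "\<And>t s. t \<in> I ==> dist s t < \<eta> t ==> dist (\<gamma> s) (\<gamma> t) < \<delta>/4" by blast+
  define g where "g t = ball t (if t \<in> I then \<eta> t else 1)" for t
  have gauge: "gauge g" unfolding g_def gauge_def using \<eta>(1) by auto
  have Eab: "E \<subseteq> cbox a b" using E(2) I(2) by (auto simp: less_imp_le)
  \<comment> \<open>The gauge is attached to a point of E in each interval, which puts the whole
    interval into the good ball of that point.\<close>
  obtain D where D: "countable D" "\<Union>D \<subseteq> cbox a b"
   "\<And>K. K \<in> D ==> interior K \<noteq> {} \<and> (\<exists>c d. K = cbox c d)"
   "pairwise (\<lambda>A B. interior A \<inter> interior B = {}) D"
   "\<And>K. K \<in> D ==> \<exists>x \<in> E \<inter> K. K \<subseteq> g x" "E \<subseteq> \<Union>D"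
  proof (rule covering_lemma[OF Eab _ gauge])
   show "box a b \<noteq> {}" using ab by simp
  qed (rule that; assumption)
  have K: "K \<subseteq> W \<and> K \<subseteq> I \<and> bounded (\<gamma> ` K) \<and> diameter (\<gamma> ` K) \<le> \<delta> \<and> ennreal (diameter (\<gamma> ` K)) \<le> emeasure N (interior K)"
   if KD: "K \<in> D" for K
  proof -
   obtain x where x: "x \<in> E" "x \<in> K" "K \<subseteq> g x" using D(5)[OF KD] by blast
   have xI: "x \<in> I" "x \<in> W" using x(1) E(2) W(1) by auto
   have Kb: "K \<subseteq> ball x (\<eta> x)" using x(3) xI by (simp add: g_def)
   obtain c d where cd: "K = {c..d}" "interior K \<noteq> {}" using D(3)[OF KD] by auto
   have cdl: "c < d" using cd by (auto simp: interior_atLeastAtMost_real)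
   have cdb: "x - \<eta> x < c" "d < x + \<eta> x"
   proof -
    have "c \<in> K" "d \<in> K" using cd(1) cdl by auto
    then have "c \<in> ball x (\<eta> x)" "d \<in> ball x (\<eta> x)" using Kb by blast+
    then show "x - \<eta> x < c" "d < x + \<eta> x" by (auto simp: dist_real_def)
   qed
   \<comment> \<open>Endpoints carry no mass, so nothing is lost on passing to the disjoint
     interiors.\<close>
   have NK: "emeasure N K = emeasure N (interior K)"
   proof -
    have e: "K = interior K \<union> ({c} \<union> {d})" using cd(1) cdl by (auto simp: interior_atLeastAtMost_real)
    have "emeasure N (interior K \<union> ({c} \<union> {d})) = emeasure N (interior K)"
     by (intro emeasure_Un_null_set null_sets.Un N_singleton) simp
    then show ?thesis using e by simp
   qed
   obtain m where m: "emeasure N K = ennreal m" "m \<ge> 0" using N_fin[of K] by (cases "emeasure N K") auto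
   have dm: "dist (\<gamma> s1) (\<gamma> s2) \<le> m" if "s1 \<in> K" "s2 \<in> K" for s1 s2
   proof -
    have *: "dist (\<gamma> s1) (\<gamma> s2) \<le> m" if "s1 \<in> K" "s2 \<in> K" "s1 \<le> s2" for s1 s2
    proof -
     have "ennreal (dist (\<gamma> s1) (\<gamma> s2)) = emeasure N {s1..s2}"
      using that cdb cd(1) by (intro \<eta>(4)[OF xI(1)]) auto
     also have "\<dots> \<le> emeasure N K" using that cd(1) by (intro emeasure_mono) auto
     finally show ?thesis unfolding m using m(2) by (simp add: ennreal_le_iff)
    qed
    show ?thesis using *[of s1 s2] *[of s2 s1] that by (cases "s1 \<le> s2") (auto simp: dist_commute)
   qed
   have dd: "dist (\<gamma> s1) (\<gamma> s2) \<le> \<delta>" if "s1 \<in> K" "s2 \<in> K" for s1 s2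
   proof -
    have "dist s1 x < \<eta> x" "dist s2 x < \<eta> x" using Kb that by (auto simp: dist_commute)
    then have "dist (\<gamma> s1) (\<gamma> x) < \<delta>/4" "dist (\<gamma> s2) (\<gamma> x) < \<delta>/4" using \<eta>(5)[OF xI(1)] by auto
    then show ?thesis using dist_triangle2[of "\<gamma> s1" "\<gamma> s2" "\<gamma> x"] d by linarith
   qed
   have ne: "\<gamma> ` K \<noteq> {}" using x(2) by auto
   have "bounded (\<gamma> ` K)" unfolding bounded_two_points using dd by blast
   moreover have "diameter (\<gamma> ` K) \<le> \<delta>"
    by (rule diameter_le) (use ne dd in \<open>auto simp: dist_norm\<close>)
   moreover have "diameter (\<gamma> ` K) \<le> m"
    by (rule diameter_le) (use ne dm in \<open>auto simp: dist_norm\<close>)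
   moreover have "K \<subseteq> I" "K \<subseteq> W" using Kb \<eta>(2)[OF xI(1)] \<eta>(3)[OF xI] by auto
   ultimately show ?thesis using m NK by (metis ennreal_leI)
  qed
  define V where "V i = (if i \<in> to_nat_on D ` D then from_nat_into D i else {})" for i
  have V: "V i \<in> D \<or> V i = {}" for i using from_nat_into_to_nat_on[OF D(1)] unfolding V_def by auto
  have VU: "(\<Union>i. V i) = \<Union>D"
  proof (intro subset_antisym subsetI)
   fix x assume "x \<in> (\<Union>i. V i)" then show "x \<in> \<Union>D" using V by blast
  next
   fix x assume "x \<in> \<Union>D"
   then obtain K where "K \<in> D" "x \<in> K" by blast
   then have "V (to_nat_on D K) = K" using D(1) by (simp add: V_def)
   then show "x \<in> (\<Union>i. V i)" using \<open>x \<in> K\<close> by blast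
  qed
  have disj: "disjoint_family (\<lambda>i. interior (V i))" unfolding disjoint_family_on_def
  proof (intro ballI impI)
   fix i j :: nat assume ij: "i \<noteq> j"
   show "interior (V i) \<inter> interior (V j) = {}"
   proof (cases "i \<in> to_nat_on D ` D \<and> j \<in> to_nat_on D ` D")
    case True
    then obtain A B where AB: "A \<in> D" "B \<in> D" "i = to_nat_on D A" "j = to_nat_on D B" by blast
    then have "V i = A" "V j = B" "A \<noteq> B" using D(1) ij by (auto simp: V_def)
    then show ?thesis using D(4) AB unfolding pairwise_def by blast
   qed (auto simp: V_def)
  qed
  have cover: "(\<lambda>i. \<gamma> ` V i) \<in> {U. \<gamma> ` E \<subseteq> (\<Union>i. U i) \<and> (\<forall>i. bounded (U i) \<and> diameter (U i) \<le> \<delta>)}"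
  proof (intro CollectI conjI allI)
   have "\<gamma> ` E \<subseteq> \<gamma> ` (\<Union>i. V i)" using D(6) unfolding VU by (rule image_mono)
   then show "\<gamma> ` E \<subseteq> (\<Union>i. \<gamma> ` V i)" by (simp add: image_UN)
   fix i show "bounded (\<gamma> ` V i)" "diameter (\<gamma> ` V i) \<le> \<delta>" using V[of i] K[of "V i"] d by auto
  qed
  have "(INF U\<in>{U. \<gamma> ` E \<subseteq> (\<Union>i. U i) \<and> (\<forall>i. bounded (U i) \<and> diameter (U i) \<le> \<delta>)}. \<Sum>i::nat. ennreal (diameter (U i)))
    \<le> (\<Sum>i. ennreal (diameter (\<gamma> ` V i)))" by (rule INF_lower[OF cover])
  also have "\<dots> \<le> (\<Sum>i. emeasure N (interior (V i)))"
  proof (rule suminf_le)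
   fix i show "ennreal (diameter (\<gamma> ` V i)) \<le> emeasure N (interior (V i))"
    using V[of i] K[of "V i"] by auto
  qed auto
  also have "\<dots> = emeasure N (\<Union>i. interior (V i))" by (rule suminf_emeasure[OF _ disj]) auto
  also have "\<dots> \<le> emeasure N W"
  proof (rule emeasure_mono)
   show "(\<Union>i. interior (V i)) \<subseteq> W" using V K interior_subset by fastforce
  qed (use W(2) in auto)
  also have "\<dots> \<le> emeasure N E + ennreal e" using W(3) by (rule less_imp_le)
  finally show ?thesis .
 qed
 have "(INF U\<in>{U. \<gamma> ` E \<subseteq> (\<Union>i. U i) \<and> (\<forall>i. bounded (U i) \<and> diameter (U i) \<le> \<delta>)}. \<Sum>i::nat. ennreal (diameter (U i)))
    \<le> emeasure N E" if "\<delta> > 0" for \<delta> :: real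
  by (rule ennreal_suminf_bound_add) (rule main[OF that])
 then show ?thesis unfolding hausdorff1_def by (intro SUP_least) auto
qed

text \<open>The candidate is the interval from Inf S to Sup S: its mass is exhausted by slightly
  trimmed intervals, each lying between two points of S.\<close>

lemma interval_hull:
 assumes S: "S \<subseteq> I" and c: "0 \<le> c" and le: "\<And>s1 s2. s1 \<in> S ==> s2 \<in> S ==> s1 \<le> s2 ==> emeasure N {s1..s2} \<le> ennreal c"
 shows "\<exists>J. J \<in> sets borel \<and> S \<subseteq> J \<and> emeasure N J \<le> ennreal c"
proof (cases "S = {}")
 case True then show ?thesis by (intro exI[of _ "{}"]) auto
next
 case False
 have bd: "bdd_below S" "bdd_above S" using S I(2) by (auto intro!: bdd_belowI[of _ a] bdd_aboveI[of _ b] less_imp_le)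
 define l u where "l = Inf S" and "u = Sup S"
 have lu: "S \<subseteq> {l..u}" using bd by (auto simp: l_def u_def cInf_lower cSup_upper)
 have "emeasure N {l<..<u} \<le> ennreal c"
 proof (cases "l < u")
  case True
  define m where "m = (l + u) / 2"
  \<comment> \<open>Denominators n + 3 keep the trimmed ends below half the length, so that the
    points of S chosen near the two ends come in the right order.\<close>
  define A where "A n = {l + (u - l) / (n + 3) .. u - (u - l) / (n + 3)}" for n :: nat
  have inc: "incseq A" unfolding A_def using True by (intro monoI) (auto intro!: divide_left_mono)
  have Am: "A n \<in> sets N" for n by (simp add: A_def)
  have Un: "(\<Union>n. A n) = {l<..<u}"
  proof (intro subset_antisym subsetI)
   fix x assume "x \<in> (\<Union>n. A n)"
   then obtain n where "x \<in> A n" by blast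
   moreover have "(u - l) / (n + 3) > 0" using True by simp
   ultimately show "x \<in> {l<..<u}" by (auto simp: A_def)
  next
   fix x assume x: "x \<in> {l<..<u}"
   define e where "e = min (x - l) (u - x)"
   have e: "e > 0" using x by (simp add: e_def)
   obtain n :: nat where n: "(u - l) / e < n" using reals_Archimedean2 by blast
   then have "(u - l) < e * (n + 3)" using e by (simp add: field_simps)
   then have "(u - l) / (n + 3) < e" by (simp add: field_simps)
   then show "x \<in> (\<Union>n. A n)" by (auto simp: A_def e_def intro!: exI[of _ n])
  qed
  have "emeasure N {l<..<u} = (SUP n. emeasure N (A n))"
   unfolding Un[symmetric] by (rule SUP_emeasure_incseq[symmetric]) (use inc Am in auto)
  also have "\<dots> \<le> ennreal c"
  proof (rule SUP_least)
   fix n :: nat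
   have q: "(u - l) / (n + 3) > 0" using True by simp
   obtain s1 where s1: "s1 \<in> S" "s1 < l + (u - l) / (n + 3)"
    using cInf_lessD[OF False, of "l + (u - l) / (n + 3)"] q unfolding l_def by auto
   obtain s2 where s2: "s2 \<in> S" "u - (u - l) / (n + 3) < s2"
    using less_cSupD[OF False, of "u - (u - l) / (n + 3)"] q unfolding u_def by auto
   have "(u - l) / (n + 3) \<le> (u - l) / 2" using True by (intro divide_left_mono) auto
   then have le12: "s1 \<le> s2" using s1(2) s2(2) by argo
   have "emeasure N (A n) \<le> emeasure N {s1..s2}" using s1 s2 by (intro emeasure_mono) (auto simp: A_def)
   also have "\<dots> \<le> ennreal c" by (rule le[OF s1(1) s2(1) le12])
   finally show "emeasure N (A n) \<le> ennreal c" .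
  qed
  finally show ?thesis .
 qed simp
 moreover have "emeasure N ({l<..<u} \<union> {l,u}) = emeasure N {l<..<u}"
 proof (rule emeasure_Un_null_set)
  have "{l} \<union> {u} \<in> null_sets N" by (intro null_sets.Un N_singleton)
  then show "{l, u} \<in> null_sets N" by (simp add: insert_commute)
 qed auto
 moreover have "S \<subseteq> {l<..<u} \<union> {l,u}" using lu by force
 ultimately show ?thesis by (intro exI[of _ "{l<..<u} \<union> {l,u}"]) auto
qed

text \<open>A version of \<open>loc\<close> at a fixed scale in the image: any two parameters that
  land within 1/(n + 1) of \<gamma> t are joined by an interval whose mass is the distance of their
  images. For some n depending on t, this follows from \<open>loc\<close> and
  \<open>inv\<close>.\<close>

definition P :: "nat \<Rightarrow> real \<Rightarrow> bool" where
 "P n t \<longleftrightarrow> (\<forall>s1\<in>I. \<forall>s2\<in>I. dist (\<gamma> s1) (\<gamma> t) < 1 / Suc n \<and> dist (\<gamma> s2) (\<gamma> t) < 1 / Suc n \<and> s1 \<le> s2 \<longrightarrow>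
   emeasure N {s1..s2} = ennreal (dist (\<gamma> s1) (\<gamma> s2)))"

lemma P_ev: "t \<in> I ==> \<exists>n. P n t"
proof -
 assume t: "t \<in> I"
 obtain d where d: "d > 0" "\<forall>s1 s2. t - d < s1 \<and> s1 \<le> s2 \<and> s2 < t + d \<longrightarrow>
    {s1..s2} \<subseteq> I \<and> ennreal (dist (\<gamma> s1) (\<gamma> s2)) = emeasure N {s1..s2}" using loc[OF t] by blast
 obtain e where e: "e > 0" "\<forall>s\<in>I. dist (\<gamma> s) (\<gamma> t) < e \<longrightarrow> \<bar>s - t\<bar> < d" using inv[OF t d(1)] by blast
 obtain n where n: "1 / Suc n < e" using e(1) nat_approx_posE by blast
 have "P n t" unfolding P_def
 proof (intro ballI impI)
  fix s1 s2 assume s: "s1 \<in> I" "s2 \<in> I" "dist (\<gamma> s1) (\<gamma> t) < 1 / Suc n \<and> dist (\<gamma> s2) (\<gamma> t) < 1 / Suc n \<and> s1 \<le> s2"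
  then have "dist (\<gamma> s1) (\<gamma> t) < e" "dist (\<gamma> s2) (\<gamma> t) < e" using n by linarith+
  then have "\<bar>s1 - t\<bar> < d" "\<bar>s2 - t\<bar> < d" using e(2) s by blast+
  then have "t - d < s1" "s2 < t + d" by linarith+
  then show "emeasure N {s1..s2} = ennreal (dist (\<gamma> s1) (\<gamma> s2))" using d(2) s(3) by metis
 qed
 then show ?thesis ..
qed

lemma P_mono: "P n t ==> n \<le> m ==> P m t"
proof -
 assume "P n t" "n \<le> m"
 moreover have "1 / real (Suc m) \<le> 1 / Suc n" using \<open>n \<le> m\<close> by (simp add: frac_le)
 ultimately show "P m t" unfolding P_def by (meson less_le_trans)
qed

text \<open>The distance conditions are strict, so they persist under small changes of t; hence
  \<open>P n\<close> passes to limits in I and its set is relatively closed.\<close>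

lemma P_measurable: "{t \<in> I. P n t} \<in> sets borel"
proof -
 have "closedin (top_of_set I) {t \<in> I. P n t}" unfolding closedin_limpt
 proof (intro conjI allI impI)
  fix t assume t: "t islimpt {t \<in> I. P n t} \<and> t \<in> I"
  have ct: "isCont \<gamma> t" using cont I(1) t continuous_on_eq_continuous_at by blast
  have "P n t" unfolding P_def
  proof (intro ballI impI)
   fix s1 s2 assume s: "s1 \<in> I" "s2 \<in> I" "dist (\<gamma> s1) (\<gamma> t) < 1 / Suc n \<and> dist (\<gamma> s2) (\<gamma> t) < 1 / Suc n \<and> s1 \<le> s2"
   define e where "e = min (1 / Suc n - dist (\<gamma> s1) (\<gamma> t)) (1 / Suc n - dist (\<gamma> s2) (\<gamma> t))"
   have "e > 0" using s by (simp add: e_def)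
   then obtain d where d: "d > 0" "\<And>s. dist s t < d ==> dist (\<gamma> s) (\<gamma> t) < e"
    using ct unfolding continuous_at_eps_delta by blast
   obtain t' where t': "t' \<in> I" "P n t'" "dist t' t < d" using t d(1) unfolding islimpt_approachable by blast
   have "dist (\<gamma> t) (\<gamma> t') < e" using d(2)[OF t'(3)] by (simp add: dist_commute)
   then have "dist (\<gamma> s1) (\<gamma> t') < 1 / Suc n" "dist (\<gamma> s2) (\<gamma> t') < 1 / Suc n"
    using dist_triangle[of "\<gamma> s1" "\<gamma> t'" "\<gamma> t"] dist_triangle[of "\<gamma> s2" "\<gamma> t'" "\<gamma> t"] by (auto simp: e_def)
   then show "emeasure N {s1..s2} = ennreal (dist (\<gamma> s1) (\<gamma> s2))" using t'(2) s unfolding P_def by blast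
  qed
  then show "t \<in> {t \<in> I. P n t}" using t by blast
 qed auto
 then obtain T where "closed T" "{t \<in> I. P n t} = I \<inter> T" using closedin_closed by blast
 then show ?thesis using I(1) by auto
qed

text \<open>On the part of E with scale n, a covering set of diameter below 1/(n + 1) pulls back
  into a Borel set of mass at most that diameter, so every fine cover has sum at least the mass of
  this part. The parts increase to E.\<close>

lemma lower:
 assumes E: "E \<in> sets borel" "E \<subseteq> I"
 shows "emeasure N E \<le> hausdorff1 (\<gamma> ` E)"
proof -
 define A where "A n = {t \<in> E. P n t}" for n
 have Ab: "A n \<in> sets borel" for n
 proof -
  have "A n = E \<inter> {t \<in> I. P n t}" using E(2) by (auto simp: A_def)
  then show ?thesis using E(1) P_measurable by auto
 qed
 have inc: "incseq A" by (intro monoI) (auto simp: A_def P_mono)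
 have Un: "(\<Union>n. A n) = E" using E(2) P_ev by (auto simp: A_def)
 have "emeasure N (A n) \<le> hausdorff1 (\<gamma> ` E)" for n
 proof -
  define \<delta> where "\<delta> = 1 / (2 * real (Suc n))"
  have d: "\<delta> > 0" "\<delta> < 1 / Suc n" by (simp_all add: \<delta>_def field_simps)
  have "emeasure N (A n) \<le> (\<Sum>i::nat. ennreal (diameter (U i)))"
   if U: "\<gamma> ` E \<subseteq> (\<Union>i. U i)" "\<forall>i. bounded (U i) \<and> diameter (U i) \<le> \<delta>" for U
  proof -
   have "\<exists>J. J \<in> sets borel \<and> {t \<in> A n. \<gamma> t \<in> U i} \<subseteq> J \<and> emeasure N J \<le> ennreal (diameter (U i))" for i
   proof -
    have h2: "0 \<le> diameter (U i)" using U(2) diameter_ge_0 by blast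
    have h3: "emeasure N {s1..s2} \<le> ennreal (diameter (U i))"
     if s: "s1 \<in> {t \<in> A n. \<gamma> t \<in> U i}" "s2 \<in> {t \<in> A n. \<gamma> t \<in> U i}" "s1 \<le> s2" for s1 s2
    proof -
     have b: "dist (\<gamma> s1) (\<gamma> s2) \<le> diameter (U i)" using s U(2) diameter_bounded_bound by blast
     then have "dist (\<gamma> s2) (\<gamma> s1) < 1 / Suc n" using U(2) d by (metis dist_commute le_less_trans)
     moreover have "dist (\<gamma> s1) (\<gamma> s1) < 1 / Suc n" by simp
     ultimately have "emeasure N {s1..s2} = ennreal (dist (\<gamma> s1) (\<gamma> s2))"
      using s E(2) unfolding A_def P_def by blast
     then show ?thesis using b by (simp add: ennreal_leI)
    qed
    have h1: "{t \<in> A n. \<gamma> t \<in> U i} \<subseteq> I" using E(2) by (auto simp: A_def)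
    show ?thesis by (rule interval_hull[OF h1 h2]) (rule h3)
   qed
   then obtain J where J: "\<And>i. J i \<in> sets borel" "\<And>i. {t \<in> A n. \<gamma> t \<in> U i} \<subseteq> J i" "\<And>i. emeasure N (J i) \<le> ennreal (diameter (U i))"
    by metis
   have "A n \<subseteq> (\<Union>i. J i)"
   proof
    fix t assume t: "t \<in> A n"
    then obtain i where "\<gamma> t \<in> U i" using U(1) by (auto simp: A_def)
    then show "t \<in> (\<Union>i. J i)" using J(2)[of i] t by blast
   qed
   then have "emeasure N (A n) \<le> emeasure N (\<Union>i. J i)" using J(1) by (intro emeasure_mono) auto
   also have "\<dots> \<le> (\<Sum>i. emeasure N (J i))" using J(1) by (intro emeasure_subadditive_countably) auto
   also have "\<dots> \<le> (\<Sum>i. ennreal (diameter (U i)))" using J(3) by (intro suminf_le) auto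
   finally show ?thesis .
  qed
  then have "emeasure N (A n) \<le> (INF U\<in>{U. \<gamma> ` E \<subseteq> (\<Union>i. U i) \<and> (\<forall>i. bounded (U i) \<and> diameter (U i) \<le> \<delta>)}. \<Sum>i::nat. ennreal (diameter (U i)))"
   by (intro INF_greatest) auto
  also have "\<dots> \<le> hausdorff1 (\<gamma> ` E)" unfolding hausdorff1_def using d by (intro SUP_upper2[of \<delta>]) auto
  finally show ?thesis .
 qed
 moreover have "emeasure N E = (SUP n. emeasure N (A n))"
  unfolding Un[symmetric] by (rule SUP_emeasure_incseq[symmetric]) (use inc Ab in auto)
 ultimately show ?thesis by (simp add: SUP_least)
qed

text \<open>Finite length makes the density integrable by the lower bound, which is the finiteness
  that the upper bound asks for.\<close>

lemma hausdorff1_image: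
 assumes "hausdorff1 (\<gamma> ` I) < \<infinity>" and E: "E \<in> sets borel" "E \<subseteq> I"
 shows "hausdorff1 (\<gamma> ` E) = emeasure N E"
proof (rule antisym)
 have "emeasure N UNIV < \<infinity>" unfolding N_UNIV using lower[of I] I(1) assms(1) by (simp add: le_less_trans)
 then show "hausdorff1 (\<gamma> ` E) \<le> emeasure N E" by (rule upper[OF _ E])
qed (rule lower[OF E])

end

section \<open>A Riesz-type inequality with a weight of small argument\<close>

section \<open>A weighted inequality for conjugate functions\<close>

text \<open>Up to \<pi>/3 the derivative of sin is at least 1/2; beyond, sin is at least 1/2 while
  s/4 stays below 1/2.\<close>

lemma sin_ge_quarter:
 assumes "0 \<le> s" "s \<le> pi / 2" shows "s / 4 \<le> sin (s :: real)"
proof (cases "s \<le> pi / 3")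
 case True
 have "(\<lambda>s. sin s - s / 2) 0 \<le> (\<lambda>s. sin s - s / 2) s"
 proof (rule DERIV_nonneg_imp_nondecreasing[OF assms(1)])
  fix x assume x: "0 \<le> x" "x \<le> s"
  have "cos (pi / 3) \<le> cos x" using x True by (intro cos_monotone_0_pi_le) auto
  then have "0 \<le> cos x - 1 / 2" by (simp add: cos_60)
  moreover have "((\<lambda>s. sin s - s / 2) has_real_derivative (cos x - 1 / 2)) (at x)"
   by (auto intro!: derivative_eq_intros)
  ultimately show "\<exists>y. ((\<lambda>s. sin s - s / 2) has_real_derivative y) (at x) \<and> 0 \<le> y" by blast
 qed
 then show ?thesis using assms by simp
next
 case False
 have "sin (pi / 6) \<le> sin s" using False assms by (intro sin_monotone_2pi_le) auto
 then show ?thesis using assms pi_less_4 by (simp add: sin_30)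
qed

text \<open>\<theta> is the argument of F, disturbed by the argument \<eta> of the weight. At
  \<theta> = \<pi>/2 the first term dies, but there cos (p \<theta> + \<eta>) = -sin y with y at
  least \<open>\<kappa>\<close>, so the second term takes over; away from \<pi>/2 the first one
  wins. With \<tau> the distance to \<pi>/2, the cases split at p \<tau> = y/2.\<close>

lemma riesz_scalar_ineq_nonneg:
 fixes p \<theta> \<eta> :: real
 assumes p: "6/5 < p" "p \<le> 2" and t: "0 \<le> \<theta>" "\<theta> < pi / 2" and e: "\<bar>\<eta>\<bar> \<le> (2 - p) / 4 * (pi / 2)"
 defines "\<kappa> \<equiv> (5 * p - 6) * pi / 8"
 shows "1 \<le> 1280 / \<kappa> powr p * cos \<theta> powr p - 8 / \<kappa> * cos (p * \<theta> + \<eta>)"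
proof -
 define \<tau> where "\<tau> = pi / 2 - \<theta>"
 define y where "y = (p - 1) * (pi / 2) + \<eta>"
 have \<tau>: "0 < \<tau>" "\<tau> \<le> pi / 2" using t by (auto simp: \<tau>_def)
 have k0: "\<kappa> > 0" using p by (simp add: \<kappa>_def)
 have y: "\<kappa> \<le> y" "y \<le> pi / 2"
 proof -
  have "\<kappa> = (p - 1) * (pi / 2) - (2 - p) / 4 * (pi / 2)" by (simp add: \<kappa>_def field_simps)
  then show "\<kappa> \<le> y" using e by (simp add: y_def abs_le_iff)
  have "y \<le> (p - 1) * (pi / 2) + (2 - p) / 4 * (pi / 2)" using e by (simp add: y_def abs_le_iff)
  also have "\<dots> = (3 * p - 2) / 4 * (pi / 2)" by (simp add: field_simps)
  also have "\<dots> \<le> 1 * (pi / 2)" using p by (intro mult_right_mono) auto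
  finally show "y \<le> pi / 2" by simp
 qed
 have c1: "cos \<theta> = sin \<tau>" by (simp add: \<tau>_def sin_diff)
 have "p * \<theta> + \<eta> = pi / 2 + (y - p * \<tau>)" by (simp add: \<tau>_def y_def field_simps)
 then have c2: "cos (p * \<theta> + \<eta>) = - sin (y - p * \<tau>)" by (simp only: cos_add) simp
 have s: "\<tau> / 4 \<le> sin \<tau>" using sin_ge_quarter \<tau> by auto
 have p0: "0 \<le> sin \<tau>" using s \<tau> by linarith
 show ?thesis
 proof (cases "p * \<tau> \<le> y / 2")
  case True
  have pt: "0 \<le> p * \<tau>" using p \<tau> by simp
  \<comment> \<open>Here y - p \<tau> is at least y/2, so its sine is at least y/8; this is the
    origin of the factor 8/\<open>\<kappa>\<close>.\<close>
  have "(y - p * \<tau>) / 4 \<le> sin (y - p * \<tau>)" by (rule sin_ge_quarter) (use True y k0 pt in linarith)+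
  then have "\<kappa> / 8 \<le> sin (y - p * \<tau>)" using True y by argo
  then have "8 / \<kappa> * (\<kappa> / 8) \<le> 8 / \<kappa> * sin (y - p * \<tau>)" using k0 by (intro mult_left_mono) auto
  then have "1 \<le> 8 / \<kappa> * sin (y - p * \<tau>)" using k0 by simp
  moreover have "0 \<le> 1280 / \<kappa> powr p * cos \<theta> powr p" by simp
  ultimately show ?thesis unfolding c2 mult_minus_right diff_minus_eq_add by linarith
 next
  case False
  \<comment> \<open>In units of \<open>\<kappa>\<close> the distance to \<pi>/2 now exceeds 1/4. The
    factor 1280 makes the first term at least 20 x, the second costs at most 16 x, and 4 x > 1 is
    left.\<close>
  define x where "x = \<tau> / \<kappa>"
  have "p * \<tau> \<le> 2 * \<tau>" using p \<tau> by (intro mult_right_mono) auto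
  then have "\<kappa> < 4 * \<tau>" using False y by linarith
  then have x: "1 / 4 < x" using k0 by (simp add: x_def field_simps)
  have "- sin (y - p * \<tau>) \<le> p * \<tau>"
  proof (cases "y - p * \<tau> \<ge> 0")
   case True
   moreover have "y - p * \<tau> \<le> pi"
   proof -
    have "0 \<le> p * \<tau>" using p \<tau> by simp
    then show ?thesis using y pi_gt_zero by linarith
   qed
   ultimately have "0 \<le> sin (y - p * \<tau>)" by (rule sin_ge_zero)
   moreover have "0 \<le> p * \<tau>" using p \<tau> by simp
   ultimately show ?thesis by linarith
  next
   case F: False
   have "- sin (y - p * \<tau>) = sin (p * \<tau> - y)" using sin_minus[of "y - p * \<tau>"] by simp
   also have "\<dots> \<le> p * \<tau> - y" using F by (intro sin_x_le_x) auto
   finally show ?thesis using y k0 by linarith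
  qed
  then have "8 / \<kappa> * (- sin (y - p * \<tau>)) \<le> 8 / \<kappa> * (2 * \<tau>)"
   using \<open>p * \<tau> \<le> 2 * \<tau>\<close> k0 by (intro mult_left_mono) auto
  then have B: "8 / \<kappa> * cos (p * \<theta> + \<eta>) \<le> 16 * x" unfolding c2 x_def by simp
  have "1280 / \<kappa> powr p * cos \<theta> powr p \<ge> 1280 / \<kappa> powr p * (\<tau> / 4) powr p"
   unfolding c1 using s \<tau> p by (intro mult_left_mono powr_mono2) auto
  moreover have "1280 / \<kappa> powr p * (\<tau> / 4) powr p = 1280 * (x powr p / 4 powr p)"
   using \<tau> k0 by (simp add: x_def powr_divide)
  moreover have "4 powr p \<le> (4::real) powr 2" using p by (intro powr_mono) auto
  moreover have "x powr p = x * x powr (p - 1)" using x by (simp add: powr_diff)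
  moreover have "x powr (p - 1) \<ge> 1 / 4"
  proof -
   have "(1/4) powr 1 \<le> (1/4::real) powr (p - 1)" using p by (intro powr_mono') auto
   also have "\<dots> \<le> x powr (p - 1)" using x p by (intro powr_mono2) auto
   finally show ?thesis by simp
  qed
  ultimately have A: "1280 / \<kappa> powr p * cos \<theta> powr p \<ge> 20 * x"
  proof -
   assume a: "1280 / \<kappa> powr p * (\<tau> / 4) powr p \<le> 1280 / \<kappa> powr p * cos \<theta> powr p"
    "1280 / \<kappa> powr p * (\<tau> / 4) powr p = 1280 * (x powr p / 4 powr p)" "4 powr p \<le> (4::real) powr 2"
    "x powr p = x * x powr (p - 1)" "1 / 4 \<le> x powr (p - 1)"
   have "x * (1/4) / 16 \<le> x powr p / 4 powr p"
    unfolding a(4) using a(3,5) x by (intro frac_le mult_left_mono) auto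
   then show ?thesis using a(1,2) by linarith
  qed
  show ?thesis using A B x by linarith
 qed
qed

lemma riesz_scalar_ineq:
 fixes p \<theta> \<eta> :: real
 assumes p: "6/5 < p" "p \<le> 2" and t: "\<bar>\<theta>\<bar> < pi / 2" and e: "\<bar>\<eta>\<bar> \<le> (2 - p) / 4 * (pi / 2)"
 defines "\<kappa> \<equiv> (5 * p - 6) * pi / 8"
 shows "1 \<le> 1280 / \<kappa> powr p * cos \<theta> powr p - 8 / \<kappa> * cos (p * \<theta> + \<eta>)"
proof (cases "\<theta> \<ge> 0")
 case True
 then show ?thesis unfolding \<kappa>_def using assms by (intro riesz_scalar_ineq_nonneg) auto
next
 case False
 have "cos (p * (- \<theta>) + (- \<eta>)) = cos (p * \<theta> + \<eta>)" using cos_minus[of "p * \<theta> + \<eta>"] by simp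
 then show ?thesis
  using riesz_scalar_ineq_nonneg[of p "- \<theta>" "- \<eta>"] False assms unfolding \<kappa>_def by simp
qed

lemma powr_eq_rcis: "s \<noteq> 0 ==> s powr of_real b = rcis (norm s powr b) (b * Arg s)"
 by (simp add: powr_def Ln_Arg rcis_def cis_conv_exp exp_add[symmetric] exp_of_real[symmetric] algebra_simps)

text \<open>The scalar inequality at \<theta> = Arg F and \<eta> = Arg H, multiplied by |F|^p
  |H|.\<close>

lemma riesz_pointwise_ineq:
 fixes F H :: complex and p :: real
 assumes p: "6/5 < p" "p \<le> 2" and F: "Re F > 0" and H: "\<bar>Arg H\<bar> \<le> (2 - p) / 4 * (pi / 2)"
 defines "\<kappa> \<equiv> (5 * p - 6) * pi / 8"
 shows "norm F powr p * norm H \<le> 1280 / \<kappa> powr p * (Re F powr p * norm H) - 8 / \<kappa> * Re (F powr of_real p * H)"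
proof -
 have F0: "F \<noteq> 0" using F by auto
 have t: "\<bar>Arg F\<bar> < pi / 2" using F Arg_Re_pos[of F] by blast
 have c0: "0 \<le> cos (Arg F)" using t by (intro cos_ge_zero) auto
 have R: "Re F = norm F * cos (Arg F)" using rcis_cmod_Arg[of F] by (metis Re_rcis)
 have Rp: "Re F powr p = norm F powr p * cos (Arg F) powr p" unfolding R using c0 by (simp add: powr_mult)
 have "F powr of_real p * H = rcis (norm F powr p * norm H) (p * Arg F + Arg H)"
  using rcis_mult[of "norm F powr p" "p * Arg F" "norm H" "Arg H"]
  by (simp only: powr_eq_rcis[OF F0] rcis_cmod_Arg)
 then have Q: "Re (F powr of_real p * H) = norm F powr p * norm H * cos (p * Arg F + Arg H)"
  by (simp only: Re_rcis)
 have "norm F powr p * norm H * 1 \<le> norm F powr p * norm H *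
  (1280 / \<kappa> powr p * cos (Arg F) powr p - 8 / \<kappa> * cos (p * Arg F + Arg H))"
  unfolding \<kappa>_def by (intro mult_left_mono riesz_scalar_ineq p t H) auto
 then show ?thesis unfolding Rp Q by (simp add: algebra_simps)
qed

lemma weighted_riesz_disc:
 fixes F H :: "complex \<Rightarrow> complex" and p :: real
 assumes p: "6/5 < p" "p \<le> 2"
  and F: "continuous_on (cball 0 1) F" "F holomorphic_on ball 0 1" "\<And>z. norm z \<le> 1 ==> Re (F z) > 0" "Im (F 0) = 0"
  and H: "continuous_on (cball 0 1) H" "H holomorphic_on ball 0 1" "\<And>z. norm z \<le> 1 ==> \<bar>Arg (H z)\<bar> \<le> (2 - p) / 4 * (pi / 2)"
 defines "\<kappa> \<equiv> (5 * p - 6) * pi / 8"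
 shows "(\<integral>ze. norm ((F ze + F 0) / 2) powr p * norm (H ze) \<partial>mu)
  \<le> 3840 / \<kappa> powr p * (\<integral>ze. Re (F ze) powr p * norm (H ze) \<partial>mu)"
proof -
 have k0: "\<kappa> > 0" using p by (simp add: \<kappa>_def)
 have sub: "continuous_on (sphere 0 1) F" "continuous_on (sphere 0 1) H"
  using F(1) H(1) continuous_on_subset sphere_cball by blast+
 have Fp: "continuous_on (cball 0 1) (\<lambda>z. F z powr of_real p)"
  using F(1) by (intro continuous_on_powr_complex continuous_on_const) (use F(3) p in \<open>fastforce simp: less_imp_le\<close>)+
 have Fph: "(\<lambda>z. F z powr of_real p) holomorphic_on ball 0 1"
 proof (intro holomorphic_on_powr F(2) holomorphic_on_const)
  fix z :: complex assume "z \<in> ball 0 1"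
  then show "F z \<notin> \<real>\<^sub>\<le>\<^sub>0" using F(3)[of z] by (auto simp: complex_nonpos_Reals_iff)
 qed
 define G where "G z = F z powr of_real p * H z" for z
 have Gc: "continuous_on (cball 0 1) G" "G holomorphic_on ball 0 1"
  unfolding G_def using Fp Fph H by (auto intro!: continuous_intros holomorphic_intros)
 have cs: "continuous_on (sphere 0 1) G" using Gc(1) continuous_on_subset sphere_cball by blast
 have mv: "(\<integral>ze. Re (G ze) \<partial>mu) = 2 * pi * Re (G 0)"
  using circle_mean_value[OF Gc] integral_Re[OF integrable_circle_continuous[OF cs]] by simp
 have mvH: "(\<integral>ze. Re (H ze) \<partial>mu) = 2 * pi * Re (H 0)"
  using circle_mean_value[OF H(1,2)] integral_Re[OF integrable_circle_continuous[OF sub(2)]] by simp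
 have cosge: "cos (pi / 3) \<le> cos \<bar>Arg (H z)\<bar>" if "norm z \<le> 1" for z
 proof (rule cos_monotone_0_pi_le)
  have "(2 - p) / 4 * (pi / 2) \<le> (1/5) * (pi / 2)" using p by (intro mult_right_mono) auto
  then show "\<bar>Arg (H z)\<bar> \<le> pi / 3" using H(3)[OF that] pi_gt_zero by linarith
 qed auto
 have ReH: "norm (H z) \<le> 2 * Re (H z)" if "norm z \<le> 1" for z
 proof -
  have "Re (H z) = norm (H z) * cos \<bar>Arg (H z)\<bar>" using rcis_cmod_Arg[of "H z"] by (metis Re_rcis cos_abs_real)
  moreover have "norm (H z) * (1/2) \<le> norm (H z) * cos \<bar>Arg (H z)\<bar>"
   using cosge[OF that] by (intro mult_left_mono) (auto simp: cos_60)
  ultimately show ?thesis by linarith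
 qed
 have "norm (H 0) \<le> 2 * Re (H 0)" by (rule ReH) simp
 then have H0: "0 \<le> Re (H 0)" using norm_ge_zero[of "H 0"] by linarith
 define c where "c = Re (F 0)"
 have c: "c > 0" "F 0 = of_real c" using F(3,4) by (auto simp: c_def complex_eq_iff)
 have G0: "Re (G 0) = c powr p * Re (H 0)" unfolding G_def c(2) using c(1) by (simp add: powr_of_real)
 have i1: "integrable mu (\<lambda>ze. norm (F ze) powr p * norm (H ze))"
  and i2: "integrable mu (\<lambda>ze. Re (F ze) powr p * norm (H ze))"
  and i3: "integrable mu (\<lambda>ze. Re (G ze))"
  and i4: "integrable mu (\<lambda>ze. norm ((F ze + F 0) / 2) powr p * norm (H ze))"
  and i5: "integrable mu (\<lambda>ze. norm (H ze))"
  and i6: "integrable mu (\<lambda>ze. Re (H ze))"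
  using sub cs p by (auto intro!: integrable_circle_continuous continuous_intros continuous_on_powr' less_imp_le[OF F(3)])
 define I where "I = (\<integral>ze. norm (F ze) powr p * norm (H ze) \<partial>mu)"
 define J where "J = (\<integral>ze. Re (F ze) powr p * norm (H ze) \<partial>mu)"
 have "I \<le> (\<integral>ze. 1280 / \<kappa> powr p * (Re (F ze) powr p * norm (H ze)) - 8 / \<kappa> * Re (G ze) \<partial>mu)"
  unfolding I_def
 proof (rule integral_mono[OF i1])
  show "integrable mu (\<lambda>ze. 1280 / \<kappa> powr p * (Re (F ze) powr p * norm (H ze)) - 8 / \<kappa> * Re (G ze))"
   using i2 i3 by (intro Bochner_Integration.integrable_diff integrable_mult_right)
  fix ze assume "ze \<in> space mu"
  then have "norm ze \<le> 1" by simp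
  then show "norm (F ze) powr p * norm (H ze) \<le> 1280 / \<kappa> powr p * (Re (F ze) powr p * norm (H ze)) - 8 / \<kappa> * Re (G ze)"
   unfolding G_def \<kappa>_def by (intro riesz_pointwise_ineq p F(3) H(3))
 qed
 also have "\<dots> = 1280 / \<kappa> powr p * J - 8 / \<kappa> * (2 * pi * Re (G 0))"
  unfolding J_def mv[symmetric] using i2 i3 by (subst Bochner_Integration.integral_diff) auto
 also have "\<dots> \<le> 1280 / \<kappa> powr p * J" unfolding G0 using k0 H0 by simp
 finally have IJ: "I \<le> 1280 / \<kappa> powr p * J" .
 \<comment> \<open>The integral of |H| is at most twice that of Re H, and c^p times the latter is
   the integral of Re (F^p H), hence at most I. The constant term thus costs 2 I, and the total
   factor is 3 times 1280.\<close>
 have cI: "c powr p * (\<integral>ze. norm (H ze) \<partial>mu) \<le> 2 * I"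
 proof -
  have "(\<integral>ze. norm (H ze) \<partial>mu) \<le> (\<integral>ze. 2 * Re (H ze) \<partial>mu)"
   using i5 i6 ReH by (intro integral_mono) auto
  also have "\<dots> = 2 * (2 * pi * Re (H 0))" using mvH by simp
  finally have "c powr p * (\<integral>ze. norm (H ze) \<partial>mu) \<le> c powr p * (2 * (2 * pi * Re (H 0)))"
   by (intro mult_left_mono) auto
  also have "\<dots> = 2 * (\<integral>ze. Re (G ze) \<partial>mu)" unfolding mv G0 by simp
  also have "(\<integral>ze. Re (G ze) \<partial>mu) \<le> I" unfolding I_def
  proof (rule integral_mono[OF i3 i1])
   fix ze :: complex
   have "norm (F ze powr of_real p) = norm (F ze) powr p" by (simp add: norm_powr_real_powr')
   then show "Re (G ze) \<le> norm (F ze) powr p * norm (H ze)"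
    using complex_Re_le_cmod[of "G ze"] by (simp add: G_def norm_mult)
  qed
  finally show ?thesis by simp
 qed
 have "(\<integral>ze. norm ((F ze + F 0) / 2) powr p * norm (H ze) \<partial>mu)
   \<le> (\<integral>ze. norm (F ze) powr p * norm (H ze) + c powr p * norm (H ze) \<partial>mu)"
 proof (rule integral_mono[OF i4])
  show "integrable mu (\<lambda>ze. norm (F ze) powr p * norm (H ze) + c powr p * norm (H ze))"
   using i1 i5 by auto
  fix ze :: complex
  have "norm ((F ze + F 0) / 2) \<le> (norm (F ze) + c) / 2"
   using norm_triangle_ineq[of "F ze" "F 0"] c by (simp add: norm_divide)
  also have "\<dots> \<le> max (norm (F ze)) c" by auto
  finally have "norm ((F ze + F 0) / 2) powr p \<le> max (norm (F ze)) c powr p"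
   using p by (intro powr_mono2) auto
  also have "\<dots> \<le> norm (F ze) powr p + c powr p" by (auto simp: max_def)
  finally show "norm ((F ze + F 0) / 2) powr p * norm (H ze) \<le> norm (F ze) powr p * norm (H ze) + c powr p * norm (H ze)"
   by (metis distrib_right mult_right_mono norm_ge_zero)
 qed
 also have "\<dots> = I + c powr p * (\<integral>ze. norm (H ze) \<partial>mu)" unfolding I_def using i1 i5 by simp
 also have "\<dots> \<le> 3 * I" using cI by simp
 also have "\<dots> \<le> 3 * (1280 / \<kappa> powr p * J)" using IJ by simp
 finally show ?thesis by (simp add: J_def)
qed

text \<open>H may be singular on the circle, so the inequality is applied to H(r z) with r = 1 -
  1/(n + 2) and carried to the boundary by dominated convergence with majorant D; V is the radial
  limit of |H|.\<close>

lemma weighted_riesz_limit: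
 fixes H :: "complex \<Rightarrow> complex" and V D :: "complex \<Rightarrow> real" and p :: real
 assumes p: "6/5 < p" "p \<le> 2"
  and F: "\<And>z. norm z \<le> 1 ==> Re (poly F z) > 0" "Im (poly F 0) = 0"
  and H: "H holomorphic_on ball 0 1" "\<And>z. norm z < 1 ==> \<bar>Arg (H z)\<bar> \<le> (2 - p) / 4 * (pi / 2)"
  and D: "integrable mu D" "\<And>n. AE ze in mu. norm (H (of_real (1 - 1 / real (n + 2)) * ze)) \<le> D ze"
  and V: "V \<in> borel_measurable mu"
   "AE ze in mu. (\<lambda>n. norm (H (of_real (1 - 1 / real (n + 2)) * ze))) \<longlonglongrightarrow> V ze"
 defines "\<kappa> \<equiv> (5 * p - 6) * pi / 8"
 shows "(\<integral>ze. norm ((poly F ze + poly F 0) / 2) powr p * V ze \<partial>mu)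
  \<le> 3840 / \<kappa> powr p * (\<integral>ze. Re (poly F ze) powr p * V ze \<partial>mu)"
proof -
 define r where "r n = 1 - 1 / real (n + 2)" for n
 have r: "0 < r n" "r n < 1" for n by (auto simp: r_def field_simps)
 have rl: "\<bar>r n\<bar> * norm z < 1" if "norm z \<le> 1" for n and z :: complex
  using r[of n] that by (metis abs_of_pos le_less_trans mult_left_le mult.commute less_imp_le)
 note D2 = D(2)[folded r_def] and V2 = V(2)[folded r_def]
 have Hc: "continuous_on (ball 0 1) H" using H(1) by (rule holomorphic_on_imp_continuous_on)
 have Hrc: "continuous_on (cball 0 1) (\<lambda>z. H (of_real (r n) * z))" for n
  by (intro continuous_on_compose2[OF Hc] continuous_intros) (auto simp: norm_mult rl)
 have Hrh: "(\<lambda>z. H (of_real (r n) * z)) holomorphic_on ball 0 1" for n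
 proof -
  have "(\<lambda>z :: complex. of_real (r n) * z) ` ball 0 1 \<subseteq> ball 0 1" by (auto simp: norm_mult rl)
  then have "(H \<circ> (\<lambda>z. of_real (r n) * z)) holomorphic_on ball 0 1"
   by (intro holomorphic_on_compose_gen[OF _ H(1)] holomorphic_intros)
  then show ?thesis by (simp add: o_def)
 qed
 have HA: "\<bar>Arg (H (of_real (r n) * z))\<bar> \<le> (2 - p) / 4 * (pi / 2)" if "norm z \<le> 1" for n z
  by (rule H(2)) (use that in \<open>simp add: norm_mult rl\<close>)
 have step: "(\<integral>ze. norm ((poly F ze + poly F 0) / 2) powr p * norm (H (of_real (r n) * ze)) \<partial>mu)
  \<le> 3840 / \<kappa> powr p * (\<integral>ze. Re (poly F ze) powr p * norm (H (of_real (r n) * ze)) \<partial>mu)" for n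
  unfolding \<kappa>_def
  by (rule weighted_riesz_disc[where F = "poly F" and H = "\<lambda>z. H (of_real (r n) * z)", OF p _ _ F(1) F(2) Hrc Hrh])
    (use HA in \<open>auto intro!: continuous_intros holomorphic_intros\<close>)
 have dct: "(\<lambda>n. \<integral>ze. q ze * norm (H (of_real (r n) * ze)) \<partial>mu) \<longlonglongrightarrow> (\<integral>ze. q ze * V ze \<partial>mu)"
  if q: "continuous_on (sphere 0 1) q" for q :: "complex \<Rightarrow> real"
 proof -
  have "compact (q ` sphere 0 1)" using q compact_continuous_image by fastforce
  then have "bounded (q ` sphere 0 1)" by (rule compact_imp_bounded)
  then obtain B where B: "\<And>x. x \<in> sphere 0 1 ==> norm (q x) \<le> B" unfolding bounded_iff by (meson imageI)
  note qm = measurable_circle_continuous[OF q]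
  have hm: "(\<lambda>z. norm (H (of_real (r n) * z))) \<in> borel_measurable mu" for n
   by (intro measurable_circle_continuous continuous_on_norm continuous_on_subset[OF Hrc]) auto
  show ?thesis
  proof (rule integral_dominated_convergence[where w = "\<lambda>ze. B * D ze"])
   show "(\<lambda>ze. q ze * V ze) \<in> borel_measurable mu" using qm V(1) by simp
   show "(\<lambda>ze. q ze * norm (H (of_real (r n) * ze))) \<in> borel_measurable mu" for n
    using qm hm by simp
   show "integrable mu (\<lambda>ze. B * D ze)" using D(1) by simp
   show "AE ze in mu. (\<lambda>n. q ze * norm (H (of_real (r n) * ze))) \<longlonglongrightarrow> q ze * V ze"
    using V2 by eventually_elim (intro tendsto_intros)
   show "AE ze in mu. norm (q ze * norm (H (of_real (r n) * ze))) \<le> B * D ze" for n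
   proof -
    have "AE ze in mu. ze \<in> sphere 0 1" using AE_space[of mu] by simp
    then show ?thesis using D2[of n]
    proof eventually_elim
     case (elim ze)
     then have "\<bar>q ze\<bar> * norm (H (of_real (r n) * ze)) \<le> B * D ze"
      using B[of ze] by (intro mult_mono) (auto intro: order_trans[OF abs_ge_zero])
     then show ?case by (simp add: abs_mult)
    qed
   qed
  qed
 qed
 have c1: "continuous_on (sphere 0 1) (\<lambda>ze. norm ((poly F ze + poly F 0) / 2) powr p)"
  using p by (intro continuous_on_powr' continuous_intros) auto
 have c2: "continuous_on (sphere 0 1) (\<lambda>ze. Re (poly F ze) powr p)"
  using p F(1) by (intro continuous_on_powr' continuous_intros) (auto simp: less_imp_le)
 show ?thesis by (rule LIMSEQ_le[OF dct[OF c1] tendsto_mult_left[OF dct[OF c2]]]) (use step in auto)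
qed

section \<open>Sectors and sides under a Riemann map; the boundary derivative\<close>

section \<open>Boundary behaviour of Riemann maps\<close>

lemma riemann_map_facts:
 assumes "riemann_map \<Omega> \<phi>" "open \<Omega>"
 shows "continuous_on (cball 0 1) \<phi>" "\<phi> holomorphic_on ball 0 1" "inj_on \<phi> (cball 0 1)"
  "\<phi> ` ball 0 1 = \<Omega>" "\<phi> ` cball 0 1 = closure \<Omega>" "\<phi> ` sphere 0 1 = frontier \<Omega>"
proof -
 obtain \<psi> where h: "\<phi> holomorphic_on ball 0 1" "\<phi> ` ball 0 1 = \<Omega>" "homeomorphism (cball 0 1) (closure \<Omega>) \<phi> \<psi>"
  using assms unfolding riemann_map_def by blast
 show "continuous_on (cball 0 1) \<phi>" "\<phi> holomorphic_on ball 0 1" "\<phi> ` ball 0 1 = \<Omega>" "\<phi> ` cball 0 1 = closure \<Omega>"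
  using h by (auto simp: homeomorphism_def)
 show inj: "inj_on \<phi> (cball 0 1)" using h(3) by (metis homeomorphism_def inj_on_inverseI)
 have "sphere (0::complex) 1 = cball 0 1 - ball 0 1" by auto
 then have "\<phi> ` sphere 0 1 = \<phi> ` cball 0 1 - \<phi> ` ball 0 1"
  using inj_on_image_set_diff[OF inj, of "cball 0 1" "ball 0 1"] by auto
 then show "\<phi> ` sphere 0 1 = frontier \<Omega>"
  using h assms(2) by (simp add: homeomorphism_def frontier_def interior_open)
qed

text \<open>A boundary point lies outside \<Omega> and so violates the strict sector inequality; it
  also lies in the closure and so satisfies the weak one. The resulting equality is what reflection
  demands.\<close>

lemma riemann_map_corner:
 assumes R: "riemann_map \<Omega> \<phi>" "open \<Omega>" and z0: "norm ze0 = 1" and a: "0 < \<alpha>" "\<alpha> < 2"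
  and s: "sector_at \<Omega> (\<phi> ze0) \<alpha>"
 obtains \<delta> g d where "\<delta> > 0" "norm d = 1" "g holomorphic_on ball ze0 \<delta>" "g ze0 = 0" "inj_on g (ball ze0 \<delta>)"
  "\<And>z. z \<in> ball ze0 \<delta> ==> norm z \<le> 1 ==> \<phi> z = \<phi> ze0 + d * (- \<i> * g z) powr of_real \<alpha>"
  "\<And>z. z \<in> ball ze0 \<delta> ==> norm z < 1 ==> Im (g z) > 0"
  "\<And>z. z \<in> ball ze0 \<delta> ==> norm z = 1 ==> Im (g z) = 0"
proof -
 note f = riemann_map_facts[OF R]
 obtain d \<rho> where d: "norm d = 1" "\<rho> > 0"
  "\<And>z. dist (\<phi> ze0) z < \<rho> ==> (z \<in> \<Omega> \<longleftrightarrow> Re ((z - \<phi> ze0) / d) > cos (\<alpha> * pi / 2) * norm (z - \<phi> ze0))"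
  using s unfolding sector_at_def by blast
 have inside: "Re ((\<phi> z - \<phi> ze0) / d) > cos (\<alpha> * pi / 2) * norm (\<phi> z - \<phi> ze0)"
  if "norm z < 1" "dist (\<phi> ze0) (\<phi> z) < \<rho>" for z using d(3)[OF that(2)] f(4) that(1) by auto
 have boundary: "Re ((\<phi> z - \<phi> ze0) / d) = cos (\<alpha> * pi / 2) * norm (\<phi> z - \<phi> ze0)"
  if z: "norm z = 1" "dist (\<phi> ze0) (\<phi> z) < \<rho>" for z
 proof -
  let ?b = "\<phi> z"
  have fr: "?b \<in> frontier \<Omega>" using f(6) z(1) by auto
  then have "?b \<notin> \<Omega>" "?b \<in> closure \<Omega>" using assms(2) by (auto simp: frontier_def interior_open)
  then have le: "Re ((?b - \<phi> ze0) / d) \<le> cos (\<alpha> * pi / 2) * norm (?b - \<phi> ze0)"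
   using d(3)[OF z(2)] by auto
  obtain x where x: "\<And>n. x n \<in> \<Omega>" "x \<longlonglongrightarrow> ?b"
   using \<open>?b \<in> closure \<Omega>\<close> unfolding closure_sequential by blast
  have "(\<lambda>n. dist (\<phi> ze0) (x n)) \<longlonglongrightarrow> dist (\<phi> ze0) ?b" using x(2) by (intro tendsto_intros)
  then have ev: "eventually (\<lambda>n. dist (\<phi> ze0) (x n) < \<rho>) sequentially" using z(2) by (rule order_tendstoD(2))
  have "cos (\<alpha> * pi / 2) * norm (?b - \<phi> ze0) \<le> Re ((?b - \<phi> ze0) / d)"
  proof (rule tendsto_le[OF sequentially_bot])
   have "d \<noteq> 0" using d(1) by auto
   then show "(\<lambda>n. Re ((x n - \<phi> ze0) / d)) \<longlonglongrightarrow> Re ((?b - \<phi> ze0) / d)" using x(2) by (intro tendsto_intros)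
   show "(\<lambda>n. cos (\<alpha> * pi / 2) * norm (x n - \<phi> ze0)) \<longlonglongrightarrow> cos (\<alpha> * pi / 2) * norm (?b - \<phi> ze0)"
    using x(2) by (intro tendsto_intros)
   show "\<forall>\<^sub>F n in sequentially. cos (\<alpha> * pi / 2) * norm (x n - \<phi> ze0) \<le> Re ((x n - \<phi> ze0) / d)"
    using ev
   proof eventually_elim
    case (elim n)
    then show ?case using d(3)[OF elim] x(1)[of n] by auto
   qed
  qed
  with le show ?thesis by simp
 qed
 show thesis
  by (rule corner_reflection[OF f(1,2,3) z0 d(1) a d(2) inside boundary]) (assumption+, rule that, assumption | rule d)+
qed

text \<open>A limit along one fixed radial sequence is a pointwise limit of continuous functions on
  the circle, hence measurable as it stands. Where the sequence diverges the value is unspecified;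
  for maps onto the polygon that can happen only over corners.\<close>

definition bd_deriv :: "(complex \<Rightarrow> complex) \<Rightarrow> complex \<Rightarrow> real" where
 "bd_deriv \<phi> ze = lim (\<lambda>n. norm (deriv \<phi> (of_real (1 - 1 / real (n + 2)) * ze)))"

lemma radial_tendsto:
 fixes ze :: complex assumes "norm ze = 1"
 shows "filterlim (\<lambda>n. of_real (1 - 1 / real (n + 2)) * ze) (at ze within ball 0 1) sequentially"
proof -
 have l: "(\<lambda>n. 1 - 1 / real (n + 2)) \<longlonglongrightarrow> 1 - 0"
  by (rule tendsto_diff[OF tendsto_const LIMSEQ_ignore_initial_segment[OF lim_1_over_n, of 2]])
 have "(\<lambda>n. of_real (1 - 1 / real (n + 2)) * ze) \<longlonglongrightarrow> of_real (1 - 0) * ze"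
  by (rule tendsto_mult_right[OF tendsto_of_real[OF l]])
 moreover have "of_real (1 - 1 / real (n + 2)) * ze \<in> ball 0 1 \<and> of_real (1 - 1 / real (n + 2)) * ze \<noteq> ze" for n
 proof -
  have r: "0 < 1 - 1 / real (n + 2)" "1 - 1 / real (n + 2) < 1" by (auto simp: field_simps)
  then have n: "norm (of_real (1 - 1 / real (n + 2)) * ze) = 1 - 1 / real (n + 2)"
   unfolding norm_mult norm_of_real assms by simp
  then have "norm (of_real (1 - 1 / real (n + 2)) * ze) < 1" using r by simp
  then show ?thesis using assms by (metis less_irrefl mem_ball_0)
 qed
 ultimately show ?thesis unfolding filterlim_at by simp
qed

lemma bd_deriv_eq:
 assumes "norm ze = 1" "((\<lambda>z. norm (deriv \<phi> z)) \<longlongrightarrow> L) (at ze within ball 0 1)"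
 shows "bd_deriv \<phi> ze = L" unfolding bd_deriv_def
 by (rule limI) (rule filterlim_compose[OF assms(2) radial_tendsto[OF assms(1)]])

text \<open>For \<alpha> = 1 the power disappears and \<phi> itself continues holomorphically across
  the side; e is the direction of the side, since g is real on the circle.\<close>

lemma side_extension:
 assumes R: "riemann_map \<Omega> \<phi>" "open \<Omega>" and z0: "norm ze0 = 1" and s: "sector_at \<Omega> (\<phi> ze0) 1"
 obtains \<delta> g e where "\<delta> > 0" "norm e = 1" "g holomorphic_on ball ze0 \<delta>" "\<And>z. z \<in> ball ze0 \<delta> ==> deriv g z \<noteq> 0"
  "\<And>z. z \<in> ball ze0 \<delta> ==> norm z \<le> 1 ==> \<phi> z = \<phi> ze0 + e * g z"
  "\<And>z. z \<in> ball ze0 \<delta> ==> norm z = 1 ==> Im (g z) = 0"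
  "\<And>z. z \<in> ball ze0 \<delta> ==> norm z = 1 ==> ((\<lambda>z. deriv \<phi> z) \<longlongrightarrow> e * deriv g z) (at z within ball 0 1)"
  "\<And>z. z \<in> ball ze0 \<delta> ==> norm z = 1 ==> bd_deriv \<phi> z = norm (deriv g z)"
proof -
 obtain \<delta> g d where g: "\<delta> > 0" "norm d = 1" "g holomorphic_on ball ze0 \<delta>" "g ze0 = 0" "inj_on g (ball ze0 \<delta>)"
  "\<And>z. z \<in> ball ze0 \<delta> ==> norm z \<le> 1 ==> \<phi> z = \<phi> ze0 + d * (- \<i> * g z) powr of_real 1"
  "\<And>z. z \<in> ball ze0 \<delta> ==> norm z < 1 ==> Im (g z) > 0"
  "\<And>z. z \<in> ball ze0 \<delta> ==> norm z = 1 ==> Im (g z) = 0"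
  using riemann_map_corner[OF R z0 _ _ s] by (metis one_less_numeral_iff semiring_norm(76) zero_less_one)
 define e where "e = - \<i> * d"
 have e: "norm e = 1" using g(2) by (simp add: e_def norm_mult)
 have dn: "deriv g z \<noteq> 0" if "z \<in> ball ze0 \<delta>" for z
  by (rule holomorphic_injective_imp_regular[OF g(3) open_ball g(5) that])
 have rep: "\<phi> z = \<phi> ze0 + e * g z" if "z \<in> ball ze0 \<delta>" "norm z \<le> 1" for z
  using g(6)[OF that] by (simp add: e_def)
 have der: "deriv \<phi> z = e * deriv g z" if z: "z \<in> ball ze0 \<delta>" "norm z < 1" for z
 proof -
  have "(g has_field_derivative deriv g z) (at z)" using g(3) z(1) holomorphic_derivI open_ball by blast
  then have "((\<lambda>z. \<phi> ze0 + e * g z) has_field_derivative (0 + e * deriv g z)) (at z)"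
   by (intro DERIV_add DERIV_const DERIV_cmult)
  then have "(\<phi> has_field_derivative (0 + e * deriv g z)) (at z)"
  proof (rule has_field_derivative_transform_within_open)
   show "open (ball ze0 \<delta> \<inter> ball 0 1)" by auto
  qed (use z rep in auto)
  then show ?thesis by (simp add: DERIV_imp_deriv)
 qed
 have lim: "((\<lambda>z. deriv \<phi> z) \<longlongrightarrow> e * deriv g z) (at z within ball 0 1)" if z: "z \<in> ball ze0 \<delta>" "norm z = 1" for z
 proof -
  have "deriv g holomorphic_on ball ze0 \<delta>" using g(3) by (rule holomorphic_deriv) auto
  then have "isCont (deriv g) z"
   using z holomorphic_on_imp_continuous_on continuous_on_eq_continuous_at open_ball by blast
  then have "((\<lambda>z. e * deriv g z) \<longlongrightarrow> e * deriv g z) (at z within ball 0 1)"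
   by (intro tendsto_mult tendsto_const) (simp add: isCont_def tendsto_within_subset[of _ _ _ UNIV])
  then show ?thesis
  proof (rule Lim_transform_eventually)
   have "eventually (\<lambda>w. w \<in> ball ze0 \<delta>) (nhds z)" using z by (intro eventually_nhds_in_open) auto
   then have "eventually (\<lambda>w. w \<in> ball ze0 \<delta>) (at z within ball 0 1)"
    unfolding eventually_at_filter by eventually_elim auto
   moreover have "eventually (\<lambda>w. w \<in> ball 0 1) (at z within ball 0 1)" by (auto simp: eventually_at_filter)
   ultimately show "\<forall>\<^sub>F w in at z within ball 0 1. e * deriv g w = deriv \<phi> w"
    by eventually_elim (simp add: der)
  qed
 qed
 have bd: "bd_deriv \<phi> z = norm (deriv g z)" if "z \<in> ball ze0 \<delta>" "norm z = 1" for z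
  using bd_deriv_eq[OF that(2) tendsto_norm[OF lim[OF that]]] e by (simp add: norm_mult)
 show thesis using that[OF g(1) e g(3) dn rep g(8) lim bd] .
qed

section \<open>Arc length of the polygon as the image of the boundary derivative\<close>

section \<open>Arc length of the boundary\<close>

text \<open>The frontier lies in four graphs of 1-Lipschitz functions over [-2, 2]. Cutting each
  into n pieces gives 4n sets of diameter at most 8/n, with sum at most 32 for every n.\<close>

lemma hausdorff1_frontier_Omega_finite: "hausdorff1 (frontier Omega) < \<infinity>"
proof -
 define F where "F j x = (if j = 0 then 2 - \<bar>x\<bar> else if j = 1 then \<bar>x\<bar> - 2 else if j = 2 then 1 + \<bar>x\<bar> else - 1 - \<bar>x\<bar>)"
  for j :: nat and x :: real
 have Flip: "\<bar>F j x - F j y\<bar> \<le> \<bar>x - y\<bar>" for j x y by (auto simp: F_def)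
 \<comment> \<open>The index i encodes the graph i mod 4 and the grid cell i div 4.\<close>
 define S where "S n i = (\<lambda>x. Complex x (F (i mod 4) x)) ` {- 2 + 4 * real (i div 4) / real n .. - 2 + 4 * (real (i div 4) + 1) / real n}"
  for n i :: nat
 have cover: "frontier Omega \<subseteq> (\<Union>i<4 * n. S n i)" if n: "n > 0" for n
 proof
  fix z assume z: "z \<in> frontier Omega"
  note fz = frontier_Omega_D[OF z]
  have x: "\<bar>Re z\<bar> \<le> 2" using fz(1) by linarith
  have "\<exists>j<4. Im z = F j (Re z)"
  proof -
   have "Im z = F 0 (Re z) \<or> Im z = F 1 (Re z) \<or> Im z = F 2 (Re z) \<or> Im z = F 3 (Re z)"
    using fz(3) unfolding F_def by auto
   then show ?thesis
   proof (elim disjE)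
    assume "Im z = F 0 (Re z)" then show ?thesis by (intro exI[of _ 0]) auto
   next
    assume "Im z = F 1 (Re z)" then show ?thesis by (intro exI[of _ 1]) auto
   next
    assume "Im z = F 2 (Re z)" then show ?thesis by (intro exI[of _ 2]) auto
   next
    assume "Im z = F 3 (Re z)" then show ?thesis by (intro exI[of _ 3]) auto
   qed
  qed
  then obtain j where j: "j < 4" "Im z = F j (Re z)" by blast
  define y where "y = (Re z + 2) * real n / 4"
  have y: "0 \<le> y" "y \<le> real n"
  proof -
   have x2: "0 \<le> Re z + 2" "Re z + 2 \<le> 4" using x by linarith+
   then show "0 \<le> y" by (simp add: y_def)
   have "(Re z + 2) * real n \<le> 4 * real n" using x2 by (intro mult_right_mono) auto
   then show "y \<le> real n" by (simp add: y_def)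
  qed
  have rz: "Re z = - 2 + 4 * y / real n" using n by (simp add: y_def)
  have "\<exists>k<n. real k \<le> y \<and> y \<le> real k + 1"
  proof (cases "y = real n")
   case True then show ?thesis using n by (intro exI[of _ "n - 1"]) (auto simp: of_nat_diff)
  next
   case False
   then have "y < real n" using y by simp
   then have "nat \<lfloor>y\<rfloor> < n" using y by linarith
   then show ?thesis using y by (intro exI[of _ "nat \<lfloor>y\<rfloor>"]) linarith
  qed
  then obtain k where k: "k < n" "real k \<le> y" "y \<le> real k + 1" by blast
  have id: "(4 * k + j) mod 4 = j" "(4 * k + j) div 4 = k" using j by auto
  have "z \<in> S n (4 * k + j)" unfolding S_def id
  proof (rule image_eqI[of _ _ "Re z"])
   show "z = Complex (Re z) (F j (Re z))" using j(2) by (simp add: complex_eq_iff)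
   show "Re z \<in> {- 2 + 4 * real k / real n .. - 2 + 4 * (real k + 1) / real n}"
    unfolding rz using k n by (auto intro!: divide_right_mono)
  qed
  moreover have "4 * k + j < 4 * n" using k j by linarith
  ultimately show "z \<in> (\<Union>i<4 * n. S n i)" by blast
 qed
 have d: "norm (u - v) \<le> 8 / real n" if uv: "u \<in> S n i" "v \<in> S n i" and n: "n > 0" for n i u v
 proof -
  obtain x y where xy: "u = Complex x (F (i mod 4) x)" "v = Complex y (F (i mod 4) y)"
   "x \<in> {- 2 + 4 * real (i div 4) / real n .. - 2 + 4 * (real (i div 4) + 1) / real n}"
   "y \<in> {- 2 + 4 * real (i div 4) / real n .. - 2 + 4 * (real (i div 4) + 1) / real n}"
   using uv unfolding S_def by blast
  have "4 * (real (i div 4) + 1) / real n = 4 * real (i div 4) / real n + 4 / real n"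
   by (simp add: add_divide_distrib distrib_left)
  then have "\<bar>x - y\<bar> \<le> 4 / real n" using xy(3,4) by (auto simp: abs_le_iff)
  moreover have "norm (u - v) \<le> \<bar>x - y\<bar> + \<bar>F (i mod 4) x - F (i mod 4) y\<bar>"
   using cmod_le[of "u - v"] by (simp add: xy)
  ultimately show ?thesis using Flip[of "i mod 4" x y] by linarith
 qed
 have "hausdorff1 (frontier Omega) \<le> ennreal 32" unfolding hausdorff1_def
 proof (rule SUP_least)
  fix \<delta> :: real assume "\<delta> \<in> {0<..}"
  then have dp: "\<delta> > 0" by simp
  obtain n0 :: nat where "8 / \<delta> < n0" using reals_Archimedean2 by blast
  define n where "n = Suc n0"
  have n: "n > 0" "8 / real n \<le> \<delta>"
   using \<open>8 / \<delta> < n0\<close> dp by (auto simp: n_def field_simps)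
  define U where "U i = (if i < 4 * n then S n i else {})" for i
  have dU: "bounded (U i)" "diameter (U i) \<le> (if i < 4 * n then 8 / real n else 0)" for i
  proof -
   show "bounded (U i)" unfolding bounded_two_points using d[OF _ _ n(1)] by (auto simp: U_def dist_norm)
   show "diameter (U i) \<le> (if i < 4 * n then 8 / real n else 0)"
    by (auto simp: U_def intro!: diameter_le d n)
  qed
  have "U \<in> {U. frontier Omega \<subseteq> (\<Union>i. U i) \<and> (\<forall>i. bounded (U i) \<and> diameter (U i) \<le> \<delta>)}"
  proof (intro CollectI conjI allI)
   show "frontier Omega \<subseteq> (\<Union>i. U i)" using cover[OF n(1)] by (fastforce simp: U_def)
   show "bounded (U i)" for i by (rule dU)
   show "diameter (U i) \<le> \<delta>" for i using dU(2)[of i] n dp by (auto split: if_splits)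
  qed
  then have "(INF U\<in>{U. frontier Omega \<subseteq> (\<Union>i. U i) \<and> (\<forall>i. bounded (U i) \<and> diameter (U i) \<le> \<delta>)}. \<Sum>i::nat. ennreal (diameter (U i)))
   \<le> (\<Sum>i. ennreal (diameter (U i)))" by (rule INF_lower)
  also have "\<dots> \<le> (\<Sum>i. ennreal (if i < 4 * n then 8 / real n else 0))"
   by (intro suminf_le ennreal_leI dU) auto
  also have "\<dots> = (\<Sum>i<4 * n. ennreal (if i < 4 * n then 8 / real n else 0))"
   by (rule suminf_finite) auto
  also have "\<dots> = ennreal (\<Sum>i<4 * n. if i < 4 * n then 8 / real n else 0)"
   by (rule sum_ennreal) auto
  also have "(\<Sum>i<4 * n. if i < 4 * n then 8 / real n else 0) = 32" using n by simp
  finally show "(INF U\<in>{U. frontier Omega \<subseteq> (\<Union>i. U i) \<and> (\<forall>i. bounded (U i) \<and> diameter (U i) \<le> \<delta>)}. \<Sum>i::nat. ennreal (diameter (U i))) \<le> ennreal 32" .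
 qed
 then show ?thesis by (simp add: le_less_trans)
qed

definition corners :: "complex set" where "corners = {\<i>, -\<i>} \<union> convex_corners"

lemma finite_corners: "finite corners" by (simp add: corners_def convex_corners_def)

lemma corner_angle_1: "b \<notin> corners ==> corner_angle b = 1" by (auto simp: corners_def corner_angle_def)

lemma bd_deriv_measurable:
 assumes "\<phi> holomorphic_on ball 0 1" shows "bd_deriv \<phi> \<in> borel_measurable mu"
proof -
 have r: "0 < 1 - 1 / real (n + 2)" "1 - 1 / real (n + 2) < 1" for n by (auto simp: field_simps)
 have dc: "continuous_on (ball 0 1) (deriv \<phi>)"
  using assms holomorphic_deriv holomorphic_on_imp_continuous_on open_ball by blast
 have "continuous_on (sphere 0 1) (\<lambda>ze. norm (deriv \<phi> (of_real (1 - 1 / real (n + 2)) * ze)))" for n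
 proof (rule continuous_on_norm, rule continuous_on_compose2[OF dc])
  show "continuous_on (sphere 0 1) (\<lambda>ze. complex_of_real (1 - 1 / real (n + 2)) * ze)" by (intro continuous_intros)
  show "(\<lambda>ze. complex_of_real (1 - 1 / real (n + 2)) * ze) ` sphere 0 1 \<subseteq> ball 0 1"
  proof
   fix w assume "w \<in> (\<lambda>ze. complex_of_real (1 - 1 / real (n + 2)) * ze) ` sphere 0 1"
   then have "norm w = 1 - 1 / real (n + 2)" using r[of n] by (auto simp only: norm_mult norm_of_real sphere_def dist_0_norm mem_Collect_eq mult_1_right abs_of_pos)
   then show "w \<in> ball 0 1" using r[of n] by simp
  qed
 qed
 then show ?thesis unfolding bd_deriv_def[abs_def]
  by (intro borel_measurable_lim_metric measurable_circle_continuous)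
qed

lemma Arg2pi_cis_eq: "0 \<le> t ==> t < 2 * pi ==> Arg2pi (cis t) = t"
 by (rule Arg2pi_unique[of 1]) (auto simp: cis_conv_exp)

locale omega_map =
 fixes \<phi> :: "complex \<Rightarrow> complex"
 assumes R: "riemann_map Omega \<phi>"
begin

lemmas facts = riemann_map_facts[OF R open_Omega]

text \<open>The point 1 is added because the parametrization by (0, 2\<pi>) is cut there.\<close>

definition exc_points where "exc_points = insert 1 {ze \<in> sphere 0 1. \<phi> ze \<in> corners}"
definition side_params where "side_params = {t \<in> {0<..<2*pi}. cis t \<notin> exc_points}"
definition bd_path where "bd_path t = \<phi> (cis t)"
definition side_density where "side_density t = ennreal (bd_deriv \<phi> (cis t)) * indicator side_params t"

lemma finite_exc_points: "finite exc_points"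
proof -
 have "inj_on \<phi> {ze \<in> sphere 0 1. \<phi> ze \<in> corners}" by (rule inj_on_subset[OF facts(3)]) auto
 moreover have "\<phi> ` {ze \<in> sphere 0 1. \<phi> ze \<in> corners} \<subseteq> corners" by auto
 ultimately have "finite {ze \<in> sphere 0 1. \<phi> ze \<in> corners}"
  using finite_corners by (meson finite_imageD finite_subset)
 then show ?thesis by (simp add: exc_points_def)
qed

lemma open_side_params: "open side_params"
proof -
 have "side_params = {0<..<2*pi} \<inter> cis -` (- exc_points)" by (auto simp: side_params_def)
 moreover have "open (cis -` (- exc_points))"
  by (intro open_vimage finite_imp_closed[OF finite_exc_points, unfolded closed_open] continuous_on_cis continuous_on_id)
 ultimately show ?thesis by auto
qed

lemma side_params_frontier: "t \<in> side_params ==> \<phi> (cis t) \<in> frontier Omega - corners"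
 using facts(6) by (auto simp: side_params_def exc_points_def)

text \<open>Near a point that is no corner the boundary path is a constant plus a unit vector times
  the real function x(s) = g(cis s), so its length is the variation of x.\<close>

lemma side_at:
 assumes t: "t \<in> side_params"
 obtains \<eta> x x' where "\<eta> > 0" "{t - \<eta><..<t + \<eta>} \<subseteq> side_params"
  "\<And>s. \<bar>s - t\<bar> < \<eta> ==> (x has_real_derivative x' s) (at s)"
  "continuous_on {t - \<eta><..<t + \<eta>} x'" "\<And>s. \<bar>s - t\<bar> < \<eta> ==> x' s \<noteq> 0"
  "\<And>s. \<bar>s - t\<bar> < \<eta> ==> bd_deriv \<phi> (cis s) = \<bar>x' s\<bar>"
  "\<And>s u. \<bar>s - t\<bar> < \<eta> ==> \<bar>u - t\<bar> < \<eta> ==> dist (bd_path s) (bd_path u) = \<bar>x s - x u\<bar>"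
proof -
 have s: "sector_at Omega (\<phi> (cis t)) 1"
  using sector_at_Omega[of "\<phi> (cis t)"] side_params_frontier[OF t] corner_angle_1 by auto
 obtain \<delta> g e where g: "\<delta> > 0" "norm e = 1" "g holomorphic_on ball (cis t) \<delta>" "\<And>z. z \<in> ball (cis t) \<delta> ==> deriv g z \<noteq> 0"
  "\<And>z. z \<in> ball (cis t) \<delta> ==> norm z \<le> 1 ==> \<phi> z = \<phi> (cis t) + e * g z"
  "\<And>z. z \<in> ball (cis t) \<delta> ==> norm z = 1 ==> Im (g z) = 0"
  "\<And>z. z \<in> ball (cis t) \<delta> ==> norm z = 1 ==> ((\<lambda>z. deriv \<phi> z) \<longlongrightarrow> e * deriv g z) (at z within ball 0 1)"
  "\<And>z. z \<in> ball (cis t) \<delta> ==> norm z = 1 ==> bd_deriv \<phi> z = norm (deriv g z)"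
  by (rule side_extension[OF R open_Omega norm_cis s]) (rule that; assumption)
 obtain e1 where e1: "e1 > 0" "ball t e1 \<subseteq> side_params" using open_side_params t open_contains_ball by blast
 have "continuous_on UNIV cis" by (intro continuous_on_cis continuous_on_id)
 then have "isCont cis t" by (simp add: continuous_on_eq_continuous_at)
 then obtain e2 where e2: "e2 > 0" "\<And>s. dist s t < e2 ==> dist (cis s) (cis t) < \<delta>"
  unfolding continuous_at_eps_delta using g(1) by blast
 define \<eta> where "\<eta> = min e1 e2"
 have cb: "cis s \<in> ball (cis t) \<delta>" if "\<bar>s - t\<bar> < \<eta>" for s
  using e2(2)[of s] that by (auto simp: \<eta>_def dist_real_def dist_commute)
 define x where "x s = Re (g (cis s))" for s
 define x' where "x' s = Re (deriv g (cis s) * (\<i> * cis s))" for s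
 have vd: "((\<lambda>s. g (cis s)) has_vector_derivative (deriv g (cis s) * (\<i> * cis s))) (at s)" if "\<bar>s - t\<bar> < \<eta>" for s
 proof -
  have "(g has_field_derivative deriv g (cis s)) (at (cis s))"
   using g(3) cb[OF that] holomorphic_derivI open_ball by blast
  moreover have "(cis has_vector_derivative (\<i> * cis s)) (at s)"
  proof -
   have "((\<lambda>t. exp (of_real t * \<i>)) has_vector_derivative (exp (of_real s * \<i>) * \<i>)) (at s)"
   proof -
    have "((\<lambda>z. exp (z * \<i>)) has_field_derivative (exp (of_real s * \<i>) * \<i>)) (at (of_real s))"
     by (auto intro!: derivative_eq_intros)
    from field_vector_diff_chain_at[OF has_vector_derivative_of_real[OF DERIV_ident] this]
    show ?thesis by (simp add: o_def)
   qed
   then show ?thesis by (simp add: cis_conv_exp[abs_def] mult.commute)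
  qed
  ultimately show ?thesis using field_vector_diff_chain_at[of cis "\<i> * cis s" s g] by (simp add: o_def mult.commute)
 qed
 have xd: "(x has_real_derivative x' s) (at s)" if "\<bar>s - t\<bar> < \<eta>" for s
  unfolding x_def[abs_def] x'_def has_real_derivative_iff_has_vector_derivative
  using bounded_linear.has_vector_derivative[OF bounded_linear_Re vd[OF that]] .
 \<comment> \<open>g is real along the circle, so its tangential derivative is real too, and |g'|
   becomes the absolute value of x'.\<close>
 have im: "Im (deriv g (cis s) * (\<i> * cis s)) = 0" if s: "\<bar>s - t\<bar> < \<eta>" for s
 proof -
  have d1: "((\<lambda>s. Im (g (cis s))) has_vector_derivative Im (deriv g (cis s) * (\<i> * cis s))) (at s)"
   using bounded_linear.has_vector_derivative[OF bounded_linear_Im vd[OF s]] .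
  have "((\<lambda>s. 0 :: real) has_vector_derivative 0) (at s)" by simp
  then have d2: "((\<lambda>s. Im (g (cis s))) has_vector_derivative 0) (at s)"
  proof (rule has_vector_derivative_transform_within_open[of _ _ _ "{t - \<eta><..<t + \<eta>}"])
   show "s \<in> {t - \<eta><..<t + \<eta>}" using s by auto
   fix u assume "u \<in> {t - \<eta><..<t + \<eta>}"
   then have "\<bar>u - t\<bar> < \<eta>" by auto
   then show "0 = Im (g (cis u))" using g(6)[OF cb] by simp
  qed auto
  show ?thesis by (rule vector_derivative_unique_at[OF d1 d2])
 qed
 have nx: "norm (deriv g (cis s)) = \<bar>x' s\<bar>" if s: "\<bar>s - t\<bar> < \<eta>" for s
 proof -
  have "norm (deriv g (cis s)) = norm (deriv g (cis s) * (\<i> * cis s))" by (simp add: norm_mult)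
  also have "\<dots> = \<bar>x' s\<bar>" using im[OF s] unfolding x'_def by (simp add: cmod_eq_Re)
  finally show ?thesis .
 qed
 show thesis
 proof (rule that[of \<eta> x x'])
  show "\<eta> > 0" using e1 e2 by (simp add: \<eta>_def)
  show "{t - \<eta><..<t + \<eta>} \<subseteq> side_params"
  proof
   fix u assume "u \<in> {t - \<eta><..<t + \<eta>}"
   then have "\<bar>t - u\<bar> < \<eta>" by auto
   moreover have "\<eta> \<le> e1" by (simp add: \<eta>_def)
   ultimately have "u \<in> ball t e1" by (simp add: dist_real_def)
   then show "u \<in> side_params" using e1(2) by blast
  qed
  show "(x has_real_derivative x' s) (at s)" if "\<bar>s - t\<bar> < \<eta>" for s by (rule xd[OF that])
  show "x' s \<noteq> 0" if "\<bar>s - t\<bar> < \<eta>" for s using nx[OF that] g(4)[OF cb[OF that]] by auto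
  show "bd_deriv \<phi> (cis s) = \<bar>x' s\<bar>" if "\<bar>s - t\<bar> < \<eta>" for s
   using g(8)[OF cb[OF that]] nx[OF that] by simp
  show "continuous_on {t - \<eta><..<t + \<eta>} x'"
  proof -
   have "continuous_on (ball (cis t) \<delta>) (deriv g)"
    using g(3) holomorphic_deriv holomorphic_on_imp_continuous_on open_ball by blast
   then have "continuous_on {t - \<eta><..<t + \<eta>} (\<lambda>s. deriv g (cis s))"
   proof (rule continuous_on_compose2)
    show "cis ` {t - \<eta><..<t + \<eta>} \<subseteq> ball (cis t) \<delta>" using cb by (auto simp: abs_less_iff)
   qed (intro continuous_intros)
   then show ?thesis unfolding x'_def[abs_def] by (intro continuous_intros)
  qed
  show "dist (bd_path s) (bd_path u) = \<bar>x s - x u\<bar>" if "\<bar>s - t\<bar> < \<eta>" "\<bar>u - t\<bar> < \<eta>" for s u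
  proof -
   have gr: "g (cis v) = of_real (x v)" if "\<bar>v - t\<bar> < \<eta>" for v
    using g(6)[OF cb[OF that]] by (simp add: x_def complex_eq_iff)
   have "bd_path s - bd_path u = e * (of_real (x s) - of_real (x u))"
    unfolding bd_path_def using g(5)[OF cb[OF that(1)]] g(5)[OF cb[OF that(2)]] gr[OF that(1)] gr[OF that(2)]
    by (simp add: algebra_simps)
   then have "norm (bd_path s - bd_path u) = norm (of_real (x s - x u) :: complex)" using g(2) by (simp add: norm_mult)
   then show ?thesis by (simp add: dist_norm del: of_real_diff)
  qed
 qed
qed

lemma bd_continuous: "continuous_on side_params (\<lambda>t. bd_deriv \<phi> (cis t))"
proof (rule continuous_at_imp_continuous_on, rule ballI)
 fix t assume t: "t \<in> side_params"
 obtain \<eta> x x' where h: "\<eta> > 0" "{t - \<eta><..<t + \<eta>} \<subseteq> side_params"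
  "\<And>s. \<bar>s - t\<bar> < \<eta> ==> (x has_real_derivative x' s) (at s)"
  "continuous_on {t - \<eta><..<t + \<eta>} x'" "\<And>s. \<bar>s - t\<bar> < \<eta> ==> x' s \<noteq> 0"
  "\<And>s. \<bar>s - t\<bar> < \<eta> ==> bd_deriv \<phi> (cis s) = \<bar>x' s\<bar>"
  "\<And>s u. \<bar>s - t\<bar> < \<eta> ==> \<bar>u - t\<bar> < \<eta> ==> dist (bd_path s) (bd_path u) = \<bar>x s - x u\<bar>"
  by (rule side_at[OF t]) (rule that; assumption)
 have "continuous_on {t - \<eta><..<t + \<eta>} (\<lambda>s. \<bar>x' s\<bar>)" using h(4) by (intro continuous_intros)
 moreover have "\<bar>x' s\<bar> = bd_deriv \<phi> (cis s)" if "s \<in> {t - \<eta><..<t + \<eta>}" for s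
  using h(6)[of s] that by (auto simp: abs_less_iff)
 ultimately have "continuous_on {t - \<eta><..<t + \<eta>} (\<lambda>s. bd_deriv \<phi> (cis s))"
  by (rule continuous_on_eq)
 then show "isCont (\<lambda>t. bd_deriv \<phi> (cis t)) t" using h(1) continuous_on_interior by fastforce
qed

lemma side_density_measurable: "side_density \<in> borel_measurable borel"
proof -
 have "(\<lambda>t. indicator side_params t *\<^sub>R bd_deriv \<phi> (cis t)) \<in> borel_measurable borel"
  using open_side_params by (intro borel_measurable_continuous_on_indicator bd_continuous) auto
 then have "(\<lambda>t. ennreal (indicator side_params t *\<^sub>R bd_deriv \<phi> (cis t))) \<in> borel_measurable borel" by simp
 moreover have "(\<lambda>t. ennreal (indicator side_params t *\<^sub>R bd_deriv \<phi> (cis t))) = side_density"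
  by (auto simp: side_density_def fun_eq_iff split: split_indicator)
 ultimately show ?thesis by simp
qed

sublocale arc: rectifiable_arc side_density side_params bd_path 0 "2*pi"
proof
 show "side_density \<in> borel_measurable borel" by (rule side_density_measurable)
 show "side_density t = 0" if "t \<notin> side_params" for t using that by (simp add: side_density_def)
 show "open side_params" by (rule open_side_params)
 show "side_params \<subseteq> {0<..<2*pi}" by (auto simp: side_params_def)
 show "(0::real) < 2 * pi" by simp
 have "side_params \<subseteq> {0<..<2*pi}" by (auto simp: side_params_def)
 show "continuous_on side_params bd_path" unfolding bd_path_def[abs_def]
  by (rule continuous_on_compose2[OF facts(1)]) (auto intro!: continuous_intros)
 show "\<exists>\<epsilon>>0. \<forall>s\<in>side_params. dist (bd_path s) (bd_path t) < \<epsilon> \<longrightarrow> \<bar>s - t\<bar> < \<delta>" if t: "t \<in> side_params" and d: "\<delta> > 0" for t \<delta>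
 proof -
  obtain \<psi> where \<psi>: "homeomorphism (cball 0 1) (closure Omega) \<phi> \<psi>" using R unfolding riemann_map_def by blast
  have inv: "\<psi> (bd_path s) = cis s" for s unfolding bd_path_def using \<psi> by (auto simp: homeomorphism_def)
  \<comment> \<open>\<open>Arg2pi\<close> is continuous off the non-negative axis, which meets the
    circle only at the excluded point 1.\<close>
  have nn: "cis t \<notin> \<real>\<^sub>\<ge>\<^sub>0"
  proof
   assume "cis t \<in> \<real>\<^sub>\<ge>\<^sub>0"
   then obtain r where "cis t = of_real r" "r \<ge> 0" by (auto simp: nonneg_Reals_def)
   moreover have "norm (cis t) = 1" by simp
   ultimately have "cis t = 1" by simp
   then show False using t by (auto simp: side_params_def exc_points_def)
  qed
  have "isCont Arg2pi (cis t)" by (rule continuous_at_Arg2pi[OF nn])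
  then obtain e1 where e1: "e1 > 0" "\<And>z. dist z (cis t) < e1 ==> dist (Arg2pi z) (Arg2pi (cis t)) < \<delta>"
   unfolding continuous_at_eps_delta using d by blast
  have "continuous_on (closure Omega) \<psi>" using \<psi> by (auto simp: homeomorphism_def)
  moreover have gc: "bd_path s \<in> closure Omega" for s using facts(5) by (auto simp: bd_path_def)
  ultimately obtain e2 where e2: "e2 > 0" "\<And>y. y \<in> closure Omega ==> dist y (bd_path t) < e2 ==> dist (\<psi> y) (\<psi> (bd_path t)) < e1"
   unfolding continuous_on_iff using e1(1) by meson
  show ?thesis
  proof (intro exI[of _ e2] conjI ballI impI)
   show "e2 > 0" by fact
   fix s assume s: "s \<in> side_params" "dist (bd_path s) (bd_path t) < e2"
   then have "dist (cis s) (cis t) < e1" using e2(2)[OF gc s(2)] by (simp add: inv)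
   then have "dist (Arg2pi (cis s)) (Arg2pi (cis t)) < \<delta>" by (rule e1(2))
   then show "\<bar>s - t\<bar> < \<delta>" using s(1) t by (simp add: Arg2pi_cis_eq side_params_def dist_real_def)
  qed
 qed
 show "\<exists>\<delta>>0. \<forall>s1 s2. t - \<delta> < s1 \<and> s1 \<le> s2 \<and> s2 < t + \<delta> \<longrightarrow>
    {s1..s2} \<subseteq> side_params \<and> ennreal (dist (bd_path s1) (bd_path s2)) = emeasure (density lborel side_density) {s1..s2}" if t: "t \<in> side_params" for t
 proof -
  obtain \<eta> x x' where h: "\<eta> > 0" "{t - \<eta><..<t + \<eta>} \<subseteq> side_params"
   "\<And>s. \<bar>s - t\<bar> < \<eta> ==> (x has_real_derivative x' s) (at s)"
   "continuous_on {t - \<eta><..<t + \<eta>} x'" "\<And>s. \<bar>s - t\<bar> < \<eta> ==> x' s \<noteq> 0"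
   "\<And>s. \<bar>s - t\<bar> < \<eta> ==> bd_deriv \<phi> (cis s) = \<bar>x' s\<bar>"
   "\<And>s u. \<bar>s - t\<bar> < \<eta> ==> \<bar>u - t\<bar> < \<eta> ==> dist (bd_path s) (bd_path u) = \<bar>x s - x u\<bar>"
   by (rule side_at[OF t]) (rule that; assumption)
  let ?J = "{t - \<eta><..<t + \<eta>}"
  have J: "s \<in> ?J \<longleftrightarrow> \<bar>s - t\<bar> < \<eta>" for s by auto
  \<comment> \<open>x' is continuous without zeros on an interval, so it has a constant sign
    \<sigma>; then \<sigma> x is monotone and the fundamental theorem computes the mass of
    [s1, s2].\<close>
  have sgn: "(\<forall>s\<in>?J. x' s > 0) \<or> (\<forall>s\<in>?J. x' s < 0)"
  proof (rule ccontr)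
   assume "\<not> ?thesis"
   then obtain a b where ab: "a \<in> ?J" "b \<in> ?J" "x' a \<le> 0" "x' b \<ge> 0" by force
   have "connected (x' ` ?J)" by (intro connected_continuous_image h(4)) auto
   then have "0 \<in> x' ` ?J" using ab connectedD_interval[of "x' ` ?J" "x' a" "x' b" 0] by blast
   then show False using h(5) J by fastforce
  qed
  then obtain \<sigma> :: real where \<sigma>: "\<sigma> = 1 \<or> \<sigma> = -1" "\<And>s. s \<in> ?J ==> \<bar>x' s\<bar> = \<sigma> * x' s"
  proof (elim disjE)
   assume "\<forall>s\<in>?J. x' s > 0" then show ?thesis by (intro that[of 1]) (auto intro!: abs_of_pos)
  next
   assume "\<forall>s\<in>?J. x' s < 0" then show ?thesis by (intro that[of "-1"]) (auto simp: abs_of_neg)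
  qed
  show ?thesis
  proof (intro exI[of _ \<eta>] conjI allI impI)
   show "\<eta> > 0" by fact
   fix s1 s2 assume s: "t - \<eta> < s1 \<and> s1 \<le> s2 \<and> s2 < t + \<eta>"
   have sub: "{s1..s2} \<subseteq> ?J" using s by auto
   then show "{s1..s2} \<subseteq> side_params" using h(2) by blast
   have "emeasure (density lborel side_density) {s1..s2} = (\<integral>\<^sup>+u. side_density u * indicator {s1..s2} u \<partial>lborel)"
    using side_density_measurable by (intro emeasure_density) auto
   also have "\<dots> = (\<integral>\<^sup>+u. ennreal (if u \<in> ?J then \<sigma> * x' u else 0) * indicator {s1..s2} u \<partial>lborel)"
   proof (intro nn_integral_cong)
    fix u show "side_density u * indicator {s1..s2} u = ennreal (if u \<in> ?J then \<sigma> * x' u else 0) * indicator {s1..s2} u"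
     using sub h(2) h(6)[of u] \<sigma>(2)[of u] J[of u] by (auto simp: side_density_def split: split_indicator)
   qed
   also have "\<dots> = ennreal (\<sigma> * x s2 - \<sigma> * x s1)"
   proof (rule nn_integral_FTC_Icc)
    have "(\<lambda>u. indicator ?J u *\<^sub>R (\<sigma> * x' u)) \<in> borel_measurable borel"
     using h(4) by (intro borel_measurable_continuous_on_indicator continuous_intros) auto
    moreover have "(\<lambda>u. indicator ?J u *\<^sub>R (\<sigma> * x' u)) = (\<lambda>u. if u \<in> ?J then \<sigma> * x' u else 0)"
     by (auto simp: fun_eq_iff indicator_def)
    ultimately show "(\<lambda>u. if u \<in> ?J then \<sigma> * x' u else 0) \<in> borel_measurable borel" by simp
    show "s1 \<le> s2" using s by simp
    fix u assume "u \<in> {s1..s2}"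
    then have u: "u \<in> ?J" using s by auto
    then show "((\<lambda>s. \<sigma> * x s) has_real_derivative (if u \<in> ?J then \<sigma> * x' u else 0)) (at u)"
     using h(3)[of u] J by (auto intro!: DERIV_cmult)
    show "0 \<le> (if u \<in> ?J then \<sigma> * x' u else 0)" using \<sigma>(2)[OF u] u by (metis abs_ge_zero)
   qed
   finally have e: "emeasure (density lborel side_density) {s1..s2} = ennreal (\<sigma> * x s2 - \<sigma> * x s1)" .
   have "0 \<le> \<sigma> * x s2 - \<sigma> * x s1"
   proof -
    have "(\<lambda>s. \<sigma> * x s) s1 \<le> (\<lambda>s. \<sigma> * x s) s2"
    proof (rule DERIV_nonneg_imp_nondecreasing[of s1 s2 "\<lambda>s. \<sigma> * x s"])
     show "s1 \<le> s2" using s by simp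
     fix u assume "s1 \<le> u" "u \<le> s2"
     then have u: "u \<in> ?J" using s by auto
     have "((\<lambda>s. \<sigma> * x s) has_real_derivative (\<sigma> * x' u)) (at u)"
      using h(3)[of u] u J by (auto intro!: DERIV_cmult)
     then show "\<exists>y. ((\<lambda>s. \<sigma> * x s) has_real_derivative y) (at u) \<and> 0 \<le> y"
      using \<sigma>(2)[OF u] by (metis abs_ge_zero)
    qed
    then show ?thesis by simp
   qed
   then have "\<bar>x s1 - x s2\<bar> = \<sigma> * x s2 - \<sigma> * x s1" using \<sigma>(1) by auto
   moreover have "dist (bd_path s1) (bd_path s2) = \<bar>x s1 - x s2\<bar>" using s by (intro h(7)) auto
   ultimately show "ennreal (dist (bd_path s1) (bd_path s2)) = emeasure (density lborel side_density) {s1..s2}" using e by simp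
  qed
 qed
qed

lemma phi_measurable: "\<phi> \<in> measurable mu (restrict_space borel (frontier Omega))"
proof (rule measurable_restrict_space2)
 show "\<phi> \<in> borel_measurable mu"
  by (rule measurable_circle_continuous) (rule continuous_on_subset[OF facts(1)], auto)
qed (use facts(6) in auto)

lemma AE_side_params: "AE t in lborel. t \<in> {0..<2*pi} \<longrightarrow> t \<in> side_params"
proof -
 have "finite {t \<in> {0..<2*pi}. cis t \<in> exc_points}"
 proof (rule finite_imageD)
  show "finite (cis ` {t \<in> {0..<2*pi}. cis t \<in> exc_points})" by (rule finite_subset[OF _ finite_exc_points]) auto
  show "inj_on cis {t \<in> {0..<2*pi}. cis t \<in> exc_points}"
   by (rule inj_on_inverseI[of _ Arg2pi]) (auto simp: Arg2pi_cis_eq)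
 qed
 then have "finite (insert 0 {t \<in> {0..<2*pi}. cis t \<in> exc_points})" by simp
 then have "AE t in lborel. t \<notin> insert 0 {t \<in> {0..<2*pi}. cis t \<in> exc_points}"
  by (intro AE_not_in finite_imp_null_set_lborel)
 then show ?thesis by eventually_elim (auto simp: side_params_def)
qed

lemma AE_circle: "AE ze in mu. ze \<in> sphere 0 1 - exc_points"
proof (rule AE_I')
 show "exc_points \<inter> sphere 0 1 \<in> null_sets mu"
 proof (rule null_setsI)
  show Xm: "exc_points \<inter> sphere 0 1 \<in> sets mu"
   using finite_imp_closed[OF finite_exc_points] by (auto simp: sets_circle_measure sets_restrict_space)
  have "emeasure mu (exc_points \<inter> sphere 0 1) = (\<integral>\<^sup>+ze. indicator (exc_points \<inter> sphere 0 1) ze \<partial>mu)"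
   using Xm by simp
  also have "\<dots> = (\<integral>\<^sup>+t. indicator (exc_points \<inter> sphere 0 1) (cis t) * indicator {0..<2*pi} t \<partial>lborel)"
   using Xm by (intro nn_integral_circle) auto
  also have "\<dots> = (\<integral>\<^sup>+(t::real). 0 \<partial>lborel)"
  proof (rule nn_integral_cong_AE)
   show "AE t in lborel. indicator (exc_points \<inter> sphere 0 1) (cis t) * indicator {0..<2*pi} t = (0 :: ennreal)"
    using AE_side_params by eventually_elim (auto simp: side_params_def split: split_indicator)
  qed
  finally show "emeasure mu (exc_points \<inter> sphere 0 1) = 0" by simp
 qed
qed auto

text \<open>Up to finitely many points, a Borel subset of the frontier is the image of a parameter
  set, whose Hausdorff measure is the integral of the speed. Since \<open>measure_of\<close> is
  determined by its values on the sigma algebra, agreement there identifies the two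
  measures.\<close>

theorem arc_length_frontier:
 "arc_length (frontier Omega) = distr (density mu (\<lambda>ze. ennreal (bd_deriv \<phi> ze))) (restrict_space borel (frontier Omega)) \<phi>"
  (is "_ = ?M")
proof -
 have bm [measurable]: "bd_deriv \<phi> \<in> borel_measurable mu" by (rule bd_deriv_measurable[OF facts(2)])
 have pm: "\<phi> \<in> measurable (density mu (\<lambda>ze. ennreal (bd_deriv \<phi> ze))) (restrict_space borel (frontier Omega))"
  using phi_measurable by simp
 have eq: "hausdorff1 A = emeasure ?M A" if A: "A \<in> sets (restrict_space borel (frontier Omega))" for A
 proof -
  have Asub: "A \<subseteq> frontier Omega" using sets.sets_into_space[OF A] by (simp add: space_restrict_space)
  have Ab: "A \<in> sets borel" using A frontier_closed[of Omega] by (auto simp: sets_restrict_space)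
  define E where "E = {t \<in> side_params. bd_path t \<in> A}"
  have Eb: "E \<in> sets borel"
  proof -
   have "bd_path \<in> borel_measurable (restrict_space borel side_params)"
    using arc.cont by (rule borel_measurable_continuous_on_restrict)
   then have "bd_path -` A \<inter> space (restrict_space borel side_params) \<in> sets (restrict_space borel side_params)"
    using Ab by (rule measurable_sets)
   then obtain B where B: "B \<in> sets borel" "bd_path -` A \<inter> side_params = side_params \<inter> B"
    by (auto simp: sets_restrict_space space_restrict_space)
   have "E = side_params \<inter> B" unfolding B(2)[symmetric] by (auto simp: E_def)
   then show ?thesis using open_side_params B(1) by auto
  qed
  have fin: "hausdorff1 (bd_path ` side_params) < \<infinity>"
  proof (rule le_less_trans[OF hausdorff1_mono hausdorff1_frontier_Omega_finite])
   show "bd_path ` side_params \<subseteq> frontier Omega" using side_params_frontier by (auto simp: bd_path_def)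
  qed
  have Aeq: "A = bd_path ` E \<union> (A \<inter> \<phi> ` exc_points)"
  proof (intro subset_antisym subsetI)
   fix b assume b: "b \<in> A"
   then obtain ze where ze: "ze \<in> sphere 0 1" "b = \<phi> ze" using Asub facts(6) by blast
   show "b \<in> bd_path ` E \<union> (A \<inter> \<phi> ` exc_points)"
   proof (cases "ze \<in> exc_points")
    case False
    define t where "t = Arg2pi ze"
    have ct: "cis t = ze" using ze(1) complex_norm_eq_1_exp[of ze] by (simp add: t_def cis_conv_exp)
    have t: "0 \<le> t" "t < 2 * pi" using Arg2pi[of ze] by (auto simp: t_def)
    have "t \<noteq> 0" using ct False by (auto simp: exc_points_def)
    then have "t \<in> side_params" using t ct False by (auto simp: side_params_def)
    then show ?thesis using b ze(2) ct by (auto simp: E_def bd_path_def)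
   qed (use b ze in auto)
  qed (auto simp: E_def)
  have "hausdorff1 A = hausdorff1 (bd_path ` E \<union> (A \<inter> \<phi> ` exc_points))" using Aeq by simp
  also have "\<dots> = hausdorff1 (bd_path ` E)" using finite_exc_points by (intro hausdorff1_Un_finite) auto
  also have "\<dots> = emeasure (density lborel side_density) E"
   by (rule arc.hausdorff1_image[OF fin Eb]) (auto simp: E_def)
  also have "\<dots> = (\<integral>\<^sup>+t. side_density t * indicator E t \<partial>lborel)"
   using Eb side_density_measurable by (intro emeasure_density) auto
  also have "\<dots> = (\<integral>\<^sup>+t. (ennreal (bd_deriv \<phi> (cis t)) * indicator A (\<phi> (cis t))) * indicator {0..<2*pi} t \<partial>lborel)"
  proof (rule nn_integral_cong_AE)
   show "AE t in lborel. side_density t * indicator E t = (ennreal (bd_deriv \<phi> (cis t)) * indicator A (\<phi> (cis t))) * indicator {0..<2*pi} t"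
    using AE_side_params by eventually_elim (auto simp: side_density_def E_def side_params_def bd_path_def split: split_indicator)
  qed
  also have "\<dots> = (\<integral>\<^sup>+ze. ennreal (bd_deriv \<phi> ze) * indicator A (\<phi> ze) \<partial>mu)"
  proof (rule nn_integral_circle[symmetric])
   have [measurable]: "(\<lambda>ze. indicator A (\<phi> ze) :: ennreal) \<in> borel_measurable mu"
    using measurable_compose[OF phi_measurable borel_measurable_indicator[OF A]] .
   show "(\<lambda>ze. ennreal (bd_deriv \<phi> ze) * indicator A (\<phi> ze)) \<in> borel_measurable mu" by measurable
  qed
  also have "\<dots> = (\<integral>\<^sup>+ze. ennreal (bd_deriv \<phi> ze) * indicator (\<phi> -` A \<inter> space mu) ze \<partial>mu)"
   by (intro nn_integral_cong) (auto split: split_indicator)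
  also have "\<dots> = emeasure (density mu (\<lambda>ze. ennreal (bd_deriv \<phi> ze))) (\<phi> -` A \<inter> space mu)"
   using measurable_sets[OF phi_measurable A] by (subst emeasure_density) auto
  also have "\<dots> = emeasure ?M A" using A pm by (subst emeasure_distr) auto
  finally show ?thesis .
 qed
 have sp: "space ?M = frontier Omega" "sets ?M = sets (restrict_space borel (frontier Omega))"
  by (simp_all add: space_restrict_space)
 have "arc_length (frontier Omega) = measure_of (frontier Omega) (sets ?M) (emeasure ?M)"
  unfolding arc_length_def sp(2)
 proof (rule measure_of_eq)
  show sub: "sets (restrict_space borel (frontier Omega)) \<subseteq> Pow (frontier Omega)"
   using sets.space_closed[of "restrict_space borel (frontier Omega)"] by (simp add: space_restrict_space)
  fix A assume "A \<in> sigma_sets (frontier Omega) (sets (restrict_space borel (frontier Omega)))"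
  moreover have "sigma_sets (frontier Omega) (sets (restrict_space borel (frontier Omega))) = sets (restrict_space borel (frontier Omega))"
   using sets.sigma_sets_eq[of "restrict_space borel (frontier Omega)"] by (simp add: space_restrict_space)
  ultimately show "hausdorff1 A = emeasure ?M A" using eq by simp
 qed
 also have "\<dots> = ?M" using measure_of_of_measure[of ?M] sp(1) by simp
 finally show ?thesis .
qed

lemma bd_deriv_finite: "(\<integral>\<^sup>+ze. ennreal (bd_deriv \<phi> ze) \<partial>mu) < \<infinity>"
proof -
 have "(\<integral>\<^sup>+ze. ennreal (bd_deriv \<phi> ze) \<partial>mu) = (\<integral>\<^sup>+t. ennreal (bd_deriv \<phi> (cis t)) * indicator {0..<2*pi} t \<partial>lborel)"
  using bd_deriv_measurable[OF facts(2)] by (intro nn_integral_circle) simp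
 also have "\<dots> = (\<integral>\<^sup>+t. side_density t * indicator side_params t \<partial>lborel)"
 proof (rule nn_integral_cong_AE)
  show "AE t in lborel. ennreal (bd_deriv \<phi> (cis t)) * indicator {0..<2*pi} t = side_density t * indicator side_params t"
   using AE_side_params by eventually_elim (auto simp: side_params_def side_density_def split: split_indicator)
 qed
 also have "\<dots> = emeasure (density lborel side_density) side_params"
  using side_density_measurable open_side_params by (intro emeasure_density[symmetric]) auto
 also have "\<dots> \<le> hausdorff1 (bd_path ` side_params)" using open_side_params by (intro arc.lower) auto
 also have "\<dots> \<le> hausdorff1 (frontier Omega)" by (rule hausdorff1_mono) (use side_params_frontier in \<open>auto simp: bd_path_def\<close>)
 also have "\<dots> < \<infinity>" by (rule hausdorff1_frontier_Omega_finite)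
 finally show ?thesis .
qed

lemma bd_deriv_pos: "ze \<in> sphere 0 1 - exc_points ==> bd_deriv \<phi> ze > 0"
proof -
 assume z: "ze \<in> sphere 0 1 - exc_points"
 then have zn: "norm ze = 1" by simp
 have "\<phi> ze \<in> frontier Omega" using facts(6) z by blast
 then have s: "sector_at Omega (\<phi> ze) 1"
  using sector_at_Omega[of "\<phi> ze"] corner_angle_1[of "\<phi> ze"] z by (auto simp: exc_points_def)
 obtain \<delta> g e where g: "\<delta> > 0" "norm e = 1" "g holomorphic_on ball ze \<delta>" "\<And>z. z \<in> ball ze \<delta> ==> deriv g z \<noteq> 0"
  "\<And>z. z \<in> ball ze \<delta> ==> norm z \<le> 1 ==> \<phi> z = \<phi> ze + e * g z"
  "\<And>z. z \<in> ball ze \<delta> ==> norm z = 1 ==> Im (g z) = 0"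
  "\<And>z. z \<in> ball ze \<delta> ==> norm z = 1 ==> ((\<lambda>z. deriv \<phi> z) \<longlongrightarrow> e * deriv g z) (at z within ball 0 1)"
  "\<And>z. z \<in> ball ze \<delta> ==> norm z = 1 ==> bd_deriv \<phi> z = norm (deriv g z)"
  by (rule side_extension[OF R open_Omega zn s]) (rule that; assumption)
 show ?thesis using g(4)[of ze] g(8)[of ze] g(1) zn by simp
qed

end

section \<open>The boundary transform and the projection on the frontier\<close>

section \<open>The projection of the domain\<close>

lemma szego_rel_AE:
 assumes "szego_rel f g" "g' \<in> borel_measurable mu" "AE x in mu. g' x = g x" "L2 mu f"
 shows "szego_rel f g'" unfolding szego_rel_def
proof (intro conjI ballI)
 have gH: "g \<in> H2_circle" by (rule szego_rel_H2[OF assms(1)])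
 show g'H: "g' \<in> H2_circle" by (rule H2_circle_AE[OF gH assms(2,3)])
 fix h assume h: "h \<in> H2_circle"
 note [measurable] = L2_measurable[OF assms(4)] L2_measurable[OF H2_circle_L2[OF gH]] assms(2) L2_measurable[OF L2_cnj[OF H2_circle_L2[OF h]]]
 have "(\<integral>ze. (f ze - g' ze) * cnj (h ze) \<partial>mu) = (\<integral>ze. (f ze - g ze) * cnj (h ze) \<partial>mu)"
  by (rule integral_cong_AE) (measurable, use assms(3) in auto)
 then show "(\<integral>ze. (f ze - g' ze) * cnj (h ze) \<partial>mu) = 0"
  using assms(1) h by (simp add: szego_rel_def)
qed

abbreviation (input) sigma :: "complex measure" where "sigma \<equiv> arc_length (frontier Omega)"

abbreviation (input) pint :: "real \<Rightarrow> (complex \<Rightarrow> complex) \<Rightarrow> ennreal" where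
 "pint p f \<equiv> (\<integral>\<^sup>+b. ennreal (norm (f b) powr p) \<partial>sigma)"

text \<open>Only the modulus of w is prescribed, so the locale also covers the positive square root
  of \<open>bd_deriv\<close>, which serves for statements about null sets.\<close>

locale good_map = omega_map +
 fixes w :: "complex \<Rightarrow> complex"
 assumes w_meas: "w \<in> borel_measurable mu"
  and w_bd: "AE ze in mu. (norm (w ze))\<^sup>2 = bd_deriv \<phi> ze"
begin

lemma sets_sigma: "sets sigma = sets (restrict_space borel (frontier Omega))"
 by (simp add: arc_length_frontier)

lemma space_sigma: "space sigma = frontier Omega" by (simp add: arc_length_frontier space_restrict_space)

lemma phi_meas: "\<phi> \<in> measurable mu sigma"
 using phi_measurable by (simp add: measurable_cong_sets[OF refl sets_sigma])

lemma comp_meas: "F \<in> borel_measurable sigma ==> (\<lambda>ze. F (\<phi> ze)) \<in> borel_measurable mu"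
 using measurable_compose[OF phi_meas] .

lemma w_nz: "AE ze in mu. w ze \<noteq> 0" using w_bd AE_circle
proof eventually_elim
 case (elim ze)
 then show ?case using bd_deriv_pos[of ze] by auto
qed

lemma sigma_eq: "sigma = distr (density mu (\<lambda>ze. ennreal ((norm (w ze))\<^sup>2))) (restrict_space borel (frontier Omega)) \<phi>"
proof -
 have "density mu (\<lambda>ze. ennreal (bd_deriv \<phi> ze)) = density mu (\<lambda>ze. ennreal ((norm (w ze))\<^sup>2))"
  using bd_deriv_measurable[OF facts(2)] w_meas by (intro density_cong) (use w_bd in auto)
 then show ?thesis unfolding arc_length_frontier by simp
qed

lemma nn_integral_sigma:
 assumes "F \<in> borel_measurable sigma"
 shows "(\<integral>\<^sup>+b. F b \<partial>sigma) = (\<integral>\<^sup>+ze. ennreal ((norm (w ze))\<^sup>2) * F (\<phi> ze) \<partial>mu)"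
proof -
 have F: "F \<in> borel_measurable (restrict_space borel (frontier Omega))"
  using assms by (simp add: measurable_cong_sets[OF sets_sigma refl])
 have "(\<integral>\<^sup>+b. F b \<partial>sigma) = (\<integral>\<^sup>+ze. F (\<phi> ze) \<partial>density mu (\<lambda>ze. ennreal ((norm (w ze))\<^sup>2)))"
  unfolding sigma_eq using phi_measurable F by (subst nn_integral_distr) auto
 also have "\<dots> = (\<integral>\<^sup>+ze. ennreal ((norm (w ze))\<^sup>2) * F (\<phi> ze) \<partial>mu)"
  using w_meas comp_meas[OF assms] by (subst nn_integral_density) auto
 finally show ?thesis .
qed

lemma integral_sigma:
 fixes F :: "complex \<Rightarrow> complex"
 assumes "F \<in> borel_measurable sigma"
 shows "(\<integral>b. F b \<partial>sigma) = (\<integral>ze. (norm (w ze))\<^sup>2 *\<^sub>R F (\<phi> ze) \<partial>mu)"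
proof -
 have F: "F \<in> borel_measurable (restrict_space borel (frontier Omega))"
  using assms by (simp add: measurable_cong_sets[OF sets_sigma refl])
 have "(\<integral>b. F b \<partial>sigma) = (\<integral>ze. F (\<phi> ze) \<partial>density mu (\<lambda>ze. ennreal ((norm (w ze))\<^sup>2)))"
  unfolding sigma_eq using phi_measurable F by (subst integral_distr) auto
 also have "\<dots> = (\<integral>ze. (norm (w ze))\<^sup>2 *\<^sub>R F (\<phi> ze) \<partial>mu)"
  using w_meas comp_meas[OF assms] by (subst integral_density) auto
 finally show ?thesis .
qed

text \<open>The density |w|^2 is positive almost everywhere, so null sets of the frontier and of the
  circle correspond.\<close>

lemma AE_sigma_iff:
 assumes "{b \<in> space sigma. P b} \<in> sets sigma"
 shows "(AE b in sigma. P b) \<longleftrightarrow> (AE ze in mu. P (\<phi> ze))"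
proof -
 have "(AE b in sigma. P b) \<longleftrightarrow> (AE ze in density mu (\<lambda>ze. ennreal ((norm (w ze))\<^sup>2)). P (\<phi> ze))"
  unfolding sigma_eq using phi_measurable assms
  by (subst AE_distr_iff) (auto simp: space_sigma sets_sigma space_restrict_space)
 also have "\<dots> \<longleftrightarrow> (AE ze in mu. 0 < ennreal ((norm (w ze))\<^sup>2) \<longrightarrow> P (\<phi> ze))"
  using w_meas by (subst AE_density) auto
 also have "\<dots> \<longleftrightarrow> (AE ze in mu. P (\<phi> ze))"
 proof
  assume "AE ze in mu. 0 < ennreal ((norm (w ze))\<^sup>2) \<longrightarrow> P (\<phi> ze)"
  then show "AE ze in mu. P (\<phi> ze)" using w_nz by eventually_elim auto
 next
  assume "AE ze in mu. P (\<phi> ze)"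
  then show "AE ze in mu. 0 < ennreal ((norm (w ze))\<^sup>2) \<longrightarrow> P (\<phi> ze)" by eventually_elim auto
 qed
 finally show ?thesis .
qed

definition psi where "psi = (SOME \<psi>. homeomorphism (cball 0 1) (closure Omega) \<phi> \<psi>)"

lemma psi_homeo: "homeomorphism (cball 0 1) (closure Omega) \<phi> psi"
proof -
 have "\<exists>\<psi>. homeomorphism (cball 0 1) (closure Omega) \<phi> \<psi>"
  using R unfolding riemann_map_def by (elim conjE)
 then show ?thesis unfolding psi_def by (rule someI_ex)
qed

lemma psi_phi: "norm z \<le> 1 ==> psi (\<phi> z) = z" using homeomorphism_apply1[OF psi_homeo] by simp

lemma psi_meas: "psi \<in> measurable sigma mu"
proof -
 have sub: "frontier Omega \<subseteq> closure Omega" by (auto simp: frontier_def)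
 have "continuous_on (frontier Omega) psi"
  using homeomorphism_cont2[OF psi_homeo] sub by (rule continuous_on_subset)
 then have "psi \<in> measurable (restrict_space borel (frontier Omega)) (restrict_space borel (sphere 0 1))"
 proof (intro measurable_restrict_space2 borel_measurable_continuous_on_restrict)
  show "psi \<in> space (restrict_space borel (frontier Omega)) \<rightarrow> sphere 0 1"
  proof
   fix b assume "b \<in> space (restrict_space borel (frontier Omega))"
   then have "b \<in> \<phi> ` sphere 0 1" by (simp only: facts(6) space_restrict_space space_borel Int_UNIV_right)
   then obtain ze where ze: "ze \<in> sphere 0 1" "b = \<phi> ze" by blast
   then have "psi b = ze" unfolding ze(2) by (intro psi_phi) simp
   then show "psi b \<in> sphere 0 1" using ze(1) by simp
  qed
 qed
 then show ?thesis by (simp add: measurable_cong_sets[OF sets_sigma sets_circle_measure])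
qed

abbreviation "tau \<equiv> tau_half \<phi> w"

lemma tau_meas: "f \<in> borel_measurable sigma ==> tau f \<in> borel_measurable mu"
 unfolding tau_half_def[abs_def] by (intro borel_measurable_times comp_meas w_meas)

text \<open>The change of variables turns L^p of the frontier into L^p of the circle with weight
  |w|^(2 - p), because composition with \<phi> costs |w|^2 and \<tau> multiplies by w.\<close>

lemma tau_powr:
 assumes f: "f \<in> borel_measurable sigma"
 shows "pint p f
  = (\<integral>\<^sup>+ze. ennreal (norm (tau f ze) powr p * norm (w ze) powr (2 - p)) \<partial>mu)"
proof -
 have "pint p f
   = (\<integral>\<^sup>+ze. ennreal ((norm (w ze))\<^sup>2) * ennreal (norm (f (\<phi> ze)) powr p) \<partial>mu)"
  using f by (intro nn_integral_sigma) simp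
 also have "\<dots> = (\<integral>\<^sup>+ze. ennreal (norm (tau f ze) powr p * norm (w ze) powr (2 - p)) \<partial>mu)"
 proof (rule nn_integral_cong_AE)
  show "AE ze in mu. ennreal ((norm (w ze))\<^sup>2) * ennreal (norm (f (\<phi> ze)) powr p)
   = ennreal (norm (tau f ze) powr p * norm (w ze) powr (2 - p))" using w_nz
  proof eventually_elim
   case (elim ze)
   then have n: "norm (w ze) > 0" by simp
   have "norm (tau f ze) powr p * norm (w ze) powr (2 - p) = norm (f (\<phi> ze)) powr p * (norm (w ze) powr p * norm (w ze) powr (2 - p))"
    using n by (simp add: tau_half_def norm_mult powr_mult)
   also have "norm (w ze) powr p * norm (w ze) powr (2 - p) = (norm (w ze))\<^sup>2"
    using n by (simp add: powr_numeral flip: powr_add)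
   finally show ?case by (simp add: ennreal_mult'' mult.commute)
  qed
 qed
 finally show ?thesis .
qed

lemma tau_sq:
 assumes f: "f \<in> borel_measurable sigma"
 shows "(\<integral>\<^sup>+b. ennreal ((norm (f b))\<^sup>2) \<partial>sigma) = (\<integral>\<^sup>+ze. ennreal ((norm (tau f ze))\<^sup>2) \<partial>mu)"
proof -
 have "(\<integral>\<^sup>+b. ennreal ((norm (f b))\<^sup>2) \<partial>sigma)
   = (\<integral>\<^sup>+ze. ennreal ((norm (w ze))\<^sup>2) * ennreal ((norm (f (\<phi> ze)))\<^sup>2) \<partial>mu)"
  using f by (intro nn_integral_sigma) simp
 also have "\<dots> = (\<integral>\<^sup>+ze. ennreal ((norm (tau f ze))\<^sup>2) \<partial>mu)"
  by (intro nn_integral_cong) (simp add: tau_half_def norm_mult power_mult_distrib ennreal_mult'' mult.commute)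
 finally show ?thesis .
qed

lemma tau_L2_iff:
 assumes f: "f \<in> borel_measurable sigma"
 shows "L2 mu (tau f) \<longleftrightarrow> L2 sigma f"
 using tau_sq[OF f] f tau_meas[OF f] by (simp add: L2_def integrable_iff_bounded)

lemma tau_L2: "L2 sigma f ==> L2 mu (tau f)" using tau_L2_iff L2_measurable by blast

lemma tau_norm2:
 assumes f: "L2 sigma f"
 shows "(\<integral>b. (norm (f b))\<^sup>2 \<partial>sigma) = (\<integral>ze. (norm (tau f ze))\<^sup>2 \<partial>mu)"
proof -
 have "(\<integral>b. (norm (f b))\<^sup>2 \<partial>sigma) = enn2real (\<integral>\<^sup>+b. ennreal ((norm (f b))\<^sup>2) \<partial>sigma)"
  by (rule integral_eq_nn_integral) (use L2_measurable[OF f] in auto)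
 also have "\<dots> = enn2real (\<integral>\<^sup>+ze. ennreal ((norm (tau f ze))\<^sup>2) \<partial>mu)"
  by (subst tau_sq[OF L2_measurable[OF f]]) (rule refl)
 also have "\<dots> = (\<integral>ze. (norm (tau f ze))\<^sup>2 \<partial>mu)"
  by (rule integral_eq_nn_integral[symmetric]) (use L2_measurable[OF tau_L2[OF f]] in auto)
 finally show ?thesis .
qed

lemma tau_inner:
 assumes "L2 sigma f" "L2 sigma k"
 shows "(\<integral>b. f b * cnj (k b) \<partial>sigma) = (\<integral>ze. tau f ze * cnj (tau k ze) \<partial>mu)"
proof -
 have "(\<integral>b. f b * cnj (k b) \<partial>sigma) = (\<integral>ze. (norm (w ze))\<^sup>2 *\<^sub>R (f (\<phi> ze) * cnj (k (\<phi> ze))) \<partial>mu)"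
  by (intro integral_sigma borel_measurable_times L2_measurable assms L2_cnj)
 also have "\<dots> = (\<integral>ze. tau f ze * cnj (tau k ze) \<partial>mu)"
 proof (intro Bochner_Integration.integral_cong refl)
  fix ze
  have "complex_of_real ((norm (w ze))\<^sup>2) = w ze * cnj (w ze)" by (rule complex_norm_square)
  then show "(norm (w ze))\<^sup>2 *\<^sub>R (f (\<phi> ze) * cnj (k (\<phi> ze))) = tau f ze * cnj (tau k ze)"
   by (simp only: tau_half_def scaleR_conv_of_real complex_cnj_mult mult_ac)
 qed
 finally show ?thesis .
qed

text \<open>The preimage is g/w composed with the inverse homeomorphism; zeros of w form a null
  set.\<close>

lemma tau_surj:
 assumes g: "L2 mu g"
 obtains F where "L2 sigma F" "AE ze in mu. tau F ze = g ze"
proof -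
 define F where "F b = g (psi b) / w (psi b)" for b
 have Fm: "F \<in> borel_measurable sigma" unfolding F_def[abs_def]
  using measurable_compose[OF psi_meas L2_measurable[OF g]] measurable_compose[OF psi_meas w_meas] by simp
 have ae: "AE ze in mu. tau F ze = g ze" using w_nz AE_space
 proof eventually_elim
  case (elim ze)
  then show ?case using psi_phi[of ze] by (simp add: tau_half_def F_def)
 qed
 have "L2 mu (tau F)" by (rule L2_dom[OF g tau_meas[OF Fm]]) (use ae in auto)
 then have "L2 sigma F" using tau_L2_iff[OF Fm] by blast
 then show ?thesis using that ae by blast
qed

abbreviation "T \<equiv> szego_projection Omega \<phi> w"

text \<open>Resolves both choices inside \<open>szego_projection\<close>: the inner one by existence
  of the projection on the circle, the outer one by surjectivity of the boundary transform.\<close>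

lemma proj_props:
 assumes f: "L2 sigma f"
 shows "L2 sigma (T f)" "szego_rel (tau f) (tau (T f))"
proof -
 note sr = szego_rel_szego_disc[OF tau_L2[OF f]]
 obtain F where "L2 sigma F" "AE ze in mu. tau F ze = szego_disc (tau f) ze"
  using tau_surj[OF szego_rel_L2[OF sr]] by blast
 then have "\<exists>F. F \<in> Lp_space sigma 2 \<and> (AE ze in mu. tau F ze = szego_disc (tau f) ze)"
  unfolding Lp_space_2_iff by blast
 from someI_ex[OF this] have *: "T f \<in> Lp_space sigma 2" "AE ze in mu. tau (T f) ze = szego_disc (tau f) ze"
  unfolding szego_projection_def tau_half_inv_def by auto
 show L: "L2 sigma (T f)" using *(1) by (simp add: Lp_space_2_iff)
 show "szego_rel (tau f) (tau (T f))"
  by (rule szego_rel_AE[OF sr tau_meas[OF L2_measurable[OF L]] *(2) tau_L2[OF f]])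
qed

lemma AE_eq_sigma:
 assumes "F \<in> borel_measurable sigma" "G \<in> borel_measurable sigma" "AE ze in mu. tau F ze = tau G ze"
 shows "AE b in sigma. F b = G b"
proof -
 have [measurable]: "F \<in> borel_measurable sigma" "G \<in> borel_measurable sigma" by fact+
 have "AE ze in mu. F (\<phi> ze) = G (\<phi> ze)"
  using assms(3) w_nz by eventually_elim (simp add: tau_half_def)
 then show ?thesis by (subst AE_sigma_iff) measurable
qed

lemma proj_unique:
 assumes "L2 sigma f" "L2 sigma F" "szego_rel (tau f) (tau F)"
 shows "AE b in sigma. F b = T f b"
 by (rule AE_eq_sigma[OF L2_measurable[OF assms(2)] L2_measurable[OF proj_props(1)[OF assms(1)]]])
   (rule szego_rel_unique[OF assms(3) proj_props(2)[OF assms(1)] tau_L2[OF assms(1)]])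

text \<open>Both sides equal the inner product of T f and T k, because f - T f and k - T k are
  transformed to functions orthogonal to the Hardy space.\<close>

lemma selfadjoint:
 assumes f: "L2 sigma f" and k: "L2 sigma k"
 shows "(\<integral>b. T f b * cnj (k b) \<partial>sigma) = (\<integral>b. f b * cnj (T k b) \<partial>sigma)"
proof -
 note Lf = tau_L2[OF f] and Lk = tau_L2[OF k]
 note LTf = tau_L2[OF proj_props(1)[OF f]] and LTk = tau_L2[OF proj_props(1)[OF k]]
 note sf = proj_props(2)[OF f] and sk = proj_props(2)[OF k]
 have 1: "(\<integral>ze. (tau f ze - tau (T f) ze) * cnj (tau (T k) ze) \<partial>mu) = 0"
  using sf szego_rel_H2[OF sk] by (simp add: szego_rel_def)
 have 2: "(\<integral>ze. (tau k ze - tau (T k) ze) * cnj (tau (T f) ze) \<partial>mu) = 0"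
  using sk szego_rel_H2[OF sf] by (simp add: szego_rel_def)
 have sp: "(\<integral>ze. (a ze - b ze) * cnj (c ze) \<partial>mu) = (\<integral>ze. a ze * cnj (c ze) \<partial>mu) - (\<integral>ze. b ze * cnj (c ze) \<partial>mu)"
  if "L2 mu a" "L2 mu b" "L2 mu c" for a b c
  unfolding left_diff_distrib using that by (intro Bochner_Integration.integral_diff L2_prod L2_cnj)
 have c: "cnj (\<integral>ze. a ze * cnj (b ze) \<partial>mu) = (\<integral>ze. b ze * cnj (a ze) \<partial>mu)" for a b
 proof -
  have "(\<integral>ze. b ze * cnj (a ze) \<partial>mu) = (\<integral>ze. cnj (a ze * cnj (b ze)) \<partial>mu)"
   by (simp add: mult.commute)
  also have "\<dots> = cnj (\<integral>ze. a ze * cnj (b ze) \<partial>mu)"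
   by (simp add: integral_cnj del: complex_cnj_mult)
  finally show ?thesis ..
 qed
 have 3: "(\<integral>ze. tau k ze * cnj (tau (T f) ze) \<partial>mu) = (\<integral>ze. tau (T k) ze * cnj (tau (T f) ze) \<partial>mu)"
  using 2[unfolded sp[OF Lk LTk LTf]] by (simp only: right_minus_eq)
 have "(\<integral>ze. tau (T f) ze * cnj (tau k ze) \<partial>mu) = (\<integral>ze. tau (T f) ze * cnj (tau (T k) ze) \<partial>mu)"
  using arg_cong[OF 3, of cnj] unfolding c .
 also have "\<dots> = (\<integral>ze. tau f ze * cnj (tau (T k) ze) \<partial>mu)"
  using 1[unfolded sp[OF Lf LTf LTk]] by (simp only: right_minus_eq)
 finally show ?thesis unfolding tau_inner[OF proj_props(1)[OF f] k] tau_inner[OF f proj_props(1)[OF k]] .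
qed

lemma w_norm_integral: "(\<integral>\<^sup>+ze. ennreal ((norm (w ze))\<^sup>2) \<partial>mu) < \<infinity>"
proof -
 have "AE ze in mu. ennreal ((norm (w ze))\<^sup>2) = ennreal (bd_deriv \<phi> ze)"
  using w_bd by eventually_elim (rule arg_cong)
 from nn_integral_cong_AE[OF this] show ?thesis using bd_deriv_finite by (simp only:)
qed

lemma finite_sigma: "finite_measure sigma"
proof (rule finite_measureI)
 have "(\<integral>\<^sup>+b. 1 \<partial>sigma) = (\<integral>\<^sup>+ze. ennreal ((norm (w ze))\<^sup>2) * 1 \<partial>mu)"
  by (rule nn_integral_sigma[of "\<lambda>_. 1"]) (rule measurable_const, simp)
 with w_norm_integral have "(\<integral>\<^sup>+b. 1 \<partial>sigma) < \<infinity>" by (simp only: mult_1_right)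
 then show "emeasure sigma (space sigma) \<noteq> \<infinity>" by simp
qed

end

text \<open>The radius ending at ze lies in the Stolz region with constant 2, since |r ze - ze| = 1
  - r < 2 (1 - r). So the non-tangential limit of h is also its limit along the sequence that
  defines \<open>bd_deriv\<close>.\<close>

lemma good_map_of_boundary_values:
 assumes R: "riemann_map Omega \<phi>" and s: "sqrt_deriv_boundary \<phi> w"
 shows "good_map \<phi> w"
proof -
 interpret omega_map \<phi> by unfold_locales (rule R)
 obtain h where h0: "\<forall>z\<in>ball 0 1. (h z)\<^sup>2 = deriv \<phi> z" "nontangential_boundary_values h w"
  using s[unfolded sqrt_deriv_boundary_def] by (elim bexE conjE)
 have h: "(h z)\<^sup>2 = deriv \<phi> z" if "z \<in> ball 0 1" for z using h0(1) that by (rule bspec)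
 show ?thesis
 proof
  show "w \<in> borel_measurable mu" using h0(2) by (simp add: nontangential_boundary_values_def)
  have ae: "AE ze in mu. \<forall>M>1. (h \<longlongrightarrow> w ze) (at ze within stolz_region ze M)"
   using h0(2) by (simp add: nontangential_boundary_values_def)
  show "AE ze in mu. (norm (w ze))\<^sup>2 = bd_deriv \<phi> ze" using ae AE_space
  proof eventually_elim
   case (elim ze)
   then have z: "norm ze = 1" and l: "(h \<longlongrightarrow> w ze) (at ze within stolz_region ze 2)" by auto
   let ?r = "\<lambda>n. complex_of_real (1 - 1 / real (n + 2)) * ze"
   have st: "?r n \<in> ball 0 1 \<inter> stolz_region ze 2" "?r n \<noteq> ze" for n
   proof -
    have r: "0 < 1 - 1 / real (n + 2)" "1 - 1 / real (n + 2) < 1" by (auto simp: field_simps)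
    have n: "norm (?r n) = 1 - 1 / real (n + 2)" unfolding norm_mult norm_of_real z using r by simp
    have "?r n - ze = - (of_real (1 / real (n + 2)) * ze)" by (simp add: algebra_simps)
    then have d: "norm (?r n - ze) = 1 / real (n + 2)"          by (simp only: norm_minus_cancel norm_mult norm_of_real z) simp
    have q: "1 / real (n + 2) > 0" by simp
    show "?r n \<noteq> ze" using n r z by auto
    show "?r n \<in> ball 0 1 \<inter> stolz_region ze 2"
    proof -
     have "norm (?r n) < 1" using n r by linarith
     moreover have "norm (?r n - ze) < 2 * (1 - norm (?r n))"
     proof -
      have aux: "x < 2 * (1 - (1 - x))" if "x > 0" for x :: real using that by simp
      show ?thesis unfolding n d by (rule aux[OF q])
     qed
     ultimately show ?thesis unfolding stolz_region_def Int_iff mem_ball_0 mem_Collect_eq by blast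
    qed
   qed
   have "filterlim ?r (at ze within stolz_region ze 2) sequentially"
   proof -
    have "(\<lambda>n. ?r n) \<longlonglongrightarrow> ze" using radial_tendsto[OF z] by (simp only: filterlim_at)
    then show ?thesis unfolding filterlim_at using st by (intro conjI always_eventually allI) blast+
   qed
   then have "(\<lambda>n. h (?r n)) \<longlonglongrightarrow> w ze" by (rule filterlim_compose[OF l])
   then have "(\<lambda>n. (norm (h (?r n)))\<^sup>2) \<longlonglongrightarrow> (norm (w ze))\<^sup>2" by (intro tendsto_intros)
   moreover have "(norm (h (?r n)))\<^sup>2 = norm (deriv \<phi> (?r n))" for n
    unfolding norm_power[symmetric] using st(1)[of n] by (subst h) (rule IntD1, assumption, rule refl)
   ultimately have "(\<lambda>n. norm (deriv \<phi> (?r n))) \<longlonglongrightarrow> (norm (w ze))\<^sup>2" by simp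
   then show ?case unfolding bd_deriv_def by (simp add: limI)
  qed
 qed
qed

section \<open>Independence of the operator from the Riemann map\<close>

section \<open>Automorphisms of the disc and change of the Riemann map\<close>

text \<open>The automorphism of the disc that takes 0 to a and has a positive multiple of c as
  derivative at 0.\<close>

definition disc_aut :: "complex \<Rightarrow> complex \<Rightarrow> complex \<Rightarrow> complex" where
 "disc_aut a c z = (c * z + a) / (1 + cnj a * c * z)"

text \<open>A holomorphic square root of the derivative of \<open>disc_aut a c\<close> divided by c;
  it is the multiplier that the boundary transform picks up under the automorphism.\<close>

definition aut_root :: "complex \<Rightarrow> complex \<Rightarrow> complex \<Rightarrow> complex" where
 "aut_root a c z = of_real (sqrt (1 - (norm a)\<^sup>2)) / (1 + cnj a * c * z)"

lemma disc_aut_denom: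
 assumes "norm a < 1" "norm c = 1" "norm z \<le> 1"
 shows "1 + cnj a * c * z \<noteq> 0"
proof
 assume "1 + cnj a * c * z = 0"
 then have "cnj a * c * z = - 1" by (simp only: eq_neg_iff_add_eq_0 add.commute)
 then have "norm (cnj a * c * z) = 1" by (simp only: norm_minus_cancel norm_one)
 moreover have "norm (cnj a * c * z) = norm a * norm z" using assms by (simp add: norm_mult)
 moreover have "norm a * norm z \<le> norm a * 1" using assms by (intro mult_left_mono) auto
 ultimately show False using assms(1) by linarith
qed

lemma one_minus_norm_sq_pos: "norm (a::complex) < 1 ==> 0 < 1 - (norm a)\<^sup>2"
 by (simp add: power_less_one_iff)

lemma disc_aut_norm:
 assumes "norm a < 1" "norm c = 1" "norm z \<le> 1"
 shows "1 - (norm (disc_aut a c z))\<^sup>2 = (1 - (norm a)\<^sup>2) * (1 - (norm z)\<^sup>2) / (norm (1 + cnj a * c * z))\<^sup>2"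
proof -
 have alg: "(norm (1 + cnj a * u))\<^sup>2 - (norm (u + a))\<^sup>2 = (1 - (norm a)\<^sup>2) * (1 - (norm u)\<^sup>2)" for u :: complex
  unfolding cmod_power2 by (simp add: algebra_simps power2_eq_square)
 have d: "norm (1 + cnj a * (c * z)) \<noteq> 0" using disc_aut_denom[OF assms] by (simp add: mult.assoc)
 have "1 - (norm (disc_aut a c z))\<^sup>2 = ((norm (1 + cnj a * (c * z)))\<^sup>2 - (norm (c * z + a))\<^sup>2) / (norm (1 + cnj a * (c * z)))\<^sup>2"
  using d by (simp add: disc_aut_def norm_divide power_divide diff_divide_distrib mult.assoc)
 then show ?thesis unfolding alg using assms(2) by (simp add: norm_mult mult.assoc)
qed

lemma disc_aut_maps:
 assumes a: "norm a < 1" and c: "norm c = 1"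
 shows "norm z < 1 ==> norm (disc_aut a c z) < 1"
  "norm z \<le> 1 ==> norm (disc_aut a c z) \<le> 1"
  "norm z = 1 ==> norm (disc_aut a c z) = 1"
proof -
 have lt: "norm x < 1 \<longleftrightarrow> 0 < 1 - (norm x)\<^sup>2" and le: "norm x \<le> 1 \<longleftrightarrow> 0 \<le> 1 - (norm x)\<^sup>2" for x :: complex
  using power2_less_imp_less[of "norm x" 1] power2_le_imp_le[of "norm x" 1] power_le_one[of "norm x" 2]
   one_minus_norm_sq_pos[of x] by auto
 note a' = one_minus_norm_sq_pos[OF a]
 { assume z: "norm z < 1"
  then have d: "0 < norm (1 + cnj a * c * z)" using disc_aut_denom[OF a c, of z] by simp
  show "norm (disc_aut a c z) < 1" unfolding lt using disc_aut_norm[OF a c, of z] z a' d lt[of z] by simp }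
 { assume z: "norm z \<le> 1"
  show "norm (disc_aut a c z) \<le> 1" unfolding le using disc_aut_norm[OF a c, of z] z a' le[of z] by simp }
 { assume z: "norm z = 1"
  then have "1 - (norm (disc_aut a c z))\<^sup>2 = 0" using disc_aut_norm[OF a c, of z] by simp
  then have "(norm (disc_aut a c z))\<^sup>2 = 1" by simp
  then show "norm (disc_aut a c z) = 1" by (simp add: power2_eq_1_iff) (metis norm_ge_zero neg_0_le_iff_le not_one_le_zero) }
qed

lemma disc_aut_inverse:
 assumes a: "norm a < 1" and c: "norm c = 1" and z: "norm z \<le> 1"
 shows "disc_aut (- cnj c * a) (cnj c) (disc_aut a c z) = z"
proof -
 define D where "D = 1 + cnj a * c * z"
 define k where "k = disc_aut a c z"
 have D: "D \<noteq> 0" using disc_aut_denom[OF assms] by (simp add: D_def)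
 have cc: "c * cnj c = 1" using c complex_norm_square[of c] by simp
 have kD: "k * D = c * z + a" using D by (simp add: k_def disc_aut_def D_def)
 have "a * cnj a \<noteq> 1"
 proof
  assume "a * cnj a = 1"
  then have "norm (a * cnj a) = 1" by (simp only: norm_one)
  then have "(norm a)\<^sup>2 = 1" by (simp add: norm_mult power2_eq_square)
  then show False using one_minus_norm_sq_pos[OF a] by linarith
 qed
 then have s: "1 - a * cnj a \<noteq> 0" by simp
 have 1: "(k - a) * D = c * z * (1 - a * cnj a)"
  unfolding left_diff_distrib kD by (simp add: D_def algebra_simps)
 have 2: "(1 - cnj a * k) * D = 1 - a * cnj a"
 proof -
  have "(1 - cnj a * k) * D = D - cnj a * (k * D)" by (simp add: algebra_simps)
  then show ?thesis unfolding kD by (simp add: D_def algebra_simps)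
 qed
 have n: "1 - cnj a * k \<noteq> 0" using 2 s by auto
 have "c * cnj a * cnj c * k = cnj a * k" using cc by (simp add: algebra_simps)
 then have "disc_aut (- cnj c * a) (cnj c) k = cnj c * (k - a) / (1 - cnj a * k)"
  by (simp add: disc_aut_def algebra_simps)
 also have "\<dots> = cnj c * ((k - a) * D) / ((1 - cnj a * k) * D)" using D n by simp
 also have "\<dots> = (c * cnj c) * z" unfolding 1 2 using s by simp
 finally show ?thesis by (simp only: cc k_def mult_1_left)
qed

lemma disc_aut_inverse':
 assumes a: "norm a < 1" and c: "norm c = 1" and z: "norm z \<le> 1"
 shows "disc_aut a c (disc_aut (- cnj c * a) (cnj c) z) = z"
proof -
 have cc: "c * cnj c = 1" using c complex_norm_square[of c] by simp
 have "- cnj (cnj c) * (- cnj c * a) = (c * cnj c) * a" by simp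
 then have e: "- cnj (cnj c) * (- cnj c * a) = a" by (simp only: cc mult_1_left)
 have "norm (- cnj c * a) < 1" "norm (cnj c) = 1" using a c by (auto simp: norm_mult)
 from disc_aut_inverse[OF this z] show ?thesis unfolding e unfolding complex_cnj_cnj .
qed

lemma disc_aut_deriv:
 assumes "norm a < 1" "norm c = 1" "norm z \<le> 1"
 shows "(disc_aut a c has_field_derivative c * (aut_root a c z)\<^sup>2) (at z)"
proof -
 note d = disc_aut_denom[OF assms]
 have s: "(complex_of_real (sqrt (1 - (norm a)\<^sup>2)))\<^sup>2 = 1 - a * cnj a"
  using one_minus_norm_sq_pos[OF assms(1)] by (simp add: complex_norm_square flip: of_real_power)
 have "(disc_aut a c has_field_derivative (c * (1 + cnj a * c * z) - (c * z + a) * (cnj a * c)) / ((1 + cnj a * c * z) * (1 + cnj a * c * z))) (at z)"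
  unfolding disc_aut_def[abs_def] using d by (auto intro!: derivative_eq_intros)
 moreover have "(c * (1 + cnj a * c * z) - (c * z + a) * (cnj a * c)) / ((1 + cnj a * c * z) * (1 + cnj a * c * z)) = c * (aut_root a c z)\<^sup>2"
  unfolding aut_root_def power_divide s by (simp add: power2_eq_square algebra_simps)
 ultimately show ?thesis by simp
qed

lemma disc_aut_cont: "norm a < 1 ==> norm c = 1 ==> continuous_on (cball 0 1) (disc_aut a c)"
 by (rule DERIV_continuous_on[where D="\<lambda>z. c * (aut_root a c z)\<^sup>2"]) (rule has_field_derivative_at_within, rule disc_aut_deriv, auto)

lemma disc_aut_holo: "norm a < 1 ==> norm c = 1 ==> disc_aut a c holomorphic_on ball 0 1"
 unfolding holomorphic_on_open[OF open_ball] by (intro ballI exI, rule disc_aut_deriv) auto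

lemma aut_root_cont: "norm a < 1 ==> norm c = 1 ==> continuous_on (cball 0 1) (aut_root a c)"
 unfolding aut_root_def[abs_def]
 by (intro continuous_on_divide continuous_on_add continuous_on_mult continuous_on_const continuous_on_id ballI)
  (rule disc_aut_denom, auto)

lemma aut_root_holo: "norm a < 1 ==> norm c = 1 ==> aut_root a c holomorphic_on ball 0 1"
 unfolding aut_root_def[abs_def] by (intro holomorphic_intros) (rule disc_aut_denom, auto)

lemma aut_root_nz: "norm a < 1 ==> norm c = 1 ==> norm z \<le> 1 ==> aut_root a c z \<noteq> 0"
 using disc_aut_denom[of a c z] one_minus_norm_sq_pos[of a] by (simp add: aut_root_def)

lemma riemann_map_disc_aut:
 assumes R: "riemann_map \<Omega> \<phi>" and a: "norm a < 1" and c: "norm c = 1"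
 shows "riemann_map \<Omega> (\<lambda>z. \<phi> (disc_aut a c z))"
proof -
 let ?k = "disc_aut a c" and ?l = "disc_aut (- cnj c * a) (cnj c)"
 have a': "norm (- cnj c * a) < 1" "norm (cnj c) = 1" using a c by (auto simp: norm_mult)
 note m = disc_aut_maps[OF a c] and m' = disc_aut_maps[OF a']
 note i = disc_aut_inverse[OF a c] and i' = disc_aut_inverse'[OF a c]
 have b: "?k ` ball 0 1 = ball 0 1"
 proof
  show "?k ` ball 0 1 \<subseteq> ball 0 1" using m(1) by auto
  show "ball 0 1 \<subseteq> ?k ` ball 0 1"
  proof
   fix z :: complex assume "z \<in> ball 0 1"
   then have "z = ?k (?l z)" "?l z \<in> ball 0 1" using i'[of z] m'(1)[of z] by auto
   then show "z \<in> ?k ` ball 0 1" by blast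
  qed
 qed
 obtain \<psi> where \<psi>: "homeomorphism (cball 0 1) (closure \<Omega>) \<phi> \<psi>" and h: "\<phi> holomorphic_on ball 0 1" "\<phi> ` ball 0 1 = \<Omega>"
  using R unfolding riemann_map_def by (elim conjE exE)
 have hk: "homeomorphism (cball 0 1) (cball 0 1) ?k ?l"
 proof (rule homeomorphismI)
  show "continuous_on (cball 0 1) ?k" by (rule disc_aut_cont[OF a c])
  show "continuous_on (cball 0 1) ?l" by (rule disc_aut_cont[OF a'])
  show "?k ` cball 0 1 \<subseteq> cball 0 1" using m(2) by auto
  show "?l ` cball 0 1 \<subseteq> cball 0 1" using m'(2) by auto
  show "?l (?k z) = z" if "z \<in> cball 0 1" for z by (rule i) (use that in simp)
  show "?k (?l z) = z" if "z \<in> cball 0 1" for z by (rule i') (use that in simp)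
 qed
 show ?thesis unfolding riemann_map_def
 proof (intro conjI exI)
  show "(\<lambda>z. \<phi> (?k z)) holomorphic_on ball 0 1"
   using holomorphic_on_compose_gen[OF disc_aut_holo[OF a c] h(1) equalityD1[OF b]] by (simp only: o_def)
  show "(\<lambda>z. \<phi> (?k z)) ` ball 0 1 = \<Omega>" unfolding h(2)[symmetric] by (subst (2) b[symmetric]) (simp only: image_image)
  show "homeomorphism (cball 0 1) (closure \<Omega>) (\<lambda>z. \<phi> (?k z)) (?l \<circ> \<psi>)"
   using homeomorphism_compose[OF hk \<psi>] by (simp only: o_def)
 qed
qed

lemma good_map_sqrt: "omega_map \<phi> ==> good_map \<phi> (\<lambda>ze. of_real (sqrt (bd_deriv \<phi> ze)))"
proof -
 assume "omega_map \<phi>"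
 then interpret omega_map \<phi> .
 show ?thesis
 proof
  show "(\<lambda>ze. complex_of_real (sqrt (bd_deriv \<phi> ze))) \<in> borel_measurable mu"
   using bd_deriv_measurable[OF facts(2)] by measurable
  show "AE ze in mu. (norm (complex_of_real (sqrt (bd_deriv \<phi> ze))))\<^sup>2 = bd_deriv \<phi> ze"
   using AE_circle
  proof eventually_elim
   case (elim ze)
   then have "bd_deriv \<phi> ze > 0" by (rule bd_deriv_pos)
   then show ?case by simp
  qed
 qed
qed

text \<open>Instead of estimating k on the circle, a null set is sent to the frontier by \<phi> and
  pulled back by \<phi>'; both correspond to null sets of the same arc length measure.\<close>

lemma AE_transfer:
 assumes O: "omega_map \<phi>" "omega_map \<phi>'"
  and k: "\<And>ze. norm ze = 1 ==> \<phi>' ze = \<phi> (k ze)" "\<And>ze. norm ze = 1 ==> norm (k ze) = 1"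
  and ae: "AE \<xi> in mu. Q \<xi>"
 shows "AE ze in mu. Q (k ze)"
proof -
 interpret A: good_map \<phi> "\<lambda>ze. of_real (sqrt (bd_deriv \<phi> ze))" by (rule good_map_sqrt[OF O(1)])
 interpret B: good_map \<phi>' "\<lambda>ze. of_real (sqrt (bd_deriv \<phi>' ze))" by (rule good_map_sqrt[OF O(2)])
 obtain N where N: "N \<in> null_sets mu" "{x \<in> space mu. \<not> Q x} \<subseteq> N"
  using ae unfolding eventually_ae_filter by blast
 have "space mu - N \<in> sets mu" using null_setsD2[OF N(1)] by (rule sets.compl_sets)
 from measurable_sets[OF A.psi_meas this]
 have "{b \<in> space sigma. A.psi b \<in> space mu - N} \<in> sets sigma"
  by (simp add: vimage_def Int_def conj_commute)
 note iffs = A.AE_sigma_iff[OF this] B.AE_sigma_iff[OF this]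
 have "AE ze in mu. A.psi (\<phi> ze) \<in> space mu - N" using AE_not_in[OF N(1)] AE_space
 proof eventually_elim
  case (elim ze)
  then show ?case using A.psi_phi[of ze] by simp
 qed
 then have "AE ze in mu. A.psi (\<phi>' ze) \<in> space mu - N" using iffs by blast
 then show ?thesis using AE_space
 proof eventually_elim
  case (elim ze)
  then have z: "norm ze = 1" by simp
  have "A.psi (\<phi>' ze) = k ze" unfolding k(1)[OF z] using A.psi_phi[of "k ze"] k(2)[OF z] by simp
  then show ?case using elim(1) N(2) by auto
 qed
qed

text \<open>For a polynomial P the function P(k) q is continuous on the closed disc and holomorphic
  inside, hence in the Hardy space. General elements follow by density, since both transforms are
  isometries on L^2 of the frontier.\<close>

lemma hardy_transfer:
 assumes G: "good_map \<phi> w" "good_map \<phi>' w'"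
  and k: "continuous_on (cball 0 1) k" "k holomorphic_on ball 0 1" "k ` cball 0 1 \<subseteq> cball 0 1" "k ` ball 0 1 \<subseteq> ball 0 1"
   "\<And>ze. norm ze = 1 ==> norm (k ze) = 1"
  and q: "continuous_on (cball 0 1) q" "q holomorphic_on ball 0 1"
  and rel: "\<And>ze. norm ze = 1 ==> \<phi>' ze = \<phi> (k ze)" "\<And>ze. norm ze = 1 ==> w' ze = w (k ze) * q ze"
  and F: "L2 sigma F" "tau_half \<phi> w F \<in> H2_circle"
 shows "tau_half \<phi>' w' F \<in> H2_circle"
proof -
 interpret A: good_map \<phi> w by (rule G(1))
 interpret B: good_map \<phi>' w' by (rule G(2))
 have O: "omega_map \<phi>" "omega_map \<phi>'" by unfold_locales
 obtain P where P: "L2lim mu (\<lambda>n. poly (P n)) (A.tau F)" by (rule H2_circle_poly_dense[OF F(2)])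
 have "\<exists>E. L2 sigma E \<and> (AE ze in mu. A.tau E ze = poly (P n) ze)" for n
  by (rule A.tau_surj[OF L2_poly_circle[of "P n"]]) blast
 then obtain E where E: "\<And>n. L2 sigma (E n)" "\<And>n. AE ze in mu. A.tau (E n) ze = poly (P n) ze"
  by metis
 have tr: "B.tau X ze = A.tau X (k ze) * q ze" if "norm ze = 1" for X ze
  using rel[OF that] by (simp add: tau_half_def)
 have H: "B.tau (E n) \<in> H2_circle" for n
 proof (rule H2_circle_AE)
  show "(\<lambda>z. poly (P n) (k z) * q z) \<in> H2_circle"
  proof (rule H2_circle_I)
   show "continuous_on (cball 0 1) (\<lambda>z. poly (P n) (k z) * q z)"
    by (intro continuous_on_mult q(1) continuous_on_compose2[OF _ k(1)] continuous_on_poly continuous_on_id) (use k(3) in auto)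
   show "(\<lambda>z. poly (P n) (k z) * q z) holomorphic_on ball 0 1"
    using k(2) q(2) by (intro holomorphic_intros)
  qed
  show "B.tau (E n) \<in> borel_measurable mu" by (rule B.tau_meas[OF L2_measurable[OF E(1)]])
  have "AE ze in mu. A.tau (E n) (k ze) = poly (P n) (k ze)" by (rule AE_transfer[OF O rel(1) k(5) E(2)])
  then show "AE ze in mu. B.tau (E n) ze = poly (P n) (k ze) * q ze" using AE_space
  proof eventually_elim
   case (elim ze)
   then show ?case using tr[of ze "E n"] by simp
  qed
 qed
 have "(\<integral>ze. (norm (B.tau (E n) ze - B.tau F ze))\<^sup>2 \<partial>mu) = (\<integral>ze. (norm (poly (P n) ze - A.tau F ze))\<^sup>2 \<partial>mu)" for n
 proof -
  have L: "L2 sigma (\<lambda>x. E n x - F x)" by (rule L2_diff[OF E(1) F(1)])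
  have d: "tau_half m v (\<lambda>x. E n x - F x) ze = tau_half m v (E n) ze - tau_half m v F ze" for m v ze
   by (simp add: tau_half_def algebra_simps)
  have "(\<integral>ze. (norm (B.tau (E n) ze - B.tau F ze))\<^sup>2 \<partial>mu) = (\<integral>ze. (norm (A.tau (E n) ze - A.tau F ze))\<^sup>2 \<partial>mu)"
   using B.tau_norm2[OF L] A.tau_norm2[OF L] unfolding d by (rule trans[OF sym])
  also have "\<dots> = (\<integral>ze. (norm (poly (P n) ze - A.tau F ze))\<^sup>2 \<partial>mu)"
  proof (rule integral_cong_AE)
   note [measurable] = L2_measurable[OF A.tau_L2[OF E(1)[of n]]] L2_measurable[OF A.tau_L2[OF F(1)]] L2_measurable[OF L2_poly_circle[of "P n"]]
   show "(\<lambda>ze. (norm (A.tau (E n) ze - A.tau F ze))\<^sup>2) \<in> borel_measurable mu" by measurable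
   show "(\<lambda>ze. (norm (poly (P n) ze - A.tau F ze))\<^sup>2) \<in> borel_measurable mu" by measurable
   show "AE ze in mu. (norm (A.tau (E n) ze - A.tau F ze))\<^sup>2 = (norm (poly (P n) ze - A.tau F ze))\<^sup>2"
    using E(2)[of n] by eventually_elim simp
  qed
  finally show ?thesis .
 qed
 then have "L2lim mu (\<lambda>n. B.tau (E n)) (B.tau F)" using P by (simp add: L2lim_def)
 then show ?thesis by (rule H2_circle_lim[OF _ H B.tau_L2[OF F(1)]])
qed

text \<open>Both transforms identify the Hardy space with the same subspace of L^2 of the frontier
  and respect the same inner product, so the orthogonal projections agree. Leaving a square root of
  c out of \<open>aut_root\<close> changes a transform by a constant phase only, which fixes every
  subspace.\<close>

lemma szego_projection_transfer:
 assumes G: "good_map \<phi> w" "good_map \<phi>' w'" and a: "norm a < 1" and c: "norm c = 1"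
  and rel: "\<And>ze. norm ze = 1 ==> \<phi>' ze = \<phi> (disc_aut a c ze)"
   "\<And>ze. norm ze = 1 ==> w' ze = w (disc_aut a c ze) * aut_root a c ze"
  and f: "L2 sigma f"
 shows "AE b in sigma. szego_projection Omega \<phi> w f b = szego_projection Omega \<phi>' w' f b"
proof -
 interpret A: good_map \<phi> w by (rule G(1))
 interpret B: good_map \<phi>' w' by (rule G(2))
 let ?k = "disc_aut a c" and ?l = "disc_aut (- cnj c * a) (cnj c)"
 have a': "norm (- cnj c * a) < 1" "norm (cnj c) = 1" using a c by (auto simp: norm_mult)
 note m = disc_aut_maps[OF a c] and m' = disc_aut_maps[OF a']
 have fwd: "B.tau F \<in> H2_circle" if "L2 sigma F" "A.tau F \<in> H2_circle" for F
  by (rule hardy_transfer[OF G disc_aut_cont[OF a c] disc_aut_holo[OF a c] _ _ _ aut_root_cont[OF a c] aut_root_holo[OF a c] rel that])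
    (use m in auto)
 \<comment> \<open>The inverse automorphism comes with the multiplier 1/\<open>aut_root\<close>
   evaluated along it, so the same transfer lemma applies backwards.\<close>
 have bwd: "A.tau F \<in> H2_circle" if F: "L2 sigma F" "B.tau F \<in> H2_circle" for F
 proof (rule hardy_transfer[OF G(2,1) disc_aut_cont[OF a'] disc_aut_holo[OF a'] _ _ _ _ _ _ _ F])
  show "?l ` cball 0 1 \<subseteq> cball 0 1" "?l ` ball 0 1 \<subseteq> ball 0 1" using m' by auto
  show l1: "norm (?l ze) = 1" if "norm ze = 1" for ze using m'(3)[OF that] .
  show "continuous_on (cball 0 1) (\<lambda>z. 1 / aut_root a c (?l z))"
  proof (rule continuous_on_divide[OF continuous_on_const])
   show "continuous_on (cball 0 1) (\<lambda>z. aut_root a c (?l z))"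
    by (rule continuous_on_compose2[OF aut_root_cont[OF a c] disc_aut_cont[OF a']]) (use m' in auto)
   show "\<forall>z\<in>cball 0 1. aut_root a c (?l z) \<noteq> 0" using m'(2) aut_root_nz[OF a c] by auto
  qed
  show "(\<lambda>z. 1 / aut_root a c (?l z)) holomorphic_on ball 0 1"
  proof (rule holomorphic_on_divide[OF holomorphic_on_const])
   have "(aut_root a c \<circ> ?l) holomorphic_on ball 0 1"
    by (rule holomorphic_on_compose_gen[OF disc_aut_holo[OF a'] aut_root_holo[OF a c]]) (use m' in auto)
   then show "(\<lambda>z. aut_root a c (?l z)) holomorphic_on ball 0 1" by (simp only: o_def)
   show "aut_root a c (?l z) \<noteq> 0" if "z \<in> ball 0 1" for z
    by (rule aut_root_nz[OF a c]) (use m'(2)[of z] that in auto)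
  qed
  fix ze :: complex assume z: "norm ze = 1"
  have i: "?k (?l ze) = ze" by (rule disc_aut_inverse'[OF a c]) (simp add: z)
  show "\<phi> ze = \<phi>' (?l ze)" unfolding rel(1)[OF l1[OF z]] i ..
  have "aut_root a c (?l ze) \<noteq> 0" by (rule aut_root_nz[OF a c]) (simp only: l1[OF z] order_refl)
  then show "w ze = w' (?l ze) * (1 / aut_root a c (?l ze))" unfolding rel(2)[OF l1[OF z]] i by simp
 qed
 note Af = A.proj_props[OF f]
 have "szego_rel (B.tau f) (B.tau (A.T f))" unfolding szego_rel_def
 proof (intro conjI ballI)
  show "B.tau (A.T f) \<in> H2_circle" by (rule fwd[OF Af(1) szego_rel_H2[OF Af(2)]])
  fix h assume h: "h \<in> H2_circle"
  obtain K where K: "L2 sigma K" "AE ze in mu. B.tau K ze = h ze" by (rule B.tau_surj[OF H2_circle_L2[OF h]])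
  have KH: "B.tau K \<in> H2_circle" by (rule H2_circle_AE[OF h B.tau_meas[OF L2_measurable[OF K(1)]] K(2)])
  have L: "L2 sigma (\<lambda>x. f x - A.T f x)" by (rule L2_diff[OF f Af(1)])
  have d: "tau_half m v (\<lambda>x. f x - A.T f x) ze = tau_half m v f ze - tau_half m v (A.T f) ze" for m v ze
   by (simp add: tau_half_def algebra_simps)
  have "(\<integral>ze. (B.tau f ze - B.tau (A.T f) ze) * cnj (h ze) \<partial>mu)
    = (\<integral>ze. (B.tau f ze - B.tau (A.T f) ze) * cnj (B.tau K ze) \<partial>mu)"
  proof (rule integral_cong_AE)
   note [measurable] = L2_measurable[OF B.tau_L2[OF f]] L2_measurable[OF B.tau_L2[OF Af(1)]]
    L2_measurable[OF L2_cnj[OF H2_circle_L2[OF h]]] L2_measurable[OF L2_cnj[OF H2_circle_L2[OF KH]]]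
   show "(\<lambda>ze. (B.tau f ze - B.tau (A.T f) ze) * cnj (h ze)) \<in> borel_measurable mu" by measurable
   show "(\<lambda>ze. (B.tau f ze - B.tau (A.T f) ze) * cnj (B.tau K ze)) \<in> borel_measurable mu" by measurable
   show "AE ze in mu. (B.tau f ze - B.tau (A.T f) ze) * cnj (h ze) = (B.tau f ze - B.tau (A.T f) ze) * cnj (B.tau K ze)"
    using K(2) by eventually_elim (simp only:)
  qed
  also have "\<dots> = (\<integral>ze. (A.tau f ze - A.tau (A.T f) ze) * cnj (A.tau K ze) \<partial>mu)"
   using B.tau_inner[OF L K(1)] A.tau_inner[OF L K(1)] unfolding d by (rule trans[OF sym])
  also have "\<dots> = 0" using Af(2) bwd[OF K(1) KH] by (simp add: szego_rel_def)
  finally show "(\<integral>ze. (B.tau f ze - B.tau (A.T f) ze) * cnj (h ze) \<partial>mu) = 0" .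
 qed
 then show ?thesis by (rule B.proj_unique[OF f Af(1)])
qed

text \<open>Away from corners the derivative of \<phi> has an unrestricted limit from inside the
  disc, so the chain rule survives at the circle even though the automorphism bends radii.\<close>

lemma bd_deriv_disc_aut:
 assumes O: "omega_map \<phi>" and a: "norm a < 1" and c: "norm c = 1" and z0: "norm ze = 1"
  and nc: "\<phi> (disc_aut a c ze) \<notin> corners"
  and rel: "\<And>z. norm z < 1 ==> \<phi>' z = \<phi> (disc_aut a c z)"
 shows "bd_deriv \<phi>' ze = bd_deriv \<phi> (disc_aut a c ze) * (norm (aut_root a c ze))\<^sup>2"
proof -
 interpret omega_map \<phi> by (rule O)
 let ?k = "disc_aut a c"
 note m = disc_aut_maps[OF a c]
 have k1: "norm (?k ze) = 1" by (rule m(3)[OF z0])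
 have "\<phi> (?k ze) \<in> frontier Omega" using facts(6) k1 by auto
 then have s: "sector_at Omega (\<phi> (?k ze)) 1" using sector_at_Omega corner_angle_1[OF nc] by metis
 obtain \<delta> g e where g: "\<delta> > 0" "norm e = 1"
  "\<And>z. z \<in> ball (?k ze) \<delta> ==> norm z = 1 ==> ((\<lambda>z. deriv \<phi> z) \<longlongrightarrow> e * deriv g z) (at z within ball 0 1)"
  "\<And>z. z \<in> ball (?k ze) \<delta> ==> norm z = 1 ==> bd_deriv \<phi> z = norm (deriv g z)"
  by (rule side_extension[OF R open_Omega k1 s]) (rule that; assumption)
 have kb: "?k ze \<in> ball (?k ze) \<delta>" using g(1) by simp
 note l = g(3)[OF kb k1] and b = g(4)[OF kb k1]
 have "continuous (at ze within cball 0 1) ?k" using disc_aut_cont[OF a c] z0 by (simp add: continuous_on_eq_continuous_within)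
 then have kt: "(?k \<longlongrightarrow> ?k ze) (at ze within ball 0 1)"
  unfolding continuous_within by (rule tendsto_within_subset) auto
 have "continuous (at ze within cball 0 1) (aut_root a c)" using aut_root_cont[OF a c] z0 by (simp add: continuous_on_eq_continuous_within)
 then have qt: "(aut_root a c \<longlongrightarrow> aut_root a c ze) (at ze within ball 0 1)"
  unfolding continuous_within by (rule tendsto_within_subset) auto
 have ev: "eventually (\<lambda>z. z \<in> ball 0 1) (at ze within ball 0 1)" by (simp add: eventually_at_filter)
 have "filterlim ?k (at (?k ze) within ball 0 1) (at ze within ball 0 1)" unfolding filterlim_at
 proof (rule conjI[OF _ kt])
  show "\<forall>\<^sub>F z in at ze within ball 0 1. ?k z \<in> ball 0 1 \<and> ?k z \<noteq> ?k ze" using ev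
  proof eventually_elim
   case (elim z)
   then have "norm (?k z) < 1" using m(1)[of z] by simp
   then show ?case using k1 by auto
  qed
 qed
 then have "((\<lambda>z. deriv \<phi> (?k z)) \<longlongrightarrow> e * deriv g (?k ze)) (at ze within ball 0 1)"
  by (rule filterlim_compose[OF l])
 then have "((\<lambda>z. norm (deriv \<phi> (?k z)) * (norm (aut_root a c z))\<^sup>2) \<longlongrightarrow> norm (e * deriv g (?k ze)) * (norm (aut_root a c ze))\<^sup>2) (at ze within ball 0 1)"
  by (intro tendsto_mult tendsto_norm tendsto_power qt)
 moreover have "\<forall>\<^sub>F z in at ze within ball 0 1. norm (deriv \<phi> (?k z)) * (norm (aut_root a c z))\<^sup>2 = norm (deriv \<phi>' z)"
  using ev
 proof eventually_elim
  case (elim z)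
  then have z: "norm z < 1" by simp
  have "(\<phi> has_field_derivative deriv \<phi> (?k z)) (at (?k z))"
   using facts(2) m(1)[OF z] by (auto intro: holomorphic_derivI)
  from DERIV_chain2[OF this disc_aut_deriv[OF a c less_imp_le[OF z]]]
  have "((\<lambda>z. \<phi> (?k z)) has_field_derivative deriv \<phi> (?k z) * (c * (aut_root a c z)\<^sup>2)) (at z)" .
  then have "(\<phi>' has_field_derivative deriv \<phi> (?k z) * (c * (aut_root a c z)\<^sup>2)) (at z)"
   by (rule has_field_derivative_transform_within_open[OF _ open_ball elim]) (use rel in auto)
  then have "deriv \<phi>' z = deriv \<phi> (?k z) * (c * (aut_root a c z)\<^sup>2)" by (rule DERIV_imp_deriv)
  then show ?case using c by (simp add: norm_mult norm_power)
 qed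
 ultimately have "((\<lambda>z. norm (deriv \<phi>' z)) \<longlongrightarrow> norm (e * deriv g (?k ze)) * (norm (aut_root a c ze))\<^sup>2) (at ze within ball 0 1)"
  by (rule Lim_transform_eventually)
 then show ?thesis using bd_deriv_eq[OF z0] g(2) b by (simp add: norm_mult)
qed

lemma good_map_disc_aut:
 assumes G: "good_map \<phi> w" and O: "omega_map \<phi>'" and a: "norm a < 1" and c: "norm c = 1"
  and rel: "\<And>z. norm z \<le> 1 ==> \<phi>' z = \<phi> (disc_aut a c z)"
 shows "good_map \<phi>' (\<lambda>ze. w (disc_aut a c ze) * aut_root a c ze)"
proof -
 interpret A: good_map \<phi> w by (rule G)
 interpret B: omega_map \<phi>' by (rule O)
 have O1: "omega_map \<phi>" by unfold_locales
 let ?k = "disc_aut a c"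
 have k1: "norm (?k ze) = 1" if "norm ze = 1" for ze using disc_aut_maps(3)[OF a c that] .
 show ?thesis
 proof
  have "continuous_on (sphere 0 1) ?k" "continuous_on (sphere 0 1) (aut_root a c)"
   by (auto intro: continuous_on_subset[OF disc_aut_cont[OF a c]] continuous_on_subset[OF aut_root_cont[OF a c]])
  note c0 = this[THEN borel_measurable_continuous_on_restrict]
  have [measurable]: "aut_root a c \<in> borel_measurable mu"
   unfolding measurable_cong_sets[OF sets_circle_measure refl] by (rule c0(2))
  have [measurable]: "?k \<in> measurable mu mu"
   unfolding measurable_cong_sets[OF sets_circle_measure sets_circle_measure]
   by (rule measurable_restrict_space2[OF _ c0(1)]) (auto simp: space_restrict_space k1)
  note [measurable] = A.w_meas
  show "(\<lambda>ze. w (?k ze) * aut_root a c ze) \<in> borel_measurable mu" by measurable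
  have "AE ze in mu. (norm (w (?k ze)))\<^sup>2 = bd_deriv \<phi> (?k ze)"
   by (rule AE_transfer[OF O1 O _ k1 A.w_bd]) (simp add: rel)
  then show "AE ze in mu. (norm (w (?k ze) * aut_root a c ze))\<^sup>2 = bd_deriv \<phi>' ze"
   using B.AE_circle
  proof eventually_elim
   case (elim ze)
   then have z: "norm ze = 1" and "\<phi>' ze \<notin> corners" by (auto simp: B.exc_points_def)
   then have "\<phi> (?k ze) \<notin> corners" using rel[of ze] by simp
   then have "bd_deriv \<phi>' ze = bd_deriv \<phi> (?k ze) * (norm (aut_root a c ze))\<^sup>2"
    by (rule bd_deriv_disc_aut[OF O1 a c z]) (simp add: rel)
   then show ?case using elim(1) by (simp add: norm_mult power_mult_distrib)
  qed
 qed
qed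

section \<open>Uniqueness, oddness and the size of the derivative of a Riemann map\<close>

section \<open>The modulus of the derivative\<close>

text \<open>After an automorphism the transition map F fixes 0 and so does its inverse G; the
  Schwarz lemma for both gives |F(h)| = |h| at one point h other than 0, which forces a rotation.
  Continuity extends the identity to the closed disc.\<close>

lemma riemann_map_unique:
 assumes R: "riemann_map \<Omega> \<phi>" "riemann_map \<Omega> \<phi>'" and o: "open \<Omega>"
 obtains a c where "norm a < 1" "norm c = 1" "\<And>z. norm z \<le> 1 ==> \<phi>' z = \<phi> (disc_aut a c z)"
proof -
 note f = riemann_map_facts[OF R(1) o] and f' = riemann_map_facts[OF R(2) o]
 have inj: "inj_on \<phi> (ball 0 1)" "inj_on \<phi>' (ball 0 1)"
  using f(3) f'(3) by (auto intro: inj_on_subset)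
 obtain g where g: "g holomorphic_on (\<phi> ` ball 0 1)" "\<And>z. z \<in> ball 0 1 ==> g (\<phi> z) = z"
  by (rule holomorphic_has_inverse[OF f(2) open_ball inj(1)]) (rule that; assumption)
 obtain g' where g': "g' holomorphic_on (\<phi>' ` ball 0 1)" "\<And>z. z \<in> ball 0 1 ==> g' (\<phi>' z) = z"
  by (rule holomorphic_has_inverse[OF f'(2) open_ball inj(2)]) (rule that; assumption)
 have in1: "norm (g (\<phi>' z)) < 1 \<and> \<phi> (g (\<phi>' z)) = \<phi>' z" if "norm z < 1" for z
 proof -
  have "\<phi>' z \<in> \<phi> ` ball 0 1" unfolding f(4) f'(4)[symmetric] using that by simp
  then obtain x where x: "x \<in> ball 0 1" "\<phi>' z = \<phi> x" by blast
  then show ?thesis using g(2)[OF x(1)] by simp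
 qed
 have in2: "norm (g' (\<phi> z)) < 1 \<and> \<phi>' (g' (\<phi> z)) = \<phi> z" if "norm z < 1" for z
 proof -
  have "\<phi> z \<in> \<phi>' ` ball 0 1" unfolding f'(4) f(4)[symmetric] using that by simp
  then obtain x where x: "x \<in> ball 0 1" "\<phi> z = \<phi>' x" by blast
  then show ?thesis using g'(2)[OF x(1)] by simp
 qed
 define a where "a = g (\<phi>' 0)"
 have a: "norm a < 1" "\<phi> a = \<phi>' 0" using in1[of 0] by (auto simp: a_def)
 have a': "norm (- a) < 1" using a by simp
 have one: "norm (1::complex) = 1" by simp
 let ?m = "disc_aut a 1" and ?l = "disc_aut (- a) 1"
 have ml: "?m (?l z) = z" if "norm z \<le> 1" for z using disc_aut_inverse'[OF a(1) one that] by simp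
 define F where "F z = ?l (g (\<phi>' z))" for z
 define G where "G z = g' (\<phi> (?m z))" for z
 have F: "F holomorphic_on ball 0 1"
 proof -
  have 1: "(g \<circ> \<phi>') holomorphic_on ball 0 1"
   by (rule holomorphic_on_compose_gen[OF f'(2) g(1)]) (simp add: f(4) f'(4))
  have "(?l \<circ> (g \<circ> \<phi>')) holomorphic_on ball 0 1"
   by (rule holomorphic_on_compose_gen[OF 1 disc_aut_holo[OF a' one]]) (use in1 in auto)
  then show ?thesis by (simp only: o_def F_def[abs_def])
 qed
 have G: "G holomorphic_on ball 0 1"
 proof -
  have 1: "(\<phi> \<circ> ?m) holomorphic_on ball 0 1"
   by (rule holomorphic_on_compose_gen[OF disc_aut_holo[OF a(1) one] f(2)]) (use disc_aut_maps[OF a(1) one] in auto)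
  have "(g' \<circ> (\<phi> \<circ> ?m)) holomorphic_on ball 0 1"
  proof (rule holomorphic_on_compose_gen[OF 1 g'(1)])
   show "(\<phi> \<circ> ?m) ` ball 0 1 \<subseteq> \<phi>' ` ball 0 1"
    unfolding f'(4) f(4)[symmetric] using disc_aut_maps(1)[OF a(1) one] by auto
  qed
  then show ?thesis by (simp only: o_def G_def[abs_def])
 qed
 have F0: "F 0 = 0" by (simp add: F_def disc_aut_def flip: a_def)
 have "G 0 = g' (\<phi>' 0)" unfolding a(2)[symmetric] by (simp add: G_def disc_aut_def)
 then have G0: "G 0 = 0" using g'(2)[of 0] by simp
 have Fb: "norm (F z) < 1" if "norm z < 1" for z
  unfolding F_def using disc_aut_maps(1)[OF a' one] in1[OF that] by blast
 have Gb: "norm (G z) < 1" if "norm z < 1" for z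
  unfolding G_def using disc_aut_maps(1)[OF a(1) one that] in2 by blast
 have GF: "G (F z) = z" if "norm z < 1" for z
 proof -
  have "?m (F z) = g (\<phi>' z)" unfolding F_def by (rule ml) (use in1[OF that] in simp)
  then have "G (F z) = g' (\<phi>' z)" unfolding G_def using in1[OF that] by simp
  then show ?thesis using g'(2)[of z] that by simp
 qed
 define h :: complex where "h = 1/2"
 have h: "norm h < 1" "h \<noteq> 0" by (auto simp: h_def)
 have "norm (F h) \<le> norm h" by (rule Schwarz_Lemma(1)[OF F F0 Fb h(1)])
 moreover have "norm (G (F h)) \<le> norm (F h)" by (rule Schwarz_Lemma(1)[OF G G0 Gb Fb[OF h(1)]])
 ultimately have e: "norm (F h) = norm h" using GF[OF h(1)] by simp
 obtain c where c: "\<forall>z. norm z < 1 \<longrightarrow> F z = c * z" "norm c = 1"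
  using Schwarz_Lemma(3)[OF F F0 Fb h(1)] e h by blast
 have eq: "\<phi>' z = \<phi> (disc_aut a c z)" if z: "norm z < 1" for z
 proof -
  have "g (\<phi>' z) = ?m (F z)" unfolding F_def by (rule ml[symmetric]) (use in1[OF z] in simp)
  also have "\<dots> = disc_aut a c z" using c(1) z by (simp add: disc_aut_def mult.assoc)
  finally show ?thesis using in1[OF z] by simp
 qed
 have "\<phi>' z - \<phi> (disc_aut a c z) = 0" if z: "norm z \<le> 1" for z
 proof (rule continuous_constant_on_closure[of "ball 0 1" "\<lambda>z. \<phi>' z - \<phi> (disc_aut a c z)"])
  show "continuous_on (closure (ball 0 1)) (\<lambda>z. \<phi>' z - \<phi> (disc_aut a c z))"
  proof -
   have "continuous_on (cball 0 1) (\<lambda>z. \<phi> (disc_aut a c z))"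
    by (rule continuous_on_compose2[OF f(1) disc_aut_cont[OF a(1) c(2)]]) (use disc_aut_maps[OF a(1) c(2)] in auto)
   then show ?thesis using f'(1) by (simp add: continuous_on_diff)
  qed
 qed (use eq z in auto)
 then show ?thesis using that[OF a(1) c(2)] by simp
qed

lemma riemann_map_Omega_uminus:
 assumes "riemann_map Omega \<phi>" shows "riemann_map Omega (\<lambda>z. - \<phi> z)"
proof -
 note f = riemann_map_facts[OF assms open_Omega]
 have neg: "uminus ` Omega = Omega" using minus_in_Omega by (metis (no_types) image_iff minus_minus subsetI subset_antisym)
 have cl: "uminus ` closure Omega = closure Omega" using closure_scaleR[of "-1" Omega] neg by simp
 have "(\<lambda>z. - \<phi> z) ` ball 0 1 = uminus ` \<phi> ` ball 0 1" "(\<lambda>z. - \<phi> z) ` cball 0 1 = uminus ` \<phi> ` cball 0 1"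
  by (simp_all only: image_image)
 then have im: "(\<lambda>z. - \<phi> z) ` ball 0 1 = Omega" "(\<lambda>z. - \<phi> z) ` cball 0 1 = closure Omega"
  unfolding f(4,5) neg cl by simp_all
 have "\<exists>\<psi>. homeomorphism (cball 0 1) (closure Omega) (\<lambda>z. - \<phi> z) \<psi>"
 proof (rule homeomorphism_compact)
  show "continuous_on (cball 0 1) (\<lambda>z. - \<phi> z)" by (rule continuous_on_minus[OF f(1)])
  show "inj_on (\<lambda>z. - \<phi> z) (cball 0 1)" using f(3) by (simp add: inj_on_def)
 qed (simp_all add: im)
 then show ?thesis using im(1) holomorphic_on_minus[OF f(2)] by (simp add: riemann_map_def)
qed

text \<open>-\<phi> is again a Riemann map of the symmetric domain and fixes 0, so -\<phi>(z) =
  \<phi>(c z). Applying this twice at z = 1 gives c^2 = 1, and injectivity excludes c = 1.\<close>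

lemma riemann_map_Omega_odd:
 assumes R: "riemann_map Omega \<phi>" and n: "\<phi> 0 = 0" and z: "norm z \<le> 1"
 shows "\<phi> (- z) = - \<phi> z"
proof -
 note f = riemann_map_facts[OF R open_Omega]
 have inj: "x = y" if "\<phi> x = \<phi> y" "norm x \<le> 1" "norm y \<le> 1" for x y
  by (rule inj_onD[OF f(3) that(1)]) (use that in auto)
 obtain a c where a: "norm a < 1" and c: "norm c = 1" and e: "\<And>z. norm z \<le> 1 ==> - \<phi> z = \<phi> (disc_aut a c z)"
  by (rule riemann_map_unique[OF R riemann_map_Omega_uminus[OF R] open_Omega]) (rule that; assumption)
 have "\<phi> a = \<phi> 0" using e[of 0] n by (simp add: disc_aut_def)
 then have a0: "a = 0" by (rule inj) (use a in auto)
 have e': "- \<phi> z = \<phi> (c * z)" if "norm z \<le> 1" for z using e[OF that] by (simp add: a0 disc_aut_def)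
 have e2: "\<phi> (c * z) = - \<phi> z" if "norm z \<le> 1" for z using e'[OF that] by (rule sym)
 have "\<phi> (c * (c * 1)) = \<phi> 1" using e2[of 1] e2[of "c * 1"] c by simp
 then have "c * (c * 1) = 1" by (rule inj) (use c in \<open>auto simp: norm_mult\<close>)
 then have "c\<^sup>2 = 1" by (simp add: power2_eq_square)
 then have "c = 1 \<or> c = - 1" by (simp add: power2_eq_1_iff)
 moreover have "c \<noteq> 1"
 proof
  assume "c = 1"
  then have "- \<phi> 1 = \<phi> 1" using e'[of 1] by simp
  then have "\<phi> 1 = \<phi> 0" using n by simp
  then have "(1::complex) = 0" by (rule inj) auto
  then show False by simp
 qed
 ultimately show ?thesis using e'[OF z] by simp
qed

text \<open>Models the square of |\<phi>'|: opening 3\<pi>/2 gives a simple zero where z^2 = s1,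
  opening \<pi>/2 a simple pole where z^2 is in S. The poles are summed, where a product would be
  comparable as well, because a sum splits into half-plane functions.\<close>

definition model_weight :: "complex \<Rightarrow> complex set \<Rightarrow> complex \<Rightarrow> real" where
 "model_weight s1 S z = norm (z\<^sup>2 - s1) * (\<Sum>s\<in>S. 1 / norm (z\<^sup>2 - s))"

lemma sq_minus_tendsto: "((\<lambda>z::complex. norm (z\<^sup>2 - s)) \<longlongrightarrow> norm (ze\<^sup>2 - s)) (at ze within A)"
 by (intro tendsto_intros)

text \<open>The square of |\<phi>'| is of order |z - ze|^(2\<alpha> - 2), and the three cases check
  that the model has the same order. They rest on |z^2 - ze^2| = |z - ze| |z + ze|, whose last
  factor tends to 2.\<close>

lemma model_weight_limit:
 fixes ze s1 :: complex
 assumes z: "norm ze = 1" and S: "finite S" "S \<noteq> {}" "s1 \<notin> S"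
  and al: "\<alpha> = (if ze\<^sup>2 = s1 then 3/2 else if ze\<^sup>2 \<in> S then 1/2 else 1)"
 shows "\<exists>L>0. ((\<lambda>z. (norm (z - ze) powr (\<alpha> - 1))\<^sup>2 / model_weight s1 S z) \<longlongrightarrow> L) (at ze within ball 0 1)"
proof -
 let ?F = "at ze within ball 0 1"
 let ?\<Sigma> = "\<lambda>z. \<Sum>s\<in>S. 1 / norm (z\<^sup>2 - s)"
 have ev: "eventually (\<lambda>z. z \<noteq> ze) ?F" by (simp add: eventually_at_filter)
 have pl: "((\<lambda>z. norm (z + ze)) \<longlongrightarrow> 2) ?F"
 proof -
  have "((\<lambda>z. norm (z + ze)) \<longlongrightarrow> norm (ze + ze)) ?F" by (intro tendsto_intros)
  moreover have "norm (ze + ze) = 2" using z by (simp add: norm_mult flip: mult_2)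
  ultimately show ?thesis by simp
 qed
 have sqf: "norm (z\<^sup>2 - ze\<^sup>2) = norm (z - ze) * norm (z + ze)" for z
  by (simp add: power2_eq_square square_diff_square_factored norm_mult mult.commute)
 have spos: "0 < ?\<Sigma> ze" if "ze\<^sup>2 \<notin> S" by (rule sum_pos[OF S(1,2)]) (use that in auto)
 have slim: "(?\<Sigma> \<longlongrightarrow> ?\<Sigma> ze) ?F" if "ze\<^sup>2 \<notin> S"
  by (intro tendsto_sum tendsto_divide tendsto_const sq_minus_tendsto) (use that in auto)
 consider (a) "ze\<^sup>2 = s1" | (b) "ze\<^sup>2 \<noteq> s1" "ze\<^sup>2 \<in> S" | (c) "ze\<^sup>2 \<noteq> s1" "ze\<^sup>2 \<notin> S" by blast
 then show ?thesis
 proof cases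
  case a
  then have n: "ze\<^sup>2 \<notin> S" using S by simp
  have "((\<lambda>z. 1 / (norm (z + ze) * ?\<Sigma> z)) \<longlongrightarrow> 1 / (2 * ?\<Sigma> ze)) ?F"
   by (intro tendsto_divide tendsto_const tendsto_mult pl slim[OF n]) (use spos[OF n] in simp)
  moreover have "eventually (\<lambda>z. 1 / (norm (z + ze) * ?\<Sigma> z) = (norm (z - ze) powr (\<alpha> - 1))\<^sup>2 / model_weight s1 S z) ?F"
   using ev
  proof eventually_elim
   case (elim z)
   then have p: "norm (z - ze) > 0" by simp
   have "\<alpha> - 1 = 1/2" using a al by simp
   then have "(norm (z - ze) powr (\<alpha> - 1))\<^sup>2 = norm (z - ze)"
    using p by (simp only: powr_half_sqrt[OF norm_ge_zero]) simp
   moreover have "model_weight s1 S z = norm (z - ze) * (norm (z + ze) * ?\<Sigma> z)"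
    unfolding model_weight_def a[symmetric] sqf by (simp only: mult.assoc)
   ultimately show ?case using p by simp
  qed
  ultimately have "((\<lambda>z. (norm (z - ze) powr (\<alpha> - 1))\<^sup>2 / model_weight s1 S z) \<longlongrightarrow> 1 / (2 * ?\<Sigma> ze)) ?F"
   by (rule Lim_transform_eventually)
  moreover have "0 < 1 / (2 * ?\<Sigma> ze)" using spos[OF n] by simp
  ultimately show ?thesis by blast
 next
  case b
  let ?t = "\<lambda>s z. norm (z - ze) / norm (z\<^sup>2 - s)"
  have t: "(?t s \<longlongrightarrow> (if s = ze\<^sup>2 then 1/2 else 0)) ?F" for s
  proof (cases "s = ze\<^sup>2")
   case True
   have "((\<lambda>z. 1 / norm (z + ze)) \<longlongrightarrow> 1 / 2) ?F"
    by (intro tendsto_divide tendsto_const pl) simp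
   moreover have "eventually (\<lambda>z. 1 / norm (z + ze) = ?t s z) ?F"
    using ev by eventually_elim (simp add: True sqf)
   ultimately have "(?t s \<longlongrightarrow> 1 / 2) ?F" by (rule Lim_transform_eventually)
   then show ?thesis using True by simp
  next
   case False
   have "(?t s \<longlongrightarrow> norm (ze - ze) / norm (ze\<^sup>2 - s)) ?F"
    by (intro tendsto_divide sq_minus_tendsto tendsto_norm tendsto_diff tendsto_ident_at tendsto_const) (use False in simp)
   then show ?thesis using False by simp
  qed
  have "((\<lambda>z. \<Sum>s\<in>S. ?t s z) \<longlongrightarrow> (\<Sum>s\<in>S. if s = ze\<^sup>2 then 1/2 else 0)) ?F"
   by (intro tendsto_sum t)
  then have sl: "((\<lambda>z. \<Sum>s\<in>S. ?t s z) \<longlongrightarrow> 1/2) ?F" using S(1) b by simp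
  have nz: "norm (ze\<^sup>2 - s1) * (1/2) \<noteq> 0" using b(1) by simp
  have "((\<lambda>z. 1 / (norm (z\<^sup>2 - s1) * (\<Sum>s\<in>S. ?t s z))) \<longlongrightarrow> 1 / (norm (ze\<^sup>2 - s1) * (1/2))) ?F"
   by (rule tendsto_divide[OF tendsto_const tendsto_mult[OF sq_minus_tendsto sl] nz])
  moreover have "eventually (\<lambda>z. 1 / (norm (z\<^sup>2 - s1) * (\<Sum>s\<in>S. ?t s z)) = (norm (z - ze) powr (\<alpha> - 1))\<^sup>2 / model_weight s1 S z) ?F"
   using ev
  proof eventually_elim
   case (elim z)
   then have p: "norm (z - ze) > 0" by simp
   have "\<alpha> - 1 = - (1/2)" using b al by simp
   then have "(norm (z - ze) powr (\<alpha> - 1))\<^sup>2 = 1 / norm (z - ze)"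
    using p by (simp only: powr_minus powr_half_sqrt[OF norm_ge_zero] power_inverse inverse_eq_divide power_divide) simp
   moreover have "(\<Sum>s\<in>S. ?t s z) = norm (z - ze) * ?\<Sigma> z" by (simp add: sum_distrib_left)
   ultimately show ?case by (simp add: model_weight_def)
  qed
  ultimately have "((\<lambda>z. (norm (z - ze) powr (\<alpha> - 1))\<^sup>2 / model_weight s1 S z) \<longlongrightarrow> 1 / (norm (ze\<^sup>2 - s1) * (1/2))) ?F"
   by (rule Lim_transform_eventually)
  moreover have "0 < 1 / (norm (ze\<^sup>2 - s1) * (1/2))" using b by simp
  ultimately show ?thesis by blast
 next
  case c
  have p0: "0 < model_weight s1 S ze" unfolding model_weight_def using spos[OF c(2)] c(1) by simp
  note nz = less_imp_neq[OF p0[unfolded model_weight_def], THEN not_sym]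
  have "((\<lambda>z. 1 / (norm (z\<^sup>2 - s1) * ?\<Sigma> z)) \<longlongrightarrow> 1 / (norm (ze\<^sup>2 - s1) * ?\<Sigma> ze)) ?F"
   by (rule tendsto_divide[OF tendsto_const tendsto_mult[OF sq_minus_tendsto slim[OF c(2)]] nz])
  moreover have "eventually (\<lambda>z. 1 / (norm (z\<^sup>2 - s1) * ?\<Sigma> z) = (norm (z - ze) powr (\<alpha> - 1))\<^sup>2 / model_weight s1 S z) ?F"
   using ev by eventually_elim (use c al in \<open>simp add: model_weight_def\<close>)
  ultimately have "((\<lambda>z. (norm (z - ze) powr (\<alpha> - 1))\<^sup>2 / model_weight s1 S z) \<longlongrightarrow> 1 / (norm (ze\<^sup>2 - s1) * ?\<Sigma> ze)) ?F"
   by (rule Lim_transform_eventually)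
  moreover have "0 < 1 / (norm (ze\<^sup>2 - s1) * ?\<Sigma> ze)"
   using p0 unfolding model_weight_def by (rule divide_pos_pos[OF zero_less_one])
  ultimately show ?thesis by blast
 qed
qed

lemma model_weight_continuous:
 assumes "finite S" "\<And>s. s \<in> S ==> z\<^sup>2 \<noteq> s"
 shows "isCont (model_weight s1 S) z"
 unfolding model_weight_def[abs_def] using assms by (intro continuous_intros) auto

text \<open>The quotient of the squared derivative and the model is positive and continuous in the
  disc, with positive limits at all boundary points including those over corners; so it is bounded
  above and below, and radial limits carry the bounds to the circle.\<close>

lemma normalized_riemann_map_comparison:
 assumes R: "riemann_map Omega \<phi>" and n: "\<phi> 0 = 0"
 obtains s1 S m M where "norm s1 = 1" "finite S" "S \<noteq> {}" "\<And>s. s \<in> S ==> norm s = 1" "s1 \<notin> S" "0 < m" "0 < M"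
  "AE ze in mu. ze\<^sup>2 \<noteq> s1 \<and> ze\<^sup>2 \<notin> S \<and> m * model_weight s1 S ze \<le> (bd_deriv \<phi> ze)\<^sup>2 \<and> (bd_deriv \<phi> ze)\<^sup>2 \<le> M * model_weight s1 S ze"
proof -
 interpret omega_map \<phi> by unfold_locales (rule R)
 have inj: "x = y" if "\<phi> x = \<phi> y" "norm x \<le> 1" "norm y \<le> 1" for x y
  by (rule inj_onD[OF facts(3) that(1)]) (use that in auto)
 define v where "v b = (SOME ze. norm ze = 1 \<and> \<phi> ze = b)" for b
 have v: "norm (v b) = 1 \<and> \<phi> (v b) = b" if "b \<in> corners" for b
 proof -
  have "b \<in> frontier Omega" using that corners_in_frontier by (auto simp: corners_def)
  then have "b \<in> \<phi> ` sphere 0 1" by (simp only: facts(6))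
  then obtain ze where "norm ze = 1 \<and> \<phi> ze = b" by auto
  then show ?thesis unfolding v_def by (rule someI)
 qed
 \<comment> \<open>One representative of each antipodal pair of convex corners; by oddness the
   preimages of b and -b have the same square.\<close>
 define CV where "CV = {2, Complex (1/2) (3/2), Complex (-1/2) (3/2)}"
 have CVi: "b \<in> corners" if "b \<in> insert \<i> CV" for b
  using that by (auto simp: corners_def convex_corners_def CV_def)
 have sq: "ze\<^sup>2 = (v b)\<^sup>2 \<longleftrightarrow> \<phi> ze = b \<or> \<phi> ze = - b" if z: "norm ze = 1" and b: "b \<in> insert \<i> CV" for ze b
 proof -
  note vb = v[OF CVi[OF b]]
  have o: "\<phi> (- v b) = - b" using riemann_map_Omega_odd[OF R n, of "v b"] vb by simp
  have "ze\<^sup>2 = (v b)\<^sup>2 \<longleftrightarrow> ze = v b \<or> ze = - v b" by (rule power2_eq_iff)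
  also have "\<dots> \<longleftrightarrow> \<phi> ze = b \<or> \<phi> ze = - b"
  proof
   assume "ze = v b \<or> ze = - v b" then show "\<phi> ze = b \<or> \<phi> ze = - b" using vb o by auto
  next
   assume "\<phi> ze = b \<or> \<phi> ze = - b"
   then show "ze = v b \<or> ze = - v b"
   proof
    assume "\<phi> ze = b" then have "\<phi> ze = \<phi> (v b)" using vb by simp
    then have "ze = v b" by (rule inj) (use z vb in auto)
    then show ?thesis ..
   next
    assume "\<phi> ze = - b" then have "\<phi> ze = \<phi> (- v b)" using o by simp
    then have "ze = - v b" by (rule inj) (use z vb in auto)
    then show ?thesis ..
   qed
  qed
  finally show ?thesis .
 qed
 define s1 where "s1 = (v \<i>)\<^sup>2"
 define S where "S = (\<lambda>b. (v b)\<^sup>2) ` CV"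
 have iCV: "\<i> \<notin> CV" "- \<i> \<notin> CV" by (auto simp: CV_def complex_eq_iff)
 have cc: "b \<in> convex_corners \<longleftrightarrow> b \<in> CV \<or> - b \<in> CV" for b
  by (auto simp: convex_corners_def CV_def complex_eq_iff)
 have S: "finite S" "S \<noteq> {}" by (auto simp: S_def CV_def)
 have s1n: "norm s1 = 1" using v[OF CVi[of \<i>]] by (simp add: s1_def norm_power)
 have Sn: "norm s = 1" if "s \<in> S" for s using that v[OF CVi] by (auto simp: S_def norm_power)
 have z1: "ze\<^sup>2 = s1 \<longleftrightarrow> \<phi> ze = \<i> \<or> \<phi> ze = - \<i>" if "norm ze = 1" for ze
  unfolding s1_def by (rule sq[OF that]) simp
 have zS: "ze\<^sup>2 \<in> S \<longleftrightarrow> \<phi> ze \<in> convex_corners" if z: "norm ze = 1" for ze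
 proof -
  have "ze\<^sup>2 \<in> S \<longleftrightarrow> (\<exists>b\<in>CV. \<phi> ze = b \<or> \<phi> ze = - b)" unfolding S_def image_iff using sq[OF z] by blast
  also have "\<dots> \<longleftrightarrow> \<phi> ze \<in> convex_corners" unfolding cc by (metis minus_minus)
  finally show ?thesis .
 qed
 have s1S: "s1 \<notin> S"
 proof
  assume "s1 \<in> S"
  then have "(v \<i>)\<^sup>2 \<in> S" by (simp add: s1_def)
  then have "\<i> \<in> convex_corners" using zS[of "v \<i>"] v[OF CVi[of \<i>]] by simp
  then show False using iCV by (simp add: cc)
 qed
 have alp: "corner_angle (\<phi> ze) = (if ze\<^sup>2 = s1 then 3/2 else if ze\<^sup>2 \<in> S then 1/2 else 1)" if "norm ze = 1" for ze
  unfolding corner_angle_def z1[OF that] zS[OF that] by (rule refl)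
 let ?U = "model_weight s1 S"
 have ne: "z\<^sup>2 \<noteq> s" if "norm z < 1" "norm s = 1" for z s :: complex
  using that by (metis norm_power power_less_one_iff norm_ge_zero less_irrefl zero_less_numeral)
 have Upos: "0 < ?U z" if "norm z < 1" for z unfolding model_weight_def
  by (intro mult_pos_pos sum_pos S) (use ne[OF that] s1n Sn in auto)
 have dnz: "deriv \<phi> z \<noteq> 0" if "z \<in> ball 0 1" for z
  by (rule holomorphic_injective_imp_regular[OF facts(2) open_ball _ that]) (use facts(3) in \<open>auto intro: inj_on_subset\<close>)
 have lim: "\<exists>L>0. ((\<lambda>z. (norm (deriv \<phi> z))\<^sup>2 / ?U z) \<longlongrightarrow> L) (at ze within ball 0 1)" if z: "norm ze = 1" for ze
 proof -
  let ?\<alpha> = "corner_angle (\<phi> ze)"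
  have a: "0 < ?\<alpha>" "?\<alpha> < 2" by (auto simp: corner_angle_def)
  have "\<phi> ze \<in> frontier Omega" using facts(6) z by auto
  note s = sector_at_Omega[OF this]
  obtain \<delta> g d where g: "\<delta> > 0" "norm d = 1" "g holomorphic_on ball ze \<delta>" "g ze = 0" "inj_on g (ball ze \<delta>)"
   "\<And>z. z \<in> ball ze \<delta> ==> norm z \<le> 1 ==> \<phi> z = \<phi> ze + d * (- \<i> * g z) powr of_real ?\<alpha>"
   "\<And>z. z \<in> ball ze \<delta> ==> norm z < 1 ==> Im (g z) > 0"
   by (rule riemann_map_corner[OF R open_Omega z a s]) (rule that; assumption)
  note l = corner_deriv_limit[OF g(1,3,4,5) a(1) g(2,6,7)]
  let ?L = "?\<alpha> * norm (deriv g ze) powr ?\<alpha>"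
  have Lp: "?L > 0" using a l(2) by simp
  obtain L' where L': "L' > 0" "((\<lambda>z. (norm (z - ze) powr (?\<alpha> - 1))\<^sup>2 / ?U z) \<longlongrightarrow> L') (at ze within ball 0 1)"
   using model_weight_limit[OF z S s1S alp[OF z]] by blast
  have "((\<lambda>z. (norm (deriv \<phi> z) / norm (z - ze) powr (?\<alpha> - 1))\<^sup>2 * ((norm (z - ze) powr (?\<alpha> - 1))\<^sup>2 / ?U z)) \<longlongrightarrow> ?L\<^sup>2 * L') (at ze within ball 0 1)"
   by (intro tendsto_mult tendsto_power l(1) L'(2))
  moreover have "eventually (\<lambda>z. (norm (deriv \<phi> z) / norm (z - ze) powr (?\<alpha> - 1))\<^sup>2 * ((norm (z - ze) powr (?\<alpha> - 1))\<^sup>2 / ?U z) = (norm (deriv \<phi> z))\<^sup>2 / ?U z) (at ze within ball 0 1)"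
  proof -
   have "eventually (\<lambda>z. z \<noteq> ze) (at ze within ball 0 1)" by (simp add: eventually_at_filter)
   then show ?thesis
   proof eventually_elim
    case (elim z)
    then have "norm (z - ze) powr (?\<alpha> - 1) \<noteq> 0" by simp
    then show ?case by (simp add: power_divide)
   qed
  qed
  ultimately have "((\<lambda>z. (norm (deriv \<phi> z))\<^sup>2 / ?U z) \<longlongrightarrow> ?L\<^sup>2 * L') (at ze within ball 0 1)"
   by (rule Lim_transform_eventually)
  moreover have "0 < ?L\<^sup>2 * L'" by (rule mult_pos_pos[OF zero_less_power[OF Lp] L'(1)])
  ultimately show ?thesis by blast
 qed
 have cont: "continuous_on (ball 0 1) (\<lambda>z. (norm (deriv \<phi> z))\<^sup>2 / ?U z)"
 proof (intro continuous_on_divide continuous_on_power continuous_on_norm ballI)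
  show "continuous_on (ball 0 1) (deriv \<phi>)"
   using facts(2) holomorphic_deriv holomorphic_on_imp_continuous_on by blast
  show "continuous_on (ball 0 1) ?U"
  proof (intro continuous_at_imp_continuous_on ballI model_weight_continuous S(1))
   fix z s :: complex assume "z \<in> ball 0 1" "s \<in> S" then show "z\<^sup>2 \<noteq> s" using ne[of z s] Sn[of s] by simp
  qed
  fix z :: complex assume "z \<in> ball 0 1" then show "?U z \<noteq> 0" using Upos[of z] by simp
 qed
 have pos: "0 < (norm (deriv \<phi> z))\<^sup>2 / ?U z" if "z \<in> ball 0 1" for z
  using dnz[OF that] Upos[of z] that by simp
 obtain m M where mM: "0 < m" "0 < M" "\<And>z. z \<in> ball 0 1 ==> m \<le> (norm (deriv \<phi> z))\<^sup>2 / ?U z \<and> (norm (deriv \<phi> z))\<^sup>2 / ?U z \<le> M"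
  by (rule bounded_from_boundary_limits[OF cont pos lim]) (assumption | rule that; assumption)+
 have ae: "AE ze in mu. ze\<^sup>2 \<noteq> s1 \<and> ze\<^sup>2 \<notin> S \<and> m * ?U ze \<le> (bd_deriv \<phi> ze)\<^sup>2 \<and> (bd_deriv \<phi> ze)\<^sup>2 \<le> M * ?U ze"
  using AE_circle
 proof eventually_elim
  case (elim ze)
  then have z: "norm ze = 1" and nc: "\<phi> ze \<notin> corners" by (auto simp: exc_points_def)
  then have n1: "ze\<^sup>2 \<noteq> s1" "ze\<^sup>2 \<notin> S" using z1[OF z] zS[OF z] by (auto simp: corners_def)
  let ?r = "\<lambda>n. complex_of_real (1 - 1 / real (n + 2)) * ze"
  have rt: "filterlim ?r (at ze within ball 0 1) sequentially" by (rule radial_tendsto[OF z])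
  have rb: "eventually (\<lambda>n. ?r n \<in> ball 0 1) sequentially" using rt by (auto simp: filterlim_at elim: eventually_mono)
  have "\<phi> ze \<in> frontier Omega" using facts(6) z by auto
  then have s: "sector_at Omega (\<phi> ze) 1" using sector_at_Omega corner_angle_1[OF nc] by metis
  obtain \<delta> g e where g: "\<delta> > 0"
   "\<And>z. z \<in> ball ze \<delta> ==> norm z = 1 ==> ((\<lambda>z. deriv \<phi> z) \<longlongrightarrow> e * deriv g z) (at z within ball 0 1)"
   by (rule side_extension[OF R open_Omega z s]) (rule that; assumption)
  have l: "((\<lambda>z. deriv \<phi> z) \<longlongrightarrow> e * deriv g ze) (at ze within ball 0 1)" by (rule g(2)) (use g(1) z in auto)
  have bd: "bd_deriv \<phi> ze = norm (e * deriv g ze)" by (rule bd_deriv_eq[OF z tendsto_norm[OF l]])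
  have l1: "(\<lambda>n. (norm (deriv \<phi> (?r n)))\<^sup>2) \<longlonglongrightarrow> (bd_deriv \<phi> ze)\<^sup>2"
   unfolding bd by (intro tendsto_power tendsto_norm filterlim_compose[OF l rt])
  have "isCont ?U ze" by (rule model_weight_continuous[OF S(1)]) (use n1 in auto)
  then have "(?U \<longlongrightarrow> ?U ze) (at ze within ball 0 1)" unfolding isCont_def by (rule tendsto_within_subset) auto
  then have l2: "(\<lambda>n. ?U (?r n)) \<longlonglongrightarrow> ?U ze" by (rule filterlim_compose[OF _ rt])
  have b: "eventually (\<lambda>n. m * ?U (?r n) \<le> (norm (deriv \<phi> (?r n)))\<^sup>2 \<and> (norm (deriv \<phi> (?r n)))\<^sup>2 \<le> M * ?U (?r n)) sequentially"
   using rb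
  proof eventually_elim
   case (elim k)
   then have "0 < ?U (?r k)" using Upos[of "?r k"] by simp
   then show ?case using mM(3)[OF elim] by (simp add: pos_le_divide_eq pos_divide_le_eq)
  qed
  have "m * ?U ze \<le> (bd_deriv \<phi> ze)\<^sup>2"
   by (rule tendsto_le[OF sequentially_bot l1 tendsto_mult_left[OF l2]]) (use b in eventually_elim, simp)
  moreover have "(bd_deriv \<phi> ze)\<^sup>2 \<le> M * ?U ze"
   by (rule tendsto_le[OF sequentially_bot tendsto_mult_left[OF l2] l1]) (use b in eventually_elim, simp)
  ultimately show ?case using n1 by blast
 qed
 show ?thesis by (rule that[OF s1n S Sn s1S mM(1,2) ae])
qed

section \<open>Powers of half-plane functions comparable to the weight\<close>

section \<open>Weights with a positive real part\<close>

text \<open>The bound 1/5 is (2 - p)/4 at p = 6/5; it keeps the power within angle \<pi>/10 of the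
  positive axis. The condition on Im is phrased through tan because such a cone is closed under
  sums.\<close>

lemma powr_cone:
 fixes x :: complex and a :: real
 assumes x: "x \<noteq> 0" "0 \<le> Re x" and a: "0 \<le> a" "a \<le> 1/5"
 shows "norm x powr a / 2 \<le> Re (x powr of_real a)"
  and "\<bar>Im (x powr of_real a)\<bar> \<le> tan (a * (pi / 2)) * Re (x powr of_real a)"
  and "norm (x powr of_real a) = norm x powr a"
proof -
 define t where "t = a * Arg x"
 have "\<bar>Arg x\<bar> \<le> pi / 2" using x(2) unfolding Arg_eq_Im_Ln[OF x(1)] Re_Ln_pos_le[OF x(1)] .
 then have t: "\<bar>t\<bar> \<le> a * (pi / 2)" using a unfolding t_def abs_mult by (intro mult_mono) auto
 have ap: "a * (pi / 2) \<le> pi / 10" using mult_right_mono[OF a(2), of "pi/2"] by simp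
 have t3: "\<bar>t\<bar> \<le> pi / 3" "\<bar>t\<bar> < pi / 2" using t ap pi_gt_zero by linarith+
 have r: "x powr of_real a = rcis (norm x powr a) t" unfolding t_def by (rule powr_eq_rcis[OF x(1)])
 have n: "norm x powr a \<ge> 0" by simp
 have "cos (pi / 3) \<le> cos \<bar>t\<bar>" by (rule cos_monotone_0_pi_le) (use t3 pi_gt_zero in linarith)+
 then have c: "1 / 2 \<le> cos t" by (simp add: cos_60)
 show "norm x powr a / 2 \<le> Re (x powr of_real a)" unfolding r Re_rcis using mult_left_mono[OF c n] by simp
 have cp: "0 < cos t" using c by linarith
 have "tan \<bar>t\<bar> \<le> tan (a * (pi / 2))"
 proof (rule tan_mono_le[OF _ t])
  show "- (pi / 2) < \<bar>t\<bar>" using pi_gt_zero abs_ge_zero[of t] by linarith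
  show "a * (pi / 2) < pi / 2" using ap pi_gt_zero by linarith
 qed
 moreover have "\<bar>sin t\<bar> = tan \<bar>t\<bar> * cos t"
 proof -
  have "\<bar>sin t\<bar> = sin \<bar>t\<bar>" using t3(2) sin_ge_zero[of "\<bar>t\<bar>"] pi_gt_zero by (auto simp: abs_if)
  also have "\<dots> = tan \<bar>t\<bar> * cos \<bar>t\<bar>" using cp by (simp add: tan_def)
  finally show ?thesis by simp
 qed
 ultimately have "\<bar>sin t\<bar> \<le> tan (a * (pi / 2)) * cos t" using cp by (simp add: mult_right_mono)
 from mult_left_mono[OF this n]
 show "\<bar>Im (x powr of_real a)\<bar> \<le> tan (a * (pi / 2)) * Re (x powr of_real a)"
  unfolding r Re_rcis Im_rcis abs_mult by (simp add: mult_ac)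
 show "norm (x powr of_real a) = norm x powr a" unfolding r by simp
qed

lemma Arg_le_of_cone:
 assumes "0 < Re x" "\<bar>Im x\<bar> \<le> tan \<theta> * Re x" "0 \<le> \<theta>" "\<theta> < pi / 2"
 shows "\<bar>Arg x\<bar> \<le> \<theta>"
proof -
 have "\<bar>Im x / Re x\<bar> \<le> tan \<theta>" using assms(1,2) by (simp add: pos_divide_le_eq)
 then have "Im x / Re x \<le> tan \<theta>" "- tan \<theta> \<le> Im x / Re x" by linarith+
 then have "arctan (Im x / Re x) \<le> arctan (tan \<theta>)" "arctan (- tan \<theta>) \<le> arctan (Im x / Re x)"
  by (simp_all only: arctan_monotone')
 then have "arctan (Im x / Re x) \<le> \<theta>" "- \<theta> \<le> arctan (Im x / Re x)"
  using assms(3,4) by (simp_all add: arctan_tan arctan_minus)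
 then show ?thesis using assms(1) by (simp add: arg_conv_arctan)
qed

text \<open>Bounds free of the exponent, so that the final constants do not depend on p.\<close>

lemma powr_between:
 fixes c a :: real
 assumes "0 < c" "0 \<le> a" "a \<le> 1"
 shows "min 1 c \<le> c powr a" "c powr a \<le> max 1 c"
proof -
 show "min 1 c \<le> c powr a"
 proof (cases "c \<le> 1")
  case True
  have "c powr 1 \<le> c powr a" using assms True by (intro powr_mono') auto
  then show ?thesis using assms True by simp
 next
  case False
  then have "1 \<le> c powr a" using assms by (intro ge_one_powr_ge_zero) auto
  then show ?thesis by simp
 qed
 show "c powr a \<le> max 1 c"
 proof (cases "c \<le> 1")
  case True
  have "c powr a \<le> c powr 0" using assms True by (intro powr_mono') auto
  then show ?thesis using assms by simp
 next
  case False
  then have "c powr a \<le> c powr 1" using assms by (intro powr_mono) auto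
  then show ?thesis using assms by simp
 qed
qed

locale outer_data =
 fixes s1 :: complex and S :: "complex set"
 assumes s1_norm: "norm s1 = 1" and S_fin: "finite S" and S_ne: "S \<noteq> {}"
  and S_norm: "\<And>s. s \<in> S ==> norm s = 1" and s1_S: "s1 \<notin> S"
begin

abbreviation U where "U \<equiv> model_weight s1 S"
definition gap where "gap = Min ((\<lambda>s. norm (s - s1)) ` S)"
abbreviation N where "N \<equiv> real (card S)"
text \<open>The factor s cnj s1 - 1 is the rotation that puts the image of the circle on the
  imaginary axis; its modulus is |s - s1|, which \<open>gap\<close> bounds from below.\<close>

definition u where "u s z = (s * cnj s1 - 1) * (z\<^sup>2 - s1) / (z\<^sup>2 - s)"
definition H where "H a z = (\<Sum>s\<in>S. u s z powr of_real a)"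

lemma N1: "1 \<le> N" using S_fin S_ne by (simp add: Suc_le_eq card_gt_0_iff)

lemma gap: "0 < gap" "\<And>s. s \<in> S ==> gap \<le> norm (s - s1)"
 using S_fin S_ne s1_S by (auto simp: gap_def)

lemma u_norm: "s \<in> S ==> norm (u s z) = norm (s - s1) * (norm (z\<^sup>2 - s1) / norm (z\<^sup>2 - s))"
proof -
 have "s1 * cnj s1 = 1" using complex_norm_square[of s1] s1_norm by simp
 then have "s * cnj s1 - 1 = (s - s1) * cnj s1" by (simp add: algebra_simps)
 then show ?thesis using s1_norm by (simp add: u_def norm_mult norm_divide)
qed

text \<open>After multiplication by the conjugate denominator, |s| = |s1| = 1 reduces twice the real
  part of the numerator to |s - s1|^2 (1 - |z|^4).\<close>

lemma u_Re:
 assumes s: "s \<in> S"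
 shows "Re (u s z) = (norm (s - s1))\<^sup>2 * (1 - (norm (z\<^sup>2))\<^sup>2) / (2 * (norm (z\<^sup>2 - s))\<^sup>2)"
proof -
 define t where "t = z\<^sup>2"
 define A where "A = (s * cnj s1 - 1) * (t - s1) * cnj (t - s)"
 have 1: "s * cnj s = 1" using complex_norm_square[of s] S_norm[OF s] by simp
 have 2: "s1 * cnj s1 = 1" using complex_norm_square[of s1] s1_norm by simp
 have c: "cnj A = (cnj s * s1 - 1) * (cnj t - cnj s1) * (t - s)" by (simp add: A_def)
 have "A + cnj A = (s - s1) * (cnj s - cnj s1) * (1 - t * cnj t)"
  unfolding c unfolding A_def complex_cnj_diff using 1 2 by algebra
 also have "\<dots> = of_real ((norm (s - s1))\<^sup>2 * (1 - (norm t)\<^sup>2))"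
  by (simp only: of_real_mult of_real_diff of_real_1 complex_norm_square complex_cnj_diff)
 finally have "Re (A + cnj A) = (norm (s - s1))\<^sup>2 * (1 - (norm t)\<^sup>2)" by (simp only: Re_complex_of_real)
 then have "2 * Re A = (norm (s - s1))\<^sup>2 * (1 - (norm t)\<^sup>2)" by simp
 moreover have "Re (u s z) = Re A / (norm (t - s))\<^sup>2"
  unfolding u_def t_def[symmetric] by (subst complex_div_cnj) (simp only: A_def Re_divide_of_real)
 ultimately show ?thesis unfolding t_def by (metis divide_divide_eq_left nonzero_mult_div_cancel_left zero_neq_numeral)
qed

lemma sq_ne: "norm z < 1 ==> norm s = 1 ==> z\<^sup>2 \<noteq> s" for z s :: complex
 by (metis norm_power power_less_one_iff norm_ge_zero less_irrefl zero_less_numeral)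

lemma u_pos:
 assumes "s \<in> S" "norm z < 1" shows "0 < Re (u s z)"
proof -
 have "norm (z\<^sup>2) < 1" using assms(2) by (simp add: norm_power power_less_one_iff)
 then have "0 < 1 - (norm (z\<^sup>2))\<^sup>2" by (rule one_minus_norm_sq_pos)
 moreover have "z\<^sup>2 \<noteq> s" using sq_ne[OF assms(2) S_norm[OF assms(1)]] .
 moreover have "s \<noteq> s1" using assms(1) s1_S by auto
 ultimately show ?thesis unfolding u_Re[OF assms(1)] by simp
qed

lemma u_boundary:
 assumes "s \<in> S" "norm z = 1" "z\<^sup>2 \<noteq> s1" "z\<^sup>2 \<noteq> s"
 shows "Re (u s z) = 0" "u s z \<noteq> 0"
proof -
 show "Re (u s z) = 0" unfolding u_Re[OF assms(1)] using assms(2) by (simp add: norm_power)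
 have "norm (u s z) \<noteq> 0" unfolding u_norm[OF assms(1)] using assms s1_S by auto
 then show "u s z \<noteq> 0" by simp
qed

lemma U_nonneg: "0 \<le> U z" unfolding model_weight_def by (intro mult_nonneg_nonneg sum_nonneg) auto

lemma U_eq: "U z = (\<Sum>s\<in>S. norm (z\<^sup>2 - s1) / norm (z\<^sup>2 - s))"
 unfolding model_weight_def sum_distrib_left by simp

lemma U_term: "s \<in> S ==> norm (z\<^sup>2 - s1) / norm (z\<^sup>2 - s) \<le> U z"
 unfolding U_eq by (rule member_le_sum[OF _ _ S_fin]) auto

lemma U_pos: "z\<^sup>2 \<noteq> s1 ==> z\<^sup>2 \<notin> S ==> 0 < U z"
 unfolding model_weight_def by (intro mult_pos_pos sum_pos S_fin S_ne) auto

lemma norm_s_le_2: "s \<in> S ==> norm (s - s1) \<le> 2"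
 using norm_triangle_ineq4[of s s1] S_norm[of s] s1_norm by simp

lemma H_holo:
 shows "H a holomorphic_on ball 0 1" unfolding H_def[abs_def]
proof (intro holomorphic_on_sum holomorphic_on_powr holomorphic_on_const)
 fix s assume s: "s \<in> S"
 show "u s holomorphic_on ball 0 1"
  unfolding u_def[abs_def] by (intro holomorphic_intros) (use sq_ne S_norm[OF s] in auto)
 fix z :: complex assume "z \<in> ball 0 1"
 then show "u s z \<notin> \<real>\<^sub>\<le>\<^sub>0" using u_pos[OF s, of z] by (auto simp: complex_nonpos_Reals_iff)
qed

lemma H_cone:
 assumes a: "0 \<le> a" "a \<le> 1/5" and u: "\<And>s. s \<in> S ==> u s z \<noteq> 0" "\<And>s. s \<in> S ==> 0 \<le> Re (u s z)"
 shows "(\<Sum>s\<in>S. norm (u s z) powr a) / 2 \<le> Re (H a z)" "\<bar>Im (H a z)\<bar> \<le> tan (a * (pi / 2)) * Re (H a z)"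
  "norm (H a z) \<le> (\<Sum>s\<in>S. norm (u s z) powr a)"
proof -
 note c = powr_cone[OF u a]
 show "(\<Sum>s\<in>S. norm (u s z) powr a) / 2 \<le> Re (H a z)"
  unfolding H_def Re_sum sum_divide_distrib by (intro sum_mono c(1))
 have "\<bar>Im (H a z)\<bar> \<le> (\<Sum>s\<in>S. \<bar>Im (u s z powr of_real a)\<bar>)" unfolding H_def Im_sum by (rule sum_abs)
 also have "\<dots> \<le> (\<Sum>s\<in>S. tan (a * (pi / 2)) * Re (u s z powr of_real a))" by (intro sum_mono c(2))
 finally show "\<bar>Im (H a z)\<bar> \<le> tan (a * (pi / 2)) * Re (H a z)" unfolding H_def Re_sum sum_distrib_left .
 have "norm (H a z) \<le> (\<Sum>s\<in>S. norm (u s z powr of_real a))" unfolding H_def by (rule norm_sum)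
 also have "\<dots> = (\<Sum>s\<in>S. norm (u s z) powr a)" by (intro sum.cong refl c(3))
 finally show "norm (H a z) \<le> (\<Sum>s\<in>S. norm (u s z) powr a)" .
qed

lemma u_nz: "s \<in> S ==> norm z < 1 ==> u s z \<noteq> 0" using u_pos by fastforce

lemma H_Arg:
 assumes a: "0 \<le> a" "a \<le> 1/5" and z: "norm z < 1"
 shows "\<bar>Arg (H a z)\<bar> \<le> a * (pi / 2)"
proof (rule Arg_le_of_cone)
 note c = H_cone[OF a u_nz[OF _ z] less_imp_le[OF u_pos[OF _ z]]]
 have "0 < (\<Sum>s\<in>S. norm (u s z) powr a) / 2"
  using S_fin S_ne u_nz[OF _ z] by (intro divide_pos_pos sum_pos) auto
 then show "0 < Re (H a z)" using c(1) by linarith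
 show "\<bar>Im (H a z)\<bar> \<le> tan (a * (pi / 2)) * Re (H a z)" by (rule c(2))
 show "0 \<le> a * (pi / 2)" using a by simp
 have "a * (pi / 2) \<le> 1/5 * (pi / 2)" using a by (intro mult_right_mono) auto
 then show "a * (pi / 2) < pi / 2" using pi_gt_zero by linarith
qed

text \<open>Each term is at most a multiple of the full weight, and one of the N terms reaches at
  least their average.\<close>

lemma norm_sum_bounds:
 assumes a: "0 \<le> a" "a \<le> 1" and z: "z\<^sup>2 \<noteq> s1" "z\<^sup>2 \<notin> S"
 shows "(\<Sum>s\<in>S. norm (u s z) powr a) \<le> 2 * N * U z powr a"
  "min 1 (gap / N) * U z powr a \<le> (\<Sum>s\<in>S. norm (u s z) powr a)"
proof -
 have Up: "0 < U z" by (rule U_pos[OF z])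
 have "norm (u s z) powr a \<le> 2 * U z powr a" if s: "s \<in> S" for s
 proof -
  have "norm (u s z) \<le> 2 * U z"
   unfolding u_norm[OF s] by (rule mult_mono[OF norm_s_le_2[OF s] U_term[OF s]]) auto
  then have "norm (u s z) powr a \<le> (2 * U z) powr a" using a by (intro powr_mono2) auto
  also have "\<dots> = 2 powr a * U z powr a" using Up by (simp add: powr_mult)
  also have "\<dots> \<le> 2 * U z powr a" using powr_between(2)[of 2 a] a by (intro mult_right_mono) auto
  finally show ?thesis .
 qed
 then have "(\<Sum>s\<in>S. norm (u s z) powr a) \<le> (\<Sum>s\<in>S. 2 * U z powr a)" by (rule sum_mono)
 then show "(\<Sum>s\<in>S. norm (u s z) powr a) \<le> 2 * N * U z powr a" by simp
 have "\<exists>s\<in>S. U z / N \<le> norm (z\<^sup>2 - s1) / norm (z\<^sup>2 - s)"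
 proof (rule ccontr)
  assume "\<not> ?thesis"
  then have "U z < (\<Sum>s\<in>S. U z / N)" unfolding U_eq[of z] using S_fin S_ne by (intro sum_strict_mono) auto
  then show False using N1 by simp
 qed
 then obtain s where s: "s \<in> S" "U z / N \<le> norm (z\<^sup>2 - s1) / norm (z\<^sup>2 - s)" by blast
 have "min 1 (gap / N) * U z powr a \<le> (gap / N) powr a * U z powr a"
  using powr_between(1)[of "gap / N" a] a gap N1 by (intro mult_right_mono) auto
 also have "\<dots> = (gap * (U z / N)) powr a" using gap N1 Up by (simp flip: powr_mult)
 also have "\<dots> \<le> norm (u s z) powr a"
  unfolding u_norm[OF s(1)] using a gap Up N1 s by (intro powr_mono2 mult_mono) auto
 also have "\<dots> \<le> (\<Sum>s\<in>S. norm (u s z) powr a)" using s(1) by (intro member_le_sum S_fin) auto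
 finally show "min 1 (gap / N) * U z powr a \<le> (\<Sum>s\<in>S. norm (u s z) powr a)" .
qed

text \<open>The majorant must be free of r. Passing from r ze to ze at most doubles the distance of
  the square to a pole, and gap/|ze^2 - s| is at most 1 + U(ze). Powers with exponent at most 1/2
  are below 1 plus the square root, and the square root of U is dominated by the integrable boundary
  derivative.\<close>

lemma H_radial_bound:
 assumes a: "0 \<le> a" "a \<le> 1/5" and z: "norm ze = 1" "ze\<^sup>2 \<notin> S" and r: "0 \<le> r" "r < 1"
 shows "norm (H a (of_real r * ze)) \<le> N * (1 + (8 / gap) + (8 / gap) * sqrt (U ze))"
proof -
 have z1: "norm (of_real r * ze) < 1" using z r by (simp add: norm_mult)
 have t: "norm (u s (of_real r * ze)) powr a \<le> 1 + (8 / gap) + (8 / gap) * sqrt (U ze)" if s: "s \<in> S" for s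
 proof -
  have ne: "0 < norm (ze\<^sup>2 - s)" using z(2) s by auto
  have r2: "0 \<le> r\<^sup>2" "r\<^sup>2 \<le> 1" using r by (auto simp: power_le_one)
  define q where "q = (of_real r * ze)\<^sup>2"
  have nq: "norm q = r\<^sup>2" using z by (simp add: q_def norm_power norm_mult)
  have "ze\<^sup>2 - q = of_real (1 - r\<^sup>2) * ze\<^sup>2" by (simp add: q_def power_mult_distrib algebra_simps)
  then have "norm (ze\<^sup>2 - q) = 1 - r\<^sup>2" using r2 z by (simp only: norm_mult norm_of_real norm_power) simp
  moreover have "norm (ze\<^sup>2 - s) \<le> norm (ze\<^sup>2 - q) + norm (q - s)" using norm_triangle_ineq[of "ze\<^sup>2 - q" "q - s"] by simp
  moreover have "1 \<le> norm q + norm (q - s)" using norm_triangle_ineq4[of q "q - s"] S_norm[OF s] by simp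
  ultimately have q2: "norm (ze\<^sup>2 - s) \<le> 2 * norm (q - s)" using nq by linarith
  have q1: "norm (q - s1) \<le> 2" using norm_triangle_ineq4[of q s1] nq r2 s1_norm by linarith
  have qp: "0 < norm (q - s)" using q2 ne by linarith
  have "norm (u s (of_real r * ze)) \<le> 2 * (2 / norm (q - s))"
   unfolding u_norm[OF s] q_def[symmetric] using qp
   by (intro mult_mono norm_s_le_2[OF s] divide_right_mono q1) auto
  also have "\<dots> \<le> 8 / norm (ze\<^sup>2 - s)" using q2 qp ne by (simp add: field_simps)
  also have "\<dots> \<le> (8 / gap) * (1 + U ze)"
  proof -
   have "gap \<le> norm (s - s1)" by (rule gap(2)[OF s])
   also have "\<dots> \<le> norm (ze\<^sup>2 - s1) + norm (ze\<^sup>2 - s)"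
    using norm_triangle_ineq4[of "ze\<^sup>2 - s1" "ze\<^sup>2 - s"] by simp
   finally have "gap / norm (ze\<^sup>2 - s) \<le> (norm (ze\<^sup>2 - s1) + norm (ze\<^sup>2 - s)) / norm (ze\<^sup>2 - s)"
    using ne by (intro divide_right_mono) auto
   also have "\<dots> = norm (ze\<^sup>2 - s1) / norm (ze\<^sup>2 - s) + 1" using ne by (simp add: add_divide_distrib)
   also have "\<dots> \<le> U ze + 1" using U_term[OF s, of ze] by simp
   finally have "8 / gap * (gap / norm (ze\<^sup>2 - s)) \<le> 8 / gap * (U ze + 1)"
    using gap(1) by (intro mult_left_mono) auto
   then show ?thesis using gap(1) by (simp add: add.commute)
  qed
  finally have b: "norm (u s (of_real r * ze)) \<le> (8 / gap) * (1 + U ze)" .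
  define x where "x = norm (u s (of_real r * ze))"
  have x0: "0 \<le> x" by (simp add: x_def)
  have g4: "1 \<le> 8 / gap"
  proof -
   have "gap \<le> 2" using gap(2)[OF s] norm_s_le_2[OF s] by linarith
   then show ?thesis using gap(1) by simp
  qed
  have "x powr a \<le> 1 + sqrt x"
  proof (cases "x \<le> 1")
   case True
   have "x powr a \<le> 1" using a x0 True by (intro powr_le1) auto
   then show ?thesis using real_sqrt_ge_zero[OF x0] by linarith
  next
   case False
   then have "x powr a \<le> x powr (1/2)" using a by (intro powr_mono) auto
   then show ?thesis using x0 by (simp add: powr_half_sqrt)
  qed
  also have "sqrt x \<le> sqrt ((8 / gap) * (1 + U ze))" using b by (simp add: x_def)
  also have "\<dots> = sqrt (8 / gap) * sqrt (1 + U ze)" by (rule real_sqrt_mult)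
  also have "\<dots> \<le> (8 / gap) * (1 + sqrt (U ze))"
  proof (rule mult_mono)
   have "8 / gap \<le> (8 / gap)\<^sup>2" by (rule self_le_power[OF g4]) simp
   then show "sqrt (8 / gap) \<le> 8 / gap" using g4 gap(1) by (intro real_le_lsqrt) auto
   have "1 + U ze \<le> (1 + sqrt (U ze))\<^sup>2" using U_nonneg[of ze] by (simp add: power2_sum)
   then show "sqrt (1 + U ze) \<le> 1 + sqrt (U ze)" using U_nonneg[of ze] by (intro real_le_lsqrt) auto
  qed (use g4 U_nonneg[of ze] gap(1) in auto)
  finally show ?thesis unfolding x_def by (simp add: distrib_left)
 qed
 have "norm (H a (of_real r * ze)) \<le> (\<Sum>s\<in>S. norm (u s (of_real r * ze)) powr a)"
  by (rule H_cone(3)[OF a u_nz[OF _ z1] less_imp_le[OF u_pos[OF _ z1]]])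
 also have "\<dots> \<le> (\<Sum>s\<in>S. 1 + (8 / gap) + (8 / gap) * sqrt (U ze))" by (intro sum_mono t)
 also have "\<dots> = N * (1 + (8 / gap) + (8 / gap) * sqrt (U ze))" by simp
 finally show ?thesis .
qed

lemma H_radial_limit:
 assumes z: "norm ze = 1" "ze\<^sup>2 \<noteq> s1" "ze\<^sup>2 \<notin> S"
 shows "(\<lambda>n. H a (of_real (1 - 1 / real (n + 2)) * ze)) \<longlonglongrightarrow> H a ze"
 unfolding H_def
proof (intro tendsto_sum tendsto_powr_complex tendsto_const)
 fix s assume s: "s \<in> S"
 then have ne: "ze\<^sup>2 \<noteq> s" using z by auto
 have "((\<lambda>z. z) \<longlongrightarrow> ze) (at ze within ball 0 1)" by (rule tendsto_ident_at)
 from filterlim_compose[OF this radial_tendsto[OF z(1)]]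
 have l: "(\<lambda>n. of_real (1 - 1 / real (n + 2)) * ze) \<longlonglongrightarrow> ze" .
 show "(\<lambda>n. u s (of_real (1 - 1 / real (n + 2)) * ze)) \<longlonglongrightarrow> u s ze"
  unfolding u_def by (intro tendsto_divide tendsto_mult tendsto_const tendsto_diff tendsto_power l) (use ne in simp)
 show "u s ze \<notin> \<real>\<^sub>\<le>\<^sub>0" using u_boundary[OF s z(1,2) ne] by (auto simp: complex_nonpos_Reals_iff complex_eq_iff)
qed

end

locale model_map = omega_map + outer_data +
 fixes m M :: real
 assumes m0: "0 < m" and M0: "0 < M"
  and comparison: "AE ze in mu. ze\<^sup>2 \<noteq> s1 \<and> ze\<^sup>2 \<notin> S \<and> m * model_weight s1 S ze \<le> (bd_deriv \<phi> ze)\<^sup>2 \<and> (bd_deriv \<phi> ze)\<^sup>2 \<le> M * model_weight s1 S ze"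
begin

text \<open>Normalized so that v^2 is the density of arc length and v^4 is comparable to
  \<open>U\<close>.\<close>

definition v where "v ze = sqrt (bd_deriv \<phi> ze)"

lemma v_meas: "v \<in> borel_measurable mu"
 unfolding v_def[abs_def] using bd_deriv_measurable[OF facts(2)] by measurable

lemma v_AE: "AE ze in mu. norm ze = 1 \<and> 0 < v ze \<and> ze\<^sup>2 \<noteq> s1 \<and> ze\<^sup>2 \<notin> S \<and> (v ze)\<^sup>2 = bd_deriv \<phi> ze
  \<and> m * U ze \<le> v ze ^ 4 \<and> v ze ^ 4 \<le> M * U ze" using comparison AE_circle
proof eventually_elim
 case (elim ze)
 then have b: "0 < bd_deriv \<phi> ze" by (intro bd_deriv_pos) auto
 then have v2: "(v ze)\<^sup>2 = bd_deriv \<phi> ze" by (simp add: v_def)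
 have "v ze ^ 4 = ((v ze)\<^sup>2)\<^sup>2" by simp
 then have "v ze ^ 4 = (bd_deriv \<phi> ze)\<^sup>2" unfolding v2 .
 then show ?case using elim b v2 by (auto simp: v_def)
qed

lemma v_sq_integrable: "integrable mu (\<lambda>ze. (v ze)\<^sup>2)"
proof (rule integrableI_bounded)
 show "(\<lambda>ze. (v ze)\<^sup>2) \<in> borel_measurable mu" using v_meas by measurable
 have "AE ze in mu. ennreal (norm ((v ze)\<^sup>2)) = ennreal (bd_deriv \<phi> ze)" using v_AE
 proof eventually_elim
  case (elim ze)
  then have e: "(v ze)\<^sup>2 = bd_deriv \<phi> ze" by (elim conjE)
  show ?case unfolding e[symmetric] real_norm_def abs_power2 ..
 qed
 from nn_integral_cong_AE[OF this] show "(\<integral>\<^sup>+ze. ennreal (norm ((v ze)\<^sup>2)) \<partial>mu) < \<infinity>"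
  using bd_deriv_finite by (simp only:)
qed

lemma v_powr_eq: "0 < x ==> x powr (4 * b) = (x ^ 4) powr (b::real)" using powr_powr[of x 4 b] by simp

lemma v_powr_bounds:
 assumes a: "0 \<le> a" "a \<le> 1" and U: "0 < U ze" "0 < v ze" "m * U ze \<le> v ze ^ 4" "v ze ^ 4 \<le> M * U ze"
 shows "min 1 m * U ze powr a \<le> v ze powr (4 * a)" "v ze powr (4 * a) \<le> max 1 M * U ze powr a"
proof -
 have "min 1 m * U ze powr a \<le> m powr a * U ze powr a"
  using powr_between(1)[OF m0 a] by (intro mult_right_mono) auto
 also have "\<dots> = (m * U ze) powr a" using m0 U by (simp add: powr_mult)
 also have "\<dots> \<le> (v ze ^ 4) powr a" using a m0 U by (intro powr_mono2) auto
 finally show "min 1 m * U ze powr a \<le> v ze powr (4 * a)" using v_powr_eq[OF U(2)] by simp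
 have "(v ze ^ 4) powr a \<le> (M * U ze) powr a" using a U by (intro powr_mono2) auto
 also have "\<dots> = M powr a * U ze powr a" using M0 U by (simp add: powr_mult)
 also have "\<dots> \<le> max 1 M * U ze powr a"
  using powr_between(2)[OF M0 a] by (intro mult_right_mono) auto
 finally show "v ze powr (4 * a) \<le> max 1 M * U ze powr a" using v_powr_eq[OF U(2)] by simp
qed

lemma v_powr_le:
 assumes p: "0 \<le> p" "p \<le> 2" and that: "0 < v ze"
 shows "v ze powr (2 - p) \<le> 1 + (v ze)\<^sup>2"
proof (cases "v ze \<le> 1")
 case True
 then have "v ze powr (2 - p) \<le> 1" using p that by (intro powr_le1) auto
 then show ?thesis using zero_le_power2[of "v ze"] by linarith
next
 case False
 then have "v ze powr (2 - p) \<le> v ze powr 2" using p by (intro powr_mono) auto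
 then show ?thesis using that by simp
qed

text \<open>3840 from the integrated inequality, times the two constants \<open>c2\<close> and
  1/\<open>c1\<close> comparing v^(2 - p) with the boundary modulus of \<open>H\<close>.\<close>

definition K1 where "K1 = 3840 * (2 * N / min 1 m) * (2 * max 1 M / min 1 (gap / N))"

text \<open>With a = (2 - p)/4 one has v^(2 - p) = (v^4)^a, comparable to U^a and hence to the
  boundary modulus V of \<open>H a\<close>. The inequality is proved with weight V and transferred
  to v^(2 - p) on both sides.\<close>

lemma weighted_poly_bound:
 assumes p: "6/5 < p" "p \<le> 2"
  and F: "\<And>z. norm z \<le> 1 ==> Re (poly F z) > 0" "Im (poly F 0) = 0"
 shows "(\<integral>\<^sup>+ze. ennreal (norm ((poly F ze + poly F 0) / 2) powr p * v ze powr (2 - p)) \<partial>mu)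
  \<le> ennreal (K1 / ((5 * p - 6) * pi / 8) powr p) * (\<integral>\<^sup>+ze. ennreal (Re (poly F ze) powr p * v ze powr (2 - p)) \<partial>mu)"
proof -
 define a where "a = (2 - p) / 4"
 have a: "0 \<le> a" "a \<le> 1/5" "a \<le> 1" "4 * a = 2 - p" using p by (auto simp: a_def)
 define V where "V ze = lim (\<lambda>n. norm (H a (of_real (1 - 1 / real (n + 2)) * ze)))" for ze
 define D where "D ze = N * (1 + (8 / gap) + (8 / gap) * ((v ze)\<^sup>2 / sqrt m))" for ze
 let ?W = "\<lambda>ze. v ze powr (2 - p)"
 define c1 where "c1 = min 1 (gap / N) / (2 * max 1 M)"
 define c2 where "c2 = 2 * N / min 1 m"
 have c12: "0 < c1" "0 < c2" unfolding c1_def c2_def using N1 m0 M0 gap(1) by auto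
 have r: "0 < 1 - 1 / real (n + 2)" "1 - 1 / real (n + 2) < 1" for n by (auto simp: field_simps)
 have Vlim: "AE ze in mu. (\<lambda>n. norm (H a (of_real (1 - 1 / real (n + 2)) * ze))) \<longlonglongrightarrow> V ze \<and> c1 * ?W ze \<le> V ze \<and> V ze \<le> c2 * ?W ze"
  using v_AE
 proof eventually_elim
  case (elim ze)
  then have z: "norm ze = 1" "ze\<^sup>2 \<noteq> s1" "ze\<^sup>2 \<notin> S" by auto
  have l: "(\<lambda>n. norm (H a (of_real (1 - 1 / real (n + 2)) * ze))) \<longlonglongrightarrow> norm (H a ze)"
   by (rule tendsto_norm[OF H_radial_limit[OF z]])
  then have V: "V ze = norm (H a ze)" unfolding V_def by (rule limI)
  have ns: "ze\<^sup>2 \<noteq> s" if "s \<in> S" for s using z(3) that by metis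
  have nz: "u s ze \<noteq> 0" "0 \<le> Re (u s ze)" if "s \<in> S" for s
   by (rule u_boundary(2)[OF that z(1,2) ns[OF that]], simp only: u_boundary(1)[OF that z(1,2) ns[OF that]] order_refl)
  define X where "X = (\<Sum>s\<in>S. norm (u s ze) powr a)"
  have X: "X / 2 \<le> V ze" "V ze \<le> X"
   using H_cone(1,3)[OF a(1,2) nz, folded X_def] complex_Re_le_cmod[of "H a ze"] unfolding V by linarith+
  note b = norm_sum_bounds[OF a(1,3) z(2,3), folded X_def]
  have Up: "0 < U ze" by (rule U_pos[OF z(2,3)])
  have e: "0 < v ze" "m * U ze \<le> v ze ^ 4" "v ze ^ 4 \<le> M * U ze" using elim by blast+
  have vb: "min 1 m * U ze powr a \<le> ?W ze" "?W ze \<le> max 1 M * U ze powr a"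
   by (rule v_powr_bounds[OF a(1,3) Up e, unfolded a(4)])+
  have "c1 * ?W ze \<le> c1 * (max 1 M * U ze powr a)" using vb(2) c12 by (intro mult_left_mono) auto
  also have "\<dots> = (min 1 (gap / N) * U ze powr a) / 2" using M0 by (simp add: c1_def)
  also have "\<dots> \<le> X / 2" by (rule divide_right_mono[OF b(2)]) simp
  finally have 1: "c1 * ?W ze \<le> V ze" using X(1) by (rule order_trans)
  have "V ze \<le> 2 * N * U ze powr a" using X(2) b(1) by linarith
  also have "\<dots> = c2 * (min 1 m * U ze powr a)" using m0 by (simp add: c2_def)
  also have "\<dots> \<le> c2 * ?W ze" using vb(1) c12 by (intro mult_left_mono) auto
  finally show ?case using 1 l V by simp
 qed
 have Vm: "V \<in> borel_measurable mu"
 proof -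
  have "continuous_on (sphere 0 1) (\<lambda>ze. norm (H a (of_real (1 - 1 / real (n + 2)) * ze)))" for n
  proof (rule continuous_on_norm, rule continuous_on_compose2[OF holomorphic_on_imp_continuous_on[OF H_holo]])
   show "continuous_on (sphere 0 1) (\<lambda>ze. complex_of_real (1 - 1 / real (n + 2)) * ze)" by (intro continuous_intros)
   show "(\<lambda>ze. complex_of_real (1 - 1 / real (n + 2)) * ze) ` sphere 0 1 \<subseteq> ball 0 1"
   proof
    fix x assume "x \<in> (\<lambda>ze. complex_of_real (1 - 1 / real (n + 2)) * ze) ` sphere 0 1"
    then have "norm x = 1 - 1 / real (n + 2)" using r[of n] by (auto simp only: norm_mult norm_of_real sphere_def dist_0_norm mem_Collect_eq mult_1_right abs_of_pos)
    then show "x \<in> ball 0 1" using r[of n] by simp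
   qed
  qed
  then have "(\<lambda>ze. norm (H a (of_real (1 - 1 / real (n + 2)) * ze))) \<in> borel_measurable mu" for n
   unfolding measurable_cong_sets[OF sets_circle_measure refl] by (rule borel_measurable_continuous_on_restrict)
  then show ?thesis unfolding V_def[abs_def] by (rule borel_measurable_lim_metric)
 qed
 have Di: "integrable mu D"
  unfolding D_def[abs_def] by (intro integrable_mult_right Bochner_Integration.integrable_add integrable_divide v_sq_integrable finite_measure.integrable_const finite_circle)
 have Dd: "AE ze in mu. norm (H a (of_real (1 - 1 / real (n + 2)) * ze)) \<le> D ze" for n using v_AE
 proof eventually_elim
  case (elim ze)
  have "norm (H a (of_real (1 - 1 / real (n + 2)) * ze)) \<le> N * (1 + (8 / gap) + (8 / gap) * sqrt (U ze))"
   by (rule H_radial_bound[OF a(1,2)]) (use elim r[of n] in auto)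
  also have "\<dots> \<le> D ze"
  proof -
   have "U ze \<le> v ze ^ 4 / m" using elim m0 by (simp add: pos_le_divide_eq mult.commute)
   then have "sqrt (U ze) \<le> sqrt (v ze ^ 4 / m)" by simp
   also have "\<dots> = (v ze)\<^sup>2 / sqrt m"
   proof -
    have "v ze ^ 4 = ((v ze)\<^sup>2)\<^sup>2" by simp
    then show ?thesis by (simp only: real_sqrt_divide real_sqrt_abs abs_power2)
   qed
   finally show ?thesis unfolding D_def using N1 gap(1) by (intro mult_left_mono add_left_mono) auto
  qed
  finally show ?case .
 qed
 let ?\<kappa> = "(5 * p - 6) * pi / 8"
 let ?G = "\<lambda>ze. norm ((poly F ze + poly F 0) / 2) powr p" and ?R = "\<lambda>ze. Re (poly F ze) powr p"
 have k: "0 < ?\<kappa>" using p by simp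
 have main: "(\<integral>ze. ?G ze * V ze \<partial>mu) \<le> 3840 / ?\<kappa> powr p * (\<integral>ze. ?R ze * V ze \<partial>mu)"
  by (rule weighted_riesz_limit[OF p F H_holo _ Di Dd Vm])
   (use H_Arg[OF a(1,2)] Vlim in \<open>auto simp: a_def\<close>)
 have "compact (poly F ` cball 0 1)" by (intro compact_continuous_image continuous_intros) auto
 then have "bounded (poly F ` cball 0 1)" by (rule compact_imp_bounded)
 then obtain B where B0: "\<forall>x\<in>poly F ` cball 0 1. norm x \<le> B" unfolding bounded_iff by (elim exE)
 have B: "norm (poly F z) \<le> B" if "norm z \<le> 1" for z
  by (rule B0[rule_format, OF imageI]) (use that in simp)
 have Vi: "integrable mu V"
 proof (rule Bochner_Integration.integrable_bound)
  show "integrable mu (\<lambda>ze. c2 * (1 + (v ze)\<^sup>2))"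
   by (intro integrable_mult_right Bochner_Integration.integrable_add v_sq_integrable finite_measure.integrable_const finite_circle)
  show "AE ze in mu. norm (V ze) \<le> norm (c2 * (1 + (v ze)\<^sup>2))" using Vlim v_AE
  proof eventually_elim
   case (elim ze)
   have "0 \<le> c1 * ?W ze" using c12 by simp
   then have V0: "0 \<le> V ze" using elim by linarith
   have "?W ze \<le> 1 + (v ze)\<^sup>2" by (rule v_powr_le) (use p elim in auto)
   then have "c2 * ?W ze \<le> c2 * (1 + (v ze)\<^sup>2)" using c12 by (intro mult_left_mono) auto
   then have "V ze \<le> c2 * (1 + (v ze)\<^sup>2)" using elim by linarith
   then show ?case using V0 by simp
  qed
 qed (rule Vm)
 have pm: "poly F \<in> borel_measurable mu" by (rule L2_measurable[OF L2_poly_circle])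
 have int: "integrable mu (\<lambda>ze. g ze * V ze)"
  if gm: "g \<in> borel_measurable mu" and gb: "\<And>ze. norm ze = 1 ==> 0 \<le> g ze \<and> g ze \<le> B powr p" for g :: "complex \<Rightarrow> real"
 proof (rule Bochner_Integration.integrable_bound)
  show "integrable mu (\<lambda>ze. B powr p * V ze)" by (intro integrable_mult_right Vi)
  show "(\<lambda>ze. g ze * V ze) \<in> borel_measurable mu" using gm Vm by measurable
  show "AE ze in mu. norm (g ze * V ze) \<le> norm (B powr p * V ze)" using AE_space
  proof eventually_elim
   case (elim ze)
   then show ?case unfolding norm_mult using gb[of ze] by (intro mult_right_mono) auto
  qed
 qed
 have Gi: "integrable mu (\<lambda>ze. ?G ze * V ze)"
 proof (rule int)
  show "?G \<in> borel_measurable mu" using pm by measurable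
  fix ze :: complex assume z: "norm ze = 1"
  have "norm ((poly F ze + poly F 0) / 2) \<le> B"
   using norm_triangle_ineq[of "poly F ze" "poly F 0"] B[of ze] B[of 0] z by (simp add: norm_divide)
  then show "0 \<le> ?G ze \<and> ?G ze \<le> B powr p" using p by (auto intro!: powr_mono2)
 qed
 have Ri: "integrable mu (\<lambda>ze. ?R ze * V ze)"
 proof (rule int)
  show "?R \<in> borel_measurable mu" using pm by measurable
  fix ze :: complex assume z: "norm ze = 1"
  then show "0 \<le> ?R ze \<and> ?R ze \<le> B powr p"
   using p F(1)[of ze] B[of ze] complex_Re_le_cmod[of "poly F ze"] by (auto intro!: powr_mono2)
 qed
 have V0: "AE ze in mu. 0 \<le> V ze" using Vlim
 proof eventually_elim
  case (elim ze)
  have "0 \<le> c1 * ?W ze" using c12 by simp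
  then show ?case using elim by linarith
 qed
 have nnG: "(\<integral>\<^sup>+ze. ennreal (?G ze * V ze) \<partial>mu) = ennreal (\<integral>ze. ?G ze * V ze \<partial>mu)"
  by (rule nn_integral_eq_integral[OF Gi]) (use V0 in eventually_elim, simp)
 have nnR: "(\<integral>\<^sup>+ze. ennreal (?R ze * V ze) \<partial>mu) = ennreal (\<integral>ze. ?R ze * V ze \<partial>mu)"
  by (rule nn_integral_eq_integral[OF Ri]) (use V0 in eventually_elim, simp)
 have [measurable]: "?G \<in> borel_measurable mu" "?R \<in> borel_measurable mu" using pm by measurable
 note [measurable] = v_meas Vm
 have "(\<integral>\<^sup>+ze. ennreal (?G ze * ?W ze) \<partial>mu) \<le> (\<integral>\<^sup>+ze. ennreal (1 / c1) * ennreal (?G ze * V ze) \<partial>mu)"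
 proof (rule nn_integral_mono_AE)
  show "AE ze in mu. ennreal (?G ze * ?W ze) \<le> ennreal (1 / c1) * ennreal (?G ze * V ze)" using Vlim
  proof eventually_elim
   case (elim ze)
   then have "?W ze \<le> 1 / c1 * V ze" using c12 by (simp add: field_simps)
   then have "?G ze * ?W ze \<le> ?G ze * (1 / c1 * V ze)" by (rule mult_left_mono) simp
   then show ?case using c12 by (subst ennreal_mult'[symmetric]) (auto intro!: ennreal_leI simp: mult_ac)
  qed
 qed
 also have "\<dots> = ennreal (1 / c1) * ennreal (\<integral>ze. ?G ze * V ze \<partial>mu)"
  unfolding nnG[symmetric] by (rule nn_integral_cmult) measurable
 also have "\<dots> \<le> ennreal (1 / c1) * ennreal (3840 / ?\<kappa> powr p * (\<integral>ze. ?R ze * V ze \<partial>mu))"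
  by (intro mult_left_mono ennreal_leI main) simp
 also have "\<dots> = ennreal (1 / c1) * (ennreal (3840 / ?\<kappa> powr p) * (\<integral>\<^sup>+ze. ennreal (?R ze * V ze) \<partial>mu))"
  unfolding nnR by (subst ennreal_mult') auto
 also have "\<dots> \<le> ennreal (1 / c1) * (ennreal (3840 / ?\<kappa> powr p) * (\<integral>\<^sup>+ze. ennreal c2 * ennreal (?R ze * ?W ze) \<partial>mu))"
 proof (intro mult_left_mono nn_integral_mono_AE)
  show "AE ze in mu. ennreal (?R ze * V ze) \<le> ennreal c2 * ennreal (?R ze * ?W ze)" using Vlim
  proof eventually_elim
   case (elim ze)
   then have "?R ze * V ze \<le> ?R ze * (c2 * ?W ze)" by (intro mult_left_mono) auto
   then show ?case using c12 by (subst ennreal_mult'[symmetric]) (auto intro!: ennreal_leI simp: mult_ac)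
  qed
 qed auto
 also have "\<dots> = ennreal (1 / c1) * (ennreal (3840 / ?\<kappa> powr p) * (ennreal c2 * (\<integral>\<^sup>+ze. ennreal (?R ze * ?W ze) \<partial>mu)))"
  by (intro arg_cong2[where f=times] refl nn_integral_cmult) measurable
 also have "\<dots> = ennreal (1 / c1 * (3840 / ?\<kappa> powr p) * c2) * (\<integral>\<^sup>+ze. ennreal (?R ze * ?W ze) \<partial>mu)"
 proof -
  have "ennreal x * (ennreal y * (ennreal z * X)) = ennreal (x * y * z) * X" if "0 \<le> x" "0 \<le> y" "0 \<le> z" for x y z :: real and X
   using that by (simp add: ennreal_mult mult.assoc)
  then show ?thesis by this (use c12 in auto)
 qed
 also have "1 / c1 * (3840 / ?\<kappa> powr p) * c2 = K1 / ?\<kappa> powr p"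
  by (simp add: K1_def c1_def c2_def mult_ac)
 finally show ?thesis .
qed

end

section \<open>From polynomials to arbitrary data: weighted limits and four positive parts\<close>

section \<open>The upper bound\<close>

lemma powr_add_le_4:
 fixes x y p :: real
 assumes "0 \<le> x" "0 \<le> y" "0 < p" "p \<le> 2"
 shows "(x + y) powr p \<le> 4 * x powr p + 4 * y powr p"
proof -
 have "(x + y) powr p \<le> (2 * max x y) powr p" using assms by (intro powr_mono2) auto
 also have "\<dots> = 2 powr p * (max x y) powr p" using assms by (simp add: powr_mult)
 also have "\<dots> \<le> 4 * (max x y) powr p"
 proof (rule mult_right_mono)
  have "(2::real) powr p \<le> 2 powr 2" using assms by (intro powr_mono) auto
  then show "2 powr p \<le> (4::real)" by simp
 qed simp
 also have "\<dots> \<le> 4 * x powr p + 4 * y powr p" by (simp add: max_def)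
 finally show ?thesis .
qed

text \<open>Replaces Hoelder's inequality by a sum with a free parameter: for x at most \<delta> y
  the weight term dominates, otherwise the square term.\<close>

lemma powr_interpolate:
 fixes x y \<delta> p :: real
 assumes "0 \<le> x" "0 < y" "0 < \<delta>" "0 < p" "p \<le> 2"
 shows "x powr p * y powr (2 - p) \<le> \<delta> powr p * y\<^sup>2 + \<delta> powr (p - 2) * x\<^sup>2"
proof (cases "x \<le> \<delta> * y")
 case True
 have "x powr p * y powr (2 - p) \<le> (\<delta> * y) powr p * y powr (2 - p)"
  using assms True by (intro mult_right_mono powr_mono2) auto
 also have "\<dots> = \<delta> powr p * (y powr p * y powr (2 - p))" using assms by (simp add: powr_mult)
 also have "y powr p * y powr (2 - p) = y\<^sup>2" using assms by (simp flip: powr_add)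
 finally have "x powr p * y powr (2 - p) \<le> \<delta> powr p * y\<^sup>2" .
 moreover have "0 \<le> \<delta> powr (p - 2) * x\<^sup>2" by simp
 ultimately show ?thesis by linarith
next
 case False
 then have y: "y \<le> x / \<delta>" and x: "0 < x"
  using assms by (auto simp: pos_le_divide_eq mult.commute intro: less_trans[of 0 "\<delta> * y"])
 have "x powr p * y powr (2 - p) \<le> x powr p * (x / \<delta>) powr (2 - p)"
  using assms y by (intro mult_left_mono powr_mono2) auto
 also have "\<dots> = (x powr p * x powr (2 - p)) * (1 / \<delta> powr (2 - p))" using assms by (simp add: powr_divide)
 also have "x powr p * x powr (2 - p) = x\<^sup>2" using x by (simp flip: powr_add)
 also have "1 / \<delta> powr (2 - p) = \<delta> powr (p - 2)" using powr_minus_divide[of \<delta> "2 - p"] by simp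
 finally have "x powr p * y powr (2 - p) \<le> \<delta> powr (p - 2) * x\<^sup>2" by (simp only: mult.commute)
 moreover have "0 \<le> \<delta> powr p * y\<^sup>2" by simp
 ultimately show ?thesis by linarith
qed

text \<open>In the interpolated bound the weight term is made small by \<delta>, using integrability
  of v^2, and the square term then by n. No boundedness of the weight is involved.\<close>

lemma L2lim_weighted:
 assumes l: "L2lim M f g" and f: "\<And>n. L2 M (f n)" "L2 M g"
  and v: "integrable M (\<lambda>x. (v x)\<^sup>2)" "AE x in M. 0 < v x" and p: "1 \<le> p" "p \<le> 2"
 shows "(\<lambda>n. \<integral>\<^sup>+x. ennreal (norm (f n x - g x) powr p * v x powr (2 - p)) \<partial>M) \<longlonglongrightarrow> 0"
proof -
 define A where "A = (\<integral>x. (v x)\<^sup>2 \<partial>M)"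
 have A: "0 \<le> A" by (simp add: A_def)
 let ?I = "\<lambda>n. \<integral>x. (norm (f n x - g x))\<^sup>2 \<partial>M"
 have I: "integrable M (\<lambda>x. (norm (f n x - g x))\<^sup>2)" for n by (rule L2_integrable[OF L2_diff[OF f]])
 have b: "(\<integral>\<^sup>+x. ennreal (norm (f n x - g x) powr p * v x powr (2 - p)) \<partial>M) \<le> ennreal (\<delta> powr p * A + \<delta> powr (p - 2) * ?I n)"
  if d: "0 < \<delta>" for \<delta> n
 proof -
  have "(\<integral>\<^sup>+x. ennreal (norm (f n x - g x) powr p * v x powr (2 - p)) \<partial>M)
   \<le> (\<integral>\<^sup>+x. ennreal (\<delta> powr p * (v x)\<^sup>2 + \<delta> powr (p - 2) * (norm (f n x - g x))\<^sup>2) \<partial>M)"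
  proof (rule nn_integral_mono_AE)
   show "AE x in M. ennreal (norm (f n x - g x) powr p * v x powr (2 - p))
     \<le> ennreal (\<delta> powr p * (v x)\<^sup>2 + \<delta> powr (p - 2) * (norm (f n x - g x))\<^sup>2)"
    using v(2)
   proof eventually_elim
    case (elim x)
    show ?case by (rule ennreal_leI, rule powr_interpolate) (use elim d p in auto)
   qed
  qed
  also have "\<dots> = ennreal (\<integral>x. \<delta> powr p * (v x)\<^sup>2 + \<delta> powr (p - 2) * (norm (f n x - g x))\<^sup>2 \<partial>M)"
   by (rule nn_integral_eq_integral) (auto intro!: Bochner_Integration.integrable_add integrable_mult_right v I)
  also have "(\<integral>x. \<delta> powr p * (v x)\<^sup>2 + \<delta> powr (p - 2) * (norm (f n x - g x))\<^sup>2 \<partial>M) = \<delta> powr p * A + \<delta> powr (p - 2) * ?I n"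
   unfolding A_def by (subst Bochner_Integration.integral_add) (auto intro!: integrable_mult_right v I)
  finally show ?thesis .
 qed
 show ?thesis
 proof (rule order_tendstoI)
  fix a :: ennreal assume "0 < a"
  then obtain z where z: "0 < z" "z < a" using dense by blast
  then obtain e where e: "z = ennreal e" "0 < e" by (cases z) (auto simp: ennreal_less_zero_iff)
  define \<delta> where "\<delta> = min 1 (e / (2 * (A + 1)))"
  have d: "0 < \<delta>" "\<delta> \<le> 1" using e A by (auto simp: \<delta>_def)
  have "\<delta> powr p * A \<le> \<delta> * A"
   using powr_mono'[of 1 p \<delta>] d p A by (intro mult_right_mono) auto
  also have "\<dots> \<le> e / (2 * (A + 1)) * A" using A by (intro mult_right_mono) (auto simp: \<delta>_def)
  also have "\<dots> \<le> e / 2"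
  proof -
   have "e * A \<le> e * (A + 1)" using e by (intro mult_left_mono) auto
   then show ?thesis using A by (simp add: field_simps)
  qed
  finally have d1: "\<delta> powr p * A \<le> e / 2" .
  have "(\<lambda>n. \<delta> powr (p - 2) * ?I n) \<longlonglongrightarrow> \<delta> powr (p - 2) * 0"
   using l unfolding L2lim_def by (rule tendsto_mult_left)
  then have "eventually (\<lambda>n. \<delta> powr (p - 2) * ?I n < e / 2) sequentially"
   by (rule order_tendstoD(2)) (use e in simp)
  then show "eventually (\<lambda>n. (\<integral>\<^sup>+x. ennreal (norm (f n x - g x) powr p * v x powr (2 - p)) \<partial>M) < a) sequentially"
  proof eventually_elim
   case (elim n)
   have "\<delta> powr p * A + \<delta> powr (p - 2) * ?I n \<le> e" using elim d1 by linarith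
   then have "ennreal (\<delta> powr p * A + \<delta> powr (p - 2) * ?I n) \<le> z" unfolding e(1) by (rule ennreal_leI)
   then show ?case using b[OF d(1), of n] z(2) by (meson le_less_trans order_trans)
  qed
 qed simp
qed

lemma nn_integral_powr_add_le:
 assumes [measurable]: "f \<in> borel_measurable M" "g \<in> borel_measurable M" "W \<in> borel_measurable M"
  and p: "0 < p" "p \<le> 2" and W: "\<And>x. 0 \<le> W x" and h: "AE x in M. norm (h x) \<le> norm (f x) + norm (g x)"
 shows "(\<integral>\<^sup>+x. ennreal (norm (h x :: complex) powr p * W x) \<partial>M)
   \<le> 4 * (\<integral>\<^sup>+x. ennreal (norm (f x :: complex) powr p * W x) \<partial>M) + 4 * (\<integral>\<^sup>+x. ennreal (norm (g x :: complex) powr p * W x) \<partial>M)"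
proof -
 have "(\<integral>\<^sup>+x. ennreal (norm (h x) powr p * W x) \<partial>M) \<le> (\<integral>\<^sup>+x. 4 * ennreal (norm (f x) powr p * W x) + 4 * ennreal (norm (g x) powr p * W x) \<partial>M)"
 proof (rule nn_integral_mono_AE)
  show "AE x in M. ennreal (norm (h x) powr p * W x) \<le> 4 * ennreal (norm (f x) powr p * W x) + 4 * ennreal (norm (g x) powr p * W x)"
   using h
  proof eventually_elim
   case (elim x)
   have "norm (h x) powr p \<le> (norm (f x) + norm (g x)) powr p" using elim p by (intro powr_mono2) auto
   also have "\<dots> \<le> 4 * norm (f x) powr p + 4 * norm (g x) powr p" by (rule powr_add_le_4) (use p in auto)
   finally have "norm (h x) powr p * W x \<le> (4 * norm (f x) powr p + 4 * norm (g x) powr p) * W x" by (rule mult_right_mono[OF _ W])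
   also have "\<dots> = 4 * (norm (f x) powr p * W x) + 4 * (norm (g x) powr p * W x)" by (simp add: distrib_right)
   finally have "ennreal (norm (h x) powr p * W x) \<le> ennreal (4 * (norm (f x) powr p * W x) + 4 * (norm (g x) powr p * W x))"
    by (rule ennreal_leI)
   then show ?case using W[of x] by (simp only: ennreal_plus ennreal_mult' mult_nonneg_nonneg powr_ge_zero zero_le_numeral ennreal_numeral)
  qed
 qed
 also have "\<dots> = 4 * (\<integral>\<^sup>+x. ennreal (norm (f x) powr p * W x) \<partial>M) + 4 * (\<integral>\<^sup>+x. ennreal (norm (g x) powr p * W x) \<partial>M)"
  by (subst nn_integral_add; (subst nn_integral_cmult)?; measurable?; (subst nn_integral_cmult)?; measurable?)
 finally show ?thesis .
qed

context model_map begin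

text \<open>Limit of the polynomial estimate. The quasi-triangle inequality with factor 4 enters
  once for the projections and once for the data, hence 16.\<close>

lemma weighted_nonneg_bound:
 assumes p: "6/5 < p" "p \<le> 2"
  and U: "U0 \<in> borel_measurable mu" "\<And>x. 0 \<le> U0 x" "integrable mu (\<lambda>x. (U0 x)\<^sup>2)"
  and G: "szego_rel (\<lambda>ze. of_real (U0 ze)) G'"
 shows "(\<integral>\<^sup>+ze. ennreal (norm (G' ze) powr p * v ze powr (2 - p)) \<partial>mu)
  \<le> 16 * (ennreal (K1 / ((5 * p - 6) * pi / 8) powr p) * (\<integral>\<^sup>+ze. ennreal (U0 ze powr p * v ze powr (2 - p)) \<partial>mu))"
proof -
 let ?W = "\<lambda>ze. v ze powr (2 - p)"
 let ?B = "ennreal (K1 / ((5 * p - 6) * pi / 8) powr p)"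
 obtain F G where F: "\<And>n. Im (poly (F n) 0) = 0" "\<And>n ze. norm ze \<le> 1 ==> 0 < Re (poly (F n) ze)"
  and l1: "L2lim mu (\<lambda>n ze. of_real (Re (poly (F n) ze))) (\<lambda>ze. of_real (U0 ze))"
  and l2: "L2lim mu (\<lambda>n ze. (poly (F n) ze + poly (F n) 0) / 2) G"
  and sG: "szego_rel (\<lambda>ze. of_real (U0 ze)) G"
  by (rule szego_rel_nonneg[OF U]) (rule that; assumption)
 have LU: "L2 mu (\<lambda>ze. complex_of_real (U0 ze))" by (rule L2_of_real[OF U(1,3)])
 have LG: "L2 mu G" by (rule szego_rel_L2[OF sG])
 let ?Gn = "\<lambda>n ze. (poly (F n) ze + poly (F n) 0) / 2" and ?Rn = "\<lambda>n ze. complex_of_real (Re (poly (F n) ze))"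
 have LGn: "L2 mu (?Gn n)" for n by (rule szego_rel_L2[OF szego_rel_Re_poly[OF F(1)]])
 have LRn: "L2 mu (?Rn n)" for n by (rule L2_circle_continuous) (intro continuous_intros)
 have vp: "AE x in mu. 0 < v x" using v_AE by eventually_elim (elim conjE)
 have [measurable]: "?W \<in> borel_measurable mu" using v_meas by measurable
 note [measurable] = L2_measurable[OF LG] L2_measurable[OF LGn] L2_measurable[OF LRn] L2_measurable[OF LU]
 define J where "J n = (\<integral>\<^sup>+x. ennreal (norm (?Gn n x - G x) powr p * ?W x) \<partial>mu)" for n
 define I where "I n = (\<integral>\<^sup>+x. ennreal (norm (?Rn n x - of_real (U0 x)) powr p * ?W x) \<partial>mu)" for n
 define X where "X = (\<integral>\<^sup>+x. ennreal (norm (complex_of_real (U0 x)) powr p * ?W x) \<partial>mu)"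
 have p1: "1 \<le> p" "0 < p" using p by auto
 have J0: "J \<longlonglongrightarrow> 0" unfolding J_def[abs_def] by (rule L2lim_weighted[OF l2 LGn LG v_sq_integrable vp p1(1) p(2)])
 have I0: "I \<longlonglongrightarrow> 0" unfolding I_def[abs_def] by (rule L2lim_weighted[OF l1 LRn LU v_sq_integrable vp p1(1) p(2)])
 have step: "(\<integral>\<^sup>+x. ennreal (norm (G x) powr p * ?W x) \<partial>mu) \<le> 4 * J n + 4 * (?B * (4 * I n + 4 * X))" for n
 proof -
  have "(\<integral>\<^sup>+x. ennreal (norm (G x) powr p * ?W x) \<partial>mu)
    \<le> 4 * J n + 4 * (\<integral>\<^sup>+x. ennreal (norm (?Gn n x) powr p * ?W x) \<partial>mu)"
   unfolding J_def
  proof (rule nn_integral_powr_add_le[OF _ _ _ p1(2) p(2)])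
   show "AE x in mu. norm (G x) \<le> norm (?Gn n x - G x) + norm (?Gn n x)"
    using norm_triangle_ineq4[of "?Gn n x" "?Gn n x - G x" for x] by (intro AE_I2) (simp add: add.commute)
  qed ((measurable; fail) | (simp; fail))+
  also have "(\<integral>\<^sup>+x. ennreal (norm (?Gn n x) powr p * ?W x) \<partial>mu)
    \<le> ?B * (\<integral>\<^sup>+ze. ennreal (Re (poly (F n) ze) powr p * ?W ze) \<partial>mu)"
   by (rule weighted_poly_bound[OF p F(2,1)])
  also have "(\<integral>\<^sup>+ze. ennreal (Re (poly (F n) ze) powr p * ?W ze) \<partial>mu)
    = (\<integral>\<^sup>+ze. ennreal (norm (?Rn n ze) powr p * ?W ze) \<partial>mu)"
  proof (rule nn_integral_cong)
   fix ze assume "ze \<in> space mu"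
   then have "0 < Re (poly (F n) ze)" using F(2) by simp
   then show "ennreal (Re (poly (F n) ze) powr p * ?W ze) = ennreal (norm (?Rn n ze) powr p * ?W ze)" by simp
  qed
  also have "\<dots> \<le> 4 * I n + 4 * X" unfolding I_def X_def
  proof (rule nn_integral_powr_add_le[OF _ _ _ p1(2) p(2)])
   show "AE x in mu. norm (?Rn n x) \<le> norm (?Rn n x - of_real (U0 x)) + norm (complex_of_real (U0 x))"
    using norm_triangle_ineq[of "?Rn n x - of_real (U0 x)" "of_real (U0 x)" for x] by (intro AE_I2) simp
  qed ((measurable; fail) | (simp; fail))+
  finally show ?thesis by (simp add: mult_left_mono)
 qed
 have "(\<lambda>n. 4 * J n + 4 * (?B * (4 * I n + 4 * X))) \<longlonglongrightarrow> 4 * 0 + 4 * (?B * (4 * 0 + 4 * X))"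
  by (intro tendsto_add ennreal_tendsto_cmult tendsto_const J0 I0) auto
 then have "(\<integral>\<^sup>+x. ennreal (norm (G x) powr p * ?W x) \<partial>mu) \<le> 4 * 0 + 4 * (?B * (4 * 0 + 4 * X))"
  by (rule LIMSEQ_le_const) (use step in blast)
 also have "\<dots> = 16 * (?B * X)" by (simp add: mult_ac flip: mult.assoc)
 also have "X = (\<integral>\<^sup>+ze. ennreal (U0 ze powr p * ?W ze) \<partial>mu)"
  unfolding X_def using U(2) by simp
 also have "(\<integral>\<^sup>+x. ennreal (norm (G x) powr p * ?W x) \<partial>mu) = (\<integral>\<^sup>+x. ennreal (norm (G' x) powr p * ?W x) \<partial>mu)"
 proof (rule nn_integral_cong_AE)
  show "AE x in mu. ennreal (norm (G x) powr p * ?W x) = ennreal (norm (G' x) powr p * ?W x)"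
   using szego_rel_unique[OF sG G LU] by eventually_elim (simp only:)
 qed
 finally show ?thesis .
qed

text \<open>The positive and negative parts of Re g and Im g are recombined by two levels of the
  quasi-triangle inequality, each contributing 2 times 4; with the earlier 16 this makes
  1024.\<close>

lemma weighted_szego_bound:
 assumes p: "6/5 < p" "p \<le> 2" and g: "L2 mu g" and G: "szego_rel g G"
 shows "(\<integral>\<^sup>+ze. ennreal (norm (G ze) powr p * v ze powr (2 - p)) \<partial>mu)
  \<le> ennreal (1024 * K1 / ((5 * p - 6) * pi / 8) powr p) * (\<integral>\<^sup>+ze. ennreal (norm (g ze) powr p * v ze powr (2 - p)) \<partial>mu)"
proof -
 let ?W = "\<lambda>ze. v ze powr (2 - p)"
 let ?B = "ennreal (K1 / ((5 * p - 6) * pi / 8) powr p)"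
 define Y where "Y = (\<integral>\<^sup>+ze. ennreal (norm (g ze) powr p * ?W ze) \<partial>mu)"
 note part = L2_part[OF g]
 have [measurable]: "?W \<in> borel_measurable mu" using v_meas by measurable
 have p1: "0 < p" using p by simp
 have S: "szego_rel (\<lambda>ze. complex_of_real (h ze)) (szego_disc (\<lambda>ze. complex_of_real (h ze)))"
  if "h \<in> borel_measurable mu" "integrable mu (\<lambda>x. (h x)\<^sup>2)" for h
  by (rule szego_rel_szego_disc[OF L2_of_real[OF that]])
 have bd: "(\<integral>\<^sup>+ze. ennreal (norm (szego_disc (\<lambda>ze. complex_of_real (h ze)) ze) powr p * ?W ze) \<partial>mu) \<le> 16 * (?B * Y)"
  if h: "h \<in> borel_measurable mu" "integrable mu (\<lambda>x. (h x)\<^sup>2)" "\<And>x. 0 \<le> h x" "\<And>x. h x \<le> norm (g x)" for h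
 proof -
  note weighted_nonneg_bound[OF p h(1,3,2) S[OF h(1,2)]]
  also have "16 * (?B * (\<integral>\<^sup>+ze. ennreal (h ze powr p * ?W ze) \<partial>mu)) \<le> 16 * (?B * Y)"
   unfolding Y_def using h(3,4) p1
   by (intro mult_left_mono nn_integral_mono ennreal_leI mult_right_mono powr_mono2) auto
  finally show ?thesis .
 qed
 define G1 where "G1 = szego_disc (\<lambda>ze. complex_of_real (max 0 (Re (g ze))))"
 define G2 where "G2 = szego_disc (\<lambda>ze. complex_of_real (max 0 (- Re (g ze))))"
 define G3 where "G3 = szego_disc (\<lambda>ze. complex_of_real (max 0 (Im (g ze))))"
 define G4 where "G4 = szego_disc (\<lambda>ze. complex_of_real (max 0 (- Im (g ze))))"
 have Re: "\<bar>Re (g x)\<bar> \<le> norm (g x)" "\<bar>Im (g x)\<bar> \<le> norm (g x)" for x by (rule abs_Re_le_cmod abs_Im_le_cmod)+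
 note s = S[OF part(1,2), folded G1_def] S[OF part(3,4), folded G2_def] S[OF part(5,6), folded G3_def] S[OF part(7,8), folded G4_def]
 have b1: "(\<integral>\<^sup>+ze. ennreal (norm (G1 ze) powr p * ?W ze) \<partial>mu) \<le> 16 * (?B * Y)"
  unfolding G1_def by (rule bd[OF part(1,2)]) (use Re in \<open>auto simp: abs_le_iff\<close>)
 have b2: "(\<integral>\<^sup>+ze. ennreal (norm (G2 ze) powr p * ?W ze) \<partial>mu) \<le> 16 * (?B * Y)"
  unfolding G2_def by (rule bd[OF part(3,4)]) (use Re in \<open>auto simp: abs_le_iff\<close>)
 have b3: "(\<integral>\<^sup>+ze. ennreal (norm (G3 ze) powr p * ?W ze) \<partial>mu) \<le> 16 * (?B * Y)"
  unfolding G3_def by (rule bd[OF part(5,6)]) (use Re in \<open>auto simp: abs_le_iff\<close>)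
 have b4: "(\<integral>\<^sup>+ze. ennreal (norm (G4 ze) powr p * ?W ze) \<partial>mu) \<le> 16 * (?B * Y)"
  unfolding G4_def by (rule bd[OF part(7,8)]) (use Re in \<open>auto simp: abs_le_iff\<close>)
 note [measurable] = s[THEN szego_rel_L2, THEN L2_measurable]
 have ae: "AE ze in mu. G ze = G1 ze - G2 ze + \<i> * (G3 ze - G4 ze)"
  by (rule szego_rel_unique[OF G szego_rel_four[OF g s] g])
 have "(\<integral>\<^sup>+ze. ennreal (norm (G ze) powr p * ?W ze) \<partial>mu)
   \<le> 4 * (\<integral>\<^sup>+ze. ennreal (norm (G1 ze - G2 ze) powr p * ?W ze) \<partial>mu) + 4 * (\<integral>\<^sup>+ze. ennreal (norm (G3 ze - G4 ze) powr p * ?W ze) \<partial>mu)"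
 proof (rule nn_integral_powr_add_le[OF _ _ _ p1 p(2)])
  show "AE ze in mu. norm (G ze) \<le> norm (G1 ze - G2 ze) + norm (G3 ze - G4 ze)" using ae
  proof eventually_elim
   case (elim ze)
   show ?case unfolding elim using norm_triangle_ineq[of "G1 ze - G2 ze" "\<i> * (G3 ze - G4 ze)"] by (simp add: norm_mult)
  qed
 qed ((measurable; fail) | (simp; fail))+
 also have "(\<integral>\<^sup>+ze. ennreal (norm (G1 ze - G2 ze) powr p * ?W ze) \<partial>mu) \<le> 4 * (16 * (?B * Y)) + 4 * (16 * (?B * Y))"
 proof -
  have "(\<integral>\<^sup>+ze. ennreal (norm (G1 ze - G2 ze) powr p * ?W ze) \<partial>mu)
   \<le> 4 * (\<integral>\<^sup>+ze. ennreal (norm (G1 ze) powr p * ?W ze) \<partial>mu) + 4 * (\<integral>\<^sup>+ze. ennreal (norm (G2 ze) powr p * ?W ze) \<partial>mu)"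
   by (rule nn_integral_powr_add_le[OF _ _ _ p1 p(2)]) ((measurable; fail) | (simp add: norm_triangle_ineq4; fail))+
  then show ?thesis using b1 b2 by (meson add_mono mult_left_mono order_trans zero_le)
 qed
 also have "(\<integral>\<^sup>+ze. ennreal (norm (G3 ze - G4 ze) powr p * ?W ze) \<partial>mu) \<le> 4 * (16 * (?B * Y)) + 4 * (16 * (?B * Y))"
 proof -
  have "(\<integral>\<^sup>+ze. ennreal (norm (G3 ze - G4 ze) powr p * ?W ze) \<partial>mu)
   \<le> 4 * (\<integral>\<^sup>+ze. ennreal (norm (G3 ze) powr p * ?W ze) \<partial>mu) + 4 * (\<integral>\<^sup>+ze. ennreal (norm (G4 ze) powr p * ?W ze) \<partial>mu)"
   by (rule nn_integral_powr_add_le[OF _ _ _ p1 p(2)]) ((measurable; fail) | (simp add: norm_triangle_ineq4; fail))+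
  then show ?thesis using b3 b4 by (meson add_mono mult_left_mono order_trans zero_le)
 qed
 also have "4 * (4 * (16 * (?B * Y)) + 4 * (16 * (?B * Y))) + 4 * (4 * (16 * (?B * Y)) + 4 * (16 * (?B * Y))) = 1024 * (?B * Y)"
  by (simp add: mult.assoc[symmetric] flip: distrib_right)
 also have "\<dots> = ennreal (1024 * K1 / ((5 * p - 6) * pi / 8) powr p) * Y"
 proof -
  have "ennreal (1024 * (K1 / ((5 * p - 6) * pi / 8) powr p)) = 1024 * ?B" by (subst ennreal_mult') auto
  then show ?thesis by (simp only: mult.assoc times_divide_eq_right)
 qed
 finally show ?thesis unfolding Y_def by (simp add: add_mono mult_left_mono)
qed

end

section \<open>Passage to the conjugate exponent; the extremal test function\<close>

section \<open>Duality and the test function\<close>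

text \<open>Without the factors 1/p and 1/q it is enough to compare Y with X^(p - 1): one of the two
  powers alone bounds the product.\<close>

lemma young_unnormalized:
 fixes X Y p q :: real
 assumes "0 \<le> X" "0 \<le> Y" and q: "1 < q" "p = q / (q - 1)"
 shows "X * Y \<le> X powr p + Y powr q"
proof (cases "Y \<le> X powr (p - 1)")
 case True
 have p1: "p - 1 = 1 / (q - 1)" using q by (simp add: field_simps)
 then have p1p: "0 < p - 1" using q by simp
 have "X * Y \<le> X * X powr (p - 1)" using True assms by (intro mult_left_mono) auto
 also have "\<dots> = X powr p"
 proof (cases "X = 0")
  case False
  then have "X powr 1 * X powr (p - 1) = X powr p" unfolding powr_add[symmetric] by simp
  then show ?thesis using assms False by simp
 qed simp
 finally show ?thesis using powr_ge_zero[of Y q] by linarith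
next
 case False
 have p1: "(p - 1) * (q - 1) = 1" using q by (simp add: field_simps)
 then have p1p: "0 < q - 1" using q by simp
 have Y: "0 < Y" using False powr_ge_zero[of X "p - 1"] by linarith
 have "X = (X powr (p - 1)) powr (q - 1)" using assms(1) p1 by (simp add: powr_powr)
 also have "\<dots> \<le> Y powr (q - 1)" using False p1p by (intro powr_mono2) auto
 finally have "X * Y \<le> Y powr (q - 1) * Y" using Y by (intro mult_right_mono) auto
 also have "\<dots> = Y powr q"
 proof -
  have "Y powr (q - 1) * Y powr 1 = Y powr q" unfolding powr_add[symmetric] by simp
  then show ?thesis using Y by simp
 qed
 finally show ?thesis using powr_ge_zero[of X p] by linarith
qed

context good_map begin

text \<open>T f is paired with a truncation of |T f|^(p - 2) T f, and self-adjointness moves T onto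
  this test function, where the L^q bound applies. Truncation keeps the pairing finite so that half
  of it can be absorbed, and monotone convergence removes it.\<close>

lemma dual_bound:
 assumes q: "1 < q" "q \<le> 2" and N: "0 < N" and p: "p = q / (q - 1)"
  and b: "\<And>f. L2 sigma f ==> (pint q (T f)) \<le> ennreal (N powr q) * (pint q f)"
  and f: "L2 sigma f"
 shows "(pint p (T f)) \<le> ennreal ((2 * N) powr p) * (pint p f)"
proof (cases "(pint p f) = \<infinity>")
 case True
 then show ?thesis using N by (simp add: ennreal_mult_top)
next
 case False
 then obtain X where X: "(pint p f) = ennreal X" "0 \<le> X"
  by (cases "(pint p f)") auto
 interpret sg: finite_measure sigma by (rule finite_sigma)
 have pq: "(p - 1) * q = p" "p / q = p - 1" and p2: "2 \<le> p" using q by (auto simp: p field_simps)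
 define g where "g = T f"
 have Lg: "L2 sigma g" unfolding g_def by (rule proj_props(1)[OF f])
 note [measurable] = L2_measurable[OF Lg] L2_measurable[OF f]
 define h where "h n b = (if norm (g b) \<le> real n then norm (g b) powr p else 0)" for n b
 define k where "k n b = (if norm (g b) \<le> real n then complex_of_real (norm (g b) powr (p - 2)) * g b else 0)" for n b
 have hm[measurable]: "h n \<in> borel_measurable sigma" for n unfolding h_def[abs_def] by measurable
 have km[measurable]: "k n \<in> borel_measurable sigma" for n unfolding k_def[abs_def] by measurable
 have h0: "0 \<le> h n b" for n b by (simp add: h_def)
 have kn: "norm (k n b) = (if norm (g b) \<le> real n then norm (g b) powr (p - 1) else 0)" for n b
 proof -
  have "norm (g b) powr (p - 2) * norm (g b) = norm (g b) powr (p - 1)"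
  proof (cases "g b = 0")
   case False
   have "norm (g b) powr (p - 2) * norm (g b) powr 1 = norm (g b) powr (p - 1)" unfolding powr_add[symmetric] by simp
   then show ?thesis using False by simp
  qed simp
  then show ?thesis by (simp add: k_def norm_mult)
 qed
 have kq: "norm (k n b) powr q = h n b" for n b unfolding kn h_def using pq(1) by (simp add: powr_powr)
 have gk: "g b * cnj (k n b) = of_real (h n b)" for n b
 proof -
  have "norm (g b) powr (p - 2) * (norm (g b))\<^sup>2 = norm (g b) powr p"
  proof (cases "g b = 0")
   case False
   have "norm (g b) powr (p - 2) * norm (g b) powr 2 = norm (g b) powr p" unfolding powr_add[symmetric] by simp
   then show ?thesis using False by simp
  qed simp
  then have "complex_of_real (norm (g b) powr p) = of_real (norm (g b) powr (p - 2)) * (g b * cnj (g b))"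
   by (simp only: complex_norm_square[symmetric] of_real_mult[symmetric])
  then show ?thesis by (simp add: h_def k_def mult_ac)
 qed
 have hb: "h n b \<le> real n powr p" for n b using p2 by (auto simp: h_def intro!: powr_mono2)
 have hi: "integrable sigma (h n)" for n
  by (rule sg.integrable_const_bound[where B="real n powr p"]) (use h0 hb in auto)
 have Lk: "L2 sigma (k n)" for n
 proof (rule L2_dom)
  show "L2 sigma (\<lambda>_. complex_of_real (real n powr (p - 1)))" by (simp add: L2_def)
  show "AE b in sigma. norm (k n b) \<le> norm (complex_of_real (real n powr (p - 1)))"
   using p2 by (intro AE_I2) (auto simp: kn intro!: powr_mono2)
 qed (rule km)
 \<comment> \<open>The scaling in Young's inequality for which the L^q term returns exactly half of
   the estimated quantity; since 2 l^p = (2N)^p, this costs the factor 2 in front of N.\<close>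
 define l where "l = N * 2 powr (1 / q)"
 have l: "0 < l" using N by (simp add: l_def)
 have lq: "(1 / l) powr q * N powr q = 1 / 2" using N q by (simp add: l_def powr_mult powr_divide powr_powr)
 have lp: "2 * l powr p = (2 * N) powr p"
 proof -
  have "2 * l powr p = N powr p * (2 powr 1 * 2 powr (p - 1))"
   using N q pq(2) by (simp add: l_def powr_mult powr_powr)
  also have "\<dots> = (2 * N) powr p" unfolding powr_add[symmetric] using N by (simp add: powr_mult)
  finally show ?thesis .
 qed
 have bound: "(\<integral>\<^sup>+b. ennreal (h n b) \<partial>sigma) \<le> ennreal ((2 * N) powr p * X)" for n
 proof -
  define a where "a = (\<integral>b. h n b \<partial>sigma)"
  have a0: "0 \<le> a" unfolding a_def using h0 by simp
  have na: "(\<integral>\<^sup>+b. ennreal (h n b) \<partial>sigma) = ennreal a"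
   unfolding a_def by (rule nn_integral_eq_integral[OF hi]) (simp add: h0)
  note LTk = proj_props(1)[OF Lk[of n]]
  note [measurable] = L2_measurable[OF LTk]
  have "(\<integral>b. f b * cnj (T (k n) b) \<partial>sigma) = (\<integral>b. g b * cnj (k n b) \<partial>sigma)"
   unfolding g_def by (rule selfadjoint[OF f Lk, symmetric])
  also have "\<dots> = of_real a" unfolding gk a_def by (rule integral_complex_of_real)
  finally have "norm (\<integral>b. f b * cnj (T (k n) b) \<partial>sigma) = a" using a0 by simp
  then have "ennreal a \<le> (\<integral>\<^sup>+b. ennreal (norm (f b * cnj (T (k n) b))) \<partial>sigma)"
   using integral_norm_bound_ennreal[OF L2_prod[OF f L2_cnj[OF LTk]]] by simp
  also have "\<dots> \<le> (\<integral>\<^sup>+b. ennreal (l powr p) * ennreal (norm (f b) powr p) + ennreal ((1 / l) powr q) * ennreal (norm (T (k n) b) powr q) \<partial>sigma)"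
  proof (rule nn_integral_mono)
   fix b
   have "norm (f b * cnj (T (k n) b)) = (l * norm (f b)) * (1 / l * norm (T (k n) b))" using l by (simp add: norm_mult)
   also have "\<dots> \<le> (l * norm (f b)) powr p + (1 / l * norm (T (k n) b)) powr q"
    by (rule young_unnormalized[OF _ _ q(1) p]) (use l in auto)
   also have "\<dots> = l powr p * norm (f b) powr p + (1 / l) powr q * norm (T (k n) b) powr q"
    using l by (simp only: powr_mult)
   finally show "ennreal (norm (f b * cnj (T (k n) b))) \<le> ennreal (l powr p) * ennreal (norm (f b) powr p) + ennreal ((1 / l) powr q) * ennreal (norm (T (k n) b) powr q)"
    by (simp only: ennreal_mult''[symmetric] powr_ge_zero ennreal_plus[symmetric] mult_nonneg_nonneg ennreal_leI)
  qed
  also have "\<dots> = ennreal (l powr p) * ennreal X + ennreal ((1 / l) powr q) * (pint q (T (k n)))"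
   unfolding X(1)[symmetric] by (simp add: nn_integral_add nn_integral_cmult)
  also have "\<dots> \<le> ennreal (l powr p) * ennreal X + ennreal ((1 / l) powr q) * (ennreal (N powr q) * (\<integral>\<^sup>+b. ennreal (norm (k n b) powr q) \<partial>sigma))"
   by (intro add_left_mono mult_left_mono b[OF Lk]) simp
  also have "\<dots> = ennreal (l powr p * X) + ennreal ((1 / l) powr q * N powr q * a)"
   unfolding kq na using X(2) a0 by (simp add: ennreal_mult mult.assoc)
  also have "\<dots> = ennreal (l powr p * X + a / 2)" unfolding lq using X(2) a0 by (simp add: ennreal_plus)
  finally have fin: "ennreal a \<le> ennreal (l powr p * X + a / 2)" .
  have "a \<le> l powr p * X + a / 2" using fin by (subst (asm) ennreal_le_iff) (use X(2) a0 in auto)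
  then have "a \<le> 2 * l powr p * X" by linarith
  then show ?thesis unfolding na lp by (rule ennreal_leI)
 qed
 have "(\<lambda>n. \<integral>\<^sup>+b. ennreal (h n b) \<partial>sigma) \<longlonglongrightarrow> (pint p g)"
 proof (rule nn_integral_LIMSEQ)
  show "incseq (\<lambda>n b. ennreal (h n b))" by (intro incseq_SucI le_funI ennreal_leI) (auto simp: h_def)
  fix b
  obtain n0 where n0: "norm (g b) \<le> real n0" using real_arch_simple by blast
  have "eventually (\<lambda>n. ennreal (h n b) = ennreal (norm (g b) powr p)) sequentially"
   using eventually_ge_at_top[of n0] by eventually_elim (use n0 in \<open>simp add: h_def\<close>)
  then show "(\<lambda>n. ennreal (h n b)) \<longlonglongrightarrow> ennreal (norm (g b) powr p)" by (rule tendsto_eventually)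
 qed measurable
 then have "(pint p g) \<le> ennreal ((2 * N) powr p * X)"
  by (rule LIMSEQ_le_const2) (use bound in blast)
 then show ?thesis unfolding X(1) g_def using X(2) by (simp add: ennreal_mult)
qed

end

lemma AE_circle_lborel:
 assumes "AE ze in mu. Q ze"
 shows "AE t in lborel. t \<in> {0..<2*pi} \<longrightarrow> Q (cis t)"
proof -
 have "AE t in restrict_space lborel {0..<2*pi}. Q (cis t)"
  using assms unfolding circle_measure_def by (rule AE_distrD[OF measurable_cis_circle])
 then show ?thesis by (subst (asm) AE_restrict_space_iff) auto
qed

context model_map begin

definition test_sup where "test_sup = max 1 (2 / m) * 64"
definition test_inf where "test_inf = min 1 (gap / (4 * M * N)) * (2 * min 1 (gap / 4))"

lemma test_pos: "0 < test_sup" "0 < test_inf"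
 unfolding test_sup_def test_inf_def using m0 M0 N1 gap(1) by auto

text \<open>The test function vanishes where the weight blows up: v^4 is at least (m/2) |ze^2 - s1|,
  so the weight costs the power -b of |ze^2 - s1| with b = (p - 2)/4, less than the p available. The
  integrand is bounded uniformly in p.\<close>

lemma test_function_upper:
 assumes p: "2 \<le> p" "p < 6"
 shows "(\<integral>\<^sup>+ze. ennreal (norm (ze\<^sup>2 - s1) powr p * v ze powr (2 - p)) \<partial>mu) \<le> ennreal (test_sup * (2 * pi))"
proof -
 define b where "b = (p - 2) / 4"
 have b: "0 \<le> b" "b \<le> 1" "2 - p = 4 * (- b)" "b \<le> p" using p by (auto simp: b_def field_simps)
 have "(\<integral>\<^sup>+ze. ennreal (norm (ze\<^sup>2 - s1) powr p * v ze powr (2 - p)) \<partial>mu) \<le> (\<integral>\<^sup>+ze. ennreal test_sup \<partial>mu)"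
 proof (rule nn_integral_mono_AE)
  show "AE ze in mu. ennreal (norm (ze\<^sup>2 - s1) powr p * v ze powr (2 - p)) \<le> ennreal test_sup"
   using v_AE
  proof eventually_elim
   case (elim ze)
   define x where "x = norm (ze\<^sup>2 - s1)"
   have x: "0 < x" using elim by (simp add: x_def)
   have n1: "norm (ze\<^sup>2) = 1" using elim by (simp add: norm_power)
   have x2: "x \<le> 2" unfolding x_def using norm_triangle_ineq4[of "ze\<^sup>2" s1] n1 s1_norm by linarith
   obtain s where s: "s \<in> S" using S_ne by blast
   have ns: "0 < norm (ze\<^sup>2 - s)" using elim s by auto
   have "norm (ze\<^sup>2 - s) \<le> 2" using norm_triangle_ineq4[of "ze\<^sup>2" s] n1 S_norm[OF s] by linarith
   then have "x / 2 \<le> x / norm (ze\<^sup>2 - s)" using x ns by (intro divide_left_mono) auto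
   then have "x / 2 \<le> U ze" using U_term[OF s, of ze] unfolding x_def by linarith
   then have "m * (x / 2) \<le> m * U ze" using m0 by (intro mult_left_mono) auto
   then have "m * (x / 2) \<le> v ze ^ 4" using elim by linarith
   then have "(v ze ^ 4) powr (- b) \<le> (m * (x / 2)) powr (- b)" using b m0 x by (intro powr_mono2') auto
   moreover have "v ze powr (2 - p) = (v ze ^ 4) powr (- b)" unfolding b(3) by (rule v_powr_eq) (use elim in simp)
   ultimately have "x powr p * v ze powr (2 - p) \<le> x powr p * (m * (x / 2)) powr (- b)" by (simp add: mult_left_mono)
   also have "(m * (x / 2)) powr (- b) = (2 / m) powr b * x powr (- b)"
    using m0 x by (simp add: powr_mult powr_divide powr_minus field_simps)
   also have "x powr p * ((2 / m) powr b * x powr (- b)) = (2 / m) powr b * x powr (p - b)"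
    by (simp add: powr_diff powr_minus field_simps)
   also have "\<dots> \<le> max 1 (2 / m) * 64"
   proof (rule mult_mono)
    show "(2 / m) powr b \<le> max 1 (2 / m)" by (rule powr_between(2)) (use m0 b in auto)
    have "x powr (p - b) \<le> 2 powr (p - b)" using x x2 b by (intro powr_mono2) auto
    also have "\<dots> \<le> 2 powr 6" using p b by (intro powr_mono) auto
    finally show "x powr (p - b) \<le> 64" by simp
   qed auto
   finally show ?case unfolding x_def test_sup_def by (rule ennreal_leI)
  qed
 qed
 also have "\<dots> = ennreal (test_sup * (2 * pi))"
  using test_pos by (simp add: emeasure_circle_space ennreal_mult')
 finally show ?thesis .
qed

text \<open>To the right of a square root cis \<theta> of s1, v^4 is at most K (t - \<theta>), so
  the weight is at least a multiple of (t - \<theta>)^(-b). Integration puts 1 - b = (6 - p)/4 into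
  the denominator.\<close>

lemma test_function_lower:
 assumes p: "2 \<le> p" "p < 6"
 shows "ennreal (test_inf / (6 - p)) \<le> (\<integral>\<^sup>+ze. ennreal (v ze powr (2 - p)) \<partial>mu)"
proof -
 define b where "b = (p - 2) / 4"
 have b: "0 \<le> b" "b < 1" "2 - p = 4 * (- b)" "6 - p = 4 * (1 - b)" using p by (auto simp: b_def field_simps)
 \<comment> \<open>Halving an argument from [0, 2\<pi>) gives \<theta> < \<pi>, which leaves room
   for an interval of length at most 1 to the right of \<theta>.\<close>
 define \<theta> where "\<theta> = Arg2pi s1 / 2"
 have th: "0 \<le> \<theta>" "\<theta> < pi" using Arg2pi[of s1] by (auto simp: \<theta>_def)
 have s1: "s1 = cis (2 * \<theta>)"
  using Arg2pi[of s1] s1_norm by (simp add: \<theta>_def cis_conv_exp is_Arg_def)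
 define \<rho> where "\<rho> = min 1 (gap / 4)"
 have \<rho>: "0 < \<rho>" "\<rho> \<le> 1" "\<rho> \<le> gap / 4" using gap(1) by (auto simp: \<rho>_def)
 define K where "K = 4 * M * N / gap"
 have K: "0 < K" using M0 N1 gap(1) by (simp add: K_def)
 \<comment> \<open>Cuts off the singularity at \<theta> and gives up exactly half of the integral,
   whatever b is.\<close>
 define \<epsilon> where "\<epsilon> = \<rho> * (1 / 2) powr (1 / (1 - b))"
 have e: "0 < \<epsilon>" "\<epsilon> \<le> \<rho>"
 proof -
  have "(1 / 2 :: real) powr (1 / (1 - b)) \<le> 1" using b by (intro powr_le1) auto
  then show "\<epsilon> \<le> \<rho>" using \<rho> unfolding \<epsilon>_def by (intro mult_left_le) auto
 qed (use \<rho> in \<open>simp add: \<epsilon>_def\<close>)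
 have e2: "\<epsilon> powr (1 - b) = \<rho> powr (1 - b) / 2"
  using \<rho> b by (simp add: \<epsilon>_def powr_mult powr_powr)
 let ?I = "{\<theta> + \<epsilon>..\<theta> + \<rho>}"
 have sub: "t \<in> {0..<2*pi}" if "t \<in> ?I" for t using that th e \<rho> pi_gt3 by auto
 define f where "f t = min 1 (1 / K) * (t - \<theta>) powr (- b)" for t
 define Fa where "Fa t = min 1 (1 / K) * ((t - \<theta>) powr (1 - b) / (1 - b))" for t
 have Kmin: "0 < min 1 (1 / K)" using K by simp
 have "(\<integral>\<^sup>+t. ennreal (f t) * indicator ?I t \<partial>lborel) = ennreal (Fa (\<theta> + \<rho>) - Fa (\<theta> + \<epsilon>))"
 proof (rule nn_integral_FTC_Icc)
  show "f \<in> borel_measurable borel" unfolding f_def[abs_def] by measurable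
  fix t assume "t \<in> ?I"
  then have t: "0 < t - \<theta>" using e by auto
  show "0 \<le> f t" using K by (simp add: f_def)
  show "(Fa has_real_derivative f t) (at t)" unfolding Fa_def[abs_def] f_def
   by (rule derivative_eq_intros refl | use t b in simp)+
 qed (use e in simp)
 also have "Fa (\<theta> + \<rho>) - Fa (\<theta> + \<epsilon>) = min 1 (1 / K) * (\<rho> powr (1 - b) / (2 * (1 - b)))"
 proof -
  have "x / c - x / 2 / c = x / (2 * c)" for x c :: real by (cases "c = 0") (simp_all add: field_simps)
  note c = this
  have "Fa (\<theta> + \<rho>) - Fa (\<theta> + \<epsilon>) = min 1 (1 / K) * (\<rho> powr (1 - b) / (1 - b) - \<rho> powr (1 - b) / 2 / (1 - b))"
   by (simp only: Fa_def add_diff_cancel_left' e2 right_diff_distrib)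
  then show ?thesis unfolding c .
 qed
 also have "ennreal (test_inf / (6 - p)) \<le> ennreal \<dots>"
 proof (rule ennreal_leI)
  have "\<rho> \<le> \<rho> powr (1 - b)" using powr_mono'[of "1 - b" 1 \<rho>] \<rho> b by simp
  then have "\<rho> / (2 * (1 - b)) \<le> \<rho> powr (1 - b) / (2 * (1 - b))" using b by (intro divide_right_mono) auto
  then have "min 1 (1 / K) * (\<rho> / (2 * (1 - b))) \<le> min 1 (1 / K) * (\<rho> powr (1 - b) / (2 * (1 - b)))"
   using Kmin by (intro mult_left_mono) auto
  moreover have "test_inf / (6 - p) = min 1 (1 / K) * (\<rho> / (2 * (1 - b)))"
  proof -
   have "x * (2 * y) / (4 * c) = x * (y / (2 * c))" for x y c :: real by simp
   moreover have "1 / K = gap / (4 * M * N)" by (simp add: K_def)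
   ultimately show ?thesis unfolding test_inf_def b(4) \<rho>_def by (simp only:)
  qed
  ultimately show "test_inf / (6 - p) \<le> min 1 (1 / K) * (\<rho> powr (1 - b) / (2 * (1 - b)))" by simp
 qed
 finally (xtrans) have 1: "ennreal (test_inf / (6 - p)) \<le> (\<integral>\<^sup>+t. ennreal (f t) * indicator ?I t \<partial>lborel)" .
 also have "\<dots> \<le> (\<integral>\<^sup>+t. ennreal (v (cis t) powr (2 - p)) * indicator {0..<2*pi} t \<partial>lborel)"
 proof (rule nn_integral_mono_AE)
  show "AE t in lborel. ennreal (f t) * indicator ?I t \<le> ennreal (v (cis t) powr (2 - p)) * indicator {0..<2*pi} t"
   using AE_circle_lborel[OF v_AE]
  proof eventually_elim
   case (elim t)
   show ?case
   proof (cases "t \<in> ?I")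
    case True
    note ti = sub[OF True]
    from elim ti have V: "0 < v (cis t)" "v (cis t) ^ 4 \<le> M * U (cis t)" by blast+
    define x where "x = norm ((cis t)\<^sup>2 - s1)"
    have t0: "0 < t - \<theta>" "t - \<theta> \<le> \<rho>" using True e by auto
    have "x \<le> 2 * (t - \<theta>)"
    proof -
     have "x = norm (cis (2 * t) - cis (2 * \<theta>))" unfolding x_def s1 by (simp only: power2_eq_square cis_mult mult_2)
     also have "\<dots> \<le> \<bar>2 * t - 2 * \<theta>\<bar>"
     proof -
      have "norm (cis (2 * t) - cis (2 * \<theta>)) = norm (cis (2 * \<theta>) * (cis (2 * t - 2 * \<theta>) - 1))"
       by (simp add: right_diff_distrib cis_mult)
      also have "\<dots> = norm (exp (\<i> * of_real (2 * t - 2 * \<theta>)) - 1)"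
       by (simp only: norm_mult norm_cis mult_1_left) (simp only: cis_conv_exp)
      also have "\<dots> \<le> \<bar>2 * t - 2 * \<theta>\<bar>"
      proof -
       have "(norm (exp (\<i> * of_real y) - 1))\<^sup>2 \<le> y\<^sup>2" for y :: real
       proof -
        have "(norm (cis y - 1))\<^sup>2 = 2 - 2 * cos y"
         unfolding cmod_power2 using sin_cos_squared_add[of y] by (simp add: power2_diff)
        also have "\<dots> = 4 * (sin (y / 2))\<^sup>2" using cos_double_sin[of "y / 2"] by simp
        also have "\<dots> \<le> 4 * (y / 2)\<^sup>2"
         by (rule mult_left_mono) (rule abs_sin_x_le_abs_x[of "y/2", unfolded abs_le_square_iff], simp)
        finally show ?thesis by (simp add: cis_conv_exp power_divide)
       qed
       then have "\<bar>norm (exp (\<i> * of_real y) - 1)\<bar> \<le> \<bar>y\<bar>" for y :: real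
        unfolding abs_le_square_iff .
       then show ?thesis by (simp only: abs_norm_cancel)
      qed
      finally show ?thesis .
     qed
     finally show ?thesis using t0 by simp
    qed
    note x1 = this
    have "2 * (t - \<theta>) \<le> 2 * (gap / 4)" using t0(2) \<rho>(3) by (intro mult_left_mono order_trans[OF t0(2)]) auto
    with x1 have xg: "x \<le> gap / 2" by simp
    have "U (cis t) \<le> (\<Sum>s\<in>S. x / (gap / 2))" unfolding U_eq x_def[symmetric]
    proof (rule sum_mono)
     fix s assume s: "s \<in> S"
     have "norm (s - s1) \<le> norm ((cis t)\<^sup>2 - s1) + norm ((cis t)\<^sup>2 - s)"
      using norm_triangle_ineq4[of "(cis t)\<^sup>2 - s1" "(cis t)\<^sup>2 - s"] by simp
     then have "gap / 2 \<le> norm ((cis t)\<^sup>2 - s)" using gap(2)[OF s] xg unfolding x_def by linarith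
     then show "x / norm ((cis t)\<^sup>2 - s) \<le> x / (gap / 2)"
      using gap(1) by (intro divide_left_mono mult_pos_pos) (auto simp: x_def)
    qed
    also have "\<dots> = N * (2 / gap) * x" by simp
    also have "\<dots> \<le> N * (2 / gap) * (2 * (t - \<theta>))" using x1 gap(1) N1 by (intro mult_left_mono) auto
    finally have "M * U (cis t) \<le> M * (N * (2 / gap) * (2 * (t - \<theta>)))" using M0 by (intro mult_left_mono) auto
    also have "\<dots> = K * (t - \<theta>)" by (simp add: K_def)
    finally have "v (cis t) ^ 4 \<le> K * (t - \<theta>)" using V by linarith
    then have "(K * (t - \<theta>)) powr (- b) \<le> (v (cis t) ^ 4) powr (- b)" using b V by (intro powr_mono2') auto
    moreover have "f t \<le> (K * (t - \<theta>)) powr (- b)"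
    proof -
     have "min 1 (1 / K) \<le> (1 / K) powr b" by (rule powr_between(1)) (use K b in auto)
     then have "f t \<le> (1 / K) powr b * (t - \<theta>) powr (- b)" unfolding f_def by (intro mult_right_mono) auto
     also have "(1 / K) powr b * y powr (- b) = (K * y) powr (- b)" for y
      by (simp add: powr_mult powr_divide powr_minus field_simps)
     finally show ?thesis .
    qed
    moreover have "v (cis t) powr (2 - p) = (v (cis t) ^ 4) powr (- b)" unfolding b(3) by (rule v_powr_eq[OF V(1)])
    ultimately have "f t \<le> v (cis t) powr (2 - p)" by linarith
    then show ?thesis using True ti by (simp add: ennreal_leI)
   qed simp
  qed
 qed
 also have "\<dots> = (\<integral>\<^sup>+ze. ennreal (v ze powr (2 - p)) \<partial>mu)"
  by (rule nn_integral_circle[symmetric]) (use v_meas in measurable)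
 finally show ?thesis .
qed

end

locale model_szego = model_map + good_map begin

lemma w_v: "AE ze in mu. norm (w ze) = v ze" using w_bd
proof eventually_elim
 case (elim ze)
 show ?case unfolding v_def elim[symmetric] by simp
qed

lemma tau_powr_v:
 assumes "f \<in> borel_measurable sigma"
 shows "(pint p f) = (\<integral>\<^sup>+ze. ennreal (norm (tau f ze) powr p * v ze powr (2 - p)) \<partial>mu)"
 unfolding tau_powr[OF assms]
proof (rule nn_integral_cong_AE)
 show "AE ze in mu. ennreal (norm (tau f ze) powr p * norm (w ze) powr (2 - p)) = ennreal (norm (tau f ze) powr p * v ze powr (2 - p))"
  using w_v by eventually_elim (simp only:)
qed

lemma szego_upper:
 assumes p: "6/5 < p" "p \<le> 2" and f: "L2 sigma f"
 shows "(pint p (T f))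
  \<le> ennreal (1024 * K1 / ((5 * p - 6) * pi / 8) powr p) * (pint p f)"
 unfolding tau_powr_v[OF L2_measurable[OF f]] tau_powr_v[OF L2_measurable[OF proj_props(1)[OF f]]]
 by (rule weighted_szego_bound[OF p tau_L2[OF f] proj_props(2)[OF f]])

text \<open>The transformed test function has modulus |ze^2 - s1| on the circle, and its
  non-constant term has a negative frequency only, so it projects to 1. The quotient of the two
  weighted integrals then bounds C from below.\<close>

lemma szego_lower:
 assumes p: "2 \<le> p" "p < 6" and N0: "0 \<le> C"
  and b: "\<And>f. L2 sigma f ==> (pint p (T f)) \<le> ennreal C * (pint p f)"
 shows "test_inf / (test_sup * (2 * pi)) / (6 - p) \<le> C"
proof -
 let ?g = "\<lambda>ze. 1 - s1 * (cnj ze)\<^sup>2"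
 have Lg: "L2 mu ?g" by (rule L2_circle_continuous) (intro continuous_intros)
 obtain f where f: "L2 sigma f" "AE ze in mu. tau f ze = ?g ze" by (rule tau_surj[OF Lg])
 have one: "(\<lambda>_. 1) \<in> H2_circle" by (rule H2_circle_I) auto
 have "szego_rel (tau f) (\<lambda>_. 1)" unfolding szego_rel_def
 proof (intro conjI one ballI)
  fix h assume h: "h \<in> H2_circle"
  note Lh = H2_circle_L2[OF h]
  note [measurable] = L2_measurable[OF tau_L2[OF f(1)]] L2_measurable[OF L2_cnj[OF Lh]] L2_measurable[OF Lg]
  have "(\<integral>ze. (tau f ze - 1) * cnj (h ze) \<partial>mu) = (\<integral>ze. (?g ze - 1) * cnj (h ze) \<partial>mu)"
  proof (rule integral_cong_AE)
   show "AE ze in mu. (tau f ze - 1) * cnj (h ze) = (?g ze - 1) * cnj (h ze)"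
    using f(2) by eventually_elim (simp only:)
   show "(\<lambda>ze. (tau f ze - 1) * cnj (h ze)) \<in> borel_measurable mu" by measurable
   show "(\<lambda>ze. (?g ze - 1) * cnj (h ze)) \<in> borel_measurable mu"
    by (intro borel_measurable_times borel_measurable_diff L2_measurable[OF Lg] L2_measurable[OF L2_cnj[OF Lh]] measurable_const) simp
  qed
  also have "\<dots> = (\<integral>ze. (- s1) * cnj (h ze * ze ^ 2) \<partial>mu)"
   by (intro Bochner_Integration.integral_cong refl) (simp add: mult_ac)
  also have "\<dots> = (- s1) * cnj (\<integral>ze. h ze * ze ^ 2 \<partial>mu)"
   by (simp only: integral_mult_right_zero) (simp add: integral_cnj del: complex_cnj_mult complex_cnj_power)
  also have "(\<integral>ze. h ze * ze ^ 2 \<partial>mu) = 0"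
   using h unfolding H2_circle_iff by (elim conjE allE[of _ 2]) simp
  finally show "(\<integral>ze. (tau f ze - 1) * cnj (h ze) \<partial>mu) = 0" by simp
 qed
 from szego_rel_unique[OF proj_props(2)[OF f(1)] this tau_L2[OF f(1)]]
 have T1: "AE ze in mu. tau (T f) ze = 1" .
 have Tf: "(pint p (T f)) = (\<integral>\<^sup>+ze. ennreal (v ze powr (2 - p)) \<partial>mu)"
  unfolding tau_powr_v[OF L2_measurable[OF proj_props(1)[OF f(1)]]]
 proof (rule nn_integral_cong_AE)
  show "AE ze in mu. ennreal (norm (tau (T f) ze) powr p * v ze powr (2 - p)) = ennreal (v ze powr (2 - p))"
   using T1 by eventually_elim simp
 qed
 have ff: "(pint p f) = (\<integral>\<^sup>+ze. ennreal (norm (ze\<^sup>2 - s1) powr p * v ze powr (2 - p)) \<partial>mu)"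
  unfolding tau_powr_v[OF L2_measurable[OF f(1)]]
 proof (rule nn_integral_cong_AE)
  show "AE ze in mu. ennreal (norm (tau f ze) powr p * v ze powr (2 - p)) = ennreal (norm (ze\<^sup>2 - s1) powr p * v ze powr (2 - p))"
   using f(2) AE_space
  proof eventually_elim
   case (elim ze)
   then have z: "norm ze = 1" by simp
   then have "ze * cnj ze = 1" using complex_norm_square[of ze] by simp
   then have "ze\<^sup>2 - s1 = ze\<^sup>2 * ?g ze" by algebra
   then have "norm (ze\<^sup>2 - s1) = norm (?g ze)" using z by (simp only: norm_mult norm_power) simp
   then show ?case unfolding elim(1) by (simp only:)
  qed
 qed
 have "ennreal (test_inf / (6 - p)) \<le> (pint p (T f))"
  unfolding Tf by (rule test_function_lower[OF p])
 also have "\<dots> \<le> ennreal C * (pint p f)" by (rule b[OF f(1)])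
 also have "\<dots> \<le> ennreal C * ennreal (test_sup * (2 * pi))"
  unfolding ff by (intro mult_left_mono test_function_upper[OF p]) simp
 also have "\<dots> = ennreal (C * (test_sup * (2 * pi)))" using N0 by (rule ennreal_mult'[symmetric])
 finally have "test_inf / (6 - p) \<le> C * (test_sup * (2 * pi))"
  using N0 test_pos by (simp add: ennreal_le_iff)
 then show ?thesis using test_pos p by (simp add: field_simps)
qed

end

section \<open>Operator norms, comparison of growth rates, conclusion\<close>

section \<open>The operator norm\<close>

lemma Lp_norm_cong_AE:
 assumes "AE x in M. f x = g x"
 shows "Lp_norm M p f = Lp_norm M p g"
proof -
 have "AE x in M. ennreal (norm (f x) powr p) = ennreal (norm (g x) powr p)"
  using assms by eventually_elim (simp only:)
 from nn_integral_cong_AE[OF this] show ?thesis by (simp only: Lp_norm_def)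
qed

lemma Lp_norm_le_iff:
 assumes p: "0 < p" and N: "0 \<le> N"
 shows "Lp_norm M p f \<le> ennreal N \<longleftrightarrow> (\<integral>\<^sup>+x. ennreal (norm (f x) powr p) \<partial>M) \<le> ennreal (N powr p)"
proof (cases "\<integral>\<^sup>+x. ennreal (norm (f x) powr p) \<partial>M")
 case (real r)
 have "r powr (1 / p) \<le> N \<longleftrightarrow> r \<le> N powr p"
 proof
  assume "r powr (1 / p) \<le> N"
  then have "(r powr (1 / p)) powr p \<le> N powr p" using p by (intro powr_mono2) auto
  then show "r \<le> N powr p" using p real by (simp add: powr_powr)
 next
  assume "r \<le> N powr p"
  then have "r powr (1 / p) \<le> (N powr p) powr (1 / p)" using p real by (intro powr_mono2) auto
  then show "r powr (1 / p) \<le> N" using p N by (simp add: powr_powr)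
 qed
 then show ?thesis using real N by (simp add: Lp_norm_def ennreal_le_iff)
next
 case top
 then show ?thesis by (simp add: Lp_norm_def top_unique)
qed

context good_map begin

text \<open>A homogeneous bound on all of L^2; for N > 0 it claims nothing where f is outside L^p,
  since the right side is then infinite.\<close>

definition Lp_bound :: "real \<Rightarrow> real \<Rightarrow> bool" where
 "Lp_bound p N \<longleftrightarrow> (\<forall>f. L2 sigma f \<longrightarrow>
   (pint p (T f)) \<le> ennreal (N powr p) * (pint p f))"

lemma opnorm_le:
 assumes p: "0 < p" and N: "0 \<le> N" and b: "Lp_bound p N"
 shows "Lp_opnorm sigma p T \<le> ennreal N" unfolding Lp_opnorm_def
proof (rule SUP_least)
 fix f assume "f \<in> {f \<in> Lp_space sigma 2 \<inter> Lp_space sigma p. Lp_norm sigma p f \<le> 1}"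
 then have f: "L2 sigma f" "Lp_norm sigma p f \<le> ennreal 1" by (auto simp: Lp_space_2_iff)
 then have "(pint p f) \<le> 1" using Lp_norm_le_iff[OF p, of 1 sigma f] by simp
 then have "ennreal (N powr p) * (pint p f) \<le> ennreal (N powr p) * 1"
  by (rule mult_left_mono) simp
 then have "(pint p (T f)) \<le> ennreal (N powr p)"
  using b f(1) unfolding Lp_bound_def mult_1_right by (blast intro: order_trans)
 then show "Lp_norm sigma p (T f) \<le> ennreal N" by (simp only: Lp_norm_le_iff[OF p N])
qed

lemma T_cmult:
 assumes f: "L2 sigma f"
 shows "AE x in sigma. c * T f x = T (\<lambda>x. c * f x) x"
proof (rule proj_unique[OF L2_cmult[OF f] L2_cmult[OF proj_props(1)[OF f]]])
 have t: "tau (\<lambda>x. c * g x) = (\<lambda>ze. c * tau g ze)" for g by (simp add: tau_half_def fun_eq_iff)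
 show "szego_rel (tau (\<lambda>x. c * f x)) (tau (\<lambda>x. c * T f x))"
  unfolding t by (rule szego_rel_cmult[OF proj_props(2)[OF f]])
qed

text \<open>Normalizing by r + e instead of r covers functions of norm 0; afterwards e tends to
  0.\<close>

lemma Lp_bound_of_opnorm:
 assumes p: "0 < p" and N: "0 < N" and b: "Lp_opnorm sigma p T \<le> ennreal N"
 shows "Lp_bound p N" unfolding Lp_bound_def
proof (intro allI impI)
 fix f assume f: "L2 sigma f"
 show "(pint p (T f)) \<le> ennreal (N powr p) * (pint p f)"
 proof (cases "\<integral>\<^sup>+x. ennreal (norm (f x) powr p) \<partial>sigma")
  case top
  then show ?thesis using N by (simp add: ennreal_mult_top)
 next
  case (real r)
  note [measurable] = L2_measurable[OF f] L2_measurable[OF proj_props(1)[OF f]]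
  have sc: "(\<integral>\<^sup>+x. ennreal (norm (of_real t * g x) powr p) \<partial>sigma) = ennreal (t powr p) * (pint p g)"
   if "0 < t" and [measurable]: "g \<in> borel_measurable sigma" for t and g :: "complex \<Rightarrow> complex"
  proof -
   have "(\<integral>\<^sup>+x. ennreal (norm (of_real t * g x) powr p) \<partial>sigma) = (\<integral>\<^sup>+x. ennreal (t powr p) * ennreal (norm (g x) powr p) \<partial>sigma)"
    using that(1) by (intro nn_integral_cong) (simp add: norm_mult powr_mult ennreal_mult'')
   also have "\<dots> = ennreal (t powr p) * (pint p g)"
    by (rule nn_integral_cmult) measurable
   finally show ?thesis .
  qed
  have step: "(pint p (T f)) \<le> ennreal (N powr p * (r + e))" if e: "0 < e" for e
  proof -
   define t where "t = (1 / (r + e)) powr (1 / p)"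
   have t: "0 < t" "t powr p = 1 / (r + e)" using e real p by (auto simp: t_def powr_powr)
   define g where "g x = of_real t * f x" for x
   have g: "L2 sigma g" unfolding g_def[abs_def] by (rule L2_cmult[OF f])
   have "(pint p g) = ennreal (1 / (r + e) * r)"
    unfolding g_def using sc[OF t(1), of f] real e by (simp add: t(2) ennreal_mult flip: ennreal_mult')
   also have "\<dots> \<le> ennreal (1 powr p)" using real e by (intro ennreal_leI) simp
   finally have ng: "Lp_norm sigma p g \<le> ennreal 1" by (simp only: Lp_norm_le_iff[OF p zero_le_one])
   then have "Lp_norm sigma p g < \<infinity>" by (rule le_less_trans) simp
   then have "g \<in> {f \<in> Lp_space sigma 2 \<inter> Lp_space sigma p. Lp_norm sigma p f \<le> 1}"
    using g ng L2_measurable[OF g] by (simp add: Lp_space_2_iff) (simp add: Lp_space_def)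
   then have "Lp_norm sigma p (T g) \<le> Lp_opnorm sigma p T" unfolding Lp_opnorm_def by (rule SUP_upper)
   then have "Lp_norm sigma p (T g) \<le> ennreal N" using b by (rule order_trans)
   moreover have "Lp_norm sigma p (T g) = Lp_norm sigma p (\<lambda>x. of_real t * T f x)"
    unfolding g_def[abs_def] by (rule Lp_norm_cong_AE[OF AE_symmetric[OF T_cmult[OF f]]])
   ultimately have "(\<integral>\<^sup>+x. ennreal (norm (of_real t * T f x) powr p) \<partial>sigma) \<le> ennreal (N powr p)"
    using N by (simp only: Lp_norm_le_iff[OF p less_imp_le])
   then have le: "ennreal (1 / (r + e)) * (pint p (T f)) \<le> ennreal (N powr p)"
    unfolding sc[OF t(1) L2_measurable[OF proj_props(1)[OF f]]] t(2) .
   have "(pint p (T f))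
     = ennreal (r + e) * (ennreal (1 / (r + e)) * (pint p (T f)))"
   proof -
    have "ennreal (r + e) * ennreal (1 / (r + e)) = ennreal ((r + e) * (1 / (r + e)))"
     by (rule ennreal_mult[symmetric]) (use e real(1) in auto)
    also have "(r + e) * (1 / (r + e)) = 1" using e real(1) by simp
    also have "ennreal 1 = 1" by simp
    finally show ?thesis by (simp only: mult.assoc[symmetric] mult_1_left)
   qed
   also have "\<dots> \<le> ennreal (r + e) * ennreal (N powr p)" by (rule mult_left_mono[OF le]) simp
   also have "\<dots> = ennreal (N powr p * (r + e))" using e real by (subst ennreal_mult[symmetric]) (auto simp: mult.commute)
   finally show ?thesis .
  qed
  have "(pint p (T f)) \<le> ennreal (N powr p * r)"
  proof (rule ennreal_le_epsilon)
   fix e :: real assume e: "0 < e"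
   have Np: "0 < N powr p" using N by simp
   have "(pint p (T f)) \<le> ennreal (N powr p * (r + e / N powr p))"
    by (rule step) (use e Np in simp)
   also have "N powr p * (r + e / N powr p) = N powr p * r + e" using Np by (simp add: distrib_left)
   also have "ennreal (N powr p * r + e) = ennreal (N powr p * r) + ennreal e" using real e by (intro ennreal_plus) auto
   finally show "(pint p (T f)) \<le> ennreal (N powr p * r) + ennreal e" .
  qed
  then show ?thesis using real by (simp add: ennreal_mult)
 qed
qed

lemma Lp_bound_dual:
 assumes "1 < q" "q \<le> 2" "0 < N" "p = q / (q - 1)" "Lp_bound q N"
 shows "Lp_bound p (2 * N)"
 using assms(5) unfolding Lp_bound_def by (intro allI impI dual_bound[OF assms(1-4)]) blast+

end

lemma powr_inverse_exponent: "(x powr p) powr (1 / p) = x" if "0 < x" "p \<noteq> 0" for x p :: real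
 using that by (simp add: powr_powr)

context model_map begin

text \<open>The factor 8/\<pi> comes from \<open>\<kappa>\<close> = (5p - 6) \<pi>/8; the maximum
  with 1 bounds 1024 \<open>K1\<close> by a p-th power.\<close>

definition upper_const where "upper_const = (8 / pi) * max 1 (1024 * K1)"
definition lower_const where "lower_const = test_inf / (test_sup * (2 * pi))"

lemma consts_pos: "0 < upper_const" "0 < lower_const"
 unfolding upper_const_def lower_const_def using test_pos by (auto intro!: mult_pos_pos divide_pos_pos)

end

text \<open>Of order 1/(6 - p) near 6, and of order (5p - 6)^(-1/5) near 6/5; the exponents 1 and
  1/(p - 1) turn both into the reciprocal distance to the endpoint.\<close>

definition growth :: "real \<Rightarrow> real" where
 "growth p = 1 / (6 - p) * (4 * (p - 1) / (5 * p - 6)) powr (p - 1)"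

text \<open>The exponent 1/(p - 1), at most 5, cancels p - 1. The factor 5^6 absorbs (1/5)^5, from
  1/(6 - p) at least 1/5, and 4/5, from p - 1 > 1/5.\<close>

lemma growth_ge_small:
 assumes p: "6/5 < p" "p \<le> 2"
 shows "1 / (5 * p - 6) \<le> 5 ^ 6 * growth p powr max 1 (1 / (p - 1))"
proof -
 let ?Y = "4 * (p - 1) / (5 * p - 6)"
 have Y: "0 < ?Y" using p by simp
 have e: "1 \<le> 1 / (p - 1)" "1 / (p - 1) \<le> 5" using p by (auto simp: field_simps)
 have "growth p powr (1 / (p - 1)) = (1 / (6 - p)) powr (1 / (p - 1)) * (?Y powr (p - 1)) powr (1 / (p - 1))"
  unfolding growth_def using p by (subst powr_mult) auto
 also have "(?Y powr (p - 1)) powr (1 / (p - 1)) = ?Y" by (rule powr_inverse_exponent) (use Y p in auto)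
 finally have g: "growth p powr max 1 (1 / (p - 1)) = (1 / (6 - p)) powr (1 / (p - 1)) * ?Y" using e by (simp add: max_absorb2)
 have "(1 / 5 :: real) ^ 5 = (1 / 5) powr 5" by simp
 also have "\<dots> \<le> (1 / 5) powr (1 / (p - 1))" by (rule powr_mono') (use e in auto)
 also have "\<dots> \<le> (1 / (6 - p)) powr (1 / (p - 1))" using p by (intro powr_mono2) (auto simp: field_simps)
 finally have 1: "(1 / 5 :: real) ^ 5 \<le> (1 / (6 - p)) powr (1 / (p - 1))" .
 have 2: "(4 / 5) / (5 * p - 6) \<le> ?Y" using p by (intro divide_right_mono) auto
 have "5 ^ 6 * ((1 / 5) ^ 5 * ((4 / 5) / (5 * p - 6))) \<le> 5 ^ 6 * growth p powr max 1 (1 / (p - 1))"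
  unfolding g using 1 2 p by (intro mult_left_mono mult_mono) auto
 moreover have "1 / (5 * p - 6) \<le> 5 ^ 6 * ((1 / 5) ^ 5 * ((4 / 5) / (5 * p - 6)))" using p by (simp add: field_simps)
 ultimately show ?thesis by (rule order_trans[rotated])
qed

lemma growth_ge_large:
 assumes p: "2 \<le> p" "p < 6"
 shows "1 / (6 - p) \<le> 5 ^ 6 * growth p powr max 1 (1 / (p - 1))"
proof -
 let ?Y = "4 * (p - 1) / (5 * p - 6)"
 have Y: "4 / 5 \<le> ?Y" using p by (simp add: field_simps)
 have "(4 / 5 :: real) ^ 5 = (4 / 5) powr 5" by simp
 also have "\<dots> \<le> (4 / 5) powr (p - 1)" by (rule powr_mono') (use p in auto)
 also have "\<dots> \<le> ?Y powr (p - 1)" using Y p by (intro powr_mono2) auto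
 finally have 1: "(4 / 5 :: real) ^ 5 \<le> ?Y powr (p - 1)" .
 have "max 1 (1 / (p - 1)) = 1" using p by (simp add: max_def field_simps)
 moreover have "0 < growth p" using p by (simp add: growth_def)
 ultimately have g: "growth p powr max 1 (1 / (p - 1)) = 1 / (6 - p) * ?Y powr (p - 1)" using p by (simp add: growth_def)
 have "5 ^ 6 * (1 / (6 - p) * (4 / 5) ^ 5) \<le> 5 ^ 6 * growth p powr max 1 (1 / (p - 1))"
  unfolding g using 1 p by (intro mult_left_mono) auto
 moreover have "1 / (6 - p) \<le> 5 ^ 6 * (1 / (6 - p) * (4 / 5) ^ 5)" using p by (simp add: field_simps)
 ultimately show ?thesis by (rule order_trans[rotated])
qed

text \<open>Halving the exponent is free up to a factor 4, because y = (1/(6 - p))^(1/(2p)) is at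
  least 1/4 and so y is at most 4 y^2.\<close>

lemma growth_le_large:
 assumes p: "2 \<le> p" "p < 6"
 shows "growth p powr (1 / (2 * p)) \<le> 4 * (1 / (6 - p)) powr (1 / p)"
proof -
 let ?Y = "4 * (p - 1) / (5 * p - 6)"
 have Y: "0 \<le> ?Y" "?Y \<le> 1" using p by (auto simp: field_simps)
 have "?Y powr (p - 1) \<le> 1" using Y p by (intro powr_le1) auto
 then have "1 / (6 - p) * ?Y powr (p - 1) \<le> 1 / (6 - p) * 1" using p by (intro mult_left_mono) auto
 then have "growth p powr (1 / (2 * p)) \<le> (1 / (6 - p)) powr (1 / (2 * p))"
  unfolding growth_def using p by (intro powr_mono2) auto
 moreover define y where "y = (1 / (6 - p)) powr (1 / (2 * p))"
 ultimately have 1: "growth p powr (1 / (2 * p)) \<le> y" by (simp only:)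
 have "1 / 4 \<le> (1 / 4 :: real) powr (1 / (2 * p))" using powr_between(1)[of "1/4" "1 / (2 * p)"] p by simp
 also have "\<dots> \<le> y" unfolding y_def using p by (intro powr_mono2) (auto simp: field_simps)
 finally have "y * 1 \<le> y * (4 * y)" by (intro mult_left_mono) (auto simp: y_def)
 also have "y * (4 * y) = 4 * (1 / (6 - p)) powr (1 / p)"
 proof -
  have "1 / (2 * p) + 1 / (2 * p) = 1 / p" by simp
  then have "y * y = (1 / (6 - p)) powr (1 / p)" unfolding y_def powr_add[symmetric] by simp
  then show ?thesis by simp
 qed
 finally show ?thesis using 1 by simp
qed

text \<open>Here 1/(6 - p) is at most 1 and the remaining base is at least 1, so doubling the
  exponent only enlarges the bound.\<close>

lemma growth_le_small:
 assumes p: "6/5 < p" "p \<le> 2"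
 shows "growth p powr (1 / (2 * p)) \<le> 4 * ((p - 1) / (5 * p - 6)) powr ((p - 1) / p)"
proof -
 let ?Y = "4 * (p - 1) / (5 * p - 6)" and ?e = "(p - 1) / p"
 have Y: "1 \<le> ?Y" using p by (simp add: field_simps)
 have e: "0 \<le> ?e" "?e \<le> 1" using p by (auto simp: field_simps)
 have "growth p \<le> 1 * ?Y powr (p - 1)" unfolding growth_def using p by (intro mult_right_mono) (auto simp: field_simps)
 then have "growth p powr (1 / (2 * p)) \<le> (?Y powr (p - 1)) powr (1 / (2 * p))"
  using p by (intro powr_mono2) (auto simp: growth_def)
 also have "\<dots> = ?Y powr (?e / 2)" by (simp add: powr_powr field_simps)
 also have "\<dots> \<le> ?Y powr ?e" using Y e by (intro powr_mono) auto
 also have "\<dots> = 4 powr ?e * ((p - 1) / (5 * p - 6)) powr ?e"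
  using p by (subst powr_mult[symmetric]) auto
 also have "\<dots> \<le> 4 * ((p - 1) / (5 * p - 6)) powr ?e"
  using powr_between(2)[of 4 ?e] e by (intro mult_right_mono) auto
 finally show ?thesis .
qed

context model_szego begin

lemma Lp_bound_small:
 assumes p: "6/5 < p" "p \<le> 2"
 shows "Lp_bound p (upper_const / (5 * p - 6))" unfolding Lp_bound_def
proof (intro allI impI)
 fix f assume f: "L2 sigma f"
 let ?K = "max 1 (1024 * K1)"
 have "?K powr 1 \<le> ?K powr p" using p by (intro powr_mono) auto
 then have "1024 * K1 \<le> ?K powr p" by simp
 then have "1024 * K1 / ((5 * p - 6) * pi / 8) powr p \<le> ?K powr p / ((5 * p - 6) * pi / 8) powr p"
  by (intro divide_right_mono) auto
 also have "\<dots> = (?K / ((5 * p - 6) * pi / 8)) powr p" by (rule powr_divide[symmetric])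
 also have "?K / ((5 * p - 6) * pi / 8) = upper_const / (5 * p - 6)" by (simp add: upper_const_def mult_ac)
 finally have "ennreal (1024 * K1 / ((5 * p - 6) * pi / 8) powr p) \<le> ennreal ((upper_const / (5 * p - 6)) powr p)" by (rule ennreal_leI)
 then have "ennreal (1024 * K1 / ((5 * p - 6) * pi / 8) powr p) * pint p f
  \<le> ennreal ((upper_const / (5 * p - 6)) powr p) * (pint p f)"
  by (rule mult_right_mono) simp
 with szego_upper[OF p f] show "(pint p (T f))
  \<le> ennreal ((upper_const / (5 * p - 6)) powr p) * (pint p f)"
  by (rule order_trans)
qed

lemma opnorm_upper:
 assumes p: "6/5 < p" "p < 6"
 shows "Lp_opnorm sigma p T \<le> ennreal (10 * upper_const * 5 ^ 6 * growth p powr max 1 (1 / (p - 1)))"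
proof (cases "p \<le> 2")
 case True
 have "Lp_opnorm sigma p T \<le> ennreal (upper_const / (5 * p - 6))"
  by (rule opnorm_le[OF _ _ Lp_bound_small[OF p(1) True]]) (use p consts_pos in auto)
 also have "\<dots> \<le> ennreal (10 * upper_const * 5 ^ 6 * growth p powr max 1 (1 / (p - 1)))"
 proof (rule ennreal_leI)
  have "upper_const * (1 / (5 * p - 6)) \<le> (10 * upper_const) * (5 ^ 6 * growth p powr max 1 (1 / (p - 1)))"
   by (rule mult_mono[OF _ growth_ge_small[OF p(1) True]]) (use consts_pos p in auto)
  then show "upper_const / (5 * p - 6) \<le> 10 * upper_const * 5 ^ 6 * growth p powr max 1 (1 / (p - 1))" by (simp add: mult.assoc)
 qed
 finally show ?thesis .
next
 case False
 \<comment> \<open>For the conjugate exponent 5q - 6 = (6 - p)/(p - 1), which turns the endpoint 6/5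
   into 6; the factor 2 (p - 1) is at most 10.\<close>
 define q where "q = p / (p - 1)"
 have q: "6/5 < q" "q \<le> 2" "1 < q" "p = q / (q - 1)" using p False by (auto simp: q_def field_simps)
 have q5: "5 * q - 6 = (6 - p) / (p - 1)" using False by (simp add: q_def field_simps)
 have b: "Lp_bound p (2 * (upper_const / (5 * q - 6)))"
  by (rule Lp_bound_dual[OF q(3,2) _ q(4) Lp_bound_small[OF q(1,2)]]) (use q consts_pos in simp)
 have "Lp_opnorm sigma p T \<le> ennreal (2 * (upper_const / (5 * q - 6)))"
  by (rule opnorm_le[OF _ _ b]) (use p q consts_pos in auto)
 also have "\<dots> \<le> ennreal (10 * upper_const * 5 ^ 6 * growth p powr max 1 (1 / (p - 1)))"
 proof (rule ennreal_leI)
  have "2 * (upper_const / (5 * q - 6)) = (2 * (p - 1) * upper_const) * (1 / (6 - p))" unfolding q5 by simp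
  also have "\<dots> \<le> (10 * upper_const) * (5 ^ 6 * growth p powr max 1 (1 / (p - 1)))"
   by (rule mult_mono[OF _ growth_ge_large]) (use consts_pos p False in \<open>auto intro!: mult_right_mono\<close>)
  finally show "2 * (upper_const / (5 * q - 6)) \<le> 10 * upper_const * 5 ^ 6 * growth p powr max 1 (1 / (p - 1))" by (simp add: mult.assoc)
 qed
 finally show ?thesis .
qed

lemma Lp_bound_lower_large:
 assumes p: "2 \<le> p" "p < 6" and B: "0 < B" and b: "Lp_bound p B"
 shows "min 1 lower_const * (1 / (6 - p)) powr (1 / p) \<le> B"
proof -
 have "lower_const / (6 - p) \<le> B powr p"
  unfolding lower_const_def using b by (intro szego_lower[OF p]) (auto simp: Lp_bound_def)
 then have "(lower_const * (1 / (6 - p))) powr (1 / p) \<le> (B powr p) powr (1 / p)"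
  using p consts_pos by (intro powr_mono2) auto
 moreover have "(B powr p) powr (1 / p) = B" by (rule powr_inverse_exponent) (use B p in auto)
 moreover have "(lower_const * (1 / (6 - p))) powr (1 / p) = lower_const powr (1 / p) * (1 / (6 - p)) powr (1 / p)"
  by (rule powr_mult)
 ultimately have 1: "lower_const powr (1 / p) * (1 / (6 - p)) powr (1 / p) \<le> B" by (simp only:)
 have "min 1 lower_const * (1 / (6 - p)) powr (1 / p) \<le> lower_const powr (1 / p) * (1 / (6 - p)) powr (1 / p)"
  using powr_between(1)[OF consts_pos(2), of "1 / p"] p by (intro mult_right_mono) auto
 with 1 show ?thesis by linarith
qed

text \<open>Below 2 the estimate is taken at the conjugate exponent r. Passing to it costs 2 and
  comparing with \<open>growth\<close> costs 4, hence 1/8.\<close>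

lemma Lp_bound_lower:
 assumes p: "6/5 < p" "p < 6" and B: "0 < B" and b: "Lp_bound p B"
 shows "min 1 lower_const / 8 * growth p powr (1 / (2 * p)) \<le> B"
proof -
 let ?c = "min 1 lower_const"
 have c: "0 < ?c" using consts_pos by simp
 show ?thesis
 proof (cases "2 \<le> p")
  case True
  have "?c * growth p powr (1 / (2 * p)) \<le> ?c * (4 * (1 / (6 - p)) powr (1 / p))"
   using growth_le_large[OF True p(2)] c by (intro mult_left_mono) auto
  also have "\<dots> = 4 * (?c * (1 / (6 - p)) powr (1 / p))" by simp
  also have "\<dots> \<le> 4 * B" using Lp_bound_lower_large[OF True p(2) B b] by simp
  finally show ?thesis using B by simp
 next
  case False
  define r where "r = p / (p - 1)"
  have r: "2 \<le> r" "r < 6" using p False by (auto simp: r_def field_simps)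
  have r6: "1 / (6 - r) = (p - 1) / (5 * p - 6)" "1 / r = (p - 1) / p"
  proof -
   have "6 - r = (5 * p - 6) / (p - 1)" using p by (simp add: r_def field_simps)
   then show "1 / (6 - r) = (p - 1) / (5 * p - 6)" by simp
  qed (simp add: r_def)
  have "Lp_bound r (2 * B)" by (rule Lp_bound_dual[OF _ _ B r_def b]) (use p False in auto)
  then have l: "?c * ((p - 1) / (5 * p - 6)) powr ((p - 1) / p) \<le> 2 * B"
   using Lp_bound_lower_large[OF r, of "2 * B"] B unfolding r6 by simp
  have "?c * growth p powr (1 / (2 * p)) \<le> ?c * (4 * ((p - 1) / (5 * p - 6)) powr ((p - 1) / p))"
   using growth_le_small[of p] p False c by (intro mult_left_mono) auto
  also have "\<dots> = 4 * (?c * ((p - 1) / (5 * p - 6)) powr ((p - 1) / p))" by simp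
  also have "\<dots> \<le> 4 * (2 * B)" by (rule mult_left_mono[OF l]) simp
  finally show ?thesis by simp
 qed
qed

lemma opnorm_lower:
 assumes p: "6/5 < p" "p < 6"
 shows "ennreal (min 1 lower_const / 8 * growth p powr (1 / (2 * p))) \<le> Lp_opnorm sigma p T"
proof (rule ccontr)
 define L where "L = min 1 lower_const / 8 * growth p powr (1 / (2 * p))"
 assume "\<not> ?thesis"
 then have lt: "Lp_opnorm sigma p T < ennreal L" by (simp add: L_def)
 have g: "0 < growth p" unfolding growth_def using p by simp
 have L0: "0 < L" unfolding L_def using consts_pos g by simp
 obtain x where x: "Lp_opnorm sigma p T = ennreal x" "0 \<le> x"
  using lt by (cases "Lp_opnorm sigma p T") auto
 then have xL: "x < L" using lt L0 by (simp add: ennreal_less_iff)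
 \<comment> \<open>The maximum with L/2 keeps B positive when the norm is 0, while B stays below
   L.\<close>
 define B where "B = max x (L / 2)"
 have B: "0 < B" "B < L" "x \<le> B" using xL L0 by (auto simp: B_def)
 have "Lp_bound p B" by (rule Lp_bound_of_opnorm) (use p B x in \<open>auto intro: ennreal_leI\<close>)
 then have "L \<le> B" unfolding L_def by (rule Lp_bound_lower[OF p B(1)])
 then show False using B by simp
qed

end

lemma Lp_opnorm_cong:
 assumes "\<And>f. L2 M f ==> AE x in M. T f x = T' f x"
 shows "Lp_opnorm M p T = Lp_opnorm M p T'" unfolding Lp_opnorm_def
 by (rule SUP_cong[OF refl], rule Lp_norm_cong_AE, rule assms) (auto simp: Lp_space_2_iff)

theorem theorem3p5:
 shows "\<exists>c C :: real. 0 < c \<and> 0 < C \<and>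
  (\<forall>\<phi> w. riemann_map Omega \<phi> \<and> sqrt_deriv_boundary \<phi> w \<longrightarrow>
   (\<forall>p::real. 6/5 < p \<and> p < 6 \<longrightarrow>
    ennreal (c * (1 / (6 - p) * (4 * (p - 1) / (5 * p - 6)) powr (p - 1)) powr (1 / (2 * p)))
     \<le> Lp_opnorm (arc_length (frontier Omega)) p (szego_projection Omega \<phi> w) \<and>
    Lp_opnorm (arc_length (frontier Omega)) p (szego_projection Omega \<phi> w)
     \<le> ennreal (C * (1 / (6 - p) * (4 * (p - 1) / (5 * p - 6)) powr (p - 1)) powr max 1 (1 / (p - 1)))))"
proof (cases "\<exists>\<phi>. riemann_map Omega \<phi>")
 case False
 then show ?thesis by (intro exI[of _ 1]) auto
next
 case True
 then obtain \<phi>1 where R1: "riemann_map Omega \<phi>1" by blast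
 note f1 = riemann_map_facts[OF R1 open_Omega]
 have "0 \<in> \<phi>1 ` ball 0 1" unfolding f1(4) by (rule zero_in_Omega)
 then obtain a where a: "norm a < 1" "\<phi>1 a = 0" by auto
 \<comment> \<open>One normalized map fixes all constants before any pair \<phi>, w is
   given.\<close>
 define \<phi>0 where "\<phi>0 z = \<phi>1 (disc_aut a 1 z)" for z
 have R0: "riemann_map Omega \<phi>0" unfolding \<phi>0_def[abs_def] by (rule riemann_map_disc_aut[OF R1 a(1)]) simp
 have n0: "\<phi>0 0 = 0" using a(2) by (simp add: \<phi>0_def disc_aut_def)
 obtain s1 S m M where sS: "norm s1 = 1" "finite S" "S \<noteq> {}" "\<And>s. s \<in> S ==> norm s = 1" "s1 \<notin> S" "0 < m" "0 < M"
  "AE ze in mu. ze\<^sup>2 \<noteq> s1 \<and> ze\<^sup>2 \<notin> S \<and> m * model_weight s1 S ze \<le> (bd_deriv \<phi>0 ze)\<^sup>2 \<and> (bd_deriv \<phi>0 ze)\<^sup>2 \<le> M * model_weight s1 S ze"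
  by (rule normalized_riemann_map_comparison[OF R0 n0]) (rule that; assumption)
 interpret model_map \<phi>0 s1 S m M by unfold_locales (rule R0 sS; assumption?)+
 have O0: "omega_map \<phi>0" by unfold_locales
 show ?thesis
 proof (rule exI[of _ "min 1 lower_const / 8"], rule exI[of _ "10 * upper_const * 5 ^ 6"], intro conjI allI impI)
  show "0 < min 1 lower_const / 8" "0 < 10 * upper_const * 5 ^ 6" using consts_pos by auto
  fix \<phi> w and p :: real
  assume h: "riemann_map Omega \<phi> \<and> sqrt_deriv_boundary \<phi> w" and p: "6/5 < p \<and> p < 6"
  have G: "good_map \<phi> w" by (rule good_map_of_boundary_values) (use h in auto)
  obtain b c where bc: "norm b < 1" "norm c = 1" "\<And>z. norm z \<le> 1 ==> \<phi>0 z = \<phi> (disc_aut b c z)"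
   by (rule riemann_map_unique[OF conjunct1[OF h] R0 open_Omega]) (rule that; assumption)
  \<comment> \<open>The root transported from w along the automorphism; it has the modulus that
    \<open>good_map\<close> asks for, and with it \<phi>0 yields the same operator up to null
    sets.\<close>
  define w0 where "w0 ze = w (disc_aut b c ze) * aut_root b c ze" for ze
  have G0: "good_map \<phi>0 w0" unfolding w0_def[abs_def] by (rule good_map_disc_aut[OF G O0 bc])
  have MS: "model_szego \<phi>0 s1 S m M w0" by (rule model_szego.intro[OF model_map_axioms G0])
  have "AE x in sigma. szego_projection Omega \<phi> w f x = szego_projection Omega \<phi>0 w0 f x" if "L2 sigma f" for f
   by (rule szego_projection_transfer[OF G G0 bc(1,2) _ _ that]) (simp_all add: bc(3) w0_def)
  then have eq: "Lp_opnorm sigma p (szego_projection Omega \<phi> w) = Lp_opnorm sigma p (szego_projection Omega \<phi>0 w0)"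
   by (rule Lp_opnorm_cong)
  show "ennreal (min 1 lower_const / 8 * (1 / (6 - p) * (4 * (p - 1) / (5 * p - 6)) powr (p - 1)) powr (1 / (2 * p)))
    \<le> Lp_opnorm sigma p (szego_projection Omega \<phi> w)"
   unfolding eq using model_szego.opnorm_lower[OF MS, of p] p by (simp only: growth_def)
  show "Lp_opnorm sigma p (szego_projection Omega \<phi> w)
    \<le> ennreal (10 * upper_const * 5 ^ 6 * (1 / (6 - p) * (4 * (p - 1) / (5 * p - 6)) powr (p - 1)) powr max 1 (1 / (p - 1)))"
   unfolding eq using model_szego.opnorm_upper[OF MS, of p] p by (simp only: growth_def)
 qed
qed

end
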